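(* Let $\mu>0$, let $\lambda_\mu>0$ be a spectral gap constant for $L_\mu$, i.e. $-\langle L_\mu g,g\rangle_H\ge\lambda_\mu\|(I-\Pi)g\|_H^2$ for all $g\in H$ ($\Pi$ the orthogonal projection of $H$ onto $\operatorname{Ker}(L_\mu)$), and let $0<\delta<\lambda_\mu$. There exists $\rho=\rho(\mu,\delta)>0$ such that for all initial data $f_0$ of the form $$f_0(\omega)=\frac1{\omega+\mu}\,(1+g_0(\omega))\quad\text{for a.e. }\omega\ge0,\qquad g_0\in(\operatorname{Ker}(L_\mu))^\perp,\qquad \|(\mu+\omega)f_0-1\|_H=\|g_0\|_H\le\rho,$$ there exists a unique global perturbative solution $f\in C^1([0,\infty);H)$ with $f(0)=f_0$. For every $t\ge0$, writing $f_t=f(t,\cdot)$ and $g_t:=(\mu+\omega)f_t-1$, one has $g_t\perp\operatorname{Ker}(L_\mu)$ and $$\|(\mu+\omega)f_t-1\|_H=\|g_t\|_H\le e^{-\delta t}\|(\mu+\omega)f_0-1\|_H\quad\text{for all }t\ge0.$$ Finally, the dynamics preserve positivity: if $f_0\ge0$ then $f_t\ge0$ for all $t>0$.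
   Context: $H=L^2((0,\infty);\sqrt\omega\,d\omega)$ (real-valued functions) with its natural inner product; inequalities between functions hold a.e. The underlying equation is the isotropic cubic NLS wave kinetic equation $$\partial_tf(t,\omega)=-\iint_{D(\omega)}\Omega\,(ff_2f_3+ff_1f_3-f_1f_2f-f_1f_2f_3)\,d\omega_1d\omega_2,$$ with $D(\omega)=\{\omega_1\ge0,\ \omega_2\ge0,\ \omega_1+\omega_2\ge\omega\}$, $\omega_0=\omega$, $\omega_3=\omega_1+\omega_2-\omega$, $f_i=f(t,\omega_i)$, $\Omega=\min(\sqrt{\omega_0},\sqrt{\omega_1},\sqrt{\omega_2},\sqrt{\omega_3})/\sqrt{\omega_0}$. A (global) perturbative solution is a function $f=n(1+g)$, $n(\omega)=\frac1{\omega+\mu}$, where $g\in C^1([0,\infty);H)$ solves the perturbation equation $\partial_tg=L_\mu g+\Gamma_\mu(g,g)+Q_\mu(g,g,g)$; uniqueness is within this class. With $n_i=n(\omega_i)$, $g_i=g(\omega_i)$ for $i=0,1,2,3$ (inside the integrals $g_0=g(\omega)$), $$L_\mu g=\iint_{D(\omega)}\Omega\,n_1n_2n_3\Big[-\frac{g_0}{n_0}-\frac{g_3}{n_3}+\frac{g_1}{n_1}+\frac{g_2}{n_2}\Big]d\omega_1d\omega_2,$$ $$\Gamma_\mu(g,g)=\iint_{D(\omega)}\Omega\,n_1n_2n_3\Big[-g_0g_3(n_2^{-1}+n_1^{-1})+g_0g_1(n_3^{-1}-n_2^{-1})+g_0g_2(n_3^{-1}-n_1^{-1})+g_3g_1(n_1^{-1}-n_3^{-1})+g_3g_2(n_2^{-1}-n_3^{-1})+g_1g_2(n_2^{-1}+n_1^{-1})\Big]d\omega_1d\omega_2,$$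 $$Q_\mu(g,g,g)=\iint_{D(\omega)}\Omega\,n_1n_2n_3\Big[n_3^{-1}g_0g_1g_2+n_0^{-1}g_1g_2g_3-n_1^{-1}g_0g_2g_3-n_2^{-1}g_0g_1g_3\Big]d\omega_1d\omega_2,$$ for $g\in C_c^\infty(0,\infty)$, extended by density and continuity to bounded linear, quadratic and cubic maps $H\to H$. *)

theory Defs
  imports "HOL-Analysis.Analysis"
begin

section \<open>The Hilbert space $H = L^2((0,\infty); \sqrt\omega\,d\omega)$\<close>

text \<open>The measure lives on the whole real line but does not charge \<open>(-\<infinity>, 0]\<close>, so a class of
  functions modulo its null sets is a class of functions on \<open>(0,\<infinity>)\<close>. As the density is positive on
  \<open>(0,\<infinity>)\<close>, ``almost everywhere'' has the same meaning as for Lebesgue measure on \<open>(0,\<infinity>)\<close>.\<close>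

definition wmeas :: "real measure" where
  "wmeas = density lborel (\<lambda>\<omega>. ennreal (indicator {0<..} \<omega> * sqrt \<omega>))"

definition sq_int :: "(real \<Rightarrow> real) \<Rightarrow> bool" where
  "sq_int g \<longleftrightarrow> g \<in> borel_measurable wmeas \<and> integrable wmeas (\<lambda>\<omega>. (g \<omega>)\<^sup>2)"

definition wrel :: "(real \<Rightarrow> real) \<Rightarrow> (real \<Rightarrow> real) \<Rightarrow> bool" where
  "wrel g h \<longleftrightarrow> sq_int g \<and> sq_int h \<and> (AE \<omega> in wmeas. g \<omega> = h \<omega>)"

lemma sq_int_mult_integrable:
  assumes "sq_int g" "sq_int h"
  shows "integrable wmeas (\<lambda>\<omega>. g \<omega> * h \<omega>)"
proof (rule Bochner_Integration.integrable_bound)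
  show "integrable wmeas (\<lambda>\<omega>. (g \<omega>)\<^sup>2 + (h \<omega>)\<^sup>2)"
    using assms by (auto simp: sq_int_def)
  show "(\<lambda>\<omega>. g \<omega> * h \<omega>) \<in> borel_measurable wmeas"
    using assms by (auto simp: sq_int_def)
  have "\<bar>a * b\<bar> \<le> a\<^sup>2 + b\<^sup>2" for a b :: real
  proof -
    have "0 \<le> (\<bar>a\<bar> - \<bar>b\<bar>)\<^sup>2" by simp
    then have "2 * \<bar>a * b\<bar> \<le> a\<^sup>2 + b\<^sup>2"
      by (simp add: power2_diff abs_mult)
    moreover have "0 \<le> \<bar>a * b\<bar>" by simp
    ultimately show ?thesis by linarith
  qed
  then show "AE \<omega> in wmeas. norm (g \<omega> * h \<omega>) \<le> norm ((g \<omega>)\<^sup>2 + (h \<omega>)\<^sup>2)"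
    by (simp del: abs_mult)
qed

lemma sq_int_zero: "sq_int (\<lambda>\<omega>. 0)"
  by (simp add: sq_int_def)

lemma sq_int_add:
  assumes "sq_int g" "sq_int h"
  shows "sq_int (\<lambda>\<omega>. g \<omega> + h \<omega>)"
  using assms sq_int_mult_integrable[OF assms]
  by (auto simp: sq_int_def power2_sum mult.assoc)

lemma sq_int_scale: "sq_int g \<Longrightarrow> sq_int (\<lambda>\<omega>. c * g \<omega>)"
  by (auto simp: sq_int_def power_mult_distrib)

lemma sq_int_uminus: "sq_int g \<Longrightarrow> sq_int (\<lambda>\<omega>. - g \<omega>)"
  using sq_int_scale[of g "-1"] by simp

lemma sq_int_diff: "sq_int g \<Longrightarrow> sq_int h \<Longrightarrow> sq_int (\<lambda>\<omega>. g \<omega> - h \<omega>)"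
  using sq_int_add[of g "\<lambda>\<omega>. - h \<omega>"] sq_int_uminus[of h] by simp

quotient_type wL2 = "real \<Rightarrow> real" / partial: wrel
  morphisms rep_wL2 abs_wL2
proof (rule part_equivpI)
  show "\<exists>g. wrel g g"
    by (rule exI[of _ "\<lambda>\<omega>. 0"]) (simp add: wrel_def sq_int_zero)
  show "symp wrel"
    by (auto intro!: sympI simp: wrel_def elim: AE_mp)
  show "transp wrel"
    by (rule transpI) (auto simp: wrel_def elim: AE_mp)
qed

instantiation wL2 :: real_vector
begin

lift_definition zero_wL2 :: wL2 is "\<lambda>\<omega>. 0"
  by (simp add: wrel_def sq_int_zero)

lift_definition plus_wL2 :: "wL2 \<Rightarrow> wL2 \<Rightarrow> wL2" is "\<lambda>g h \<omega>. g \<omega> + h \<omega>"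
  by (auto simp: wrel_def sq_int_add)

lift_definition uminus_wL2 :: "wL2 \<Rightarrow> wL2" is "\<lambda>g \<omega>. - g \<omega>"
  by (auto simp: wrel_def sq_int_uminus)

lift_definition minus_wL2 :: "wL2 \<Rightarrow> wL2 \<Rightarrow> wL2" is "\<lambda>g h \<omega>. g \<omega> - h \<omega>"
  by (auto simp: wrel_def sq_int_diff)

lift_definition scaleR_wL2 :: "real \<Rightarrow> wL2 \<Rightarrow> wL2" is "\<lambda>c g \<omega>. c * g \<omega>"
  by (auto simp: wrel_def sq_int_scale)

instance
  by standard
    (transfer; force simp: wrel_def algebra_simps
      intro: sq_int_add sq_int_diff sq_int_uminus sq_int_scale sq_int_zero)+

end

instantiation wL2 :: real_inner
begin

lift_definition inner_wL2 :: "wL2 \<Rightarrow> wL2 \<Rightarrow> real" is "\<lambda>g h. \<integral>\<omega>. g \<omega> * h \<omega> \<partial>wmeas"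
  by (rule integral_cong_AE) (auto simp: wrel_def sq_int_def)

definition norm_wL2 :: "wL2 \<Rightarrow> real" where
  "norm_wL2 g = sqrt (g \<bullet> g)"

definition sgn_wL2 :: "wL2 \<Rightarrow> wL2" where
  "sgn_wL2 g = g /\<^sub>R norm g"

definition dist_wL2 :: "wL2 \<Rightarrow> wL2 \<Rightarrow> real" where
  "dist_wL2 g h = norm (g - h)"

definition uniformity_wL2 :: "(wL2 \<times> wL2) filter" where
  "uniformity_wL2 = (INF e\<in>{0<..}. principal {(x, y). dist x y < e})"

definition open_wL2 :: "wL2 set \<Rightarrow> bool" where
  "open_wL2 U = (\<forall>x\<in>U. eventually (\<lambda>(x', y). x' = x \<longrightarrow> y \<in> U) uniformity)"

instance
proof
  fix g h k :: wL2 and r :: real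
  show "dist g h = norm (g - h)" by (rule dist_wL2_def)
  show "sgn g = g /\<^sub>R norm g" by (rule sgn_wL2_def)
  show "uniformity = (INF e\<in>{0<..}. principal {(x :: wL2, y). dist x y < e})"
    by (rule uniformity_wL2_def)
  show "open U = (\<forall>x\<in>U. eventually (\<lambda>(x', y). x' = x \<longrightarrow> y \<in> U) uniformity)" for U :: "wL2 set"
    by (rule open_wL2_def)
  show "norm g = sqrt (g \<bullet> g)" by (rule norm_wL2_def)
  show "g \<bullet> h = h \<bullet> g"
    by transfer (simp add: mult.commute)
  show "(g + h) \<bullet> k = g \<bullet> k + h \<bullet> k"
    by transfer (simp add: wrel_def algebra_simps sq_int_mult_integrable)
  show "(r *\<^sub>R g) \<bullet> h = r * (g \<bullet> h)"
    by transfer (simp add: mult.assoc)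
  show "0 \<le> g \<bullet> g"
    by transfer simp
  show "(g \<bullet> g = 0) = (g = 0)"
  proof transfer
    fix g assume "wrel g g"
    then have g: "sq_int g" by (simp add: wrel_def)
    have "(\<integral>\<omega>. g \<omega> * g \<omega> \<partial>wmeas) = 0 \<longleftrightarrow> (AE \<omega> in wmeas. g \<omega> * g \<omega> = 0)"
      by (rule integral_nonneg_eq_0_iff_AE) (use g in \<open>auto intro: sq_int_mult_integrable\<close>)
    then show "(\<integral>\<omega>. g \<omega> * g \<omega> \<partial>wmeas) = 0 \<longleftrightarrow> wrel g (\<lambda>\<omega>. 0)"
      using g by (simp add: wrel_def sq_int_zero)
  qed
qed

end

section \<open>The operators $L_\mu$, $\Gamma_\mu$, $Q_\mu$\<close>

definition equil :: "real \<Rightarrow> real \<Rightarrow> real" where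
  "equil \<mu> \<omega> = 1 / (\<omega> + \<mu>)"

definition coll_dom :: "real \<Rightarrow> (real \<times> real) set" where
  "coll_dom \<omega> = {(\<omega>1, \<omega>2). 0 \<le> \<omega>1 \<and> 0 \<le> \<omega>2 \<and> \<omega> \<le> \<omega>1 + \<omega>2}"

definition coll_weight :: "real \<Rightarrow> real \<Rightarrow> real \<Rightarrow> real \<Rightarrow> real" where
  "coll_weight \<omega>0 \<omega>1 \<omega>2 \<omega>3 = Min {sqrt \<omega>0, sqrt \<omega>1, sqrt \<omega>2, sqrt \<omega>3} / sqrt \<omega>0"

definition coll_int ::
    "real \<Rightarrow> (real \<Rightarrow> real \<Rightarrow> real \<Rightarrow> real \<Rightarrow> real) \<Rightarrow> real \<Rightarrow> real" where
  "coll_int \<mu> B \<omega> = set_lebesgue_integral lborel (coll_dom \<omega>)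
     (\<lambda>(\<omega>1, \<omega>2). let \<omega>3 = \<omega>1 + \<omega>2 - \<omega> in
        coll_weight \<omega> \<omega>1 \<omega>2 \<omega>3 * equil \<mu> \<omega>1 * equil \<mu> \<omega>2 * equil \<mu> \<omega>3 * B \<omega> \<omega>1 \<omega>2 \<omega>3)"

definition L_formula :: "real \<Rightarrow> (real \<Rightarrow> real) \<Rightarrow> real \<Rightarrow> real" where
  "L_formula \<mu> g = coll_int \<mu> (\<lambda>\<omega>0 \<omega>1 \<omega>2 \<omega>3. let n = equil \<mu> in
     - g \<omega>0 / n \<omega>0 - g \<omega>3 / n \<omega>3 + g \<omega>1 / n \<omega>1 + g \<omega>2 / n \<omega>2)"

definition \<Gamma>_formula :: "real \<Rightarrow> (real \<Rightarrow> real) \<Rightarrow> real \<Rightarrow> real" where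
  "\<Gamma>_formula \<mu> g = coll_int \<mu> (\<lambda>\<omega>0 \<omega>1 \<omega>2 \<omega>3. let m = (\<lambda>\<omega>. inverse (equil \<mu> \<omega>)) in
     - g \<omega>0 * g \<omega>3 * (m \<omega>2 + m \<omega>1)
     + g \<omega>0 * g \<omega>1 * (m \<omega>3 - m \<omega>2)
     + g \<omega>0 * g \<omega>2 * (m \<omega>3 - m \<omega>1)
     + g \<omega>3 * g \<omega>1 * (m \<omega>1 - m \<omega>3)
     + g \<omega>3 * g \<omega>2 * (m \<omega>2 - m \<omega>3)
     + g \<omega>1 * g \<omega>2 * (m \<omega>2 + m \<omega>1))"

definition Q_formula :: "real \<Rightarrow> (real \<Rightarrow> real) \<Rightarrow> real \<Rightarrow> real" where
  "Q_formula \<mu> g = coll_int \<mu> (\<lambda>\<omega>0 \<omega>1 \<omega>2 \<omega>3. let m = (\<lambda>\<omega>. inverse (equil \<mu> \<omega>)) in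
     m \<omega>3 * g \<omega>0 * g \<omega>1 * g \<omega>2 + m \<omega>0 * g \<omega>1 * g \<omega>2 * g \<omega>3
     - m \<omega>1 * g \<omega>0 * g \<omega>2 * g \<omega>3 - m \<omega>2 * g \<omega>0 * g \<omega>1 * g \<omega>3)"

text \<open>$C_c^\infty(0,\infty)$, each function being extended by zero to the real line.\<close>

definition test_fun :: "(real \<Rightarrow> real) set" where
  "test_fun = {\<phi>. (\<forall>k x. (deriv ^^ k) \<phi> differentiable (at x)) \<and>
                  compact (closure {x. \<phi> x \<noteq> 0}) \<and> closure {x. \<phi> x \<noteq> 0} \<subseteq> {0<..}}"

lemma test_fun_sq_int:
  assumes "\<phi> \<in> test_fun"
  shows "sq_int \<phi>"
proof -
  let ?K = "closure {x. \<phi> x \<noteq> 0}"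
  have "((deriv ^^ 0) \<phi>) differentiable (at x)" for x
    using assms unfolding test_fun_def by blast
  then have cont: "continuous_on UNIV \<phi>"
    by (simp add: continuous_on_eq_continuous_at differentiable_imp_continuous_within)
  then have meas: "\<phi> \<in> borel_measurable borel"
    by (rule borel_measurable_continuous_onI)
  have K: "compact ?K" "?K \<subseteq> {0<..}"
    using assms by (auto simp: test_fun_def)
  have zero: "\<phi> x = 0" if "x \<notin> ?K" for x
    using that closure_subset[of "{x. \<phi> x \<noteq> 0}"] by auto
  have "set_integrable lborel ?K (\<lambda>x. sqrt x * (\<phi> x)\<^sup>2)"
    unfolding set_integrable_def
    by (rule borel_integrable_compact[OF K(1)])
      (intro continuous_intros continuous_on_subset[OF cont], auto)
  moreover have "indicat_real ?K x *\<^sub>R (sqrt x * (\<phi> x)\<^sup>2)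
      = (indicat_real {0<..} x * sqrt x) *\<^sub>R (\<phi> x)\<^sup>2" for x
    using zero[of x] K(2) by (cases "x \<in> ?K") auto
  ultimately have "integrable lborel (\<lambda>x. (indicat_real {0<..} x * sqrt x) *\<^sub>R (\<phi> x)\<^sup>2)"
    unfolding set_integrable_def by (simp only:)
  then have "integrable wmeas (\<lambda>x. (\<phi> x)\<^sup>2)"
    unfolding wmeas_def using meas
    by (subst integrable_density) (auto simp: indicator_def)
  then show ?thesis
    using meas by (simp add: sq_int_def wmeas_def)
qed

definition extends_formula :: "((real \<Rightarrow> real) \<Rightarrow> real \<Rightarrow> real) \<Rightarrow> (wL2 \<Rightarrow> wL2) \<Rightarrow> bool" where
  "extends_formula F T \<longleftrightarrow>
     (\<forall>\<phi>\<in>test_fun. AE \<omega> in wmeas. rep_wL2 (T (abs_wL2 \<phi>)) \<omega> = F \<phi> \<omega>)"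

text \<open>Bounded quadratic and cubic maps are the restrictions to the diagonal of bounded bilinear and
  trilinear maps. Since the classes of test functions are dense, each of the extensions below is
  unique.\<close>

definition bounded_quadratic :: "(wL2 \<Rightarrow> wL2) \<Rightarrow> bool" where
  "bounded_quadratic T \<longleftrightarrow> (\<exists>B :: wL2 \<Rightarrow>\<^sub>L wL2 \<Rightarrow>\<^sub>L wL2. \<forall>g. T g = B g g)"

definition bounded_cubic :: "(wL2 \<Rightarrow> wL2) \<Rightarrow> bool" where
  "bounded_cubic T \<longleftrightarrow> (\<exists>C :: wL2 \<Rightarrow>\<^sub>L wL2 \<Rightarrow>\<^sub>L wL2 \<Rightarrow>\<^sub>L wL2. \<forall>g. T g = C g g g)"

definition L_op :: "real \<Rightarrow> wL2 \<Rightarrow> wL2" where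
  "L_op \<mu> = (THE T. bounded_linear T \<and> extends_formula (L_formula \<mu>) T)"

definition \<Gamma>_op :: "real \<Rightarrow> wL2 \<Rightarrow> wL2" where
  "\<Gamma>_op \<mu> = (THE T. bounded_quadratic T \<and> extends_formula (\<Gamma>_formula \<mu>) T)"

definition Q_op :: "real \<Rightarrow> wL2 \<Rightarrow> wL2" where
  "Q_op \<mu> = (THE T. bounded_cubic T \<and> extends_formula (Q_formula \<mu>) T)"

definition ker_L :: "real \<Rightarrow> wL2 set" where
  "ker_L \<mu> = {g. L_op \<mu> g = 0}"

definition orth_proj :: "wL2 set \<Rightarrow> wL2 \<Rightarrow> wL2" where
  "orth_proj V g = (THE p. p \<in> V \<and> g - p \<in> V\<^sup>\<bottom>)"

definition spectral_gap :: "real \<Rightarrow> real \<Rightarrow> bool" where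
  "spectral_gap \<mu> l \<longleftrightarrow>
     0 < l \<and> (\<forall>g. - (L_op \<mu> g \<bullet> g) \<ge> l * (norm (g - orth_proj (ker_L \<mu>) g))\<^sup>2)"

section \<open>Perturbative solutions\<close>

definition perturbation_of :: "real \<Rightarrow> wL2 \<Rightarrow> wL2 \<Rightarrow> bool" where
  "perturbation_of \<mu> f g \<longleftrightarrow> (AE \<omega> in wmeas. rep_wL2 f \<omega> = equil \<mu> \<omega> * (1 + rep_wL2 g \<omega>))"

text \<open>One-sided derivative at \<open>t = 0\<close>; values at negative times are irrelevant.\<close>

definition C1_half_line :: "(real \<Rightarrow> wL2) \<Rightarrow> bool" where
  "C1_half_line u \<longleftrightarrow> (\<exists>u'. (\<forall>t\<ge>0. (u has_vector_derivative u' t) (at t within {0..})) \<and>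
     continuous_on {0..} u')"

definition solves_perturbation_eq :: "real \<Rightarrow> (real \<Rightarrow> wL2) \<Rightarrow> bool" where
  "solves_perturbation_eq \<mu> g \<longleftrightarrow> (\<forall>t\<ge>0.
     (g has_vector_derivative L_op \<mu> (g t) + \<Gamma>_op \<mu> (g t) + Q_op \<mu> (g t)) (at t within {0..}))"

definition perturbative_solution :: "real \<Rightarrow> (real \<Rightarrow> wL2) \<Rightarrow> bool" where
  "perturbative_solution \<mu> f \<longleftrightarrow>
     (\<exists>g. C1_half_line g \<and> solves_perturbation_eq \<mu> g \<and> (\<forall>t\<ge>0. perturbation_of \<mu> (f t) (g t)))"

end

theory Submission
  imports Defs
begin

text \<open>
The perturbation equation is an ordinary differential equation \<open>g' = F g\<close> in the Hilbert space \<open>H\<close>. Its right-hand side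
\<open>F = L + \<Gamma> + Q\<close> is a polynomial of degree three with bounded coefficients, is orthogonal to the kernel of \<open>L\<close>, and is
dissipative near \<open>0\<close> on the orthogonal complement of that kernel. Global existence, decay and uniqueness are then
facts about such equations; positivity is the invariance of a closed set.

\<^bold>\<open>Boundedness.\<close> Write \<open>1 / n(\<omega>) = \<omega> + \<mu>\<close> and use the resonance \<open>\<omega>\<^sub>0 + \<omega>\<^sub>3 = \<omega>\<^sub>1 + \<omega>\<^sub>2\<close> to expand the three integrands. Terms of
the first kind are a product \<open>n\<^sub>j n\<^sub>k\<close> times functions in slots \<open>1\<close>, \<open>2\<close>, \<open>3\<close>; they are estimated by the Cauchy--Schwarz inequality
on each fiber \<open>\<omega>\<^sub>0 = const\<close> with power weights (\<open>coll_energy_linear\<close>, \<open>coll_energy_bilinear\<close>, \<open>coll_energy_trilinear\<close>). Terms of the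
second kind contain \<open>g\<^sub>0\<close>, and the remaining integral is a multiplier that is bounded uniformly in \<open>\<omega>\<^sub>0\<close>
(\<open>collision_frequency_bound\<close> and the three bounds before it). So the integrals define bounded multilinear maps on all of \<open>H\<close>,
and because test functions are dense these are the operators of the equation (\<open>L_op_eq_lift\<close>, \<open>\<Gamma>_op_eq\<close>, \<open>Q_op_eq\<close>).

\<^bold>\<open>Orthogonality.\<close> The weight of \<open>H\<close> cancels the denominator of the collision weight, so the inner product of a collision
integral with \<open>g = n \<phi>\<close> is an integral over all resonant quadruples against a weight that is symmetric in the four
frequencies. The bracket is antisymmetric under exchange of the two pairs, and averaging replaces \<open>\<phi>\<^sub>0\<close> by a quarter of the
defect \<open>\<phi>\<^sub>0 + \<phi>\<^sub>3 - \<phi>\<^sub>1 - \<phi>\<^sub>2\<close> (\<open>inner_coll_antisymmetric\<close>). For \<open>L\<close> itself the bracket is minus the defect of \<open>g / n\<close>; therefore the elements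
of the kernel have zero defect, and all three operators take values orthogonal to the kernel (\<open>operators_orthogonal_ker_L\<close>).

\<^bold>\<open>Decay.\<close> If \<open>g\<close> is orthogonal to the kernel, the gap inequality reads \<open>\<langle>L g, g\<rangle> \<le> - l * \<parallel>g\<parallel>\<^sup>2\<close>, and in a small ball the terms of
higher order use up at most \<open>l - \<delta>\<close> (\<open>coll_field_dissipative\<close>). Truncating \<open>F\<close> outside the ball gives a globally Lipschitz equation;
its solution stays in the complement of the kernel and inside the ball, so the truncation is never active
(\<open>dissipative_ode_global_solution\<close>). Uniqueness among all solutions is Gronwall's inequality.

\<^bold>\<open>Positivity.\<close> A density \<open>f = n (1 + g)\<close> is nonnegative iff \<open>g \<ge> - 1\<close>. As the whole collision term is a loss proportional to \<open>f\<^sub>0\<close>, with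
a rate bounded on balls, plus the gain \<open>f\<^sub>1 f\<^sub>2 f\<^sub>3\<close>, a short Euler step does not leave the closed set of these \<open>g\<close>
(\<open>nonneg_perturbations_step\<close>), and hence the flow does not either (\<open>ode_invariant_closed_set\<close>).\<close>

section \<open>Differential equations in Hilbert spaces\<close>

lemma integral_half_line_has_vector_derivative:
  fixes f :: "real \<Rightarrow> 'a::banach"
  assumes "continuous_on {0..} f" and "0 \<le> t"
  shows "((\<lambda>u. integral {0..u} f) has_vector_derivative f t) (at t within {0..})"
proof -
  have "((\<lambda>u. integral {0..u} f) has_vector_derivative f t) (at t within {0..t + 1})"
    by (rule integral_has_vector_derivative)
      (use assms in \<open>auto intro: continuous_on_subset\<close>)
  moreover have "at t within {0..t + 1} = at t within {0..}"
    by (rule at_within_nhd[of t "{..<t + 1}"]) auto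
  ultimately show ?thesis by simp
qed

lemma has_integral_exp_scaled:
  fixes k :: real
  assumes "0 < k" and "0 \<le> t"
  shows "((\<lambda>s. c * exp (k * s)) has_integral c / k * (exp (k * t) - 1)) {0..t}"
proof -
  have "((\<lambda>s. c * exp (k * s)) has_integral (c / k * exp (k * t) - c / k * exp (k * 0))) {0..t}"
    by (rule fundamental_theorem_of_calculus)
      (use assms in \<open>auto intro!: derivative_eq_intros
         simp: has_real_derivative_iff_has_vector_derivative[symmetric]\<close>)
  then show ?thesis by (simp add: algebra_simps)
qed

text \<open>The Picard operator becomes a contraction on the whole half line when the distance of two curves is
measured with the weight \<open>exp (- k * t)\<close> (Bielecki's norm). A bounded continuous curve \<open>y\<close> stands for
the candidate solution \<open>exp (k * t) *\<^sub>R y t\<close>.\<close>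

lemma global_ode_solution_exists:
  fixes F :: "'a::banach \<Rightarrow> 'a"
  assumes lip: "L-lipschitz_on UNIV F"
  obtains u where "u 0 = x0"
    and "\<And>t. 0 \<le> t \<Longrightarrow> (u has_vector_derivative F (u t)) (at t within {0..})"
proof -
  (* The rate is more than twice the Lipschitz constant, so the contraction constant L / k is at most 1/2. *)
  define k where "k = 2 * L + 1"
  have L: "0 \<le> L" using lip by (rule lipschitz_on_nonneg)
  then have k: "0 < k" "L / k \<le> 1 / 2" by (auto simp: k_def field_simps)
  have Fc: "continuous_on UNIV F" using lip by (rule lipschitz_on_continuous_on)
  have F_le: "norm (F x) \<le> norm (F 0) + L * norm x" for x
    using lipschitz_onD[OF lip, of x 0] norm_triangle_ineq2[of "F x" "F 0"] by (simp add: dist_norm)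
  define f where "f y s = F (exp (k * s) *\<^sub>R apply_bcontfun y s)" for y :: "real \<Rightarrow>\<^sub>C 'a" and s
  have fc: "continuous_on A (f y)" for A y
    unfolding f_def
    by (rule continuous_on_compose2[OF Fc]) (auto intro!: continuous_intros)
  have fi: "f y integrable_on {0..t}" for y t
    using fc by (rule integrable_continuous_interval)
  define J where "J y t = exp (- k * t) *\<^sub>R (x0 + integral {0..t} (f y))" for y t
  have Jc: "continuous_on {0..} (J y)" for y
  proof -
    have "continuous_on {0..} (\<lambda>t. integral {0..t} (f y))"
      by (rule continuous_on_vector_derivative)
        (use integral_half_line_has_vector_derivative[OF fc] in auto)
    then show ?thesis unfolding J_def by (intro continuous_intros)
  qed
  (* The weight turns a bound that grows like exp (k * s) into one that gains the factor 1 / k. *)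
  have exp_bound: "exp (- k * t) * norm (integral {0..t} h) \<le> c / k"
    if t: "0 \<le> t" and c: "0 \<le> c" and h: "h integrable_on {0..t}"
      and le: "\<And>s. s \<in> {0..t} \<Longrightarrow> norm (h s) \<le> c * exp (k * s)" for t c and h :: "real \<Rightarrow> 'a"
  proof -
    note hi = has_integral_exp_scaled[OF k(1) t, of c]
    have "norm (integral {0..t} h) \<le> integral {0..t} (\<lambda>s. c * exp (k * s))"
      using le hi by (intro integral_norm_bound_integral h) auto
    also have "\<dots> = c / k * (exp (k * t) - 1)" using hi by (rule integral_unique)
    also have "\<dots> \<le> c / k * exp (k * t)" using c k by (intro mult_left_mono) auto
    finally have "exp (- k * t) * norm (integral {0..t} h) \<le> exp (- k * t) * (c / k * exp (k * t))"
      by (intro mult_left_mono) auto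
    also have "\<dots> = c / k" by (simp add: exp_minus field_simps)
    finally show ?thesis .
  qed
  (* Bounded continuous functions live on the whole real line: at negative times the value at 0 is used. *)
  have JB: "(\<lambda>t. J y (max 0 t)) \<in> bcontfun" for y
  proof -
    obtain b where b: "\<And>t. norm (apply_bcontfun y t) \<le> b"
      using bounded_apply_bcontfun[of y] unfolding bounded_iff by auto
    have b0: "0 \<le> b" using b[of 0] norm_ge_zero order_trans by blast
    have "norm (J y t) \<le> norm x0 + (norm (F 0) + L * b) / k" if t: "0 \<le> t" for t
    proof -
      have "norm (f y s) \<le> (norm (F 0) + L * b) * exp (k * s)" if "s \<in> {0..t}" for s
      proof -
        have e: "1 \<le> exp (k * s)" using that k by simp
        have "norm (f y s) \<le> norm (F 0) + L * (exp (k * s) * norm (apply_bcontfun y s))"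
          using F_le[of "exp (k * s) *\<^sub>R apply_bcontfun y s"] by (simp add: f_def)
        also have "\<dots> \<le> norm (F 0) * exp (k * s) + L * (exp (k * s) * b)"
          using e b[of s] L by (intro add_mono mult_left_mono) (auto simp: mult_le_cancel_left1)
        finally show ?thesis by (simp add: algebra_simps)
      qed
      then have "exp (- k * t) * norm (integral {0..t} (f y)) \<le> (norm (F 0) + L * b) / k"
        using L b0 fi t by (intro exp_bound) auto
      moreover have "exp (- k * t) * norm x0 \<le> 1 * norm x0"
        using k t by (intro mult_right_mono) auto
      moreover have "norm (J y t) \<le> exp (- k * t) * norm x0 + exp (- k * t) * norm (integral {0..t} (f y))"
        unfolding J_def by (auto simp flip: distrib_left intro!: mult_left_mono norm_triangle_ineq)
      ultimately show ?thesis by linarith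
    qed
    then have "bounded (range (\<lambda>t. J y (max 0 t)))"
      unfolding bounded_iff by (auto intro!: exI[of _ "norm x0 + (norm (F 0) + L * b) / k"])
    moreover have "continuous_on UNIV (\<lambda>t. J y (max 0 t))"
      by (rule continuous_on_compose2[OF Jc]) (auto intro!: continuous_intros)
    ultimately show ?thesis by (simp add: bcontfun_def)
  qed
  define \<Psi> where "\<Psi> y = Bcontfun (\<lambda>t. J y (max 0 t))" for y
  have \<Psi>: "apply_bcontfun (\<Psi> y) t = J y (max 0 t)" for y t
    unfolding \<Psi>_def using JB by (simp add: Bcontfun_inverse)
  have "dist (\<Psi> y) (\<Psi> z) \<le> 1 / 2 * dist y z" for y z
  proof (rule dist_bound)
    fix t :: real
    let ?t = "max 0 t"
    have "norm (f y s - f z s) \<le> (L * dist y z) * exp (k * s)" for s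
    proof -
      have "norm (f y s - f z s) \<le> L * dist (exp (k * s) *\<^sub>R apply_bcontfun y s) (exp (k * s) *\<^sub>R apply_bcontfun z s)"
        using lipschitz_onD[OF lip] by (simp add: f_def dist_norm)
      also have "\<dots> = L * (exp (k * s) * dist (apply_bcontfun y s) (apply_bcontfun z s))"
        by (simp add: dist_norm flip: scaleR_diff_right)
      also have "\<dots> \<le> L * (exp (k * s) * dist y z)"
        using L by (intro mult_left_mono dist_bounded) auto
      finally show ?thesis by (simp add: mult_ac)
    qed
    then have "exp (- k * ?t) * norm (integral {0..?t} (\<lambda>s. f y s - f z s)) \<le> (L * dist y z) / k"
      using L fi by (intro exp_bound integrable_diff) auto
    moreover have "dist (J y ?t) (J z ?t) = exp (- k * ?t) * norm (integral {0..?t} (\<lambda>s. f y s - f z s))"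
      by (simp add: J_def dist_norm integral_diff[OF fi fi] flip: scaleR_diff_right)
    moreover have "L * dist y z / k \<le> 1 / 2 * dist y z"
      using mult_right_mono[OF k(2), of "dist y z"] by simp
    ultimately show "dist (apply_bcontfun (\<Psi> y) t) (apply_bcontfun (\<Psi> z) t) \<le> 1 / 2 * dist y z"
      unfolding \<Psi> by linarith
  qed
  then have "\<exists>!y. \<Psi> y = y" by (intro banach_fix_type[of "1 / 2"]) auto
  then obtain y where y: "\<Psi> y = y" by auto
  define u where "u t = x0 + integral {0..t} (f y)" for t
  have uy: "u t = exp (k * t) *\<^sub>R apply_bcontfun y t" if "0 \<le> t" for t
  proof -
    have "apply_bcontfun y t = exp (- k * t) *\<^sub>R u t"
      using \<Psi>[of y t] that unfolding y by (simp add: J_def u_def)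
    then show ?thesis by (simp flip: exp_add)
  qed
  have "(u has_vector_derivative F (u t)) (at t within {0..})" if "0 \<le> t" for t
  proof -
    have "(u has_vector_derivative 0 + f y t) (at t within {0..})"
      unfolding u_def
      by (intro has_vector_derivative_add has_vector_derivative_const
          integral_half_line_has_vector_derivative fc that)
    then show ?thesis using uy[OF that] by (simp add: f_def)
  qed
  moreover have "u 0 = x0" by (simp add: u_def)
  ultimately show ?thesis using that by blast
qed

text \<open>The derivative of \<open>exp (- 2 * c * t) * (norm (u t))\<^sup>2\<close> is nonpositive. The one-sided bound on the inner product
may have a negative \<open>c\<close>, so this also yields exponential decay.\<close>

lemma gronwall_inner:
  fixes u :: "real \<Rightarrow> 'a::real_inner"
  assumes der: "\<And>t. 0 \<le> t \<Longrightarrow> (u has_vector_derivative u' t) (at t within {0..})"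
    and le: "\<And>t. 0 \<le> t \<Longrightarrow> t \<le> T \<Longrightarrow> u' t \<bullet> u t \<le> c * (norm (u t))\<^sup>2"
    and T: "0 \<le> T"
  shows "norm (u T) \<le> exp (c * T) * norm (u 0)"
proof -
  define \<phi> where "\<phi> t = exp (- 2 * c * t) * (u t \<bullet> u t)" for t
  have d: "(\<phi> has_real_derivative
      exp (- 2 * c * t) * (2 * (u' t \<bullet> u t) - 2 * c * (u t \<bullet> u t))) (at t within {0..})"
    if "0 \<le> t" for t
  proof -
    have "((\<lambda>t. u t \<bullet> u t) has_derivative (\<lambda>h. u t \<bullet> (h *\<^sub>R u' t) + (h *\<^sub>R u' t) \<bullet> u t)) (at t within {0..})"
      using der[OF that] unfolding has_vector_derivative_def
      by (intro has_derivative_inner) auto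
    then have "((\<lambda>t. u t \<bullet> u t) has_real_derivative 2 * (u' t \<bullet> u t)) (at t within {0..})"
      unfolding has_field_derivative_def
      by (rule has_derivative_eq_rhs) (auto simp: fun_eq_iff inner_commute)
    then show ?thesis unfolding \<phi>_def
      by (auto intro!: derivative_eq_intros simp: algebra_simps)
  qed
  have "\<phi> T \<le> \<phi> 0"
  proof (rule DERIV_nonpos_imp_decreasing_open[OF T])
    fix t assume t: "0 < t" "t < T"
    have "at t within {0..} = at t"
      using t by (intro at_within_interior) (auto simp: interior_Ici[of "-1"])
    then show "\<exists>y. (\<phi> has_real_derivative y) (at t) \<and> y \<le> 0"
      using d[of t] le[of t] t
      by (intro exI conjI, simp) (auto simp: power2_norm_eq_inner mult_nonneg_nonpos)
  next
    show "continuous_on {0..T} \<phi>"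
      by (rule DERIV_continuous_on[where D = "\<lambda>t. exp (- 2 * c * t) * (2 * (u' t \<bullet> u t) - 2 * c * (u t \<bullet> u t))"])
        (rule has_field_derivative_subset[OF d], auto)
  qed
  then have "exp (- 2 * c * T) * (norm (u T))\<^sup>2 \<le> (norm (u 0))\<^sup>2"
    by (simp add: \<phi>_def power2_norm_eq_inner)
  then have "exp (2 * c * T) * (exp (- 2 * c * T) * (norm (u T))\<^sup>2) \<le> exp (2 * c * T) * (norm (u 0))\<^sup>2"
    by (intro mult_left_mono) auto
  moreover have "exp (2 * c * T) * (exp (- 2 * c * T) * (norm (u T))\<^sup>2) = (norm (u T))\<^sup>2"
    by (simp add: mult.assoc[symmetric] flip: exp_add)
  moreover have "exp (2 * c * T) * (norm (u 0))\<^sup>2 = (exp (c * T) * norm (u 0))\<^sup>2"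
    by (simp add: power_mult_distrib mult.assoc flip: exp_double)
  ultimately have "(norm (u T))\<^sup>2 \<le> (exp (c * T) * norm (u 0))\<^sup>2" by metis
  then show ?thesis by (rule power2_le_imp_le) auto
qed

definition lipschitz_on_balls :: "('a::real_normed_vector \<Rightarrow> 'a) \<Rightarrow> bool" where
  "lipschitz_on_balls F \<longleftrightarrow> (\<forall>R. \<exists>L. L-lipschitz_on (cball 0 R) F)"

lemma solution_bounded:
  fixes u :: "real \<Rightarrow> 'a::real_normed_vector"
  assumes "\<And>t. 0 \<le> t \<Longrightarrow> (u has_vector_derivative u' t) (at t within {0..})"
  obtains R where "\<And>t. t \<in> {0..T} \<Longrightarrow> norm (u t) \<le> R"
proof -
  have "continuous_on {0..T} u"
    by (rule continuous_on_vector_derivative[where f' = u'])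
      (rule has_vector_derivative_within_subset[OF assms], auto)
  then have "bounded (u ` {0..T})"
    by (intro compact_imp_bounded compact_continuous_image) auto
  then obtain R where "\<forall>x\<in>u ` {0..T}. norm x \<le> R" unfolding bounded_iff by blast
  then show ?thesis using that by blast
qed

text \<open>Two solutions stay in a common ball up to any given time, where Gronwall's inequality applies to their difference.\<close>

lemma ode_solution_unique:
  fixes u v :: "real \<Rightarrow> 'a::real_inner"
  assumes F: "lipschitz_on_balls F"
    and u: "\<And>t. 0 \<le> t \<Longrightarrow> (u has_vector_derivative F (u t)) (at t within {0..})"
    and v: "\<And>t. 0 \<le> t \<Longrightarrow> (v has_vector_derivative F (v t)) (at t within {0..})"
    and "u 0 = v 0" and "0 \<le> t"
  shows "u t = v t"
proof -
  obtain R1 where R1: "\<And>s. s \<in> {0..t} \<Longrightarrow> norm (u s) \<le> R1" using solution_bounded[OF u] by blast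
  obtain R2 where R2: "\<And>s. s \<in> {0..t} \<Longrightarrow> norm (v s) \<le> R2" using solution_bounded[OF v] by blast
  obtain L where L: "L-lipschitz_on (cball 0 (max R1 R2)) F"
    using F unfolding lipschitz_on_balls_def by blast
  have "norm (u t - v t) \<le> exp (L * t) * norm (u 0 - v 0)"
  proof (rule gronwall_inner[where u = "\<lambda>t. u t - v t" and u' = "\<lambda>t. F (u t) - F (v t)"])
    show "((\<lambda>t. u t - v t) has_vector_derivative F (u s) - F (v s)) (at s within {0..})" if "0 \<le> s" for s
      using that by (intro has_vector_derivative_diff u v)
    show "(F (u s) - F (v s)) \<bullet> (u s - v s) \<le> L * (norm (u s - v s))\<^sup>2" if "0 \<le> s" "s \<le> t" for s
    proof -
      have "norm (F (u s) - F (v s)) \<le> L * norm (u s - v s)"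
        using lipschitz_onD[OF L, of "u s" "v s"] R1[of s] R2[of s] that
        by (simp add: dist_norm max.coboundedI1 max.coboundedI2)
      then have "norm (F (u s) - F (v s)) * norm (u s - v s) \<le> L * norm (u s - v s) * norm (u s - v s)"
        by (intro mult_right_mono) auto
      then show ?thesis
        using norm_cauchy_schwarz[of "F (u s) - F (v s)" "u s - v s"]
        by (simp add: power2_eq_square mult.assoc)
    qed
  qed fact
  then show ?thesis using assms(4) by simp
qed

definition radial_retraction :: "real \<Rightarrow> 'a::real_normed_vector \<Rightarrow> 'a" where
  "radial_retraction R x = (R / max R (norm x)) *\<^sub>R x"

lemma norm_radial_retraction_le: "0 < R \<Longrightarrow> norm (radial_retraction R x) \<le> R"
  by (auto simp: radial_retraction_def field_simps mult_left_mono)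

lemma radial_retraction_lipschitz:
  assumes R: "0 < R"
  shows "2-lipschitz_on UNIV (radial_retraction R :: 'a::real_normed_vector \<Rightarrow> 'a)"
proof (rule lipschitz_onI)
  fix x y :: 'a
  define m where "m = max R (norm x)"
  define m' where "m' = max R (norm y)"
  have m: "R \<le> m" "0 < m" "R \<le> m'" "0 < m'" "norm y \<le> m'"
    using R by (auto simp: m_def m'_def)
  have mm: "\<bar>m' - m\<bar> \<le> norm (x - y)"
    unfolding m_def m'_def using norm_triangle_ineq3[of x y] by linarith
  (* The factor R / max R (norm x) varies slowly: the two summands below contribute 1 each to the constant 2. *)
  have "radial_retraction R x - radial_retraction R y
      = (R / m) *\<^sub>R (x - y) + (R / m - R / m') *\<^sub>R y"
    by (simp add: radial_retraction_def m_def m'_def algebra_simps)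
  also have "norm \<dots> \<le> R / m * norm (x - y) + \<bar>R / m - R / m'\<bar> * norm y"
    using norm_triangle_ineq[of "(R / m) *\<^sub>R (x - y)" "(R / m - R / m') *\<^sub>R y"] m R by simp
  also have "\<bar>R / m - R / m'\<bar> * norm y = R / m * \<bar>m' - m\<bar> * (norm y / m')"
  proof -
    have "R / m - R / m' = R / m * (m' - m) / m'" using m by (simp add: field_simps)
    then show ?thesis using m R by (simp add: abs_mult)
  qed
  also have "\<dots> \<le> 1 * \<bar>m' - m\<bar> * 1"
    using m R by (intro mult_mono) auto
  also have "R / m * norm (x - y) + 1 * \<bar>m' - m\<bar> * 1 \<le> 1 * norm (x - y) + norm (x - y)"
    using m mm R by (intro add_mono mult_right_mono) auto
  finally show "dist (radial_retraction R x) (radial_retraction R y) \<le> 2 * dist x y"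
    by (simp add: dist_norm)
qed simp

text \<open>Composing \<open>F\<close> with the radial retraction gives a globally Lipschitz field, hence a global solution \<open>u\<close>. Its
components along \<open>N\<close> are constant because \<open>F\<close> takes values in the orthogonal complement. As the retraction
only rescales a vector by a positive factor, dissipativity also makes the norm of \<open>u\<close> nonincreasing; so \<open>u\<close>
never leaves the ball, solves the original equation, and the dissipation inequality gives the decay rate.\<close>

lemma dissipative_ode_global_solution:
  fixes F :: "'a::{real_inner,banach} \<Rightarrow> 'a"
  assumes F: "lipschitz_on_balls F"
    and range: "\<And>x. F x \<in> N\<^sup>\<bottom>"
    and dissip: "\<And>x. x \<in> N\<^sup>\<bottom> \<Longrightarrow> norm x \<le> R \<Longrightarrow> F x \<bullet> x \<le> - \<delta> * (norm x)\<^sup>2"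
    and R: "0 < R" and \<delta>: "0 \<le> \<delta>" and x0: "x0 \<in> N\<^sup>\<bottom>" "norm x0 \<le> R"
  obtains u where "u 0 = x0"
    and "\<And>t. 0 \<le> t \<Longrightarrow> (u has_vector_derivative F (u t)) (at t within {0..})"
    and "\<And>t. 0 \<le> t \<Longrightarrow> u t \<in> N\<^sup>\<bottom>"
    and "\<And>t. 0 \<le> t \<Longrightarrow> norm (u t) \<le> exp (- \<delta> * t) * norm x0"
proof -
  let ?P = "radial_retraction R :: 'a \<Rightarrow> 'a"
  obtain L where "L-lipschitz_on (cball 0 R) F" using F unfolding lipschitz_on_balls_def by blast
  then have "(L * 2)-lipschitz_on UNIV (\<lambda>x. F (?P x))"
    using norm_radial_retraction_le[OF R]
    by (intro lipschitz_on_compose2[OF radial_retraction_lipschitz[OF R]])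
      (auto elim!: lipschitz_on_subset)
  then obtain u where u0: "u 0 = x0"
    and u: "\<And>t. 0 \<le> t \<Longrightarrow> (u has_vector_derivative F (?P (u t))) (at t within {0..})"
    by (rule global_ode_solution_exists[where ?x0.0 = x0]) blast
  have uN: "u t \<in> N\<^sup>\<bottom>" if t: "0 \<le> t" for t
    unfolding orthogonal_comp_def
  proof clarify
    fix \<phi> assume \<phi>: "\<phi> \<in> N"
    have "((\<lambda>t. u t \<bullet> \<phi>) has_vector_derivative 0) (at s within {0..})" if "s \<in> {0..}" for s
    proof -
      have "((\<lambda>t. u t \<bullet> \<phi>) has_vector_derivative F (?P (u s)) \<bullet> \<phi>) (at s within {0..})"
        using that by (intro bounded_linear.has_vector_derivative[OF bounded_linear_inner_left] u) auto
      moreover have "F (?P (u s)) \<bullet> \<phi> = 0"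
        using range[of "?P (u s)"] \<phi> by (auto simp: orthogonal_comp_def orthogonal_def inner_commute)
      ultimately show ?thesis by simp
    qed
    then obtain c where c: "\<And>s. s \<in> {0..} \<Longrightarrow> u s \<bullet> \<phi> = c"
      using has_vector_derivative_zero_constant[of "{0..}" "\<lambda>t. u t \<bullet> \<phi>"] by auto
    moreover have "u 0 \<bullet> \<phi> = 0"
      using x0 \<phi> by (auto simp: u0 orthogonal_comp_def orthogonal_def inner_commute)
    ultimately show "orthogonal \<phi> (u t)"
      using c[of 0] c[of t] t by (simp add: orthogonal_def inner_commute)
  qed
  (* Here the truncated field is used: the retraction of u s is a positive multiple of u s. *)
  have u_le: "norm (u t) \<le> R" if t: "0 \<le> t" for t
  proof -
    have "norm (u t) \<le> exp (0 * t) * norm (u 0)"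
    proof (rule gronwall_inner[OF u _ t])
      fix s :: real assume s: "0 \<le> s"
      define c where "c = R / max R (norm (u s))"
      have c: "0 < c" "?P (u s) = c *\<^sub>R u s" using R by (auto simp: c_def radial_retraction_def)
      have PN: "?P (u s) \<in> N\<^sup>\<bottom>"
        unfolding c using uN[OF s] by (auto simp: orthogonal_comp_def orthogonal_clauses)
      have "F (?P (u s)) \<bullet> ?P (u s) \<le> - \<delta> * (norm (?P (u s)))\<^sup>2"
        using dissip[OF PN norm_radial_retraction_le[OF R]] .
      also have "\<dots> \<le> 0" using \<delta> by (simp add: mult_nonneg_nonneg)
      finally have "c * (F (?P (u s)) \<bullet> u s) \<le> 0" unfolding c by simp
      then show "F (?P (u s)) \<bullet> u s \<le> 0 * (norm (u s))\<^sup>2"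
        using c(1) by (simp add: mult_le_0_iff)
    qed
    then show ?thesis using x0 u0 by simp
  qed
  have P: "?P (u t) = u t" if "0 \<le> t" for t
    using u_le[OF that] R by (simp add: radial_retraction_def max_absorb1)
  have u': "(u has_vector_derivative F (u t)) (at t within {0..})" if "0 \<le> t" for t
    using u[OF that] P[OF that] by simp
  have "norm (u t) \<le> exp (- \<delta> * t) * norm x0" if "0 \<le> t" for t
    unfolding u0[symmetric]
    by (rule gronwall_inner[OF u' _ that]) (auto intro!: dissip[simplified] uN u_le)
  with u0 u' uN show ?thesis using that by blast
qed

text \<open>If short Euler steps starting in \<open>K\<close> end in \<open>K\<close>, then \<open>K\<close> is invariant under the flow (a form of Nagumo's theorem).
Comparing the solution with the Euler step from an almost nearest point \<open>k\<close> of \<open>K\<close> shows that the distance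
\<open>d\<close> to \<open>K\<close> satisfies \<open>d (t + h) \<le> (1 + h * L) * d t + o(h)\<close>, so \<open>d\<close> stays below \<open>\<epsilon> * exp ((L + 1) * t)\<close> for every
\<open>\<epsilon> > 0\<close> and therefore vanishes. As \<open>K\<close> is only closed, a nearest point need not exist.\<close>

lemma ode_invariant_closed_set:
  fixes u :: "real \<Rightarrow> 'a::real_normed_vector"
  assumes F: "lipschitz_on_balls F"
    and u: "\<And>t. 0 \<le> t \<Longrightarrow> (u has_vector_derivative F (u t)) (at t within {0..})"
    and K: "closed K" "u 0 \<in> K"
    and step: "\<And>R. \<exists>h0>0. \<forall>h k. 0 < h \<and> h \<le> h0 \<and> k \<in> K \<and> norm k \<le> R \<longrightarrow> k + h *\<^sub>R F k \<in> K"
    and T: "0 \<le> T"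
  shows "u T \<in> K"
proof -
  define T1 where "T1 = T + 1"
  obtain R where R: "\<And>t. t \<in> {0..T1} \<Longrightarrow> norm (u t) \<le> R" using solution_bounded[OF u] by blast
  have R0: "0 \<le> R" using R[of 0] T norm_ge_zero[of "u 0"] by (auto simp: T1_def simp del: norm_ge_zero)
  (* The solution has norm at most R and distance at most 2 * R + 1 from the points of K used below. *)
  define R' where "R' = 3 * R + 1"
  obtain L where L: "L-lipschitz_on (cball 0 R') F"
    using F unfolding lipschitz_on_balls_def by blast
  have L0: "0 \<le> L" using L by (rule lipschitz_on_nonneg)
  obtain h0 where h0: "0 < h0" "\<And>h k. 0 < h \<Longrightarrow> h \<le> h0 \<Longrightarrow> k \<in> K \<Longrightarrow> norm k \<le> R' \<Longrightarrow> k + h *\<^sub>R F k \<in> K"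
    using step[of R'] by blast
  have Kne: "K \<noteq> {}" using K by auto
  define d where "d t = infdist (u t) K" for t
  have uc: "continuous_on {0..} u"
    by (rule continuous_on_vector_derivative) (use u in auto)
  have dc: "continuous_on {0..} d" unfolding d_def by (intro continuous_intros uc)
  (* The error h^2 of the almost nearest point is o(h). *)
  have growth: "d (t + h) \<le> norm (u (t + h) - u t - h *\<^sub>R F (u t)) + (1 + h * L) * (d t + h\<^sup>2)"
    if t: "t \<in> {0..T1}" and h: "0 < h" "h \<le> h0" "h \<le> 1" for t h
  proof -
    have "d t < d t + h\<^sup>2" using h by simp
    then obtain k where k: "k \<in> K" "dist (u t) k < d t + h\<^sup>2"
      using infdist_attains_inf infdist_notempty[OF Kne, of "u t"] cINF_less_iff[of K "dist (u t)"] Kne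
      unfolding d_def by (metis bdd_below_image_dist)
    have "d t \<le> dist (u t) (u 0)" unfolding d_def using K(2) by (rule infdist_le)
    also have "\<dots> \<le> norm (u t) + norm (u 0)" by (simp add: dist_norm norm_triangle_ineq4)
    also have "\<dots> \<le> 2 * R" using R[OF t] R[of 0] T by (auto simp: T1_def)
    finally have dR: "d t \<le> 2 * R" .
    have h2: "h\<^sup>2 \<le> 1" using h by (simp add: power_le_one)
    have "norm k \<le> norm (u t) + dist (u t) k"
      using norm_triangle_ineq2[of k "u t"] by (simp add: dist_norm norm_minus_commute)
    then have kR: "norm k \<le> R'" using R[OF t] dR h2 k(2) by (simp add: R'_def)
    have uR: "norm (u t) \<le> R'" using R[OF t] R0 by (simp add: R'_def)
    have "d (t + h) \<le> dist (u (t + h)) (k + h *\<^sub>R F k)"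
      unfolding d_def by (rule infdist_le) (use h0 h k kR in auto)
    also have "\<dots> = norm ((u (t + h) - u t - h *\<^sub>R F (u t)) + ((u t - k) + h *\<^sub>R (F (u t) - F k)))"
      by (simp add: dist_norm algebra_simps)
    also have "\<dots> \<le> norm (u (t + h) - u t - h *\<^sub>R F (u t)) + (norm (u t - k) + norm (h *\<^sub>R (F (u t) - F k)))"
      by (intro order_trans[OF norm_triangle_ineq] add_left_mono norm_triangle_ineq)
    also have "norm (h *\<^sub>R (F (u t) - F k)) \<le> h * (L * norm (u t - k))"
      using lipschitz_onD[OF L, of "u t" k] uR kR h by (simp add: dist_norm)
    also have "norm (u t - k) + h * (L * norm (u t - k)) = (1 + h * L) * norm (u t - k)"
      by (simp add: algebra_simps)
    also have "\<dots> \<le> (1 + h * L) * (d t + h\<^sup>2)"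
      using k(2) h L0 by (intro mult_left_mono) (auto simp: dist_norm)
    finally show ?thesis by simp
  qed
  have main: "d T \<le> \<epsilon> * exp ((L + 1) * T)" if \<epsilon>: "0 < \<epsilon>" for \<epsilon>
  proof -
    define \<psi> where "\<psi> t = \<epsilon> * exp ((L + 1) * t)" for t
    have \<psi>pos: "0 < \<psi> t" for t using \<epsilon> by (simp add: \<psi>_def)
    have \<psi>c: "continuous_on A \<psi>" for A unfolding \<psi>_def by (intro continuous_intros)
    (* Times up to which the barrier has not been crossed; its supremum c is shown to be T. *)
    define A where "A = {t \<in> {0..T}. \<forall>s\<in>{0..t}. d s \<le> \<psi> s}"
    have d0: "d 0 \<le> \<psi> 0" using K \<psi>pos[of 0] by (simp add: d_def)
    have A0: "0 \<in> A" using T d0 by (auto simp: A_def)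
    have bdd: "bdd_above A" by (auto simp: A_def bdd_above_def)
    define c where "c = Sup A"
    have c: "0 \<le> c" "c \<le> T"
      unfolding c_def using A0 bdd by (auto intro: cSup_upper intro!: cSup_least simp: A_def)
    have below: "d s \<le> \<psi> s" if "0 \<le> s" "s < c" for s
    proof -
      obtain t where "t \<in> A" "s < t" using \<open>s < c\<close> A0 unfolding c_def by (auto elim: less_cSupE)
      then show ?thesis using that by (auto simp: A_def)
    qed
    have dpsic: "continuous_on {0..} (\<lambda>t. d t - \<psi> t)" by (intro continuous_intros dc \<psi>c)
    have at_c: "d c \<le> \<psi> c"
    proof (rule ccontr)
      assume "\<not> d c \<le> \<psi> c"
      then have "c \<noteq> 0" "0 < d c - \<psi> c" using d0 by auto
      then obtain e where e: "0 < e" "\<And>x. x \<in> {0..} \<Longrightarrow> dist x c < e \<Longrightarrow> dist (d x - \<psi> x) (d c - \<psi> c) < d c - \<psi> c"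
        using dpsic c unfolding continuous_on_iff by (metis atLeast_iff)
      define s where "s = max 0 (c - e / 2)"
      have "0 \<le> s" "s < c" "dist s c < e" using e c \<open>c \<noteq> 0\<close> by (auto simp: s_def dist_real_def)
      then show False using e(2)[of s] below[of s] by (auto simp: dist_real_def)
    qed
    have "c = T"
    proof (rule ccontr)
      assume "c \<noteq> T"
      then have cT: "c < T" using c by simp
      have "\<forall>e>0. \<exists>d>0. \<forall>y\<in>{0..}. 0 < norm (y - c) \<and> norm (y - c) < d \<longrightarrow>
          norm (u y - u c - (y - c) *\<^sub>R F (u c)) / norm (y - c) < e"
        using u[OF c(1)] unfolding has_vector_derivative_def has_derivative_within' by blast
      from this[rule_format, of "\<psi> c / 2"] \<psi>pos[of c]
      obtain e where e: "0 < e" "\<And>y. y \<in> {0..} \<Longrightarrow> 0 < norm (y - c) \<Longrightarrow> norm (y - c) < e \<Longrightarrow>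
          norm (u y - u c - (y - c) *\<^sub>R F (u c)) / norm (y - c) < \<psi> c / 2"
        by (metis half_gt_zero)
      (* The bounds on the step: differentiability at c, the Euler step, the time interval, and h^2 * (1 + L) against h * psi c / 2. *)
      define \<eta> where "\<eta> = min (min (e / 2) (min h0 1)) (min (T - c) (\<psi> c / (2 * (1 + L))))"
      have \<eta>: "0 < \<eta>" using e h0 cT \<psi>pos[of c] L0 by (simp add: \<eta>_def)
      have after: "d (c + h) \<le> \<psi> (c + h)" if h: "0 < h" "h \<le> \<eta>" for h
      proof -
        have hh: "h < e" "h \<le> h0" "h \<le> 1" "h \<le> T - c" "h \<le> \<psi> c / (2 * (1 + L))"
          using h e by (auto simp: \<eta>_def)
        have "norm (u (c + h) - u c - h *\<^sub>R F (u c)) \<le> h * (\<psi> c / 2)"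
          using e(2)[of "c + h"] hh h c by (simp add: divide_less_eq mult.commute)
        moreover have "(1 + h * L) * (d c + h\<^sup>2) \<le> \<psi> c + h * L * \<psi> c + h * (\<psi> c / 2)"
        proof -
          have "(1 + h * L) * (d c + h\<^sup>2) \<le> (1 + h * L) * (\<psi> c + h\<^sup>2)"
            using at_c h L0 by (intro mult_left_mono) auto
          also have "\<dots> = \<psi> c + h * L * \<psi> c + (1 + h * L) * h\<^sup>2" by (simp add: algebra_simps)
          also have "(1 + h * L) * h\<^sup>2 \<le> (1 + L) * h\<^sup>2"
            using hh L0 h by (intro mult_right_mono) (auto simp: mult_left_le_one_le)
          also have "\<dots> = h * (h * (1 + L))" by (simp add: power2_eq_square)
          also have "\<dots> \<le> h * (\<psi> c / 2)"
            using hh(5) L0 h by (intro mult_left_mono) (auto simp: field_simps)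
          finally show ?thesis by simp
        qed
        moreover have "\<psi> c + h * L * \<psi> c + h * \<psi> c \<le> \<psi> (c + h)"
        proof -
          have "\<psi> (c + h) = \<psi> c * exp ((L + 1) * h)" by (simp add: \<psi>_def algebra_simps flip: exp_add)
          moreover have "\<psi> c * (1 + (L + 1) * h) \<le> \<psi> c * exp ((L + 1) * h)"
            using \<psi>pos[of c] by (intro mult_left_mono exp_ge_add_one_self) auto
          ultimately show ?thesis by (simp add: algebra_simps)
        qed
        ultimately show ?thesis using growth[of c h] hh h c by (simp add: T1_def)
      qed
      have "c + \<eta> \<in> A"
      proof -
        have "d s \<le> \<psi> s" if "s \<in> {0..c + \<eta>}" for s
          using that below[of s] at_c after[of "s - c"] by (cases s c rule: linorder_cases) auto
        then show ?thesis using c \<eta> by (auto simp: A_def \<eta>_def)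
      qed
      then have "c + \<eta> \<le> c" unfolding c_def using bdd by (rule cSup_upper)
      then show False using \<eta> by simp
    qed
    then show ?thesis using at_c by (simp add: \<psi>_def)
  qed
  have "d T \<le> 0"
  proof (rule field_le_epsilon)
    fix e :: real assume "0 < e"
    then show "d T \<le> 0 + e" using main[of "e / exp ((L + 1) * T)"] by simp
  qed
  then have "infdist (u T) K = 0" using infdist_nonneg[of "u T" K] by (simp add: d_def)
  then show ?thesis using in_closed_iff_infdist_zero[OF K(1) Kne] by simp
qed

section \<open>Classes of square integrable functions\<close>

lemma sets_wmeas [measurable_cong, simp]: "sets wmeas = sets borel"
  by (simp add: wmeas_def)

lemma space_wmeas [simp]: "space wmeas = UNIV"
  by (simp add: wmeas_def)

lemma borel_measurable_wmeas [simp]: "borel_measurable wmeas = borel_measurable borel"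
  by (rule measurable_cong_sets) simp_all

lemma AE_wmeas_iff:
  "(AE \<omega> in wmeas. P \<omega>) \<longleftrightarrow> (AE \<omega> in lborel. 0 < \<omega> \<longrightarrow> P \<omega>)"
proof -
  have "(AE \<omega> in wmeas. P \<omega>) \<longleftrightarrow>
      (AE \<omega> in lborel. 0 < ennreal (indicator {0<..} \<omega> * sqrt \<omega>) \<longrightarrow> P \<omega>)"
    unfolding wmeas_def by (rule AE_density) simp
  also have "\<dots> \<longleftrightarrow> (AE \<omega> in lborel. 0 < \<omega> \<longrightarrow> P \<omega>)"
    by (intro AE_cong) (auto simp: indicator_def)
  finally show ?thesis .
qed

lemma AE_wmeas_pos: "AE \<omega> in wmeas. 0 < \<omega>"
  by (simp add: AE_wmeas_iff)

lemma nn_integral_wmeas: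
  assumes "f \<in> borel_measurable borel"
  shows "(\<integral>\<^sup>+\<omega>. f \<omega> \<partial>wmeas) = (\<integral>\<^sup>+\<omega>. ennreal (indicator {0<..} \<omega> * sqrt \<omega>) * f \<omega> \<partial>lborel)"
  unfolding wmeas_def by (rule nn_integral_density) (use assms in auto)

lemma emeasure_wmeas_interval_finite: "emeasure wmeas {a..b} < \<infinity>"
proof -
  have "emeasure wmeas {a..b} = (\<integral>\<^sup>+\<omega>. indicator {a..b} \<omega> \<partial>wmeas)" by simp
  also have "\<dots> = (\<integral>\<^sup>+\<omega>. ennreal (indicator {0<..} \<omega> * sqrt \<omega>) * indicator {a..b} \<omega> \<partial>lborel)"
    by (rule nn_integral_wmeas) simp
  also have "\<dots> \<le> (\<integral>\<^sup>+\<omega>. ennreal (sqrt \<bar>b\<bar>) * indicator {a..b} \<omega> \<partial>lborel)"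
    by (intro nn_integral_mono) (auto simp: indicator_def intro!: ennreal_leI)
  also have "\<dots> = ennreal (sqrt \<bar>b\<bar>) * emeasure lborel {a..b}"
    by (simp add: nn_integral_cmult)
  also have "\<dots> < \<infinity>"
    by (simp add: emeasure_lborel_Icc_eq ennreal_mult_less_top)
  finally show ?thesis .
qed

lemma sq_int_rep [simp]: "sq_int (rep_wL2 g)"
  using Quotient3_rep_reflp[OF Quotient3_wL2, of g] by (simp add: wrel_def)

lemma abs_rep_wL2 [simp]: "abs_wL2 (rep_wL2 g) = g"
  by (rule Quotient3_abs_rep[OF Quotient3_wL2])

lemma sq_int_measurable [measurable_dest]: "sq_int \<phi> \<Longrightarrow> \<phi> \<in> borel_measurable borel"
  by (simp add: sq_int_def)

lemma rep_measurable [measurable]: "rep_wL2 g \<in> borel_measurable borel"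
  by (rule sq_int_measurable) simp

lemma rep_abs_wL2: "sq_int \<phi> \<Longrightarrow> AE \<omega> in wmeas. rep_wL2 (abs_wL2 \<phi>) \<omega> = \<phi> \<omega>"
  using Quotient3_rep_abs[OF Quotient3_wL2, of \<phi>] by (simp add: wrel_def)

lemma abs_wL2_cong: "sq_int \<phi> \<Longrightarrow> sq_int \<psi> \<Longrightarrow> AE \<omega> in wmeas. \<phi> \<omega> = \<psi> \<omega> \<Longrightarrow> abs_wL2 \<phi> = abs_wL2 \<psi>"
  by (rule Quotient3_rel_abs[OF Quotient3_wL2]) (simp add: wrel_def)

lemma wL2_eqI: "AE \<omega> in wmeas. rep_wL2 g \<omega> = rep_wL2 h \<omega> \<Longrightarrow> g = h"
  using Quotient3_rel_rep[OF Quotient3_wL2, of g h] by (simp add: wrel_def)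

lemma abs_wL2_eqI: "sq_int \<phi> \<Longrightarrow> AE \<omega> in wmeas. rep_wL2 g \<omega> = \<phi> \<omega> \<Longrightarrow> abs_wL2 \<phi> = g"
  using abs_wL2_cong[of \<phi> "rep_wL2 g"] by (simp add: eq_commute)

lemma abs_wL2_add: "sq_int \<phi> \<Longrightarrow> sq_int \<psi> \<Longrightarrow> abs_wL2 (\<lambda>\<omega>. \<phi> \<omega> + \<psi> \<omega>) = abs_wL2 \<phi> + abs_wL2 \<psi>"
  by (rule sym, rule plus_wL2.abs_eq) (auto simp: wrel_def)

lemma abs_wL2_diff: "sq_int \<phi> \<Longrightarrow> sq_int \<psi> \<Longrightarrow> abs_wL2 (\<lambda>\<omega>. \<phi> \<omega> - \<psi> \<omega>) = abs_wL2 \<phi> - abs_wL2 \<psi>"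
  by (rule sym, rule minus_wL2.abs_eq) (auto simp: wrel_def)

lemma abs_wL2_scale: "sq_int \<phi> \<Longrightarrow> abs_wL2 (\<lambda>\<omega>. c * \<phi> \<omega>) = c *\<^sub>R abs_wL2 \<phi>"
  by (rule sym, rule scaleR_wL2.abs_eq) (auto simp: wrel_def)

lemma rep_add: "AE \<omega> in wmeas. rep_wL2 (g + h) \<omega> = rep_wL2 g \<omega> + rep_wL2 h \<omega>"
  using rep_abs_wL2[of "\<lambda>\<omega>. rep_wL2 g \<omega> + rep_wL2 h \<omega>"] by (simp add: abs_wL2_add sq_int_add)

lemma rep_diff: "AE \<omega> in wmeas. rep_wL2 (g - h) \<omega> = rep_wL2 g \<omega> - rep_wL2 h \<omega>"
  using rep_abs_wL2[of "\<lambda>\<omega>. rep_wL2 g \<omega> - rep_wL2 h \<omega>"] by (simp add: abs_wL2_diff sq_int_diff)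

lemma rep_scale: "AE \<omega> in wmeas. rep_wL2 (c *\<^sub>R g) \<omega> = c * rep_wL2 g \<omega>"
  using rep_abs_wL2[of "\<lambda>\<omega>. c * rep_wL2 g \<omega>"] by (simp add: abs_wL2_scale sq_int_scale)

lemma inner_abs_wL2: "sq_int \<phi> \<Longrightarrow> sq_int \<psi> \<Longrightarrow> abs_wL2 \<phi> \<bullet> abs_wL2 \<psi> = (\<integral>\<omega>. \<phi> \<omega> * \<psi> \<omega> \<partial>wmeas)"
  by (rule inner_wL2.abs_eq) (auto simp: wrel_def)

lemma norm_abs_wL2: "sq_int \<phi> \<Longrightarrow> (norm (abs_wL2 \<phi>))\<^sup>2 = (\<integral>\<omega>. (\<phi> \<omega>)\<^sup>2 \<partial>wmeas)"
  unfolding power2_norm_eq_inner by (simp add: inner_abs_wL2) (simp add: power2_eq_square)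

lemma ennreal_norm_abs_wL2: "sq_int \<phi> \<Longrightarrow> (\<integral>\<^sup>+\<omega>. ennreal ((\<phi> \<omega>)\<^sup>2) \<partial>wmeas) = ennreal ((norm (abs_wL2 \<phi>))\<^sup>2)"
  by (subst norm_abs_wL2, simp, rule nn_integral_eq_integral) (auto simp: sq_int_def)

lemma sq_intI_nn:
  assumes "\<phi> \<in> borel_measurable borel" "(\<integral>\<^sup>+\<omega>. ennreal ((\<phi> \<omega>)\<^sup>2) \<partial>wmeas) < \<infinity>"
  shows "sq_int \<phi>"
  using assms by (auto simp: sq_int_def integrable_iff_bounded)

lemma sq_int_bound:
  assumes "sq_int \<psi>" "\<phi> \<in> borel_measurable borel" "AE \<omega> in wmeas. \<bar>\<phi> \<omega>\<bar> \<le> \<bar>\<psi> \<omega>\<bar>"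
  shows "sq_int \<phi>"
proof -
  have "integrable wmeas (\<lambda>\<omega>. (\<phi> \<omega>)\<^sup>2)"
  proof (rule Bochner_Integration.integrable_bound)
    show "integrable wmeas (\<lambda>\<omega>. (\<psi> \<omega>)\<^sup>2)" using assms by (simp add: sq_int_def)
    show "AE \<omega> in wmeas. norm ((\<phi> \<omega>)\<^sup>2) \<le> norm ((\<psi> \<omega>)\<^sup>2)"
      using assms(3) by eventually_elim (simp add: abs_le_square_iff)
  qed (use assms in auto)
  then show ?thesis using assms by (simp add: sq_int_def)
qed

section \<open>Completeness of the space\<close>

text \<open>From \<open>\<bar>a n\<bar> \<le> (1 / 2) ^ n + 2 ^ n * (a n)\<^sup>2\<close>, the arithmetic-geometric mean inequality.\<close>

lemma summable_if_weighted_squares_summable: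
  fixes a :: "nat \<Rightarrow> real"
  assumes "summable (\<lambda>n. 2 ^ n * (a n)\<^sup>2)"
  shows "summable a"
proof (rule summable_comparison_test')
  show "summable (\<lambda>n. (1 / 2) ^ n + 2 ^ n * (a n)\<^sup>2)"
    by (intro summable_add assms summable_geometric) simp
  show "norm (a n) \<le> (1 / 2) ^ n + 2 ^ n * (a n)\<^sup>2" if "0 \<le> n" for n
  proof -
    have "0 \<le> (1 - 2 ^ n * \<bar>a n\<bar>)\<^sup>2 + 2 ^ n * \<bar>a n\<bar> + 1 - 1" by simp
    also have "\<dots> = 1 + (2 ^ n)\<^sup>2 * (a n)\<^sup>2 - 2 ^ n * \<bar>a n\<bar>"
      by (simp add: power2_eq_square algebra_simps)
    finally have "2 ^ n * \<bar>a n\<bar> \<le> 2 ^ n * ((1 / 2) ^ n + 2 ^ n * (a n)\<^sup>2)"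
      by (simp add: algebra_simps power2_eq_square flip: power_mult_distrib)
    then show ?thesis by simp
  qed
qed

text \<open>Fatou's lemma for the squares.\<close>

lemma wL2_norm_le_of_AE_limit:
  assumes meas: "\<psi> \<in> borel_measurable borel" and lim: "AE \<omega> in wmeas. (\<lambda>n. rep_wL2 (X n) \<omega>) \<longlonglongrightarrow> \<psi> \<omega>"
    and e: "\<And>n. N \<le> n \<Longrightarrow> norm (X n) \<le> e" and e0: "0 \<le> e"
  shows "sq_int \<psi> \<and> norm (abs_wL2 \<psi>) \<le> e"
proof -
  have "(\<integral>\<^sup>+\<omega>. ennreal ((\<psi> \<omega>)\<^sup>2) \<partial>wmeas) \<le> (\<integral>\<^sup>+\<omega>. liminf (\<lambda>n. ennreal ((rep_wL2 (X n) \<omega>)\<^sup>2)) \<partial>wmeas)"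
    by (rule nn_integral_mono_AE, use lim in eventually_elim)
      (auto intro!: eq_refl sym[OF lim_imp_Liminf] tendsto_intros)
  also have "\<dots> \<le> liminf (\<lambda>n. \<integral>\<^sup>+\<omega>. ennreal ((rep_wL2 (X n) \<omega>)\<^sup>2) \<partial>wmeas)"
    by (rule nn_integral_liminf) simp
  also have "\<dots> = liminf (\<lambda>n. ennreal ((norm (X n))\<^sup>2))"
    by (simp add: ennreal_norm_abs_wL2)
  also have "\<dots> \<le> ennreal (e\<^sup>2)"
    by (rule order_trans[OF Liminf_le_Limsup], simp, rule Limsup_bounded)
      (auto simp: eventually_sequentially intro!: exI[of _ N] ennreal_leI power_mono e)
  finally have le: "(\<integral>\<^sup>+\<omega>. ennreal ((\<psi> \<omega>)\<^sup>2) \<partial>wmeas) \<le> ennreal (e\<^sup>2)" .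
  then have sq: "sq_int \<psi>"
    by (intro sq_intI_nn meas) (auto intro: le_less_trans)
  have "(norm (abs_wL2 \<psi>))\<^sup>2 \<le> e\<^sup>2"
    using le unfolding ennreal_norm_abs_wL2[OF sq] by simp
  then show ?thesis using sq e0 by (auto intro: power2_le_imp_le)
qed

text \<open>Riesz--Fischer. A subsequence with increments \<open>\<Delta> k\<close> of norm at most \<open>2 ^ - k\<close> converges almost everywhere: the
integral of \<open>\<Sum>k. 2 ^ k * (\<Delta> k)\<^sup>2\<close> is finite. The pointwise limit is the limit in norm by Fatou's lemma.\<close>

instance wL2 :: banach
proof
  fix X :: "nat \<Rightarrow> wL2"
  assume X: "Cauchy X"
  have "\<exists>N. \<forall>m\<ge>N. \<forall>n\<ge>N. dist (X m) (X n) < (1 / 2) ^ k" for k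
    using X unfolding Cauchy_def by (meson zero_less_power half_gt_zero_iff zero_less_one)
  then obtain N where N: "\<And>k m n. N k \<le> m \<Longrightarrow> N k \<le> n \<Longrightarrow> dist (X m) (X n) < (1 / 2) ^ k"
    by metis
  (* Summing the indices makes the subsequence strictly increasing and at least N. *)
  define r where "r k = (\<Sum>i\<le>k. N i) + k" for k
  have r: "strict_mono r" by (rule strict_monoI_Suc) (simp add: r_def)
  have rN: "N k \<le> r m" if "k \<le> m" for k m
    unfolding r_def using that member_le_sum[of k "{..m}" N] by auto
  define Y where "Y k = X (r k)" for k
  define \<Delta> where "\<Delta> k = Y (Suc k) - Y k" for k
  have \<Delta>: "norm (\<Delta> k) \<le> (1 / 2) ^ k" for k
    using N[of k "r (Suc k)" "r k"] rN[of k] by (simp add: \<Delta>_def Y_def dist_norm less_imp_le)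
  have "(\<integral>\<^sup>+\<omega>. (\<Sum>k. ennreal (2 ^ k * (rep_wL2 (\<Delta> k) \<omega>)\<^sup>2)) \<partial>wmeas)
      = (\<Sum>k. \<integral>\<^sup>+\<omega>. ennreal (2 ^ k * (rep_wL2 (\<Delta> k) \<omega>)\<^sup>2) \<partial>wmeas)"
    by (rule nn_integral_suminf) simp
  also have "\<dots> = (\<Sum>k. ennreal (2 ^ k * (norm (\<Delta> k))\<^sup>2))"
    by (simp add: ennreal_mult nn_integral_cmult ennreal_norm_abs_wL2)
  also have "\<dots> \<le> (\<Sum>k. ennreal ((1 / 2) ^ k))"
  proof (intro suminf_le ennreal_leI)
    fix k
    have "2 ^ k * (norm (\<Delta> k))\<^sup>2 \<le> 2 ^ k * ((1 / 2) ^ k)\<^sup>2"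
      using \<Delta>[of k] by (intro mult_left_mono power_mono) auto
    also have "\<dots> = (1 / 2) ^ k"
      by (simp add: power2_eq_square flip: mult.assoc power_mult_distrib)
    finally show "2 ^ k * (norm (\<Delta> k))\<^sup>2 \<le> (1 / 2) ^ k" .
  qed auto
  also have "\<dots> < \<infinity>"
    by (subst suminf_ennreal2) (auto intro: summable_geometric)
  finally have "AE \<omega> in wmeas. (\<Sum>k. ennreal (2 ^ k * (rep_wL2 (\<Delta> k) \<omega>)\<^sup>2)) \<noteq> \<infinity>"
    by (intro nn_integral_PInf_AE) auto
  moreover have "AE \<omega> in wmeas. \<forall>k. rep_wL2 (\<Delta> k) \<omega> = rep_wL2 (Y (Suc k)) \<omega> - rep_wL2 (Y k) \<omega>"
    unfolding AE_all_countable \<Delta>_def by (intro allI rep_diff)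
  ultimately have conv: "AE \<omega> in wmeas. convergent (\<lambda>k. rep_wL2 (Y k) \<omega>)"
  proof eventually_elim
    case (elim \<omega>)
    then have "summable (\<lambda>k. 2 ^ k * (rep_wL2 (\<Delta> k) \<omega>)\<^sup>2)"
      by (intro summable_suminf_not_top) auto
    then have "summable (\<lambda>k. rep_wL2 (\<Delta> k) \<omega>)" by (rule summable_if_weighted_squares_summable)
    then have "convergent (\<lambda>n. \<Sum>k<n. rep_wL2 (\<Delta> k) \<omega>)" by (simp add: summable_iff_convergent)
    moreover have "(\<Sum>k<n. rep_wL2 (\<Delta> k) \<omega>) = rep_wL2 (Y n) \<omega> - rep_wL2 (Y 0) \<omega>" for n
      using elim(2) by (simp add: sum_lessThan_telescope[of "\<lambda>k. rep_wL2 (Y k) \<omega>"])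
    ultimately have "convergent (\<lambda>n. rep_wL2 (Y n) \<omega> - rep_wL2 (Y 0) \<omega>)" by simp
    then have "convergent (\<lambda>n. (rep_wL2 (Y n) \<omega> - rep_wL2 (Y 0) \<omega>) + rep_wL2 (Y 0) \<omega>)"
      by (intro convergent_add convergent_const)
    then show ?case by simp
  qed
  define \<phi> where "\<phi> \<omega> = lim (\<lambda>k. rep_wL2 (Y k) \<omega>)" for \<omega>
  have \<phi>m: "\<phi> \<in> borel_measurable borel" unfolding \<phi>_def by simp
  have lim: "AE \<omega> in wmeas. (\<lambda>k. rep_wL2 (Y k) \<omega>) \<longlonglongrightarrow> \<phi> \<omega>"
    using conv by eventually_elim (simp add: \<phi>_def convergent_LIMSEQ_iff)
  have diff: "sq_int (\<lambda>\<omega>. \<phi> \<omega> - rep_wL2 (Y n) \<omega>) \<and> norm (abs_wL2 (\<lambda>\<omega>. \<phi> \<omega> - rep_wL2 (Y n) \<omega>)) \<le> (1 / 2) ^ n" for n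
  proof (rule wL2_norm_le_of_AE_limit[where X = "\<lambda>m. Y m - Y n" and N = n])
    have "AE \<omega> in wmeas. \<forall>m. rep_wL2 (Y m - Y n) \<omega> = rep_wL2 (Y m) \<omega> - rep_wL2 (Y n) \<omega>"
      unfolding AE_all_countable by (intro allI rep_diff)
    with lim show "AE \<omega> in wmeas. (\<lambda>m. rep_wL2 (Y m - Y n) \<omega>) \<longlonglongrightarrow> \<phi> \<omega> - rep_wL2 (Y n) \<omega>"
      by eventually_elim (auto intro: tendsto_diff)
    show "norm (Y m - Y n) \<le> (1 / 2) ^ n" if "n \<le> m" for m
      using N[of n "r m" "r n"] rN[of n] that by (simp add: Y_def dist_norm less_imp_le)
  qed (use \<phi>m in auto)
  have "sq_int (\<lambda>\<omega>. (\<phi> \<omega> - rep_wL2 (Y 0) \<omega>) + rep_wL2 (Y 0) \<omega>)"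
    using diff[of 0] by (intro sq_int_add) auto
  then have \<phi>: "sq_int \<phi>" by simp
  have "norm (Y n - abs_wL2 \<phi>) \<le> (1 / 2) ^ n" for n
    using diff[of n] abs_wL2_diff[OF \<phi>, of "rep_wL2 (Y n)"] by (simp add: norm_minus_commute)
  then have "(\<lambda>n. Y n - abs_wL2 \<phi>) \<longlonglongrightarrow> 0"
    by (intro tendsto_0_le[OF LIMSEQ_realpow_zero[of "1 / 2 :: real"], where K = 1] always_eventually) auto
  then have "(X \<circ> r) \<longlonglongrightarrow> abs_wL2 \<phi>"
    by (simp add: LIM_zero_iff Y_def comp_def)
  then have "X \<longlonglongrightarrow> abs_wL2 \<phi>" by (rule Cauchy_converges_subseq[OF X r])
  then show "convergent X" by (auto simp: convergent_def)
qed

section \<open>Density of the test functions\<close>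

lemma wL2_dominated_convergence:
  assumes \<psi>: "sq_int \<psi>" and \<phi>m: "\<phi> \<in> borel_measurable borel" "\<And>n. U n \<in> borel_measurable borel"
    and le: "\<And>n \<omega>. \<bar>U n \<omega>\<bar> \<le> \<psi> \<omega>"
    and lim: "AE \<omega> in wmeas. (\<lambda>n. U n \<omega>) \<longlonglongrightarrow> \<phi> \<omega>"
  shows "sq_int \<phi>" and "\<And>n. sq_int (U n)" and "(\<lambda>n. abs_wL2 (U n)) \<longlonglongrightarrow> abs_wL2 \<phi>"
proof -
  have \<phi>le: "AE \<omega> in wmeas. \<bar>\<phi> \<omega>\<bar> \<le> \<psi> \<omega>"
    using lim by eventually_elim (rule LIMSEQ_le_const2[OF tendsto_rabs], use le in auto)
  then have "AE \<omega> in wmeas. \<bar>\<phi> \<omega>\<bar> \<le> \<bar>\<psi> \<omega>\<bar>" by eventually_elim simp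
  then show \<phi>: "sq_int \<phi>" by (rule sq_int_bound[OF \<psi> \<phi>m(1)])
  show U: "sq_int (U n)" for n
    using le[of n] by (intro sq_int_bound[OF \<psi> \<phi>m(2)] AE_I2) (meson abs_ge_self order_trans)
  have "(\<lambda>n. \<integral>\<omega>. (U n \<omega> - \<phi> \<omega>)\<^sup>2 \<partial>wmeas) \<longlonglongrightarrow> (\<integral>\<omega>. 0 \<partial>wmeas)"
  proof (rule integral_dominated_convergence[where w = "\<lambda>\<omega>. (2 * \<psi> \<omega>)\<^sup>2"])
    show "integrable wmeas (\<lambda>\<omega>. (2 * \<psi> \<omega>)\<^sup>2)" using sq_int_scale[OF \<psi>, of 2] by (simp add: sq_int_def)
    show "AE \<omega> in wmeas. (\<lambda>n. (U n \<omega> - \<phi> \<omega>)\<^sup>2) \<longlonglongrightarrow> 0"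
      using lim by eventually_elim (auto intro!: tendsto_eq_intros simp: LIM_zero)
    show "AE \<omega> in wmeas. norm ((U n \<omega> - \<phi> \<omega>)\<^sup>2) \<le> (2 * \<psi> \<omega>)\<^sup>2" for n
      using \<phi>le
    proof eventually_elim
      case (elim \<omega>)
      have "\<bar>U n \<omega> - \<phi> \<omega>\<bar> \<le> \<bar>2 * \<psi> \<omega>\<bar>" using elim le[of n \<omega>] by linarith
      then have "(U n \<omega> - \<phi> \<omega>)\<^sup>2 \<le> (2 * \<psi> \<omega>)\<^sup>2" using abs_le_square_iff by blast
      then show ?case by simp
    qed
  qed (use \<phi>m \<psi> in auto)
  moreover have "(\<integral>\<omega>. (U n \<omega> - \<phi> \<omega>)\<^sup>2 \<partial>wmeas) = (norm (abs_wL2 (U n) - abs_wL2 \<phi>))\<^sup>2" for n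
    using norm_abs_wL2[OF sq_int_diff[OF U \<phi>, of n]] by (simp add: abs_wL2_diff U \<phi>)
  ultimately have "(\<lambda>n. (norm (abs_wL2 (U n) - abs_wL2 \<phi>))\<^sup>2) \<longlonglongrightarrow> 0" by simp
  from tendsto_real_sqrt[OF this] have "(\<lambda>n. norm (abs_wL2 (U n) - abs_wL2 \<phi>)) \<longlonglongrightarrow> 0" by simp
  then show "(\<lambda>n. abs_wL2 (U n)) \<longlonglongrightarrow> abs_wL2 \<phi>"
    by (simp add: tendsto_norm_zero_iff LIM_zero_iff)
qed

lemma smooth_deriv_add:
  fixes f g :: "real \<Rightarrow> real"
  assumes "\<forall>k x. (deriv ^^ k) f differentiable (at x)" "\<forall>k x. (deriv ^^ k) g differentiable (at x)"
  shows "(deriv ^^ k) (\<lambda>x. f x + g x) = (\<lambda>x. (deriv ^^ k) f x + (deriv ^^ k) g x)"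
proof (induction k)
  case (Suc k)
  have "deriv (\<lambda>x. (deriv ^^ k) f x + (deriv ^^ k) g x) x = deriv ((deriv ^^ k) f) x + deriv ((deriv ^^ k) g) x" for x
    using assms by (intro deriv_add) (auto simp: field_differentiable_def real_differentiable_def)
  then show ?case using Suc by auto
qed simp

lemma smooth_deriv_scale:
  fixes f :: "real \<Rightarrow> real"
  assumes "\<forall>k x. (deriv ^^ k) f differentiable (at x)"
  shows "(deriv ^^ k) (\<lambda>x. c * f x) = (\<lambda>x. c * (deriv ^^ k) f x)"
proof (induction k)
  case (Suc k)
  have "deriv (\<lambda>x. c * (deriv ^^ k) f x) x = c * deriv ((deriv ^^ k) f) x" for x
    using assms by (intro deriv_cmult) (auto simp: field_differentiable_def real_differentiable_def)
  then show ?case using Suc by auto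
qed simp

lemma test_funI:
  assumes "\<And>k x. (deriv ^^ k) f differentiable (at x)"
    and "{x. f x \<noteq> 0} \<subseteq> A" "compact A" "A \<subseteq> {0<..}"
  shows "f \<in> test_fun"
proof -
  have sub: "closure {x. f x \<noteq> 0} \<subseteq> A"
    using assms by (intro closure_minimal compact_imp_closed)
  then have "closure {x. f x \<noteq> 0} = A \<inter> closure {x. f x \<noteq> 0}" by blast
  moreover have "compact (A \<inter> closure {x. f x \<noteq> 0})"
    by (intro compact_Int_closed assms closed_closure)
  ultimately have "compact (closure {x. f x \<noteq> 0})" by (simp only:)
  then show ?thesis
    unfolding test_fun_def using assms(1) sub assms(4) by blast
qed

lemma test_funD:
  assumes "f \<in> test_fun"
  shows "\<forall>k x. (deriv ^^ k) f differentiable (at x)" "compact (closure {x. f x \<noteq> 0})"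
    "closure {x. f x \<noteq> 0} \<subseteq> {0<..}"
  using assms unfolding test_fun_def by blast+

lemma test_fun_add:
  assumes f: "f \<in> test_fun" and g: "g \<in> test_fun"
  shows "(\<lambda>x. f x + g x) \<in> test_fun"
proof (rule test_funI)
  note sm = test_funD(1)[OF f] test_funD(1)[OF g]
  show "(deriv ^^ k) (\<lambda>x. f x + g x) differentiable (at x)" for k x
    unfolding smooth_deriv_add[OF sm] using sm by (intro differentiable_add) blast+
  show "{x. f x + g x \<noteq> 0} \<subseteq> closure {x. f x \<noteq> 0} \<union> closure {x. g x \<noteq> 0}"
  proof
    fix x assume "x \<in> {x. f x + g x \<noteq> 0}"
    then have "x \<in> {x. f x \<noteq> 0} \<or> x \<in> {x. g x \<noteq> 0}" by auto
    then show "x \<in> closure {x. f x \<noteq> 0} \<union> closure {x. g x \<noteq> 0}"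
      by (meson UnCI closure_subset subsetD)
  qed
  show "compact (closure {x. f x \<noteq> 0} \<union> closure {x. g x \<noteq> 0})"
    by (intro compact_Un test_funD f g)
  show "closure {x. f x \<noteq> 0} \<union> closure {x. g x \<noteq> 0} \<subseteq> {0<..}"
    using test_funD(3)[OF f] test_funD(3)[OF g] by blast
qed

lemma test_fun_scale:
  assumes f: "f \<in> test_fun"
  shows "(\<lambda>x. c * f x) \<in> test_fun"
proof (rule test_funI)
  note sm = test_funD(1)[OF f]
  show "(deriv ^^ k) (\<lambda>x. c * f x) differentiable (at x)" for k x
    unfolding smooth_deriv_scale[OF sm] using sm by (intro differentiable_mult differentiable_const) blast
  show "{x. c * f x \<noteq> 0} \<subseteq> closure {x. f x \<noteq> 0}"
    by (rule subset_trans[OF _ closure_subset]) auto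
qed (use test_funD[OF f] in blast)+

text \<open>All derivatives of the classical flat function \<open>exp (- c / x)\<close>, \<open>x > 0\<close>, are combinations of these functions, whose
powers of \<open>inverse x\<close> are swallowed by the exponential at \<open>0\<close>.\<close>

definition flat_exp :: "real \<Rightarrow> nat \<Rightarrow> real \<Rightarrow> real" where
  "flat_exp c n x = (if 0 < x then inverse x ^ n * exp (- c / x) else 0)"

lemma flat_exp_has_derivative:
  assumes c: "0 < c"
  shows "(flat_exp c n has_real_derivative - real n * flat_exp c (Suc n) x + c * flat_exp c (n + 2) x) (at x)"
proof (cases x "0::real" rule: linorder_cases)
  case less
  have "((\<lambda>x. 0) has_real_derivative 0) (at x)" by simp
  then have "(flat_exp c n has_real_derivative 0) (at x)"
    by (rule has_field_derivative_transform_within_open[where S = "{..<0}"])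
      (use less in \<open>auto simp: flat_exp_def\<close>)
  then show ?thesis using less by (simp add: flat_exp_def)
next
  case greater
  have pow: "((\<lambda>x. inverse x ^ n) has_real_derivative - real n * inverse x ^ Suc n) (at x)" for n
  proof (induction n)
    case (Suc n)
    from greater have "((\<lambda>x. inverse x * inverse x ^ n) has_real_derivative
        - (inverse x)\<^sup>2 * inverse x ^ n + - real n * inverse x ^ Suc n * inverse x) (at x)"
      by (intro DERIV_mult Suc) (auto intro!: derivative_eq_intros simp: power2_eq_square)
    then show ?case by (simp add: power2_eq_square algebra_simps)
  qed simp
  have "((\<lambda>x. exp (- c / x)) has_real_derivative exp (- c / x) * (c * (inverse x)\<^sup>2)) (at x)"
    using greater by (auto intro!: derivative_eq_intros simp: field_simps power2_eq_square)
  from DERIV_mult[OF pow[of n] this]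
  have "((\<lambda>x. inverse x ^ n * exp (- c / x)) has_real_derivative
      - real n * flat_exp c (Suc n) x + c * flat_exp c (n + 2) x) (at x)"
    using greater by (simp add: flat_exp_def power2_eq_square algebra_simps)
  then show ?thesis
    by (rule has_field_derivative_transform_within_open[where S = "{0<..}"])
      (use greater in \<open>auto simp: flat_exp_def\<close>)
next
  case equal
  have "((\<lambda>h. flat_exp c n h / h) \<longlongrightarrow> 0) (at 0)"
  proof (rule filterlim_split_at)
    show "((\<lambda>h. flat_exp c n h / h) \<longlongrightarrow> 0) (at_left 0)"
      by (rule tendsto_eventually) (auto simp: eventually_at_filter flat_exp_def)
    have "filterlim (\<lambda>h. c * inverse h) at_top (at_right (0::real))"
      using filterlim_tendsto_pos_mult_at_top[OF tendsto_const c filterlim_inverse_at_top_right] by simp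
    from filterlim_compose[OF tendsto_power_div_exp_0[of "Suc n"] this]
    have "((\<lambda>h. inverse c ^ Suc n * ((c * inverse h) ^ Suc n / exp (c * inverse h))) \<longlongrightarrow> inverse c ^ Suc n * 0) (at_right 0)"
      by (intro tendsto_mult tendsto_const)
    then have "((\<lambda>h. inverse c ^ Suc n * ((c * inverse h) ^ Suc n / exp (c * inverse h))) \<longlongrightarrow> 0) (at_right 0)" by simp
    then show "((\<lambda>h. flat_exp c n h / h) \<longlongrightarrow> 0) (at_right 0)"
    proof (rule Lim_transform_eventually)
      show "\<forall>\<^sub>F h in at_right 0. inverse c ^ Suc n * ((c * inverse h) ^ Suc n / exp (c * inverse h)) = flat_exp c n h / h"
        unfolding eventually_at_filter
        by (rule always_eventually)
          (use c in \<open>auto simp: flat_exp_def exp_minus power_mult_distrib field_simps\<close>)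
    qed
  qed
  then show ?thesis using equal by (simp add: has_field_derivative_iff flat_exp_def)
qed

text \<open>A linear space of functions supported in \<open>{a..b}\<close> that is closed under differentiation; membership is
therefore enough for smoothness, with no formula for higher derivatives.\<close>

inductive_set bump_span :: "real \<Rightarrow> real \<Rightarrow> real \<Rightarrow> (real \<Rightarrow> real) set" for c a b where
  base: "(\<lambda>x. flat_exp c m (x - a) * flat_exp c n (b - x)) \<in> bump_span c a b"
| add: "f \<in> bump_span c a b \<Longrightarrow> g \<in> bump_span c a b \<Longrightarrow> (\<lambda>x. f x + g x) \<in> bump_span c a b"
| scale: "f \<in> bump_span c a b \<Longrightarrow> (\<lambda>x. r * f x) \<in> bump_span c a b"

lemma bump_span_deriv:
  assumes "f \<in> bump_span c a b" and c: "0 < c"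
  shows "\<exists>f'\<in>bump_span c a b. \<forall>x. (f has_real_derivative f' x) (at x)"
  using assms(1)
proof induction
  case (base m n)
  let ?e = "flat_exp c"
  let ?f' = "\<lambda>x. (- real m * (?e (Suc m) (x - a) * ?e n (b - x)) + c * (?e (m + 2) (x - a) * ?e n (b - x)))
     + (real n * (?e m (x - a) * ?e (Suc n) (b - x)) + (- c) * (?e m (x - a) * ?e (n + 2) (b - x)))"
  have "((\<lambda>x. ?e m (x - a) * ?e n (b - x)) has_real_derivative ?f' x) (at x)" for x
  proof -
    have "((\<lambda>x. ?e m (x - a)) has_real_derivative (- real m * ?e (Suc m) (x - a) + c * ?e (m + 2) (x - a)) * 1) (at x)"
      by (rule DERIV_chain2[OF flat_exp_has_derivative[OF c]]) (auto intro!: derivative_eq_intros)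
    moreover have "((\<lambda>x. ?e n (b - x)) has_real_derivative (- real n * ?e (Suc n) (b - x) + c * ?e (n + 2) (b - x)) * (- 1)) (at x)"
      by (rule DERIV_chain2[OF flat_exp_has_derivative[OF c]]) (auto intro!: derivative_eq_intros)
    ultimately show ?thesis
      by (rule DERIV_mult[THEN DERIV_cong]) (simp add: algebra_simps)
  qed
  moreover have "?f' \<in> bump_span c a b"
    by (intro bump_span.add bump_span.scale bump_span.base)
  ultimately show ?case by (intro bexI[of _ ?f'] allI)
next
  case (add f g)
  then obtain f' g' where "f' \<in> bump_span c a b" "\<forall>x. (f has_real_derivative f' x) (at x)"
    "g' \<in> bump_span c a b" "\<forall>x. (g has_real_derivative g' x) (at x)" by blast
  then show ?case by (intro bexI[of _ "\<lambda>x. f' x + g' x"]) (auto intro: bump_span.add DERIV_add)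
next
  case (scale f r)
  then obtain f' where "f' \<in> bump_span c a b" "\<forall>x. (f has_real_derivative f' x) (at x)" by blast
  then show ?case by (intro bexI[of _ "\<lambda>x. r * f' x"]) (auto intro: bump_span.scale DERIV_cmult)
qed

lemma bump_span_smooth:
  assumes "f \<in> bump_span c a b" "0 < c"
  shows "(deriv ^^ k) f differentiable (at x)"
proof -
  have d: "deriv g \<in> bump_span c a b \<and> (\<forall>x. g differentiable (at x))" if g: "g \<in> bump_span c a b" for g
  proof -
    obtain g' where g': "g' \<in> bump_span c a b" "\<forall>x. (g has_real_derivative g' x) (at x)"
      using bump_span_deriv[OF g assms(2)] by blast
    then have "deriv g = g'" by (auto intro: DERIV_imp_deriv)
    then show ?thesis using g' by (auto simp: real_differentiable_def)
  qed
  have "(deriv ^^ k) f \<in> bump_span c a b"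
    by (induction k) (use assms d in auto)
  then show ?thesis using d by blast
qed

text \<open>For \<open>a > 0\<close>, test functions that increase to the indicator of the open interval as the exponents tend to \<open>0\<close>.\<close>

definition bump :: "real \<Rightarrow> real \<Rightarrow> nat \<Rightarrow> real \<Rightarrow> real" where
  "bump a b k x = flat_exp (1 / real (Suc k)) 0 (x - a) * flat_exp (1 / real (Suc k)) 0 (b - x)"

lemma bump_test_fun:
  assumes "0 < a"
  shows "bump a b k \<in> test_fun"
proof -
  have eq: "bump a b k = (\<lambda>x. flat_exp (1 / real (Suc k)) 0 (x - a) * flat_exp (1 / real (Suc k)) 0 (b - x))"
    by (auto simp: bump_def)
  have "bump a b k \<in> bump_span (1 / real (Suc k)) a b"
    unfolding eq by (rule bump_span.base)
  then have "(deriv ^^ j) (bump a b k) differentiable (at x)" for j x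
    by (rule bump_span_smooth) simp
  moreover have "{x. bump a b k x \<noteq> 0} \<subseteq> {a..b}" by (auto simp: bump_def flat_exp_def)
  ultimately show ?thesis
    using assms by (intro test_funI[where A = "{a..b}"]) auto
qed

lemma bump_tendsto: "(\<lambda>k. bump a b k x) \<longlonglongrightarrow> indicator {a<..<b} x"
proof (cases "a < x \<and> x < b")
  case True
  have "(\<lambda>k. exp (- (1 / real (Suc k)) / (x - a)) * exp (- (1 / real (Suc k)) / (b - x))) \<longlonglongrightarrow> exp (- 0 / (x - a)) * exp (- 0 / (b - x))"
    by (intro tendsto_intros LIMSEQ_Suc[OF lim_1_over_n]) (use True in auto)
  then show ?thesis using True by (simp add: bump_def flat_exp_def)
qed (auto simp: bump_def flat_exp_def)

lemma bump_bounds: "\<bar>bump a b k x\<bar> \<le> indicator {a..b} x"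
  by (auto simp: bump_def flat_exp_def indicator_def intro!: mult_le_one)

lemma sq_int_indicator: "A \<in> sets borel \<Longrightarrow> A \<subseteq> {a..b} \<Longrightarrow> sq_int (indicator A)"
proof -
  assume A: "A \<in> sets borel" "A \<subseteq> {a..b}"
  have "(\<lambda>\<omega>. (indicat_real A \<omega>)\<^sup>2) = indicator A" by (auto simp: indicator_def)
  moreover have "emeasure wmeas A < \<infinity>"
    using emeasure_mono[of A "{a..b}" wmeas] emeasure_wmeas_interval_finite[of a b] A by (auto intro: le_less_trans)
  ultimately show ?thesis using A by (simp add: sq_int_def integrable_indicator_iff)
qed

text \<open>The closure \<open>V\<close> of the test functions is a closed linear subspace. It contains the indicators of bounded open
intervals that stay away from \<open>0\<close> (limits of bumps), then those of their Borel subsets (a \<open>\<pi>\<close>-\<open>\<lambda>\<close> argument), then all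
nonnegative square integrable functions (monotone approximation), and finally every class.\<close>

lemma test_fun_dense: "closure (abs_wL2 ` test_fun) = UNIV"
proof -
  define V where "V = closure (abs_wL2 ` test_fun)"
  have cl: "closed V" by (simp add: V_def)
  have V_lim: "l \<in> V" if "\<And>n. X n \<in> V" "X \<longlonglongrightarrow> l" for X l
    using cl that unfolding closed_sequential_limits by blast
  have V_add: "x + y \<in> V" if xy: "x \<in> V" "y \<in> V" for x y
  proof -
    obtain X Y where XY: "\<And>n. X n \<in> abs_wL2 ` test_fun" "X \<longlonglongrightarrow> x" "\<And>n. Y n \<in> abs_wL2 ` test_fun" "Y \<longlonglongrightarrow> y"
      using xy unfolding V_def closure_sequential by blast
    have "X n + Y n \<in> abs_wL2 ` test_fun" for n
    proof -
      obtain f g where "f \<in> test_fun" "X n = abs_wL2 f" "g \<in> test_fun" "Y n = abs_wL2 g"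
        using XY(1)[of n] XY(3)[of n] by blast
      then show ?thesis
        using abs_wL2_add[OF test_fun_sq_int test_fun_sq_int, of f g] test_fun_add[of f g] by (metis imageI)
    qed
    moreover have "(\<lambda>n. X n + Y n) \<longlonglongrightarrow> x + y" by (intro tendsto_add XY)
    ultimately show ?thesis unfolding V_def closure_sequential by (intro exI[of _ "\<lambda>n. X n + Y n"]) simp
  qed
  have V_scale: "c *\<^sub>R x \<in> V" if x: "x \<in> V" for c x
  proof -
    obtain X where X: "\<And>n. X n \<in> abs_wL2 ` test_fun" "X \<longlonglongrightarrow> x"
      using x unfolding V_def closure_sequential by blast
    have "c *\<^sub>R X n \<in> abs_wL2 ` test_fun" for n
    proof -
      obtain f where "f \<in> test_fun" "X n = abs_wL2 f" using X(1)[of n] by blast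
      then show ?thesis
        using abs_wL2_scale[OF test_fun_sq_int, of f c] test_fun_scale[of f c] by (metis imageI)
    qed
    moreover have "(\<lambda>n. c *\<^sub>R X n) \<longlonglongrightarrow> c *\<^sub>R x" by (intro tendsto_intros X)
    ultimately show ?thesis unfolding V_def closure_sequential by (intro exI[of _ "\<lambda>n. c *\<^sub>R X n"]) simp
  qed
  have V_diff: "x - y \<in> V" if "x \<in> V" "y \<in> V" for x y
    using V_add[OF that(1) V_scale[OF that(2), of "-1"]] by simp
  have interval: "abs_wL2 (indicator {a<..<b}) \<in> V" if "0 < a" for a b :: real
  proof (rule V_lim)
    show "abs_wL2 (bump a b k) \<in> V" for k
      unfolding V_def using bump_test_fun[OF that] closure_subset by blast
    show "(\<lambda>k. abs_wL2 (bump a b k)) \<longlonglongrightarrow> abs_wL2 (indicator {a<..<b})"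
      using sq_int_measurable[OF test_fun_sq_int[OF bump_test_fun[OF that]]]
      by (intro wL2_dominated_convergence(3)[where \<psi> = "indicator {a..b}"] AE_I2)
        (auto intro!: sq_int_indicator[of _ a b] bump_tendsto bump_bounds)
  qed
  have "indicator {} = (\<lambda>x::real. 0::real)" by auto
  then have V_empty: "abs_wL2 (indicator {}) \<in> V"
    using V_scale[OF interval[of 1 2], of 0] by (simp add: zero_wL2_def)
  (* Restricting to a bounded interval keeps all indicators square integrable. *)
  have ind: "abs_wL2 (indicator (A \<inter> {a<..<b})) \<in> V" if a: "0 < a" and A: "A \<in> sets borel" for a b and A :: "real set"
  proof -
    let ?I = "{a<..<b}"
    have sq: "sq_int (indicator (A \<inter> ?I))" if "A \<in> sets borel" for A
      using that by (intro sq_int_indicator[of _ a b]) auto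
    have A': "A \<in> sigma_sets UNIV (range (\<lambda>(a, b). box a b))"
      using A by (simp add: borel_eq_box)
    have "Int_stable (range (\<lambda>(a, b). box a b) :: real set set)"
      unfolding Int_stable_def
    proof clarify
      fix a b c d :: real
      have "box a b \<inter> box c d = box (max a c) (min b d)" by (auto simp: box_real)
      then show "box a b \<inter> box c d \<in> range (\<lambda>(a, b). box a b)" by auto
    qed
    moreover have "range (\<lambda>(a, b). box a b) \<subseteq> Pow (UNIV :: real set)" by simp
    ultimately show ?thesis
      using A'
    proof (induction rule: sigma_sets_induct_disjoint)
      fix A :: "real set" assume "A \<in> range (\<lambda>(a, b). box a b)"
      then obtain x y where "A = {x<..<y}" by (auto simp: box_real)
      then show "abs_wL2 (indicator (A \<inter> ?I)) \<in> V"
        using interval[of "max x a" "min y b"] a by (simp add: Int_greaterThanLessThan)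
    next
      show "abs_wL2 (indicator ({} \<inter> ?I)) \<in> V" using V_empty by simp
    next
      fix A assume A: "A \<in> sigma_sets UNIV (range (\<lambda>(a, b). box a b))" "abs_wL2 (indicator (A \<inter> ?I)) \<in> V"
      then have Am: "A \<in> sets borel" by (simp add: borel_eq_box)
      have "abs_wL2 (indicator ((UNIV - A) \<inter> ?I)) = abs_wL2 (\<lambda>x. indicator (UNIV \<inter> ?I) x - indicator (A \<inter> ?I) x)"
        by (intro arg_cong[where f = abs_wL2]) (auto simp: indicator_def fun_eq_iff)
      also have "\<dots> = abs_wL2 (indicator (UNIV \<inter> ?I)) - abs_wL2 (indicator (A \<inter> ?I))"
        using Am by (intro abs_wL2_diff sq) auto
      finally show "abs_wL2 (indicator ((UNIV - A) \<inter> ?I)) \<in> V"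
        using V_diff[OF interval[OF a, of b] A(2)] by simp
    next
      fix A :: "nat \<Rightarrow> real set"
      assume A: "disjoint_family A" "range A \<subseteq> sigma_sets UNIV (range (\<lambda>(a, b). box a b))"
        "\<And>i. abs_wL2 (indicator (A i \<inter> ?I)) \<in> V"
      have Am: "A i \<in> sets borel" for i using A(2) by (auto simp: borel_eq_box)
      define B where "B n = (\<Union>i<n. A i)" for n
      have Bm: "B n \<in> sets borel" for n using Am by (auto simp: B_def)
      have BV: "abs_wL2 (indicator (B n \<inter> ?I)) \<in> V" for n
      proof (induction n)
        case 0
        have "B 0 \<inter> ?I = {}" by (simp add: B_def)
        then show ?case using V_empty by (simp only:)
      next
        case (Suc n)
        have "A n \<inter> A i = {}" if "i < n" for i
          using A(1) that disjoint_family_onD[of A UNIV n i] by simp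
        then have "A n \<inter> B n = {}" unfolding B_def by blast
        then have "abs_wL2 (indicator (B (Suc n) \<inter> ?I)) = abs_wL2 (\<lambda>x. indicator (B n \<inter> ?I) x + indicator (A n \<inter> ?I) x)"
          by (intro arg_cong[where f = abs_wL2]) (auto simp: indicator_def fun_eq_iff B_def lessThan_Suc)
        also have "\<dots> = abs_wL2 (indicator (B n \<inter> ?I)) + abs_wL2 (indicator (A n \<inter> ?I))"
          using Am Bm by (intro abs_wL2_add sq) auto
        finally show ?case using V_add[OF Suc A(3)] by simp
      qed
      show "abs_wL2 (indicator (\<Union> (range A) \<inter> ?I)) \<in> V"
      proof (rule V_lim[OF BV])
        show "(\<lambda>n. abs_wL2 (indicator (B n \<inter> ?I))) \<longlonglongrightarrow> abs_wL2 (indicator (\<Union> (range A) \<inter> ?I))"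
        proof (rule wL2_dominated_convergence(3)[where \<psi> = "indicator {a..b}"])
          show "AE \<omega> in wmeas. (\<lambda>n. indicat_real (B n \<inter> ?I) \<omega>) \<longlonglongrightarrow> indicat_real (\<Union> (range A) \<inter> ?I) \<omega>"
          proof (rule AE_I2)
            fix \<omega> :: real
            have "(\<lambda>n. indicat_real (\<Union>i<n. A i \<inter> ?I) \<omega>) \<longlonglongrightarrow> indicat_real (\<Union>i. A i \<inter> ?I) \<omega>"
              by (rule LIMSEQ_indicator_UN)
            then show "(\<lambda>n. indicat_real (B n \<inter> ?I) \<omega>) \<longlonglongrightarrow> indicat_real (\<Union> (range A) \<inter> ?I) \<omega>"
              by (simp add: B_def)
          qed
        qed (use Am Bm in \<open>auto simp: indicator_def intro!: sq_int_indicator[of _ a b]\<close>)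
      qed
    qed
  qed
  have nonneg: "sq_int \<phi> \<longrightarrow> abs_wL2 \<phi> \<in> V"
    if "\<phi> \<in> borel_measurable borel" "\<And>x. 0 \<le> \<phi> x" for \<phi>
    using that
  proof (induction rule: borel_measurable_induct_real)
    case (set A)
    show ?case
    proof
      assume sqA: "sq_int (indicator A)"
      let ?I = "\<lambda>n::nat. {1 / (real n + 1)<..<real n}"
      show "abs_wL2 (indicator A) \<in> V"
      proof (rule V_lim)
        show "abs_wL2 (indicator (A \<inter> ?I n)) \<in> V" for n
          using set by (intro ind) auto
        show "(\<lambda>n. abs_wL2 (indicator (A \<inter> ?I n))) \<longlonglongrightarrow> abs_wL2 (indicator A)"
        proof (rule wL2_dominated_convergence(3)[OF sqA])
          show "AE \<omega> in wmeas. (\<lambda>n. indicat_real (A \<inter> ?I n) \<omega>) \<longlonglongrightarrow> indicat_real A \<omega>"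
            using AE_wmeas_pos
          proof eventually_elim
            case (elim \<omega>)
            obtain m :: nat where m: "\<omega> < real m" using reals_Archimedean2 by blast
            obtain l :: nat where l: "1 / \<omega> < real l" using reals_Archimedean2 by blast
            have "\<omega> \<in> ?I n" if "max m l \<le> n" for n
            proof -
              have "1 / \<omega> < real n + 1" using l that by linarith
              then show ?thesis using elim m that by (auto simp: field_simps)
            qed
            then show ?case
              by (intro tendsto_eventually eventually_sequentiallyI[of "max m l"]) (auto simp: indicator_def)
          qed
        qed (use set in \<open>auto simp: indicator_def\<close>)
      qed
    qed
  next
    case (mult u c)
    show ?case
    proof
      assume sq: "sq_int (\<lambda>x. c * u x)"
      show "abs_wL2 (\<lambda>x. c * u x) \<in> V"
      proof (cases "c = 0")
        case True
        then show ?thesis using V_scale[OF interval[of 1 2], of 0] by (simp add: zero_wL2_def)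
      next
        case False
        then have u: "sq_int u" using sq_int_scale[OF sq, of "inverse c"] by (simp add: mult.assoc[symmetric])
        then show ?thesis using mult V_scale by (simp add: abs_wL2_scale)
      qed
    qed
  next
    case (add u v)
    show ?case
    proof
      assume sq: "sq_int (\<lambda>x. v x + u x)"
      have "sq_int u" "sq_int v"
        by (rule sq_int_bound[OF sq]; use add in auto)+
      then show "abs_wL2 (\<lambda>x. v x + u x) \<in> V" using add V_add by (simp add: abs_wL2_add)
    qed
  next
    case (seq U)
    show ?case
    proof
      assume sq: "sq_int \<phi>"
      have le: "\<bar>U i x\<bar> \<le> \<phi> x" for i x
        using seq incseq_le[of "\<lambda>i. U i x" "\<phi> x" i] by (auto simp: incseq_def le_fun_def)
      have Um: "U i \<in> borel_measurable borel" for i using seq by blast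
      have Ulim: "AE \<omega> in wmeas. (\<lambda>i. U i \<omega>) \<longlonglongrightarrow> \<phi> \<omega>" using seq by (intro AE_I2) auto
      note dc = wL2_dominated_convergence[OF sq sq_int_measurable[OF sq] Um le Ulim]
      have "abs_wL2 (U i) \<in> V" for i using dc(2) seq by blast
      then show "abs_wL2 \<phi> \<in> V" by (rule V_lim[OF _ dc(3)])
    qed
  qed
  have "g \<in> V" for g
  proof -
    let ?p = "\<lambda>x. max 0 (rep_wL2 g x)" and ?n = "\<lambda>x. max 0 (- rep_wL2 g x)"
    have sq: "sq_int ?p" "sq_int ?n"
      by (rule sq_int_bound[of "rep_wL2 g"]; simp)+
    have "(\<lambda>x. ?p x - ?n x) = rep_wL2 g" by (auto simp: max_def fun_eq_iff)
    then have "g = abs_wL2 (\<lambda>x. ?p x - ?n x)" by simp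
    also have "\<dots> = abs_wL2 ?p - abs_wL2 ?n" using sq by (rule abs_wL2_diff)
    also have "\<dots> \<in> V" using nonneg[of ?p] nonneg[of ?n] sq by (intro V_diff) auto
    finally show ?thesis .
  qed
  then show ?thesis unfolding V_def by blast
qed

section \<open>Integral inequalities\<close>

text \<open>The form used for Schur tests: \<open>f\<close> is only bounded by the geometric mean of two densities, which need not be
squares. Integrating \<open>\<bar>f\<bar> \<le> t / 2 * p + 1 / (2 * t) * q\<close> and choosing \<open>t\<close> to balance the two terms gives the product.\<close>

lemma nn_integral_Cauchy_Schwarz:
  fixes f p q :: "'a \<Rightarrow> real"
  assumes [measurable]: "f \<in> borel_measurable M" "p \<in> borel_measurable M" "q \<in> borel_measurable M"
    and pos: "\<And>x. 0 \<le> p x" "\<And>x. 0 \<le> q x" and le: "\<And>x. (f x)\<^sup>2 \<le> p x * q x"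
  shows "(\<integral>\<^sup>+x. ennreal \<bar>f x\<bar> \<partial>M)\<^sup>2 \<le> (\<integral>\<^sup>+x. ennreal (p x) \<partial>M) * (\<integral>\<^sup>+x. ennreal (q x) \<partial>M)"
proof -
  define F where "F = (\<integral>\<^sup>+x. ennreal \<bar>f x\<bar> \<partial>M)"
  define P where "P = (\<integral>\<^sup>+x. ennreal (p x) \<partial>M)"
  define Q where "Q = (\<integral>\<^sup>+x. ennreal (q x) \<partial>M)"
  have f0: "F = 0" if "r \<in> borel_measurable M" "(\<integral>\<^sup>+x. ennreal (r x) \<partial>M) = 0" "\<And>x. r x \<le> 0 \<Longrightarrow> (f x)\<^sup>2 \<le> 0" for r
  proof -
    have "AE x in M. ennreal (r x) = 0" using that by (subst (asm) nn_integral_0_iff_AE) auto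
    then have "AE x in M. ennreal \<bar>f x\<bar> = 0" by eventually_elim (use that(3) in \<open>auto simp: ennreal_eq_0_iff\<close>)
    then show ?thesis unfolding F_def by (subst nn_integral_0_iff_AE) auto
  qed
  consider "P = 0 \<or> Q = 0" | "P \<noteq> 0" "Q \<noteq> 0" "P = \<infinity> \<or> Q = \<infinity>" | "P \<noteq> 0" "Q \<noteq> 0" "P \<noteq> \<infinity>" "Q \<noteq> \<infinity>" by blast
  then have "F\<^sup>2 \<le> P * Q"
  proof cases
    case 1
    have *: "(f x)\<^sup>2 \<le> 0" if "p x \<le> 0 \<or> q x \<le> 0" for x
      using that pos[of x] le[of x] by (metis antisym mult_zero_left mult_zero_right)
    have "F = 0" using 1 f0[of p] f0[of q] * by (auto simp: P_def Q_def)
    then show ?thesis by simp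
  next
    case 2
    then have "P * Q = \<infinity>" by (auto simp: ennreal_mult_eq_top_iff)
    then show ?thesis by simp
  next
    case 3
    obtain a where a: "P = ennreal a" "0 < a" using 3 by (cases P) (auto simp: less_le)
    obtain b where b: "Q = ennreal b" "0 < b" using 3 by (cases Q) (auto simp: less_le)
    define t where "t = sqrt (b / a)"
    have t: "0 < t" using a b by (simp add: t_def)
    have ptw: "\<bar>f x\<bar> \<le> t / 2 * p x + 1 / (2 * t) * q x" for x
    proof (rule power2_le_imp_le)
      have "0 \<le> (t / 2 * p x - 1 / (2 * t) * q x)\<^sup>2" by simp
      also have "\<dots> = (t / 2 * p x + 1 / (2 * t) * q x)\<^sup>2 - p x * q x"
        using t by (simp add: power2_eq_square field_simps)
      finally show "\<bar>f x\<bar>\<^sup>2 \<le> (t / 2 * p x + 1 / (2 * t) * q x)\<^sup>2" using le[of x] by simp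
      show "0 \<le> t / 2 * p x + 1 / (2 * t) * q x" using t pos by simp
    qed
    have "F \<le> (\<integral>\<^sup>+x. ennreal (t / 2) * ennreal (p x) + ennreal (1 / (2 * t)) * ennreal (q x) \<partial>M)"
      unfolding F_def
      by (rule nn_integral_mono) (use ptw t pos in \<open>auto simp: ennreal_mult[symmetric] ennreal_plus[symmetric] simp del: ennreal_plus intro!: ennreal_leI\<close>)
    also have "\<dots> = ennreal (t / 2) * P + ennreal (1 / (2 * t)) * Q"
      by (simp add: nn_integral_add nn_integral_cmult P_def Q_def)
    also have "\<dots> = ennreal (t / 2 * a + 1 / (2 * t) * b)"
      using a b t by (simp add: ennreal_mult[symmetric] ennreal_plus[symmetric] del: ennreal_plus)
    also have "t / 2 * a + 1 / (2 * t) * b = sqrt (a * b)"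
    proof -
      have "t * t = b / a" using a b by (simp add: t_def)
      then have b': "b = t * t * a" using a by (simp add: field_simps)
      have "sqrt (a * b) = sqrt ((t * a)\<^sup>2)" unfolding b' by (simp add: power2_eq_square mult_ac)
      also have "\<dots> = t * a" using t a by simp
      finally show ?thesis using t unfolding b' by (simp add: field_simps)
    qed
    finally have "F\<^sup>2 \<le> (ennreal (sqrt (a * b)))\<^sup>2" by (intro power_mono) auto
    also have "\<dots> = ennreal (a * b)" using a b by (simp add: ennreal_power)
    also have "\<dots> = P * Q" using a b by (simp add: ennreal_mult)
    finally show ?thesis .
  qed
  then show ?thesis by (simp add: F_def P_def Q_def)
qed

text \<open>For \<open>\<mu> > 0\<close> this weight is integrable exactly when \<open>\<beta> < 1 < \<alpha> + \<beta>\<close>: \<open>\<beta>\<close> governs the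
singularity at \<open>0\<close> and \<open>\<alpha> + \<beta>\<close> the decay at infinity.\<close>

definition shifted_powr :: "real \<Rightarrow> real \<Rightarrow> real \<Rightarrow> real \<Rightarrow> real" where
  "shifted_powr \<mu> \<alpha> \<beta> t = (if 0 < t then (t + \<mu>) powr - \<alpha> * t powr - \<beta> else 0)"

lemma shifted_powr_measurable [measurable]: "shifted_powr \<mu> \<alpha> \<beta> \<in> borel_measurable borel"
  unfolding shifted_powr_def by measurable

lemma shifted_powr_nonneg [simp]: "0 \<le> shifted_powr \<mu> \<alpha> \<beta> t"
  by (simp add: shifted_powr_def)

lemma nn_integral_powr_from_0:
  assumes "- 1 < r" "0 \<le> c"
  shows "(\<integral>\<^sup>+t. ennreal (indicator {0..c} t * t powr r) \<partial>lborel) = ennreal (c powr (r + 1) / (r + 1))"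
proof -
  have "((\<lambda>t. if t \<in> {0..c} then t powr r else 0) has_integral c powr (r + 1) / (r + 1)) UNIV"
    unfolding has_integral_restrict_UNIV by (rule has_integral_powr_from_0[OF assms])
  from nn_integral_has_integral_lborel[OF _ _ this]
  have "(\<integral>\<^sup>+t. ennreal (if t \<in> {0..c} then t powr r else 0) \<partial>lborel) = ennreal (c powr (r + 1) / (r + 1))"
    by simp
  moreover have "(if t \<in> {0..c} then t powr r else 0) = indicator {0..c} t * t powr r" for t
    by (auto simp: indicator_def)
  ultimately show ?thesis by (simp only:)
qed

lemma nn_integral_powr_to_inf:
  assumes "r < - 1" "0 < c"
  shows "(\<integral>\<^sup>+t. ennreal (indicator {c..} t * t powr r) \<partial>lborel) = ennreal (- (c powr (r + 1)) / (r + 1))"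
proof -
  have "((\<lambda>t. if t \<in> {c..} then t powr r else 0) has_integral - (c powr (r + 1)) / (r + 1)) UNIV"
    unfolding has_integral_restrict_UNIV by (rule has_integral_powr_to_inf[OF assms])
  from nn_integral_has_integral_lborel[OF _ _ this]
  have "(\<integral>\<^sup>+t. ennreal (if t \<in> {c..} then t powr r else 0) \<partial>lborel) = ennreal (- (c powr (r + 1)) / (r + 1))"
    by simp
  moreover have "(if t \<in> {c..} then t powr r else 0) = indicator {c..} t * t powr r" for t
    by (auto simp: indicator_def)
  ultimately show ?thesis by (simp only:)
qed

lemma nn_integral_shifted_powr_finite:
  assumes "0 < \<mu>" "0 \<le> \<alpha>" "\<beta> < 1" "1 < \<alpha> + \<beta>"
  shows "(\<integral>\<^sup>+t. ennreal (shifted_powr \<mu> \<alpha> \<beta> t) \<partial>lborel) < \<infinity>"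
proof -
  let ?f = "\<lambda>t. ennreal (indicator {0..1} t * t powr - \<beta>)" and ?g = "\<lambda>t. ennreal (indicator {1..} t * t powr - (\<alpha> + \<beta>))"
  have le: "shifted_powr \<mu> \<alpha> \<beta> t \<le> \<mu> powr - \<alpha> * (indicator {0..1} t * t powr - \<beta>) + indicator {1..} t * t powr - (\<alpha> + \<beta>)" for t
  proof (cases "t \<le> 0")
    case True
    then show ?thesis by (auto simp: shifted_powr_def)
  next
    case False
    then have t: "0 < t" by simp
    show ?thesis
    proof (cases "t \<le> 1")
      case True
      have "(t + \<mu>) powr - \<alpha> \<le> \<mu> powr - \<alpha>" using t assms by (intro powr_mono2') auto
      then have "(t + \<mu>) powr - \<alpha> * t powr - \<beta> \<le> \<mu> powr - \<alpha> * t powr - \<beta>"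
        by (intro mult_right_mono) auto
      then show ?thesis using t True by (auto simp: shifted_powr_def indicator_def intro: add_increasing2)
    next
      case False
      have "(t + \<mu>) powr - \<alpha> \<le> t powr - \<alpha>" using t assms by (intro powr_mono2') auto
      then have "(t + \<mu>) powr - \<alpha> * t powr - \<beta> \<le> t powr - \<alpha> * t powr - \<beta>"
        by (intro mult_right_mono) auto
      also have "\<dots> = t powr - (\<alpha> + \<beta>)" by (simp flip: powr_add)
      finally show ?thesis using t False by (simp add: shifted_powr_def)
    qed
  qed
  have "(\<integral>\<^sup>+t. ennreal (shifted_powr \<mu> \<alpha> \<beta> t) \<partial>lborel) \<le> (\<integral>\<^sup>+t. ennreal (\<mu> powr - \<alpha>) * ?f t + ?g t \<partial>lborel)"
    by (rule nn_integral_mono, rule order_trans[OF ennreal_leI[OF le]]) (simp add: ennreal_mult)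
  also have "\<dots> = ennreal (\<mu> powr - \<alpha>) * (\<integral>\<^sup>+t. ?f t \<partial>lborel) + (\<integral>\<^sup>+t. ?g t \<partial>lborel)"
    by (subst nn_integral_add) (auto simp: nn_integral_cmult)
  also have "\<dots> < \<infinity>"
    using assms nn_integral_powr_from_0[of "- \<beta>" 1] nn_integral_powr_to_inf[of "- (\<alpha> + \<beta>)" 1]
    by (simp add: ennreal_mult_less_top)
  finally show ?thesis .
qed

text \<open>The exponents satisfy \<open>3/4 < 1 < 3/4 + 3/8\<close>, so the singularity at \<open>0\<close> and the tail are both integrable.\<close>

definition max_kernel :: "real \<Rightarrow> real \<Rightarrow> real" where
  "max_kernel a t = (if 0 < t then t powr - (3/4) * (max a t) powr - (3/8) else 0)"

lemma max_kernel_measurable [measurable]: "max_kernel a \<in> borel_measurable borel"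
  unfolding max_kernel_def by measurable

lemma max_kernel_nonneg [simp]: "0 \<le> max_kernel a t"
  by (simp add: max_kernel_def)

lemma nn_integral_max_kernel:
  assumes a: "0 < a"
  shows "(\<integral>\<^sup>+t. ennreal (max_kernel a t) \<partial>lborel) \<le> ennreal (12 * a powr - (1/8))"
proof -
  let ?f = "\<lambda>t. ennreal (indicator {0..a} t * t powr - (3/4))" and ?g = "\<lambda>t. ennreal (indicator {a..} t * t powr - (9/8))"
  have le: "max_kernel a t \<le> a powr - (3/8) * (indicator {0..a} t * t powr - (3/4)) + indicator {a..} t * t powr - (9/8)" for t
  proof (cases "t \<le> a")
    case True
    then show ?thesis by (auto simp: max_kernel_def indicator_def intro: add_increasing2)
  next
    case False
    then have "max_kernel a t = t powr - (9/8)" using a by (simp add: max_kernel_def flip: powr_add)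
    then show ?thesis using False a by simp
  qed
  have "(\<integral>\<^sup>+t. ennreal (max_kernel a t) \<partial>lborel) \<le> (\<integral>\<^sup>+t. ennreal (a powr - (3/8)) * ?f t + ?g t \<partial>lborel)"
    by (rule nn_integral_mono, rule order_trans[OF ennreal_leI[OF le]]) (simp add: ennreal_mult)
  also have "\<dots> = ennreal (a powr - (3/8)) * (\<integral>\<^sup>+t. ?f t \<partial>lborel) + (\<integral>\<^sup>+t. ?g t \<partial>lborel)"
    by (subst nn_integral_add) (auto simp: nn_integral_cmult)
  also have "\<dots> = ennreal (a powr - (3/8)) * ennreal (4 * a powr (1/4)) + ennreal (8 * a powr - (1/8))"
    using a nn_integral_powr_from_0[of "- (3/4)" a] nn_integral_powr_to_inf[of "- (9/8)" a] by (simp add: mult.commute)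
  also have "\<dots> = ennreal (a powr - (3/8) * (4 * a powr (1/4)) + 8 * a powr - (1/8))"
    by (simp add: ennreal_mult[symmetric] ennreal_plus[symmetric] del: ennreal_plus)
  also have "a powr - (3/8) * (4 * a powr (1/4)) + 8 * a powr - (1/8) = 12 * a powr - (1/8)"
    by (simp add: mult.left_commute flip: powr_add)
  finally show ?thesis .
qed

section \<open>Resonant quadruples\<close>

text \<open>A resonant quadruple \<open>\<omega>\<^sub>0 + \<omega>\<^sub>3 = \<omega>\<^sub>1 + \<omega>\<^sub>2\<close>, given by its first three entries and stored as a function of the index.
Integrands become functions on \<open>nat \<Rightarrow> real\<close>, so that the collisional symmetries are permutations of the slots,
and a bound for one assignment of slots covers all of them.\<close>

definition quad :: "real \<Rightarrow> real \<Rightarrow> real \<Rightarrow> nat \<Rightarrow> real" where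
  "quad a b c i = (if i = 0 then a else if i = 1 then b else if i = 2 then c else b + c - a)"

lemma quad_simps [simp]: "quad a b c 0 = a" "quad a b c (Suc 0) = b" "quad a b c 2 = c" "quad a b c 3 = b + c - a"
  by (simp_all add: quad_def)

text \<open>Measurability of the restriction to resonant quadruples, in the three free coordinates.\<close>

definition quad_measurable :: "((nat \<Rightarrow> real) \<Rightarrow> 'b::topological_space) \<Rightarrow> bool" where
  "quad_measurable f \<longleftrightarrow> (\<lambda>w. f (quad (fst w) (fst (snd w)) (snd (snd w))))
     \<in> borel_measurable (lborel \<Otimes>\<^sub>M (lborel \<Otimes>\<^sub>M lborel))"

lemma quad_measurableD:
  assumes f: "quad_measurable f" and [measurable]: "g \<in> borel_measurable M" "h \<in> borel_measurable M" "k \<in> borel_measurable M"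
  shows "(\<lambda>x. f (quad (g x) (h x) (k x))) \<in> borel_measurable M"
proof -
  have "(\<lambda>x. (g x, h x, k x)) \<in> M \<rightarrow>\<^sub>M (lborel \<Otimes>\<^sub>M (lborel \<Otimes>\<^sub>M lborel))" by measurable
  from measurable_compose[OF this f[unfolded quad_measurable_def]] show ?thesis by simp
qed

lemma quad_measurableI:
  "(\<lambda>w. f (quad (fst w) (fst (snd w)) (snd (snd w)))) \<in> borel_measurable (lborel \<Otimes>\<^sub>M (lborel \<Otimes>\<^sub>M lborel)) \<Longrightarrow> quad_measurable f"
  unfolding quad_measurable_def .

lemma quad_measurable_slot [intro, simp]:
  "(g :: real \<Rightarrow> 'b::topological_space) \<in> borel_measurable borel \<Longrightarrow> quad_measurable (\<lambda>x. g (x i))"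
proof (rule quad_measurableI)
  assume [measurable]: "g \<in> borel_measurable borel"
  consider "i = 0" | "i = 1" | "i = 2" | "i \<notin> {0, 1, 2}" by auto
  then show "(\<lambda>w. g (quad (fst w) (fst (snd w)) (snd (snd w)) i)) \<in> borel_measurable (lborel \<Otimes>\<^sub>M (lborel \<Otimes>\<^sub>M lborel))"
    by cases (auto simp: quad_def)
qed

lemma quad_measurable_real [intro, simp]:
  fixes f g :: "(nat \<Rightarrow> real) \<Rightarrow> real"
  assumes "quad_measurable f" "quad_measurable g"
  shows "quad_measurable (\<lambda>x. f x * g x)" "quad_measurable (\<lambda>x. f x + g x)" "quad_measurable (\<lambda>x. f x - g x)"
    "quad_measurable (\<lambda>x. f x / g x)"
  using assms unfolding quad_measurable_def by measurable

lemma quad_measurable_unary [intro, simp]: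
  fixes f :: "(nat \<Rightarrow> real) \<Rightarrow> real"
  assumes "quad_measurable f"
  shows "quad_measurable (\<lambda>x. \<bar>f x\<bar>)" "quad_measurable (\<lambda>x. - f x)" "quad_measurable (\<lambda>x. sqrt (f x))"
  using assms unfolding quad_measurable_def by measurable

lemma quad_measurable_ennreal [intro, simp]:
  assumes "quad_measurable f"
  shows "quad_measurable (\<lambda>x. ennreal (f x))"
  using assms unfolding quad_measurable_def by measurable

lemma quad_measurable_const [intro, simp]: "quad_measurable (\<lambda>x. c)"
  unfolding quad_measurable_def by measurable

lemma quad_measurable_coord [intro, simp]: "quad_measurable (\<lambda>x. x i)"
  using quad_measurable_slot[of "\<lambda>t. t"] by simp

lemma quad_measurable_ennreal_mult [intro, simp]:
  fixes f g :: "(nat \<Rightarrow> real) \<Rightarrow> ennreal"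
  assumes "quad_measurable f" "quad_measurable g"
  shows "quad_measurable (\<lambda>x. f x * g x)" "quad_measurable (\<lambda>x. f x + g x)"
  using assms unfolding quad_measurable_def by measurable

lemma quad_measurable_permute:
  assumes f: "quad_measurable f"
  shows "quad_measurable (\<lambda>x. f (quad (x i) (x j) (x k)))"
proof (rule quad_measurableI)
  have *: "(\<lambda>w. quad (fst w) (fst (snd w)) (snd (snd w)) i) \<in> borel_measurable (lborel \<Otimes>\<^sub>M (lborel \<Otimes>\<^sub>M lborel))" for i
    using quad_measurable_coord[of i] unfolding quad_measurable_def .
  show "(\<lambda>w. f (quad (quad (fst w) (fst (snd w)) (snd (snd w)) i) (quad (fst w) (fst (snd w)) (snd (snd w)) j)
      (quad (fst w) (fst (snd w)) (snd (snd w)) k))) \<in> borel_measurable (lborel \<Otimes>\<^sub>M (lborel \<Otimes>\<^sub>M lborel))"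
    by (rule quad_measurableD[OF f * * *])
qed

text \<open>The integral over \<open>(\<omega>\<^sub>1, \<omega>\<^sub>2)\<close> with \<open>\<omega>\<^sub>0 = a\<close> held fixed; integrands vanish off the region of positive entries.\<close>

definition fiber_integral :: "((nat \<Rightarrow> real) \<Rightarrow> ennreal) \<Rightarrow> real \<Rightarrow> ennreal" where
  "fiber_integral f a = (\<integral>\<^sup>+z. f (quad a (fst z) (snd z)) \<partial>(lborel \<Otimes>\<^sub>M lborel))"

definition quad_integral :: "((nat \<Rightarrow> real) \<Rightarrow> ennreal) \<Rightarrow> ennreal" where
  "quad_integral f = (\<integral>\<^sup>+a. fiber_integral f a \<partial>lborel)"

lemma fiber_integral_cong: "(\<And>b c. f (quad a b c) = g (quad a b c)) \<Longrightarrow> fiber_integral f a = fiber_integral g a"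
  by (simp add: fiber_integral_def)

lemma quad_integral_cong: "(\<And>a b c. f (quad a b c) = g (quad a b c)) \<Longrightarrow> quad_integral f = quad_integral g"
  by (simp add: quad_integral_def fiber_integral_def)

lemma fiber_integral_iterated:
  assumes f: "quad_measurable f"
  shows "fiber_integral f a = (\<integral>\<^sup>+b. \<integral>\<^sup>+c. f (quad a b c) \<partial>lborel \<partial>lborel)"
    and "fiber_integral f a = (\<integral>\<^sup>+c. \<integral>\<^sup>+b. f (quad a b c) \<partial>lborel \<partial>lborel)"
proof -
  note [measurable (raw)] = quad_measurableD[OF f]
  show "fiber_integral f a = (\<integral>\<^sup>+b. \<integral>\<^sup>+c. f (quad a b c) \<partial>lborel \<partial>lborel)"
    unfolding fiber_integral_def by (subst lborel.nn_integral_fst[symmetric]) auto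
  show "fiber_integral f a = (\<integral>\<^sup>+c. \<integral>\<^sup>+b. f (quad a b c) \<partial>lborel \<partial>lborel)"
    unfolding fiber_integral_def by (subst lborel_pair.nn_integral_snd[symmetric]) auto
qed

lemma quad_integral_iterated:
  "quad_measurable f \<Longrightarrow> quad_integral f = (\<integral>\<^sup>+a. \<integral>\<^sup>+b. \<integral>\<^sup>+c. f (quad a b c) \<partial>lborel \<partial>lborel \<partial>lborel)"
  unfolding quad_integral_def by (rule nn_integral_cong) (rule fiber_integral_iterated(1))

lemma nn_integral_shift: "f \<in> borel_measurable borel \<Longrightarrow> (\<integral>\<^sup>+x. f (x + t) \<partial>lborel) = (\<integral>\<^sup>+x. f x \<partial>lborel)" for f :: "real \<Rightarrow> ennreal"
  using nn_integral_real_affine[of f 1 t] by (simp add: add.commute)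

lemma nn_integral_reflect: "f \<in> borel_measurable borel \<Longrightarrow> (\<integral>\<^sup>+x. f (t - x) \<partial>lborel) = (\<integral>\<^sup>+x. f x \<partial>lborel)" for f :: "real \<Rightarrow> ennreal"
  using nn_integral_real_affine[of f "-1" t] by simp

text \<open>On a fiber any two of the slots \<open>1\<close>, \<open>2\<close>, \<open>3\<close> can serve as coordinates, by a translation.\<close>

lemma fiber_integral_mult:
  assumes [measurable]: "\<phi> \<in> borel_measurable borel" "\<psi> \<in> borel_measurable borel"
    and ij: "i \<in> {1, 2, 3}" "j \<in> {1, 2, 3}" "i \<noteq> j"
  shows "fiber_integral (\<lambda>x. \<phi> (x i) * \<psi> (x j)) a = (\<integral>\<^sup>+t. \<phi> t \<partial>lborel) * (\<integral>\<^sup>+t. \<psi> t \<partial>lborel)"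
proof -
  have 12: "fiber_integral (\<lambda>x. \<phi> (x 1) * \<psi> (x 2)) a = (\<integral>\<^sup>+t. \<phi> t \<partial>lborel) * (\<integral>\<^sup>+t. \<psi> t \<partial>lborel)"
    if [measurable]: "\<phi> \<in> borel_measurable borel" "\<psi> \<in> borel_measurable borel" for \<phi> \<psi>
    by (subst fiber_integral_iterated(1)) (auto simp: nn_integral_cmult nn_integral_multc)
  have 13: "fiber_integral (\<lambda>x. \<phi> (x 1) * \<psi> (x 3)) a = (\<integral>\<^sup>+t. \<phi> t \<partial>lborel) * (\<integral>\<^sup>+t. \<psi> t \<partial>lborel)"
    if [measurable]: "\<phi> \<in> borel_measurable borel" "\<psi> \<in> borel_measurable borel" for \<phi> \<psi>
  proof -
    have "(\<integral>\<^sup>+c. \<psi> (b + c - a) \<partial>lborel) = (\<integral>\<^sup>+t. \<psi> t \<partial>lborel)" for b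
      using nn_integral_shift[of \<psi> "b - a"] by (simp add: algebra_simps)
    then show ?thesis
      by (subst fiber_integral_iterated(1)) (auto simp: nn_integral_cmult nn_integral_multc)
  qed
  have 23: "fiber_integral (\<lambda>x. \<phi> (x 2) * \<psi> (x 3)) a = (\<integral>\<^sup>+t. \<phi> t \<partial>lborel) * (\<integral>\<^sup>+t. \<psi> t \<partial>lborel)"
    if [measurable]: "\<phi> \<in> borel_measurable borel" "\<psi> \<in> borel_measurable borel" for \<phi> \<psi>
  proof -
    have "(\<integral>\<^sup>+b. \<psi> (b + c - a) \<partial>lborel) = (\<integral>\<^sup>+t. \<psi> t \<partial>lborel)" for c
      using nn_integral_shift[of \<psi> "c - a"] by (simp add: algebra_simps)
    then show ?thesis
      by (subst fiber_integral_iterated(2)) (auto simp: nn_integral_cmult nn_integral_multc)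
  qed
  show ?thesis
    using ij 12[of \<phi> \<psi>] 12[of \<psi> \<phi>] 13[of \<phi> \<psi>] 13[of \<psi> \<phi>] 23[of \<phi> \<psi>] 23[of \<psi> \<phi>]
    by (auto simp: mult.commute)
qed

text \<open>The Lebesgue measure on resonant quadruples is invariant under the symmetries of the collision: exchanging \<open>1\<close> and
\<open>2\<close>, exchanging \<open>0\<close> and \<open>3\<close>, exchanging the pairs, and composites of these. Each is a linear change of variables of
determinant \<open>\<plusminus> 1\<close>, and follows from Fubini's theorem with a translation or reflection in one variable.\<close>

lemma quad_integral_swap12:
  assumes f: "quad_measurable f"
  shows "quad_integral (\<lambda>x. f (quad (x 0) (x 2) (x 1))) = quad_integral f"
proof -
  have "fiber_integral (\<lambda>x. f (quad (x 0) (x 2) (x 1))) a = fiber_integral f a" for a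
    using fiber_integral_iterated(1)[OF quad_measurable_permute[OF f, of 0 2 1], of a] fiber_integral_iterated(2)[OF f, of a]
    by simp
  then show ?thesis by (simp add: quad_integral_def)
qed

lemma quad_integral_swap03:
  assumes f: "quad_measurable f"
  shows "quad_integral (\<lambda>x. f (quad (x 3) (x 1) (x 2))) = quad_integral f"
proof -
  note [measurable (raw)] = quad_measurableD[OF f]
  have *: "quad_integral f = (\<integral>\<^sup>+z. \<integral>\<^sup>+a. f (quad a (fst z) (snd z)) \<partial>lborel \<partial>(lborel \<Otimes>\<^sub>M lborel))"
    if f: "quad_measurable f" for f
  proof -
    note [measurable (raw)] = quad_measurableD[OF f]
    interpret pair_sigma_finite "lborel :: real measure" "lborel \<Otimes>\<^sub>M lborel :: (real \<times> real) measure"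
      by (simp add: pair_sigma_finite_def lborel.sigma_finite_measure_axioms lborel_pair.sigma_finite_measure_axioms lborel_prod)
    show ?thesis unfolding quad_integral_def fiber_integral_def by (subst Fubini') auto
  qed
  have "(\<integral>\<^sup>+a. f (quad (b + c - a) b c) \<partial>lborel) = (\<integral>\<^sup>+a. f (quad a b c) \<partial>lborel)" for b c
    using nn_integral_reflect[of "\<lambda>a. f (quad a b c)" "b + c"] by simp
  then show ?thesis
    by (simp add: *[OF quad_measurable_permute[OF f]] *[OF f])
qed

lemma quad_integral_swap01_23:
  assumes f: "quad_measurable f"
  shows "quad_integral (\<lambda>x. f (quad (x 1) (x 0) (x 3))) = quad_integral f"
proof -
  note [measurable (raw)] = quad_measurableD[OF f]
  have "(\<integral>\<^sup>+c. f (quad b a (b + c - a)) \<partial>lborel) = (\<integral>\<^sup>+c. f (quad b a c) \<partial>lborel)" for a b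
    using nn_integral_shift[of "\<lambda>c. f (quad b a c)" "b - a"] by (simp add: algebra_simps)
  then have "quad_integral (\<lambda>x. f (quad (x 1) (x 0) (x 3))) = (\<integral>\<^sup>+a. \<integral>\<^sup>+b. \<integral>\<^sup>+c. f (quad b a c) \<partial>lborel \<partial>lborel \<partial>lborel)"
    by (subst quad_integral_iterated[OF quad_measurable_permute[OF f]]) simp
  also have "\<dots> = (\<integral>\<^sup>+b. \<integral>\<^sup>+a. \<integral>\<^sup>+c. f (quad b a c) \<partial>lborel \<partial>lborel \<partial>lborel)"
    by (rule lborel_pair.Fubini') measurable
  finally show ?thesis by (simp add: quad_integral_iterated[OF f])
qed

lemma quad_integral_swap02_13:
  assumes f: "quad_measurable f"
  shows "quad_integral (\<lambda>x. f (quad (x 2) (x 0) (x 3))) = quad_integral f"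
proof -
  have "quad_integral (\<lambda>x. f (quad (x 2) (x 0) (x 3)))
      = quad_integral (\<lambda>x. (\<lambda>y. f (quad (y 1) (y 0) (y 3))) (quad (x 0) (x 2) (x 1)))"
    by (rule quad_integral_cong) (simp add: add.commute)
  also have "\<dots> = quad_integral f"
    using quad_integral_swap12[OF quad_measurable_permute[OF f, of 1 0 3]] quad_integral_swap01_23[OF f] by simp
  finally show ?thesis .
qed

lemma fiber_integral_measurable [measurable]:
  assumes f: "quad_measurable f"
  shows "fiber_integral f \<in> borel_measurable borel"
proof -
  note [measurable (raw)] = quad_measurableD[OF f]
  have "sigma_finite_measure (lborel \<Otimes>\<^sub>M lborel :: (real \<times> real) measure)"
    by (simp add: lborel_prod lborel.sigma_finite_measure_axioms)
  from sigma_finite_measure.borel_measurable_nn_integral[OF this, of "\<lambda>a z. f (quad a (fst z) (snd z))" borel]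
  show ?thesis unfolding fiber_integral_def by measurable
qed

lemma triple_slots:
  assumes "{i, j, k} = {1, 2, 3::nat}"
  shows "i \<in> {1, 2, 3}" "j \<in> {1, 2, 3}" "k \<in> {1, 2, 3}" "i \<in> {0, 1, 2, 3}" "j \<in> {0, 1, 2, 3}" "k \<in> {0, 1, 2, 3}"
    "i \<noteq> j" "j \<noteq> k" "i \<noteq> k"
proof -
  show 1: "i \<in> {1, 2, 3}" "j \<in> {1, 2, 3}" "k \<in> {1, 2, 3}"
    unfolding assms[symmetric] by simp_all
  then show "i \<in> {0, 1, 2, 3}" "j \<in> {0, 1, 2, 3}" "k \<in> {0, 1, 2, 3}" by auto
  have "card {i, j, k} = 3" unfolding assms by simp
  then show "i \<noteq> j" "j \<noteq> k" "i \<noteq> k" by (auto simp: card_insert_if split: if_splits)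
qed

text \<open>For slots \<open>1\<close>, \<open>2\<close>, \<open>3\<close> this uses the exchange of \<open>0\<close> and \<open>3\<close>: these slots then become the free coordinates.\<close>

lemma quad_integral_mult3:
  assumes [measurable]: "\<alpha> \<in> borel_measurable borel" "\<beta> \<in> borel_measurable borel" "\<gamma> \<in> borel_measurable borel"
    and ijk: "{i, j, k} = {1, 2, 3::nat}"
  shows "quad_integral (\<lambda>x. \<alpha> (x i) * \<beta> (x j) * \<gamma> (x k)) = (\<integral>\<^sup>+t. \<alpha> t \<partial>lborel) * (\<integral>\<^sup>+t. \<beta> t \<partial>lborel) * (\<integral>\<^sup>+t. \<gamma> t \<partial>lborel)"
proof -
  have *: "quad_integral (\<lambda>x. \<alpha> (x 1) * \<beta> (x 2) * \<gamma> (x 3)) = (\<integral>\<^sup>+t. \<alpha> t \<partial>lborel) * (\<integral>\<^sup>+t. \<beta> t \<partial>lborel) * (\<integral>\<^sup>+t. \<gamma> t \<partial>lborel)"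
    if [measurable]: "\<alpha> \<in> borel_measurable borel" "\<beta> \<in> borel_measurable borel" "\<gamma> \<in> borel_measurable borel" for \<alpha> \<beta> \<gamma>
  proof -
    have "quad_integral (\<lambda>x. \<alpha> (x 1) * \<beta> (x 2) * \<gamma> (x 3))
        = quad_integral (\<lambda>x. \<alpha> (x 1) * \<beta> (x 2) * \<gamma> (x 0))"
      by (subst quad_integral_swap03[of "\<lambda>x. \<alpha> (x 1) * \<beta> (x 2) * \<gamma> (x 3)", symmetric], simp)
        (rule quad_integral_cong, simp)
    also have "\<dots> = (\<integral>\<^sup>+a. \<integral>\<^sup>+b. \<integral>\<^sup>+c. \<alpha> b * \<beta> c * \<gamma> a \<partial>lborel \<partial>lborel \<partial>lborel)"
      by (subst quad_integral_iterated) auto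
    also have "\<dots> = (\<integral>\<^sup>+t. \<alpha> t \<partial>lborel) * (\<integral>\<^sup>+t. \<beta> t \<partial>lborel) * (\<integral>\<^sup>+t. \<gamma> t \<partial>lborel)"
      by (simp add: nn_integral_cmult nn_integral_multc mult_ac)
    finally show ?thesis .
  qed
  note s = triple_slots[OF ijk]
  from s(1-3) s(7-9) consider "i = 1" "j = 2" "k = 3" | "i = 1" "j = 3" "k = 2" | "i = 2" "j = 1" "k = 3"
    | "i = 2" "j = 3" "k = 1" | "i = 3" "j = 1" "k = 2" | "i = 3" "j = 2" "k = 1"
    by auto
  then show ?thesis
    by cases (use *[of \<alpha> \<beta> \<gamma>] *[of \<alpha> \<gamma> \<beta>] *[of \<beta> \<alpha> \<gamma>] *[of \<beta> \<gamma> \<alpha>] *[of \<gamma> \<alpha> \<beta>] *[of \<gamma> \<beta> \<alpha>] in \<open>simp_all add: mult_ac\<close>)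
qed

lemma fiber_integral_mono: "(\<And>b c. f (quad a b c) \<le> g (quad a b c)) \<Longrightarrow> fiber_integral f a \<le> fiber_integral g a"
  unfolding fiber_integral_def by (rule nn_integral_mono) simp

lemma quad_measurable_fiber:
  "quad_measurable f \<Longrightarrow> (\<lambda>z. f (quad a (fst z) (snd z))) \<in> borel_measurable (lborel \<Otimes>\<^sub>M lborel)"
  by (rule quad_measurableD) auto

lemma fiber_integral_add:
  "quad_measurable f \<Longrightarrow> quad_measurable g \<Longrightarrow> fiber_integral (\<lambda>x. f x + g x) a = fiber_integral f a + fiber_integral g a"
  unfolding fiber_integral_def by (intro nn_integral_add quad_measurable_fiber)

lemma fiber_integral_cmult:
  "quad_measurable f \<Longrightarrow> fiber_integral (\<lambda>x. c * f x) a = c * fiber_integral f a"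
  unfolding fiber_integral_def by (intro nn_integral_cmult quad_measurable_fiber)

section \<open>Collision integrals and their energy\<close>

definition pos_quad :: "(nat \<Rightarrow> real) \<Rightarrow> bool" where
  "pos_quad x \<longleftrightarrow> 0 < x 0 \<and> 0 < x 1 \<and> 0 < x 2 \<and> 0 < x 3"

text \<open>The numerator of the collision weight. Its value \<open>0\<close> off the positive quadruples replaces the restriction of the
integrals to \<open>D(\<omega>)\<close>, and makes it invariant under the collisional symmetries everywhere.\<close>

definition root_min :: "(nat \<Rightarrow> real) \<Rightarrow> real" where
  "root_min x = (if pos_quad x then sqrt (min (min (x 0) (x 1)) (min (x 2) (x 3))) else 0)"

text \<open>The absolute collision integral at one frequency; \<open>coll\<close> is the signed one, a Bochner integral that is meaningful
where \<open>coll_abs\<close> is finite.\<close>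

definition coll_abs :: "((nat \<Rightarrow> real) \<Rightarrow> real) \<Rightarrow> real \<Rightarrow> ennreal" where
  "coll_abs F = fiber_integral (\<lambda>x. ennreal (root_min x / sqrt (x 0) * \<bar>F x\<bar>))"

definition coll :: "((nat \<Rightarrow> real) \<Rightarrow> real) \<Rightarrow> real \<Rightarrow> real" where
  "coll F a = (\<integral>z. root_min (quad a (fst z) (snd z)) / sqrt a * F (quad a (fst z) (snd z)) \<partial>(lborel \<Otimes>\<^sub>M lborel))"

text \<open>The squared norm in \<open>H\<close> of the absolute collision integral. All bounds on the operators are bounds on this
quantity.\<close>

definition coll_energy :: "((nat \<Rightarrow> real) \<Rightarrow> real) \<Rightarrow> ennreal" where
  "coll_energy F = (\<integral>\<^sup>+a. (coll_abs F a)\<^sup>2 \<partial>wmeas)"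

definition sq_mass :: "(real \<Rightarrow> real) \<Rightarrow> ennreal" where
  "sq_mass g = (\<integral>\<^sup>+\<omega>. ennreal ((g \<omega>)\<^sup>2) \<partial>wmeas)"

text \<open>The density of the squared norm in \<open>H\<close> with respect to Lebesgue measure.\<close>

definition wsq :: "(real \<Rightarrow> real) \<Rightarrow> real \<Rightarrow> real" where
  "wsq g t = (if 0 < t then sqrt t * (g t)\<^sup>2 else 0)"

lemma wsq_measurable [measurable]:
  assumes [measurable]: "g \<in> borel_measurable borel"
  shows "wsq g \<in> borel_measurable borel"
  unfolding wsq_def by measurable

lemma wsq_nonneg [simp]: "0 \<le> wsq g t"
  by (simp add: wsq_def)

lemma sq_mass_wsq: "g \<in> borel_measurable borel \<Longrightarrow> sq_mass g = (\<integral>\<^sup>+t. ennreal (wsq g t) \<partial>lborel)"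
  unfolding sq_mass_def
  by (subst nn_integral_wmeas) (auto intro!: nn_integral_cong simp: wsq_def ennreal_mult indicator_def)

lemma pos_quad_nth: "pos_quad x \<Longrightarrow> i \<in> {0, 1, 2, 3} \<Longrightarrow> 0 < x i"
  by (auto simp: pos_quad_def)

lemma root_min_nonneg [simp]: "0 \<le> root_min x"
  by (auto simp: root_min_def pos_quad_def)

lemma root_min_le: "pos_quad x \<Longrightarrow> i \<in> {0, 1, 2, 3} \<Longrightarrow> root_min x \<le> sqrt (x i)"
  by (auto simp: root_min_def)

lemma root_min_sq_le: "pos_quad x \<Longrightarrow> i \<in> {0, 1, 2, 3} \<Longrightarrow> j \<in> {0, 1, 2, 3} \<Longrightarrow> (root_min x)\<^sup>2 \<le> sqrt (x i) * sqrt (x j)"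
  unfolding power2_eq_square by (intro mult_mono root_min_le) (auto simp: pos_quad_def)

lemma quad_measurable_root_min [simp, intro]: "quad_measurable root_min"
  unfolding root_min_def pos_quad_def
  by (rule quad_measurableI) (simp only: quad_simps One_nat_def, measurable)

lemma quad_measurable_coll_integrand:
  "quad_measurable F \<Longrightarrow> quad_measurable (\<lambda>x. ennreal (root_min x / sqrt (x 0) * \<bar>F x\<bar>))"
  by (intro quad_measurable_real quad_measurable_unary quad_measurable_ennreal quad_measurable_root_min quad_measurable_coord)

lemma coll_abs_measurable [measurable]: "quad_measurable F \<Longrightarrow> coll_abs F \<in> borel_measurable borel"
  unfolding coll_abs_def by (intro fiber_integral_measurable quad_measurable_coll_integrand)

lemma coll_abs_le_fiber_integral:
  assumes "\<And>x. pos_quad x \<Longrightarrow> x 3 = x 1 + x 2 - x 0 \<Longrightarrow> x 0 = a \<Longrightarrow> ennreal (root_min x / sqrt (x 0) * \<bar>F x\<bar>) \<le> G x"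
  shows "coll_abs F a \<le> fiber_integral G a"
  unfolding coll_abs_def
proof (rule fiber_integral_mono)
  fix b c
  show "ennreal (root_min (quad a b c) / sqrt (quad a b c 0) * \<bar>F (quad a b c)\<bar>) \<le> G (quad a b c)"
  proof (cases "pos_quad (quad a b c)")
    case True
    then show ?thesis by (rule assms) simp_all
  qed (simp add: root_min_def)
qed

lemma coll_abs_mono:
  assumes "\<And>x. pos_quad x \<Longrightarrow> x 3 = x 1 + x 2 - x 0 \<Longrightarrow> \<bar>F x\<bar> \<le> \<bar>G x\<bar>"
  shows "coll_abs F a \<le> coll_abs G a"
  unfolding coll_abs_def[of G]
  by (rule coll_abs_le_fiber_integral) (auto intro!: ennreal_leI mult_left_mono assms divide_right_mono simp: pos_quad_def)

lemma coll_abs_add: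
  assumes "quad_measurable F" "quad_measurable G"
  shows "coll_abs (\<lambda>x. \<bar>F x\<bar> + \<bar>G x\<bar>) a = coll_abs F a + coll_abs G a"
proof -
  have "coll_abs (\<lambda>x. \<bar>F x\<bar> + \<bar>G x\<bar>) a = fiber_integral (\<lambda>x. ennreal (root_min x / sqrt (x 0) * \<bar>F x\<bar>) + ennreal (root_min x / sqrt (x 0) * \<bar>G x\<bar>)) a"
    unfolding coll_abs_def
  proof (rule fiber_integral_cong)
    fix b c
    let ?x = "quad a b c"
    define w where "w = root_min ?x / sqrt (?x 0)"
    have "0 \<le> w" unfolding w_def by (cases "pos_quad ?x") (auto simp: root_min_def pos_quad_def)
    then have "ennreal (w * \<bar>\<bar>F ?x\<bar> + \<bar>G ?x\<bar>\<bar>) = ennreal (w * \<bar>F ?x\<bar>) + ennreal (w * \<bar>G ?x\<bar>)"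
      by (subst ennreal_plus[symmetric]) (auto simp: distrib_left)
    then show "ennreal (root_min ?x / sqrt (?x 0) * \<bar>\<bar>F ?x\<bar> + \<bar>G ?x\<bar>\<bar>)
        = ennreal (root_min ?x / sqrt (?x 0) * \<bar>F ?x\<bar>) + ennreal (root_min ?x / sqrt (?x 0) * \<bar>G ?x\<bar>)"
      unfolding w_def .
  qed
  then show ?thesis
    unfolding coll_abs_def using assms by (simp only: fiber_integral_add quad_measurable_coll_integrand)
qed

lemma ennreal_power2_add_le: "(x + y)\<^sup>2 \<le> 4 * x\<^sup>2 + 4 * y\<^sup>2" for x y :: ennreal
proof -
  have *: "(u + v)\<^sup>2 \<le> 4 * v\<^sup>2" if "u \<le> v" for u v :: ennreal
  proof -
    have "(u + v)\<^sup>2 \<le> (2 * v)\<^sup>2" using that by (intro power_mono) (auto simp: mult_2 add_right_mono)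
    also have "(2 * v)\<^sup>2 = 4 * v\<^sup>2" by (simp add: power_mult_distrib)
    finally show ?thesis .
  qed
  show ?thesis
  proof (cases "x \<le> y")
    case True
    then show ?thesis using *[of x y] by (simp add: add_increasing)
  next
    case False
    then show ?thesis using *[of y x] by (simp add: add_increasing2 add.commute)
  qed
qed

lemma coll_energy_mono:
  assumes "\<And>x. pos_quad x \<Longrightarrow> x 3 = x 1 + x 2 - x 0 \<Longrightarrow> \<bar>F x\<bar> \<le> \<bar>G x\<bar>"
  shows "coll_energy F \<le> coll_energy G"
  unfolding coll_energy_def by (intro nn_integral_mono power_mono coll_abs_mono assms) auto

lemma coll_energy_add:
  assumes "quad_measurable F" "quad_measurable G"
  shows "coll_energy (\<lambda>x. \<bar>F x\<bar> + \<bar>G x\<bar>) \<le> 4 * coll_energy F + 4 * coll_energy G"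
proof -
  have "coll_energy (\<lambda>x. \<bar>F x\<bar> + \<bar>G x\<bar>) \<le> (\<integral>\<^sup>+a. 4 * (coll_abs F a)\<^sup>2 + 4 * (coll_abs G a)\<^sup>2 \<partial>wmeas)"
    unfolding coll_energy_def coll_abs_add[OF assms] by (intro nn_integral_mono ennreal_power2_add_le)
  also have "\<dots> = 4 * coll_energy F + 4 * coll_energy G"
    unfolding coll_energy_def using assms
    by (subst nn_integral_add) (auto simp: nn_integral_cmult)
  finally show ?thesis .
qed

lemma quad_measurable_sum_list_abs:
  "(\<And>F. F \<in> set Fs \<Longrightarrow> quad_measurable F) \<Longrightarrow> quad_measurable (\<lambda>x. \<Sum>F\<leftarrow>Fs. \<bar>F x\<bar>)"
  for Fs :: "((nat \<Rightarrow> real) \<Rightarrow> real) list"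
  by (induction Fs) auto

lemma sum_list_abs_nonneg [simp]: "0 \<le> (\<Sum>F\<leftarrow>Fs. \<bar>F x\<bar>)" for Fs :: "('a \<Rightarrow> real) list"
  by (rule sum_list_nonneg) auto

lemma coll_energy_sum_list:
  assumes "\<And>F. F \<in> set Fs \<Longrightarrow> quad_measurable F \<and> coll_energy F \<le> B"
  shows "coll_energy (\<lambda>x. \<Sum>F\<leftarrow>Fs. \<bar>F x\<bar>) \<le> 2 ^ (3 * length Fs) * B"
  using assms
proof (induction Fs)
  case Nil
  then show ?case by (simp add: coll_energy_def coll_abs_def fiber_integral_def)
next
  case (Cons F Fs)
  have m: "quad_measurable F" "quad_measurable (\<lambda>x. \<Sum>F\<leftarrow>Fs. \<bar>F x\<bar>)"
    using Cons.prems by (auto intro!: quad_measurable_sum_list_abs)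
  have one: "(1::ennreal) \<le> 2 ^ n" for n by (rule one_le_power) simp
  have "coll_energy (\<lambda>x. \<Sum>F\<leftarrow>F # Fs. \<bar>F x\<bar>) \<le> 4 * coll_energy F + 4 * coll_energy (\<lambda>x. \<Sum>F\<leftarrow>Fs. \<bar>F x\<bar>)"
    using coll_energy_add[OF m] by simp
  also have "\<dots> \<le> 4 * (2 ^ (3 * length Fs) * B) + 4 * (2 ^ (3 * length Fs) * B)"
  proof (intro add_mono mult_left_mono)
    have "coll_energy F \<le> 1 * B" using Cons.prems by simp
    also have "\<dots> \<le> 2 ^ (3 * length Fs) * B" by (intro mult_right_mono one) simp
    finally show "coll_energy F \<le> 2 ^ (3 * length Fs) * B" .
    show "coll_energy (\<lambda>x. \<Sum>F\<leftarrow>Fs. \<bar>F x\<bar>) \<le> 2 ^ (3 * length Fs) * B"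
      using Cons by simp
  qed auto
  (* Each further summand costs a factor 8 = 4 + 4. *)
  also have "\<dots> = (4 + 4) * (2 ^ (3 * length Fs) * B)" by (simp only: distrib_right)
  also have "\<dots> = 2 ^ (3 * length (F # Fs)) * B"
    by (simp add: power_add mult.assoc flip: numeral_mult)
  finally show ?case .
qed

lemma coll_energy_le_sum_list:
  assumes "\<And>F. F \<in> set Fs \<Longrightarrow> quad_measurable F \<and> coll_energy F \<le> B"
    and "\<And>x. pos_quad x \<Longrightarrow> x 3 = x 1 + x 2 - x 0 \<Longrightarrow> \<bar>G x\<bar> \<le> (\<Sum>F\<leftarrow>Fs. \<bar>F x\<bar>)"
  shows "coll_energy G \<le> 2 ^ (3 * length Fs) * B"
  by (rule order_trans[OF coll_energy_mono coll_energy_sum_list]) (use assms in auto)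

text \<open>The common frame of the energy estimates. The integrand is dominated by the geometric mean of \<open>P\<close> and \<open>Q\<close>; the density
\<open>P\<close> is integrable on each fiber, uniformly in the frequency, while \<open>Q\<close> carries the squared functions and is
integrated over all quadruples. The factor \<open>sqrt (x 0)\<close> reconciles the weight of \<open>H\<close> with the division by
\<open>sqrt (x 0)\<close> in the collision weight.\<close>

lemma coll_energy_Cauchy_Schwarz:
  assumes F: "quad_measurable F" and P: "quad_measurable P" "\<And>x. 0 \<le> P x" and Q: "quad_measurable Q" "\<And>x. 0 \<le> Q x"
    and le: "\<And>x. pos_quad x \<Longrightarrow> x 3 = x 1 + x 2 - x 0 \<Longrightarrow> (root_min x * F x)\<^sup>2 \<le> P x * Q x * sqrt (x 0)"
    and C: "\<And>a. 0 < a \<Longrightarrow> fiber_integral (\<lambda>x. ennreal (P x)) a \<le> C"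
  shows "coll_energy F \<le> C * quad_integral (\<lambda>x. ennreal (Q x))"
proof -
  have mQ: "quad_measurable (\<lambda>x. ennreal (Q x))" using Q by simp
  have "coll_energy F = (\<integral>\<^sup>+a. ennreal (indicator {0<..} a * sqrt a) * (coll_abs F a)\<^sup>2 \<partial>lborel)"
    unfolding coll_energy_def by (rule nn_integral_wmeas) (use F in measurable)
  also have "\<dots> \<le> (\<integral>\<^sup>+a. C * fiber_integral (\<lambda>x. ennreal (Q x)) a \<partial>lborel)"
  proof (rule nn_integral_mono)
    fix a :: real
    show "ennreal (indicator {0<..} a * sqrt a) * (coll_abs F a)\<^sup>2 \<le> C * fiber_integral (\<lambda>x. ennreal (Q x)) a"
    proof (cases "0 < a")
      case a: True
      let ?q = "\<lambda>z. quad a (fst z) (snd z)"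
      let ?f = "\<lambda>z. root_min (?q z) / sqrt a * F (?q z)"
      have eq: "coll_abs F a = (\<integral>\<^sup>+z. ennreal \<bar>?f z\<bar> \<partial>(lborel \<Otimes>\<^sub>M lborel))"
        using a by (simp add: coll_abs_def fiber_integral_def abs_mult)
      have "(coll_abs F a)\<^sup>2 \<le> (\<integral>\<^sup>+z. ennreal (P (?q z)) \<partial>(lborel \<Otimes>\<^sub>M lborel)) * (\<integral>\<^sup>+z. ennreal (1 / sqrt a * Q (?q z)) \<partial>(lborel \<Otimes>\<^sub>M lborel))"
        unfolding eq
      proof (rule nn_integral_Cauchy_Schwarz)
        show "?f \<in> borel_measurable (lborel \<Otimes>\<^sub>M lborel)"
          by (intro borel_measurable_times borel_measurable_divide borel_measurable_const quad_measurableD F quad_measurable_root_min) measurable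
        show "(\<lambda>z. P (?q z)) \<in> borel_measurable (lborel \<Otimes>\<^sub>M lborel)" by (intro quad_measurableD P) measurable
        show "(\<lambda>z. 1 / sqrt a * Q (?q z)) \<in> borel_measurable (lborel \<Otimes>\<^sub>M lborel)"
          by (intro borel_measurable_times borel_measurable_const quad_measurableD Q) measurable
        show "(?f z)\<^sup>2 \<le> P (?q z) * (1 / sqrt a * Q (?q z))" for z
        proof (cases "pos_quad (?q z)")
          case True
          have "(?f z)\<^sup>2 = (root_min (?q z) * F (?q z))\<^sup>2 / a"
            using a by (simp add: power_mult_distrib power_divide)
          also have "\<dots> \<le> P (?q z) * Q (?q z) * sqrt a / a"
            using le[OF True] a by (intro divide_right_mono) auto
          also have "sqrt a / a = 1 / sqrt a" using a by (simp add: field_simps)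
          then have "P (?q z) * Q (?q z) * sqrt a / a = P (?q z) * (1 / sqrt a * Q (?q z))"
            by (metis mult.assoc mult.commute times_divide_eq_right)
          finally show ?thesis .
        next
          case False
          then show ?thesis using P Q a by (simp add: root_min_def)
        qed
      qed (use P Q a in auto)
      also have "(\<integral>\<^sup>+z. ennreal (1 / sqrt a * Q (?q z)) \<partial>(lborel \<Otimes>\<^sub>M lborel)) = ennreal (1 / sqrt a) * fiber_integral (\<lambda>x. ennreal (Q x)) a"
        unfolding fiber_integral_def
        by (subst nn_integral_cmult[symmetric], rule quad_measurable_fiber[OF mQ]) (use a Q(2) in \<open>auto simp: ennreal_mult[symmetric]\<close>)
      finally have "ennreal (sqrt a) * (coll_abs F a)\<^sup>2
          \<le> ennreal (sqrt a) * (C * (ennreal (1 / sqrt a) * fiber_integral (\<lambda>x. ennreal (Q x)) a))"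
        using C[OF a] unfolding fiber_integral_def by (meson dual_order.trans mult_left_mono mult_right_mono zero_le)
      also have "\<dots> = ennreal (sqrt a * (1 / sqrt a)) * (C * fiber_integral (\<lambda>x. ennreal (Q x)) a)"
        using a by (subst ennreal_mult) (auto simp: mult_ac)
      also have "\<dots> = C * fiber_integral (\<lambda>x. ennreal (Q x)) a" using a by simp
      finally show ?thesis using a by simp
    qed simp
  qed
  also have "\<dots> = C * quad_integral (\<lambda>x. ennreal (Q x))"
    unfolding quad_integral_def by (rule nn_integral_cmult) (use fiber_integral_measurable[OF mQ] in simp)
  finally show ?thesis .
qed

text \<open>A term that contains \<open>g (x 0)\<close> acts as multiplication of \<open>g\<close> by the collision integral of the rest.\<close>

lemma coll_energy_multiplier:
  assumes [measurable]: "g \<in> borel_measurable borel" and K: "quad_measurable K"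
    and B: "\<And>a. 0 < a \<Longrightarrow> (coll_abs K a)\<^sup>2 \<le> B"
  shows "coll_energy (\<lambda>x. g (x 0) * K x) \<le> B * sq_mass g"
proof -
  have eq: "coll_abs (\<lambda>x. g (x 0) * K x) a = ennreal \<bar>g a\<bar> * coll_abs K a" for a
  proof -
    have "coll_abs (\<lambda>x. g (x 0) * K x) a = fiber_integral (\<lambda>x. ennreal \<bar>g a\<bar> * ennreal (root_min x / sqrt (x 0) * \<bar>K x\<bar>)) a"
      unfolding coll_abs_def
    proof (rule fiber_integral_cong)
      fix b c
      let ?x = "quad a b c"
      define w where "w = root_min ?x / sqrt (?x 0)"
      have "0 \<le> w" unfolding w_def by (cases "pos_quad ?x") (auto simp: root_min_def pos_quad_def)
      then have "ennreal (w * \<bar>g a * K ?x\<bar>) = ennreal \<bar>g a\<bar> * ennreal (w * \<bar>K ?x\<bar>)"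
        by (subst ennreal_mult[symmetric]) (auto simp: abs_mult mult_ac)
      then show "ennreal (root_min ?x / sqrt (?x 0) * \<bar>g (?x 0) * K ?x\<bar>) = ennreal \<bar>g a\<bar> * ennreal (root_min ?x / sqrt (?x 0) * \<bar>K ?x\<bar>)"
        by (simp add: w_def)
    qed
    then show ?thesis
      unfolding coll_abs_def by (simp only: fiber_integral_cmult[OF quad_measurable_coll_integrand[OF K]])
  qed
  have "coll_energy (\<lambda>x. g (x 0) * K x) \<le> (\<integral>\<^sup>+a. B * ennreal ((g a)\<^sup>2) \<partial>wmeas)"
    unfolding coll_energy_def
  proof (rule nn_integral_mono_AE, use AE_wmeas_pos in eventually_elim)
    case (elim a)
    have "(coll_abs (\<lambda>x. g (x 0) * K x) a)\<^sup>2 = ennreal ((g a)\<^sup>2) * (coll_abs K a)\<^sup>2"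
      unfolding eq power_mult_distrib by (simp add: ennreal_power)
    also have "\<dots> \<le> ennreal ((g a)\<^sup>2) * B" by (intro mult_left_mono B elim) simp
    finally show ?case by (simp add: mult.commute)
  qed
  also have "\<dots> = B * sq_mass g" unfolding sq_mass_def by (rule nn_integral_cmult) measurable
  finally show ?thesis .
qed

section \<open>Energy estimates\<close>

text \<open>The weights compared pointwise below have exponents in multiples of \<open>1/4\<close>. In terms of fourth roots the inequalities between powers become
inequalities between monomials, which ring and field simplification can handle.\<close>

lemma fourth_root:
  fixes t :: real
  assumes "0 < t"
  obtains u where "0 < u" "t = u ^ 4" "sqrt t = u\<^sup>2" "t powr (1/4) = u" "t powr - (1/4) = inverse u"
    "t powr - (1/2) = inverse (u\<^sup>2)" "t powr - (3/4) = inverse (u ^ 3)" "t powr - (5/4) = inverse (u ^ 5)"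
    "t powr - (3/2) = inverse (u ^ 6)" "t powr - 1 = inverse (u ^ 4)" "t powr - 2 = inverse (u ^ 8)"
proof
  define u where "u = t powr (1/4)"
  have u: "u ^ n = t powr (real n / 4)" for n
    using assms by (simp add: u_def powr_powr flip: powr_realpow)
  have inv: "t powr - (real n / 4) = inverse (u ^ n)" for n by (simp add: u powr_minus)
  show "0 < u" using assms by (simp add: u_def)
  show "t = u ^ 4" using u[of 4] assms by simp
  show "sqrt t = u\<^sup>2" using u[of 2] assms by (simp add: powr_half_sqrt)
  show "t powr (1/4) = u" by (simp add: u_def)
  show "t powr - (1/4) = inverse u" "t powr - (1/2) = inverse (u\<^sup>2)" "t powr - (3/4) = inverse (u ^ 3)" "t powr - (5/4) = inverse (u ^ 5)"
    "t powr - (3/2) = inverse (u ^ 6)" "t powr - 1 = inverse (u ^ 4)" "t powr - 2 = inverse (u ^ 8)"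
    using inv[of 1] inv[of 2] inv[of 3] inv[of 5] inv[of 6] inv[of 4] inv[of 8] by simp_all
qed

text \<open>The Schur weight. Its fiber integral is homogeneous of degree \<open>2 - 9/4 = - 1/4\<close>, and the exponent \<open>3/4\<close> is less than \<open>1\<close>,
which keeps each single factor locally integrable.\<close>

definition triple_powr :: "(nat \<Rightarrow> real) \<Rightarrow> real" where
  "triple_powr x = (if 0 < x 1 \<and> 0 < x 2 \<and> 0 < x 3 then (x 1 * x 2 * x 3) powr - (3/4) else 0)"

lemma quad_measurable_triple_powr [simp, intro]: "quad_measurable triple_powr"
  unfolding triple_powr_def
  by (rule quad_measurableI) (simp only: quad_simps One_nat_def, measurable)

lemma triple_powr_nonneg [simp]: "0 \<le> triple_powr x"
  by (simp add: triple_powr_def)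

text \<open>The power of an entry \<open>s\<close> that dominates the other entries up to a factor \<open>2\<close> is shared equally between two of them.\<close>

lemma powr_le_max_powr:
  fixes a s r d :: real
  assumes "0 < a" "0 < s" "0 < r" "0 < d" "a \<le> 2 * s" "r \<le> 2 * s" "d \<le> 2 * s"
  shows "s powr - (3/4) \<le> 2 * (max a r powr - (3/8) * max a d powr - (3/8))"
proof -
  have "(2 * s) powr - (3/8) * (2 * s) powr - (3/8) \<le> max a r powr - (3/8) * max a d powr - (3/8)"
    using assms by (intro mult_mono powr_mono2') auto
  moreover have "(2 * s) powr - (3/8) * (2 * s) powr - (3/8) = 2 powr - (3/4) * s powr - (3/4)"
  proof -
    have "(2 * s) powr - (3/8) * (2 * s) powr - (3/8) = (2 * s) powr - (3/4)" by (simp flip: powr_add)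
    also have "\<dots> = 2 powr - (3/4) * s powr - (3/4)" using assms by (simp add: powr_mult)
    finally show ?thesis .
  qed
  moreover have "(1::real) \<le> 2 * 2 powr - (3/4)"
  proof -
    have "(2::real) * 2 powr - (3/4) = 2 powr (1/4)" using powr_add[of "2::real" 1 "- (3/4)"] by simp
    then show ?thesis by (simp add: ge_one_powr_ge_zero)
  qed
  then have "1 * s powr - (3/4) \<le> 2 * 2 powr - (3/4) * s powr - (3/4)" by (intro mult_right_mono) auto
  ultimately show ?thesis by linarith
qed

text \<open>On the fiber, the larger of \<open>x 1\<close> and \<open>x 2\<close> is at least half of every other entry. Its factor is split between the other
two slots, which leaves a product of two integrable kernels in independent coordinates; the two cases give
\<open>576 = 4 * 12\<^sup>2\<close>.\<close>

lemma fiber_integral_triple_powr: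
  assumes a: "0 < a"
  shows "fiber_integral (\<lambda>x. ennreal (triple_powr x)) a \<le> ennreal (576 * a powr - (1/4))"
proof -
  let ?k = "\<lambda>t. ennreal (max_kernel a t)"
  have ptw: "triple_powr x \<le> 2 * (max_kernel a (x 2) * max_kernel a (x 3)) + 2 * (max_kernel a (x 1) * max_kernel a (x 3))"
    if x: "x 3 = x 1 + x 2 - a" for x
  proof (cases "0 < x 1 \<and> 0 < x 2 \<and> 0 < x 3")
    case True
    have tp: "triple_powr x = x 1 powr - (3/4) * (x 2 powr - (3/4) * x 3 powr - (3/4))"
      using True by (simp add: triple_powr_def powr_mult)
    show ?thesis
    proof (cases "x 2 \<le> x 1")
      case le: True
      have "x 1 powr - (3/4) \<le> 2 * (max a (x 2) powr - (3/8) * max a (x 3) powr - (3/8))"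
        using True a x le by (intro powr_le_max_powr) auto
      then have "x 1 powr - (3/4) * (x 2 powr - (3/4) * x 3 powr - (3/4))
          \<le> 2 * (max a (x 2) powr - (3/8) * max a (x 3) powr - (3/8)) * (x 2 powr - (3/4) * x 3 powr - (3/4))"
        by (intro mult_right_mono) auto
      also have "\<dots> = 2 * (max_kernel a (x 2) * max_kernel a (x 3))"
        using True by (simp add: max_kernel_def mult_ac)
      finally show ?thesis unfolding tp by (simp add: add_increasing2)
    next
      case le: False
      have "x 2 powr - (3/4) \<le> 2 * (max a (x 1) powr - (3/8) * max a (x 3) powr - (3/8))"
        using True a x le by (intro powr_le_max_powr) auto
      then have "x 2 powr - (3/4) * (x 1 powr - (3/4) * x 3 powr - (3/4))
          \<le> 2 * (max a (x 1) powr - (3/8) * max a (x 3) powr - (3/8)) * (x 1 powr - (3/4) * x 3 powr - (3/4))"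
        by (intro mult_right_mono) auto
      also have "\<dots> = 2 * (max_kernel a (x 1) * max_kernel a (x 3))"
        using True by (simp add: max_kernel_def mult_ac)
      finally show ?thesis unfolding tp by (simp add: add_increasing mult.left_commute)
    qed
  qed (auto simp: triple_powr_def)
  have mk: "quad_measurable (\<lambda>x. ?k (x i) * ?k (x j))" for i j by (intro quad_measurable_ennreal_mult quad_measurable_slot) auto
  have "fiber_integral (\<lambda>x. ennreal (triple_powr x)) a
      \<le> fiber_integral (\<lambda>x. 2 * (?k (x 2) * ?k (x 3)) + 2 * (?k (x 1) * ?k (x 3))) a"
  proof (rule fiber_integral_mono)
    fix b c
    show "ennreal (triple_powr (quad a b c)) \<le> 2 * (?k (quad a b c 2) * ?k (quad a b c 3)) + 2 * (?k (quad a b c 1) * ?k (quad a b c 3))"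
      using ennreal_leI[OF ptw[of "quad a b c"]] by (simp add: ennreal_mult)
  qed
  also have "\<dots> = 2 * ((\<integral>\<^sup>+t. ?k t \<partial>lborel) * (\<integral>\<^sup>+t. ?k t \<partial>lborel)) + 2 * ((\<integral>\<^sup>+t. ?k t \<partial>lborel) * (\<integral>\<^sup>+t. ?k t \<partial>lborel))"
  proof -
    have "fiber_integral (\<lambda>x. ?k (x i) * ?k (x 3)) a = (\<integral>\<^sup>+t. ?k t \<partial>lborel) * (\<integral>\<^sup>+t. ?k t \<partial>lborel)" if "i = 1 \<or> i = 2" for i
      using that by (intro fiber_integral_mult) auto
    from this[of 1] this[of 2] show ?thesis
      by (simp only: fiber_integral_add fiber_integral_cmult mk quad_measurable_ennreal_mult quad_measurable_const simp_thms)
  qed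
  also have "\<dots> \<le> 2 * (ennreal (12 * a powr - (1/8)) * ennreal (12 * a powr - (1/8))) + 2 * (ennreal (12 * a powr - (1/8)) * ennreal (12 * a powr - (1/8)))"
    by (intro add_mono mult_mono nn_integral_max_kernel a) auto
  also have "\<dots> = ennreal (2 * ((12 * a powr - (1/8)) * (12 * a powr - (1/8))) + 2 * ((12 * a powr - (1/8)) * (12 * a powr - (1/8))))"
  proof -
    have "2 * (ennreal k * ennreal k) + 2 * (ennreal k * ennreal k) = ennreal (2 * (k * k) + 2 * (k * k))"
      if k: "0 \<le> k" for k
    proof -
      have "ennreal (2 * (k * k)) = 2 * (ennreal k * ennreal k)" using k by (simp add: ennreal_mult)
      moreover have "ennreal (2 * (k * k) + 2 * (k * k)) = ennreal (2 * (k * k)) + ennreal (2 * (k * k))"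
        using k by (intro ennreal_plus) auto
      ultimately show ?thesis by (simp only:)
    qed
    then show ?thesis by simp
  qed
  also have "2 * ((12 * a powr - (1/8)) * (12 * a powr - (1/8))) + 2 * ((12 * a powr - (1/8)) * (12 * a powr - (1/8))) = 576 * a powr - (1/4)"
    by (simp flip: powr_add)
  finally show ?thesis .
qed

lemma equil_fourth_root:
  assumes "0 < \<mu>" "0 < t"
  obtains u v where "0 < u" "0 < v" "t = u ^ 4" "t + \<mu> = v ^ 4" "u < v" "sqrt t = u\<^sup>2" "t powr (1/4) = u"
    "equil \<mu> t = inverse (v ^ 4)" "t powr - (3/4) = inverse (u ^ 3)"
    "shifted_powr \<mu> 2 0 t = inverse (v ^ 8)" "shifted_powr \<mu> (3/4) (1/2) t = inverse (v ^ 3) * inverse (u\<^sup>2)"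
    "shifted_powr \<mu> (5/4) 0 t = inverse (v ^ 5)" "shifted_powr \<mu> 2 (1/2) t = inverse (v ^ 8) * inverse (u\<^sup>2)"
    "shifted_powr \<mu> 1 (1/4) t = inverse (v ^ 4) * inverse u" "shifted_powr \<mu> (3/2) 0 t = inverse (v ^ 6)"
proof -
  obtain u where u: "0 < u" "t = u ^ 4" "sqrt t = u\<^sup>2" "t powr (1/4) = u" "t powr - (1/4) = inverse u"
    "t powr - (1/2) = inverse (u\<^sup>2)" "t powr - (3/4) = inverse (u ^ 3)"
    by (rule fourth_root[OF assms(2)]) (rule that; assumption)
  have "0 < t + \<mu>" using assms by simp
  then obtain v where v: "0 < v" "t + \<mu> = v ^ 4" "(t + \<mu>) powr - (3/4) = inverse (v ^ 3)" "(t + \<mu>) powr - (5/4) = inverse (v ^ 5)"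
    "(t + \<mu>) powr - (3/2) = inverse (v ^ 6)" "(t + \<mu>) powr - 1 = inverse (v ^ 4)" "(t + \<mu>) powr - 2 = inverse (v ^ 8)"
    by (rule fourth_root) (rule that; assumption)
  have "u ^ 4 < v ^ 4" using u(2) v(2) assms(1) by linarith
  then have "u < v" using u(1) v(1) by (meson less_imp_le power_less_imp_less_base)
  have sp: "shifted_powr \<mu> \<alpha> \<beta> t = (t + \<mu>) powr - \<alpha> * t powr - \<beta>" for \<alpha> \<beta>
    using assms by (simp add: shifted_powr_def)
  have t0: "t powr - 0 = 1" using assms by simp
  show ?thesis
  proof (rule that[OF u(1) v(1) u(2) v(2) \<open>u < v\<close> u(3,4) _ u(7)])
    show "equil \<mu> t = inverse (v ^ 4)" unfolding equil_def v(2) by (simp add: inverse_eq_divide)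
    show "shifted_powr \<mu> 2 0 t = inverse (v ^ 8)" "shifted_powr \<mu> (3/4) (1/2) t = inverse (v ^ 3) * inverse (u\<^sup>2)"
      "shifted_powr \<mu> (5/4) 0 t = inverse (v ^ 5)" "shifted_powr \<mu> 2 (1/2) t = inverse (v ^ 8) * inverse (u\<^sup>2)"
      "shifted_powr \<mu> 1 (1/4) t = inverse (v ^ 4) * inverse u" "shifted_powr \<mu> (3/2) 0 t = inverse (v ^ 6)"
      unfolding sp v(3-) u(5-7) t0 by simp_all
  qed
qed

text \<open>A Schur test with power weights. The weight \<open>root_min\<close> is at most the geometric mean of \<open>sqrt (x j)\<close> and \<open>sqrt (x k)\<close>, and
\<open>equil \<mu> (x j) \<le> inverse (x j)\<close>, so the squared kernel is at most \<open>(x j * x k) powr - (3/2)\<close>. It splits into \<open>P\<close>, the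
Schur weight normalised to be bounded on the fibers over slot \<open>0\<close>, and \<open>Q\<close>, the same weight with slot \<open>i\<close> in the
place of slot \<open>0\<close>. A collisional symmetry moves slot \<open>i\<close> to slot \<open>0\<close> and turns \<open>Q\<close> into \<open>R\<close>, whose fiber integrals are
at most \<open>576\<close> times the density of \<open>g\<close>.\<close>

lemma coll_energy_linear:
  assumes \<mu>: "0 < \<mu>" and g [measurable]: "g \<in> borel_measurable borel" and ijk: "{i, j, k} = {1, 2, 3::nat}"
  shows "coll_energy (\<lambda>x. equil \<mu> (x j) * equil \<mu> (x k) * g (x i)) \<le> ennreal (576 * 576) * sq_mass g"
proof -
  have mem: "i \<in> {0, 1, 2, 3}" "j \<in> {0, 1, 2, 3}" "k \<in> {0, 1, 2, 3}" "i \<in> {1, 2, 3}"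
    and dist: "i \<noteq> j" "j \<noteq> k" "i \<noteq> k" by (rule triple_slots[OF ijk])+
  have prod: "f (x 1) * f (x 2) * f (x 3) = f (x i) * f (x j) * f (x k)" for x :: "nat \<Rightarrow> real" and f :: "real \<Rightarrow> real"
  proof -
    have "(\<Prod>l\<in>{1, 2, 3}. f (x l)) = (\<Prod>l\<in>{i, j, k}. f (x l))" using ijk by simp
    then show ?thesis using dist by (simp add: mult_ac)
  qed
  define P where "P x = (if pos_quad x then x 0 powr (1/4) * triple_powr x else 0)" for x :: "nat \<Rightarrow> real"
  define R where "R x = (if 0 < x 0 then wsq g (x 0) * (x 0 powr (1/4) * triple_powr x) else 0)" for x :: "nat \<Rightarrow> real"
  define Q where "Q x = (if pos_quad x then wsq g (x i) * (x i powr (1/4) * (x 0 powr - (3/4) * (x j powr - (3/4) * x k powr - (3/4)))) else 0)" for x :: "nat \<Rightarrow> real"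
  have pq: "quad_measurable (\<lambda>x. if pos_quad x then f x else 0)" if "quad_measurable f" for f :: "(nat \<Rightarrow> real) \<Rightarrow> real"
  proof -
    note [measurable (raw)] = quad_measurableD[OF that]
    show ?thesis
      unfolding pos_quad_def by (rule quad_measurableI) (simp only: quad_simps One_nat_def, measurable)
  qed
  have mpw: "quad_measurable (\<lambda>x. x l powr r)" for l r by (rule quad_measurable_slot) measurable
  have mP: "quad_measurable P" unfolding P_def by (intro pq quad_measurable_real(1) quad_measurable_triple_powr mpw)
  have mQ: "quad_measurable Q" unfolding Q_def
    by (intro pq quad_measurable_real(1) mpw quad_measurable_slot wsq_measurable g)
  have mR: "quad_measurable R"
  proof -
    note [measurable (raw)] = quad_measurableD[OF quad_measurable_triple_powr]
    show ?thesis unfolding R_def by (rule quad_measurableI) (simp only: quad_simps One_nat_def, measurable)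
  qed
  have R0: "0 \<le> R x" for x by (simp add: R_def)
  (* The quadruple with slot i in front, up to the order of slots 1, 2, 3 that does not matter for R. *)
  have RQ: "quad_integral (\<lambda>x. ennreal (Q x)) \<le> quad_integral (\<lambda>x. ennreal (R x))"
  proof -
    have le: "Q x \<le> R (quad (x i) (if i = 3 then x 1 else x 0) (if i = 3 then x 2 else x 3))" if x: "x = quad a b c" for x a b c
    proof (cases "pos_quad x")
      case True
      let ?y = "quad (x i) (if i = 3 then x 1 else x 0) (if i = 3 then x 2 else x 3)"
      have pos: "0 < x 0" "0 < x 1" "0 < x 2" "0 < x 3" using True by (auto simp: pos_quad_def)
      let ?f = "\<lambda>t::real. t powr - (3/4)"
      have x123: "x 3 = x 1 + x 2 - x 0" unfolding x by simp
      consider "i = 1" | "i = 2" | "i = 3" using mem(4) by auto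
      then have "?f (x i) * triple_powr ?y = ?f (x 0) * (?f (x 1) * ?f (x 2) * ?f (x 3))"
        by cases (use pos x123 in \<open>simp_all add: triple_powr_def powr_mult mult_ac\<close>)
      also have "\<dots> = ?f (x i) * (?f (x 0) * (?f (x j) * ?f (x k)))" unfolding prod[of ?f x] by (simp add: mult_ac)
      finally have "triple_powr ?y = x 0 powr - (3/4) * (x j powr - (3/4) * x k powr - (3/4))"
        using pos_quad_nth[OF True mem(1)] by simp
      then show ?thesis using True pos_quad_nth[OF True mem(1)] by (simp add: Q_def R_def)
    next
      case False
      then show ?thesis using R0 by (simp add: Q_def)
    qed
    have "quad_integral (\<lambda>x. ennreal (Q x)) \<le> quad_integral (\<lambda>x. ennreal (R (quad (x i) (if i = 3 then x 1 else x 0) (if i = 3 then x 2 else x 3))))"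
      unfolding quad_integral_def by (intro nn_integral_mono fiber_integral_mono ennreal_leI le[OF refl])
    also have "\<dots> = quad_integral (\<lambda>x. ennreal (R x))"
      using mem(4) quad_integral_swap01_23[of "\<lambda>x. ennreal (R x)"] quad_integral_swap02_13[of "\<lambda>x. ennreal (R x)"]
        quad_integral_swap03[of "\<lambda>x. ennreal (R x)"] mR by auto
    finally show ?thesis .
  qed
  have fP: "fiber_integral (\<lambda>x. ennreal (P x)) a \<le> ennreal 576" if a: "0 < a" for a
  proof -
    have "fiber_integral (\<lambda>x. ennreal (P x)) a \<le> fiber_integral (\<lambda>x. ennreal (a powr (1/4)) * ennreal (triple_powr x)) a"
      by (rule fiber_integral_mono) (auto simp: P_def ennreal_mult[symmetric])
    also have "\<dots> = ennreal (a powr (1/4)) * fiber_integral (\<lambda>x. ennreal (triple_powr x)) a"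
      by (intro fiber_integral_cmult quad_measurable_ennreal quad_measurable_triple_powr)
    also have "\<dots> \<le> ennreal (a powr (1/4)) * ennreal (576 * a powr - (1/4))"
      by (intro mult_left_mono fiber_integral_triple_powr a) simp
    also have "\<dots> = ennreal (a powr (1/4) * (576 * a powr - (1/4)))" by (simp add: ennreal_mult)
    also have "a powr (1/4) * (576 * a powr - (1/4)) = 576" using a by (simp flip: powr_add)
    finally show ?thesis .
  qed
  have "quad_integral (\<lambda>x. ennreal (R x)) \<le> (\<integral>\<^sup>+a. ennreal 576 * ennreal (wsq g a) \<partial>lborel)"
    unfolding quad_integral_def
  proof (rule nn_integral_mono)
    fix a :: real
    show "fiber_integral (\<lambda>x. ennreal (R x)) a \<le> ennreal 576 * ennreal (wsq g a)"
    proof (cases "0 < a")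
      case a: True
      have "fiber_integral (\<lambda>x. ennreal (R x)) a \<le> fiber_integral (\<lambda>x. ennreal (wsq g a * a powr (1/4)) * ennreal (triple_powr x)) a"
        by (rule fiber_integral_mono) (auto simp: R_def ennreal_mult[symmetric] mult_ac)
      also have "\<dots> = ennreal (wsq g a * a powr (1/4)) * fiber_integral (\<lambda>x. ennreal (triple_powr x)) a"
        by (intro fiber_integral_cmult quad_measurable_ennreal quad_measurable_triple_powr)
      also have "\<dots> \<le> ennreal (wsq g a * a powr (1/4)) * ennreal (576 * a powr - (1/4))"
        by (intro mult_left_mono fiber_integral_triple_powr a) simp
      also have "\<dots> = ennreal (wsq g a * a powr (1/4) * (576 * a powr - (1/4)))" by (simp add: ennreal_mult)
      also have "wsq g a * a powr (1/4) * (576 * a powr - (1/4)) = 576 * wsq g a" using a by (simp flip: powr_add)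
      finally show ?thesis by (simp add: ennreal_mult)
    next
      case False
      then have "fiber_integral (\<lambda>x. ennreal (R x)) a = fiber_integral (\<lambda>x. 0) a" by (intro fiber_integral_cong) (simp add: R_def)
      then show ?thesis by (simp add: fiber_integral_def)
    qed
  qed
  also have "\<dots> = ennreal 576 * sq_mass g"
    unfolding sq_mass_wsq[OF g] by (rule nn_integral_cmult) measurable
  finally have iR: "quad_integral (\<lambda>x. ennreal (R x)) \<le> ennreal 576 * sq_mass g" .
  have "coll_energy (\<lambda>x. equil \<mu> (x j) * equil \<mu> (x k) * g (x i)) \<le> ennreal 576 * quad_integral (\<lambda>x. ennreal (Q x))"
  proof (rule coll_energy_Cauchy_Schwarz[OF _ mP _ mQ _ _ fP])
    show "quad_measurable (\<lambda>x. equil \<mu> (x j) * equil \<mu> (x k) * g (x i))"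
      by (intro quad_measurable_real(1) quad_measurable_slot g) (auto simp: equil_def)
    show "0 \<le> P x" "0 \<le> Q x" for x by (auto simp: P_def Q_def)
    fix x :: "nat \<Rightarrow> real" assume x: "pos_quad x"
    have pos: "0 < x 0" "0 < x i" "0 < x j" "0 < x k" using pos_quad_nth[OF x] mem by auto
    obtain z where z: "0 < z" "sqrt (x 0) = z\<^sup>2" "x 0 powr (1/4) = z" "x 0 powr - (3/4) = inverse (z ^ 3)"
      by (rule fourth_root[OF pos(1)]) (rule that; assumption)
    obtain p where p: "0 < p" "sqrt (x i) = p\<^sup>2" "x i powr (1/4) = p" "x i powr - (3/4) = inverse (p ^ 3)"
      by (rule fourth_root[OF pos(2)]) (rule that; assumption)
    obtain q q' where q: "0 < q" "0 < q'" "q < q'" "sqrt (x j) = q\<^sup>2" "equil \<mu> (x j) = inverse (q' ^ 4)" "x j powr - (3/4) = inverse (q ^ 3)"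
      by (rule equil_fourth_root[OF \<mu> pos(3)]) (rule that; assumption)
    obtain r r' where r: "0 < r" "0 < r'" "r < r'" "sqrt (x k) = r\<^sup>2" "equil \<mu> (x k) = inverse (r' ^ 4)" "x k powr - (3/4) = inverse (r ^ 3)"
      by (rule equil_fourth_root[OF \<mu> pos(4)]) (rule that; assumption)
    have "triple_powr x = x i powr - (3/4) * x j powr - (3/4) * x k powr - (3/4)"
      using x prod[of "\<lambda>t. t powr - (3/4)" x] by (simp add: triple_powr_def pos_quad_def powr_mult)
    then have PQ: "P x * Q x * sqrt (x 0) = (g (x i))\<^sup>2 * (inverse (q ^ 6) * inverse (r ^ 6))"
      using x pos z(1) p(1) q(1) r(1) unfolding P_def Q_def wsq_def z p q r
      by (simp add: field_simps power2_eq_square power_numeral_reduce)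
    have m: "(root_min x)\<^sup>2 \<le> q\<^sup>2 * r\<^sup>2" using root_min_sq_le[OF x mem(2,3)] by (simp add: q r)
    have "(root_min x * (equil \<mu> (x j) * equil \<mu> (x k) * g (x i)))\<^sup>2 = (g (x i))\<^sup>2 * ((root_min x)\<^sup>2 * (inverse (q' ^ 8) * inverse (r' ^ 8)))"
      unfolding q r by (simp add: power_mult_distrib power_inverse mult_ac flip: power_mult)
    also have "\<dots> \<le> (g (x i))\<^sup>2 * (q\<^sup>2 * r\<^sup>2 * (inverse (q ^ 8) * inverse (r ^ 8)))"
      using q r by (intro mult_left_mono mult_mono m le_imp_inverse_le power_mono) auto
    also have "\<dots> = P x * Q x * sqrt (x 0)"
      unfolding PQ using q(1) r(1) by (simp add: field_simps power_numeral_reduce)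
    finally show "(root_min x * (equil \<mu> (x j) * equil \<mu> (x k) * g (x i)))\<^sup>2 \<le> P x * Q x * sqrt (x 0)" .
  qed
  also have "\<dots> \<le> ennreal 576 * (ennreal 576 * sq_mass g)"
    by (intro mult_left_mono order_trans[OF RQ iR]) simp
  also have "\<dots> = ennreal (576 * 576) * sq_mass g" by (simp add: ennreal_mult mult.assoc)
  finally show ?thesis .
qed

definition moment :: "real \<Rightarrow> real \<Rightarrow> real \<Rightarrow> ennreal" where
  "moment \<mu> \<alpha> \<beta> = (\<integral>\<^sup>+t. ennreal (shifted_powr \<mu> \<alpha> \<beta> t) \<partial>lborel)"

lemma fiber_integral_real_mult:
  fixes \<phi> \<psi> :: "real \<Rightarrow> real"
  assumes [measurable]: "\<phi> \<in> borel_measurable borel" "\<psi> \<in> borel_measurable borel"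
    and "\<And>t. 0 \<le> \<phi> t" "\<And>t. 0 \<le> \<psi> t" "i \<in> {1, 2, 3}" "j \<in> {1, 2, 3}" "i \<noteq> j"
  shows "fiber_integral (\<lambda>x. ennreal (\<phi> (x i) * \<psi> (x j))) a = (\<integral>\<^sup>+t. ennreal (\<phi> t) \<partial>lborel) * (\<integral>\<^sup>+t. ennreal (\<psi> t) \<partial>lborel)"
  using assms fiber_integral_mult[of "\<lambda>t. ennreal (\<phi> t)" "\<lambda>t. ennreal (\<psi> t)" i j a] by (simp add: ennreal_mult)

lemma quad_integral_real_mult3:
  fixes \<alpha> \<beta> \<gamma> :: "real \<Rightarrow> real"
  assumes [measurable]: "\<alpha> \<in> borel_measurable borel" "\<beta> \<in> borel_measurable borel" "\<gamma> \<in> borel_measurable borel"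
    and "\<And>t. 0 \<le> \<alpha> t" "\<And>t. 0 \<le> \<beta> t" "\<And>t. 0 \<le> \<gamma> t" "{i, j, k} = {1, 2, 3::nat}"
  shows "quad_integral (\<lambda>x. ennreal (\<alpha> (x i) * \<beta> (x j) * \<gamma> (x k)))
    = (\<integral>\<^sup>+t. ennreal (\<alpha> t) \<partial>lborel) * (\<integral>\<^sup>+t. ennreal (\<beta> t) \<partial>lborel) * (\<integral>\<^sup>+t. ennreal (\<gamma> t) \<partial>lborel)"
  using quad_integral_mult3[of "\<lambda>t. ennreal (\<alpha> t)" "\<lambda>t. ennreal (\<beta> t)" "\<lambda>t. ennreal (\<gamma> t)" i j k] assms(4-)
  by (simp add: ennreal_mult)

lemma equil_measurable [measurable]: "equil \<mu> \<in> borel_measurable borel"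
  unfolding equil_def by measurable

text \<open>Here \<open>root_min\<close> is bounded by the geometric mean of \<open>sqrt (x j)\<close>, which completes the density of \<open>h\<close>, and \<open>sqrt (x 0)\<close>, which
the Cauchy--Schwarz lemma provides. The density of \<open>g\<close> needs a factor \<open>sqrt (x i)\<close> as well; an integrable singularity of
order \<open>1/2\<close> in \<open>P\<close> pays for it. If \<open>x i \<le> x k\<close>, the singularity is at slot \<open>i\<close>, to which part of the decay in slot \<open>k\<close> is
moved; otherwise it is at slot \<open>k\<close>, where \<open>sqrt (x k) \<le> sqrt (x i)\<close>.\<close>

lemma coll_energy_bilinear:
  assumes \<mu>: "0 < \<mu>" and g [measurable]: "g \<in> borel_measurable borel" and h [measurable]: "h \<in> borel_measurable borel"
    and ijk: "{i, j, k} = {1, 2, 3::nat}"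
  shows "coll_energy (\<lambda>x. equil \<mu> (x j) * equil \<mu> (x k) * (g (x i) * h (x j)))
    \<le> 2 * moment \<mu> 2 0 * moment \<mu> (3/4) (1/2) * moment \<mu> (5/4) 0 * (sq_mass g * sq_mass h)"
proof -
  note s = triple_slots[OF ijk]
  let ?A = "shifted_powr \<mu> 2 0" and ?h = "shifted_powr \<mu> (3/4) (1/2)" and ?B = "shifted_powr \<mu> (5/4) 0"
  define P where "P x = ?A (x j) * ?h (x i) + ?A (x j) * ?h (x k)" for x :: "nat \<Rightarrow> real"
  define Q where "Q x = wsq g (x i) * wsq h (x j) * ?B (x k)" for x :: "nat \<Rightarrow> real"
  have m2: "quad_measurable (\<lambda>x. ennreal (?A (x l) * ?h (x n)))" for l n
    by (intro quad_measurable_real(1) quad_measurable_ennreal quad_measurable_slot) measurable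
  have "coll_energy (\<lambda>x. equil \<mu> (x j) * equil \<mu> (x k) * (g (x i) * h (x j)))
      \<le> (2 * moment \<mu> 2 0 * moment \<mu> (3/4) (1/2)) * quad_integral (\<lambda>x. ennreal (Q x))"
  proof (rule coll_energy_Cauchy_Schwarz[where P = P])
    show "quad_measurable (\<lambda>x. equil \<mu> (x j) * equil \<mu> (x k) * (g (x i) * h (x j)))"
      by (intro quad_measurable_real(1) quad_measurable_slot) measurable
    show "quad_measurable P" "quad_measurable Q"
      unfolding P_def Q_def by (intro quad_measurable_real(1,2) quad_measurable_slot; measurable)+
    show "0 \<le> P x" "0 \<le> Q x" for x by (auto simp: P_def Q_def)
    show "fiber_integral (\<lambda>x. ennreal (P x)) a \<le> 2 * moment \<mu> 2 0 * moment \<mu> (3/4) (1/2)" for a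
    proof -
      have "fiber_integral (\<lambda>x. ennreal (P x)) a
          = fiber_integral (\<lambda>x. ennreal (?A (x j) * ?h (x i)) + ennreal (?A (x j) * ?h (x k))) a"
        by (rule fiber_integral_cong) (simp add: P_def)
      also have "\<dots> = moment \<mu> 2 0 * moment \<mu> (3/4) (1/2) + moment \<mu> 2 0 * moment \<mu> (3/4) (1/2)"
        using s m2 by (simp add: fiber_integral_add fiber_integral_real_mult moment_def)
      finally show ?thesis by (simp add: mult_2 distrib_right)
    qed
    fix x :: "nat \<Rightarrow> real" assume x: "pos_quad x"
    have pos: "0 < x 0" "0 < x i" "0 < x j" "0 < x k" using pos_quad_nth[OF x] s by auto
    obtain z where z: "0 < z" "sqrt (x 0) = z\<^sup>2"
      by (rule fourth_root[OF pos(1)]) (rule that; assumption)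
    obtain p p' where p: "0 < p" "0 < p'" "x i = p ^ 4" "x i + \<mu> = p' ^ 4" "sqrt (x i) = p\<^sup>2" "?h (x i) = inverse (p' ^ 3) * inverse (p\<^sup>2)"
      by (rule equil_fourth_root[OF \<mu> pos(2)]) (rule that; assumption)
    obtain q q' where q: "0 < q" "0 < q'" "sqrt (x j) = q\<^sup>2" "equil \<mu> (x j) = inverse (q' ^ 4)" "?A (x j) = inverse (q' ^ 8)"
      by (rule equil_fourth_root[OF \<mu> pos(3)]) (rule that; assumption)
    obtain r r' where r: "0 < r" "0 < r'" "x k = r ^ 4" "x k + \<mu> = r' ^ 4" "equil \<mu> (x k) = inverse (r' ^ 4)"
      "?h (x k) = inverse (r' ^ 3) * inverse (r\<^sup>2)" "?B (x k) = inverse (r' ^ 5)"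
      by (rule equil_fourth_root[OF \<mu> pos(4)]) (rule that; assumption)
    have key: "inverse (r' ^ 8) \<le> (inverse (p' ^ 3) * inverse (p\<^sup>2) + inverse (r' ^ 3) * inverse (r\<^sup>2)) * p\<^sup>2 * inverse (r' ^ 5)"
    proof (cases "x i \<le> x k")
      case True
      then have "p' ^ 4 \<le> r' ^ 4" by (simp flip: p(4) r(4))
      then have "p' \<le> r'" using p r by (simp add: power_mono_iff)
      then have "inverse (r' ^ 3) \<le> inverse (p' ^ 3)" using p by (intro le_imp_inverse_le power_mono) auto
      then have "inverse (r' ^ 3) * inverse (r' ^ 5) \<le> inverse (p' ^ 3) * inverse (r' ^ 5)"
        using r by (intro mult_right_mono) auto
      also have "\<dots> = (inverse (p' ^ 3) * inverse (p\<^sup>2)) * p\<^sup>2 * inverse (r' ^ 5)" using p by simp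
      also have "\<dots> \<le> (inverse (p' ^ 3) * inverse (p\<^sup>2) + inverse (r' ^ 3) * inverse (r\<^sup>2)) * p\<^sup>2 * inverse (r' ^ 5)"
        using p r by (intro mult_right_mono) auto
      finally show ?thesis by (simp flip: power_add inverse_mult_distrib)
    next
      case False
      then have "r ^ 4 \<le> p ^ 4" by (simp flip: p(3) r(3))
      then have "r \<le> p" using p r by (simp add: power_mono_iff)
      then have "r\<^sup>2 \<le> p\<^sup>2" using r by (intro power_mono) auto
      then have "1 \<le> inverse (r\<^sup>2) * p\<^sup>2" using r by (simp add: field_simps)
      then have "inverse (r' ^ 3) * inverse (r' ^ 5) * 1 \<le> inverse (r' ^ 3) * inverse (r' ^ 5) * (inverse (r\<^sup>2) * p\<^sup>2)"
        using r by (intro mult_left_mono) auto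
      also have "\<dots> = (inverse (r' ^ 3) * inverse (r\<^sup>2)) * p\<^sup>2 * inverse (r' ^ 5)" by (simp add: mult_ac)
      also have "\<dots> \<le> (inverse (p' ^ 3) * inverse (p\<^sup>2) + inverse (r' ^ 3) * inverse (r\<^sup>2)) * p\<^sup>2 * inverse (r' ^ 5)"
        using p r by (intro mult_right_mono) auto
      finally show ?thesis by (simp flip: power_add inverse_mult_distrib)
    qed
    have m: "(root_min x)\<^sup>2 \<le> q\<^sup>2 * z\<^sup>2" using root_min_sq_le[OF x s(5), of 0] by (simp add: q z)
    let ?G = "(g (x i))\<^sup>2 * (h (x j))\<^sup>2 * inverse (q' ^ 8)"
    have "(root_min x * (equil \<mu> (x j) * equil \<mu> (x k) * (g (x i) * h (x j))))\<^sup>2 = (root_min x)\<^sup>2 * (?G * inverse (r' ^ 8))"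
      unfolding q(4) r(5) by (simp add: power_mult_distrib power_inverse mult_ac flip: power_mult)
    also have "\<dots> \<le> (q\<^sup>2 * z\<^sup>2) * (?G * ((inverse (p' ^ 3) * inverse (p\<^sup>2) + inverse (r' ^ 3) * inverse (r\<^sup>2)) * p\<^sup>2 * inverse (r' ^ 5)))"
      using q r by (intro mult_mono m key mult_nonneg_nonneg order_refl) auto
    also have "\<dots> = P x * Q x * sqrt (x 0)"
      using pos by (simp add: P_def Q_def wsq_def p(5,6) q(3,5) r(6,7) z(2) algebra_simps)
    finally show "(root_min x * (equil \<mu> (x j) * equil \<mu> (x k) * (g (x i) * h (x j))))\<^sup>2 \<le> P x * Q x * sqrt (x 0)" .
  qed
  also have "quad_integral (\<lambda>x. ennreal (Q x)) = sq_mass g * sq_mass h * moment \<mu> (5/4) 0"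
    unfolding Q_def moment_def sq_mass_wsq[OF g] sq_mass_wsq[OF h] by (rule quad_integral_real_mult3) (auto simp: ijk)
  finally show ?thesis by (simp add: mult_ac)
qed

text \<open>With a function in each of the slots \<open>1\<close>, \<open>2\<close>, \<open>3\<close> their densities already integrate to the product of the masses; bounding
\<open>root_min\<close> by slots \<open>0\<close> and \<open>i\<close> leaves the weights of slots \<open>j\<close> and \<open>k\<close> to \<open>P\<close>.\<close>

lemma coll_energy_trilinear:
  assumes \<mu>: "0 < \<mu>" and g [measurable]: "g \<in> borel_measurable borel" and h [measurable]: "h \<in> borel_measurable borel"
    and f [measurable]: "f \<in> borel_measurable borel" and ijk: "{i, j, k} = {1, 2, 3::nat}"
  shows "coll_energy (\<lambda>x. equil \<mu> (x j) * equil \<mu> (x k) * (g (x i) * h (x j) * f (x k)))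
    \<le> moment \<mu> 2 (1/2) * moment \<mu> 2 (1/2) * (sq_mass g * sq_mass h * sq_mass f)"
proof -
  note s = triple_slots[OF ijk]
  let ?A = "shifted_powr \<mu> 2 (1/2)"
  define P where "P x = ?A (x j) * ?A (x k)" for x :: "nat \<Rightarrow> real"
  define Q where "Q x = wsq g (x i) * wsq h (x j) * wsq f (x k)" for x :: "nat \<Rightarrow> real"
  have "coll_energy (\<lambda>x. equil \<mu> (x j) * equil \<mu> (x k) * (g (x i) * h (x j) * f (x k)))
      \<le> (moment \<mu> 2 (1/2) * moment \<mu> 2 (1/2)) * quad_integral (\<lambda>x. ennreal (Q x))"
  proof (rule coll_energy_Cauchy_Schwarz[where P = P])
    show "quad_measurable (\<lambda>x. equil \<mu> (x j) * equil \<mu> (x k) * (g (x i) * h (x j) * f (x k)))"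
      by (intro quad_measurable_real(1) quad_measurable_slot) measurable
    show "quad_measurable P" "quad_measurable Q"
      unfolding P_def Q_def by (intro quad_measurable_real(1,2) quad_measurable_slot; measurable)+
    show "0 \<le> P x" "0 \<le> Q x" for x by (auto simp: P_def Q_def)
    show "fiber_integral (\<lambda>x. ennreal (P x)) a \<le> moment \<mu> 2 (1/2) * moment \<mu> 2 (1/2)" for a
      unfolding P_def moment_def using s by (subst fiber_integral_real_mult) auto
    fix x :: "nat \<Rightarrow> real" assume x: "pos_quad x"
    have pos: "0 < x 0" "0 < x i" "0 < x j" "0 < x k" using pos_quad_nth[OF x] s by auto
    obtain q q' where q: "0 < q" "0 < q'" "sqrt (x j) = q\<^sup>2" "equil \<mu> (x j) = inverse (q' ^ 4)" "?A (x j) = inverse (q' ^ 8) * inverse (q\<^sup>2)"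
      by (rule equil_fourth_root[OF \<mu> pos(3)]) (rule that; assumption)
    obtain r r' where r: "0 < r" "0 < r'" "sqrt (x k) = r\<^sup>2" "equil \<mu> (x k) = inverse (r' ^ 4)" "?A (x k) = inverse (r' ^ 8) * inverse (r\<^sup>2)"
      by (rule equil_fourth_root[OF \<mu> pos(4)]) (rule that; assumption)
    let ?G = "(g (x i) * h (x j) * f (x k))\<^sup>2 * (inverse (q' ^ 8) * inverse (r' ^ 8))"
    have "(root_min x * (equil \<mu> (x j) * equil \<mu> (x k) * (g (x i) * h (x j) * f (x k))))\<^sup>2 = (root_min x)\<^sup>2 * ?G"
      unfolding q r by (simp add: power_mult_distrib power_inverse mult_ac flip: power_mult)
    also have "\<dots> \<le> (sqrt (x i) * sqrt (x 0)) * ?G"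
      using q r root_min_sq_le[OF x s(4), of 0] by (intro mult_right_mono) auto
    also have "\<dots> = P x * Q x * sqrt (x 0)"
      using pos q(1) r(1) unfolding P_def Q_def wsq_def q r by (simp add: field_simps power_mult_distrib)
    finally show "(root_min x * (equil \<mu> (x j) * equil \<mu> (x k) * (g (x i) * h (x j) * f (x k))))\<^sup>2 \<le> P x * Q x * sqrt (x 0)" .
  qed
  also have "quad_integral (\<lambda>x. ennreal (Q x)) = sq_mass g * sq_mass h * sq_mass f"
    unfolding Q_def sq_mass_wsq[OF g] sq_mass_wsq[OF h] sq_mass_wsq[OF f] by (rule quad_integral_real_mult3) (auto simp: ijk)
  finally show ?thesis .
qed

section \<open>Uniform bounds for multipliers\<close>

text \<open>For \<open>r = 0\<close> and \<open>r = 1/4\<close> the weight makes every function of \<open>H\<close> integrable, by Cauchy--Schwarz; these integrals control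
the multipliers that stand in front of \<open>g (x 0)\<close>.\<close>

definition equil_powr_abs :: "real \<Rightarrow> real \<Rightarrow> (real \<Rightarrow> real) \<Rightarrow> real \<Rightarrow> real" where
  "equil_powr_abs r \<mu> g t = (if 0 < t then equil \<mu> t * t powr r * \<bar>g t\<bar> else 0)"

lemma equil_powr_abs_measurable [measurable]:
  assumes [measurable]: "g \<in> borel_measurable borel"
  shows "equil_powr_abs r \<mu> g \<in> borel_measurable borel"
  unfolding equil_powr_abs_def by measurable

lemma equil_powr_abs_nonneg [simp]: "0 < \<mu> \<Longrightarrow> 0 \<le> equil_powr_abs r \<mu> g t"
  by (simp add: equil_powr_abs_def equil_def)

lemma integral_equil_powr_abs_le:
  assumes \<mu>: "0 < \<mu>" and g [measurable]: "g \<in> borel_measurable borel" and r: "\<beta> = 1/2 - 2 * r"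
  shows "(\<integral>\<^sup>+t. ennreal (equil_powr_abs r \<mu> g t) \<partial>lborel)\<^sup>2 \<le> moment \<mu> 2 \<beta> * sq_mass g"
proof -
  have "(\<integral>\<^sup>+t. ennreal \<bar>equil_powr_abs r \<mu> g t\<bar> \<partial>lborel)\<^sup>2 \<le> moment \<mu> 2 \<beta> * sq_mass g"
    unfolding moment_def sq_mass_wsq[OF g]
  proof (rule nn_integral_Cauchy_Schwarz)
    show "(equil_powr_abs r \<mu> g t)\<^sup>2 \<le> shifted_powr \<mu> 2 \<beta> t * wsq g t" for t
    proof (cases "0 < t")
      case True
      have "(t + \<mu>) powr - 2 = (equil \<mu> t)\<^sup>2"
        using True \<mu> powr_minus[of "t + \<mu>" 2] by (simp add: equil_def power_divide inverse_eq_divide)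
      then have C: "(equil \<mu> t)\<^sup>2 = (t + \<mu>) powr - 2" by simp
      have B: "(t powr r)\<^sup>2 = t powr - \<beta> * sqrt t"
        using True by (simp add: r powr_half_sqrt[symmetric] power2_eq_square flip: powr_add)
      have "(equil_powr_abs r \<mu> g t)\<^sup>2 = (equil \<mu> t)\<^sup>2 * (t powr r)\<^sup>2 * (g t)\<^sup>2"
        using True by (simp add: equil_powr_abs_def power_mult_distrib)
      then show ?thesis by (simp only: B C shifted_powr_def wsq_def True if_True mult_ac order_refl)
    qed (simp add: equil_powr_abs_def shifted_powr_def)
  qed auto
  then show ?thesis using \<mu> by simp
qed

text \<open>The collision weight gains a fourth root: if \<open>x 0\<close> dominates, then \<open>root_min x / sqrt (x 0)\<close> is at most
\<open>sqrt (x i / x 0)\<close>, and half of this gain pays for \<open>d powr (1/4)\<close>; otherwise \<open>d\<close> is itself at most \<open>2 * x i\<close>.\<close>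

lemma root_min_over_sqrt_bound:
  assumes x: "pos_quad x" and i: "i \<in> {1, 2, 3}" and d: "0 \<le> d" "d \<le> 2 * max (x 0) (x i)"
  shows "root_min x / sqrt (x 0) * d powr (1/4) \<le> 2 * x i powr (1/4)"
proof -
  have pos: "0 < x 0" "0 < x i" using pos_quad_nth[OF x] i by auto
  have two: "(2 * s) powr (1/4) \<le> 2 * s powr (1/4)" if "0 < s" for s :: real
  proof -
    have "(2::real) powr (1/4) \<le> 2 powr 1" by (intro powr_mono) auto
    then show ?thesis using that by (simp add: powr_mult mult_right_mono)
  qed
  have one: "root_min x / sqrt (x 0) \<le> 1" using root_min_le[OF x, of 0] pos by simp
  show ?thesis
  proof (cases "x 0 \<le> x i")
    case True
    have "root_min x / sqrt (x 0) * d powr (1/4) \<le> 1 * (2 * x i) powr (1/4)"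
      using d True pos by (intro mult_mono one powr_mono2) auto
    then show ?thesis using two[OF pos(2)] by simp
  next
    case False
    obtain z where z: "0 < z" "x 0 = z ^ 4" "sqrt (x 0) = z\<^sup>2" "x 0 powr (1/4) = z"
      by (rule fourth_root[OF pos(1)]) (rule that; assumption)
    obtain p where p: "0 < p" "x i = p ^ 4" "sqrt (x i) = p\<^sup>2" "x i powr (1/4) = p"
      by (rule fourth_root[OF pos(2)]) (rule that; assumption)
    have "p ^ 4 \<le> z ^ 4" using False by (simp flip: p(2) z(2))
    then have pz: "p \<le> z" using p z by (simp add: power_mono_iff)
    have "d powr (1/4) \<le> (2 * x 0) powr (1/4)" using d False by (intro powr_mono2) auto
    also have "\<dots> \<le> 2 * z" using two[OF pos(1)] by (simp add: z(4))
    finally have dz: "d powr (1/4) \<le> 2 * z" .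
    have "root_min x / sqrt (x 0) \<le> p\<^sup>2 / z\<^sup>2"
      unfolding z(3) using root_min_le[OF x, of i] i by (intro divide_right_mono) (auto simp: p(3))
    then have "root_min x / sqrt (x 0) * d powr (1/4) \<le> p\<^sup>2 / z\<^sup>2 * (2 * z)"
      by (rule mult_mono[OF _ dz]) simp_all
    also have "\<dots> = 2 * p * (p / z)" using z(1) by (simp add: power2_eq_square)
    also have "\<dots> \<le> 2 * p * 1" using pz p(1) z(1) by (intro mult_left_mono) auto
    finally show ?thesis by (simp add: p(4))
  qed
qed

text \<open>Without the collision weight the factor \<open>equil \<mu> (x j)\<close> alone would not be integrable. The fourth root gained from
the weight supplies the missing decay, because \<open>x j\<close> is at most \<open>x 0 + x 3\<close>.\<close>

lemma loss_multiplier_bound: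
  assumes \<mu>: "0 < \<mu>" and g [measurable]: "g \<in> borel_measurable borel" and j: "j \<in> {1, 2}"
  shows "(coll_abs (\<lambda>x. equil \<mu> (x j) * equil \<mu> (x 3) * g (x 3)) a)\<^sup>2 \<le> 4 * (moment \<mu> 1 (1/4))\<^sup>2 * moment \<mu> 2 0 * sq_mass g"
proof -
  let ?B = "shifted_powr \<mu> 1 (1/4)" and ?m = "equil_powr_abs (1/4) \<mu> g"
  have mm: "quad_measurable (\<lambda>x. ennreal (?B (x j) * ?m (x 3)))"
    by (intro quad_measurable_real(1) quad_measurable_ennreal quad_measurable_slot) measurable
  have "coll_abs (\<lambda>x. equil \<mu> (x j) * equil \<mu> (x 3) * g (x 3)) a \<le> fiber_integral (\<lambda>x. 2 * ennreal (?B (x j) * ?m (x 3))) a"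
  proof (rule coll_abs_le_fiber_integral)
    fix x :: "nat \<Rightarrow> real" assume x: "pos_quad x" and x3: "x 3 = x 1 + x 2 - x 0"
    have pos: "0 < x 0" "0 < x 1" "0 < x 2" "0 < x 3" "0 < x j" using x j by (auto simp: pos_quad_def)
    have jle: "x j \<le> 2 * max (x 0) (x 3)" using j x3 pos by (auto simp: max_def)
    obtain q q' where q: "0 < q" "0 < q'" "x j powr (1/4) = q" "equil \<mu> (x j) = inverse (q' ^ 4)" "?B (x j) = inverse (q' ^ 4) * inverse q"
      by (rule equil_fourth_root[OF \<mu> pos(5)]) (rule that; assumption)
    have "root_min x / sqrt (x 0) * q \<le> 2 * x 3 powr (1/4)"
      using root_min_over_sqrt_bound[OF x _ _ jle] pos by (simp add: q(3))
    then have le: "root_min x / sqrt (x 0) \<le> 2 * x 3 powr (1/4) * inverse q"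
      using q(1) by (simp add: field_simps)
    have e0: "0 \<le> equil \<mu> (x 3)" using pos \<mu> by (simp add: equil_def)
    have "root_min x / sqrt (x 0) * \<bar>equil \<mu> (x j) * equil \<mu> (x 3) * g (x 3)\<bar>
        = root_min x / sqrt (x 0) * (inverse (q' ^ 4) * equil \<mu> (x 3) * \<bar>g (x 3)\<bar>)"
      using q e0 by (simp add: abs_mult)
    also have "\<dots> \<le> (2 * x 3 powr (1/4) * inverse q) * (inverse (q' ^ 4) * equil \<mu> (x 3) * \<bar>g (x 3)\<bar>)"
      using q e0 by (intro mult_right_mono le) auto
    also have "\<dots> = 2 * (?B (x j) * ?m (x 3))" using pos by (simp add: q(5) equil_powr_abs_def mult_ac)
    finally have "ennreal (root_min x / sqrt (x 0) * \<bar>equil \<mu> (x j) * equil \<mu> (x 3) * g (x 3)\<bar>) \<le> ennreal (2 * (?B (x j) * ?m (x 3)))"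
      by (rule ennreal_leI)
    also have "\<dots> = 2 * ennreal (?B (x j) * ?m (x 3))" using \<mu> by (subst ennreal_mult) auto
    finally show "ennreal (root_min x / sqrt (x 0) * \<bar>equil \<mu> (x j) * equil \<mu> (x 3) * g (x 3)\<bar>) \<le> 2 * ennreal (?B (x j) * ?m (x 3))" .
  qed
  also have "\<dots> = 2 * (moment \<mu> 1 (1/4) * (\<integral>\<^sup>+t. ennreal (?m t) \<partial>lborel))"
    using j \<mu> unfolding fiber_integral_cmult[OF mm] moment_def by (subst fiber_integral_real_mult) auto
  finally have "(coll_abs (\<lambda>x. equil \<mu> (x j) * equil \<mu> (x 3) * g (x 3)) a)\<^sup>2
      \<le> (2 * (moment \<mu> 1 (1/4) * (\<integral>\<^sup>+t. ennreal (?m t) \<partial>lborel)))\<^sup>2" by (intro power_mono) auto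
  also have "\<dots> = 4 * (moment \<mu> 1 (1/4))\<^sup>2 * (\<integral>\<^sup>+t. ennreal (?m t) \<partial>lborel)\<^sup>2"
    by (simp add: power_mult_distrib mult.assoc)
  also have "\<dots> \<le> 4 * (moment \<mu> 1 (1/4))\<^sup>2 * (moment \<mu> 2 0 * sq_mass g)"
    by (intro mult_left_mono integral_equil_powr_abs_le \<mu> g) auto
  finally show ?thesis by (simp add: mult.assoc)
qed

text \<open>By resonance \<open>x i - x 0 = x 3 - x l\<close>, where \<open>l\<close> is the remaining slot. Hence the difference is at most the larger of
\<open>x 3\<close> and \<open>x l\<close> and cancels the corresponding equilibrium factor, except for a fourth root, which the collision weight
compensates.\<close>

lemma difference_multiplier_bound:
  assumes \<mu>: "0 < \<mu>" and g [measurable]: "g \<in> borel_measurable borel" and i: "i \<in> {1, 2}"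
  shows "(coll_abs (\<lambda>x. equil \<mu> (x 1) * equil \<mu> (x 2) * equil \<mu> (x 3) * (x i - x 0) * g (x i)) a)\<^sup>2
    \<le> 16 * (moment \<mu> 1 (1/4))\<^sup>2 * moment \<mu> 2 0 * sq_mass g"
proof -
  define l where "l = 3 - i"
  have l: "l \<in> {1, 2}" "l \<noteq> i" "l \<noteq> 3" "i \<noteq> 3" using i by (auto simp: l_def)
  let ?B = "shifted_powr \<mu> 1 (1/4)" and ?m = "equil_powr_abs (1/4) \<mu> g"
  let ?K = "\<lambda>x. equil \<mu> (x 1) * equil \<mu> (x 2) * equil \<mu> (x 3) * (x i - x 0) * g (x i)"
  have mm: "quad_measurable (\<lambda>x. 2 * ennreal (?m (x i) * ?B (x n)))" for n
    by (intro quad_measurable_ennreal_mult quad_measurable_const quad_measurable_real(1) quad_measurable_ennreal quad_measurable_slot) measurable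
  have mm': "quad_measurable (\<lambda>x. ennreal (?m (x i) * ?B (x n)))" for n
    by (intro quad_measurable_real(1) quad_measurable_ennreal quad_measurable_slot) measurable
  have "coll_abs ?K a \<le> fiber_integral (\<lambda>x. 2 * ennreal (?m (x i) * ?B (x l)) + 2 * ennreal (?m (x i) * ?B (x 3))) a"
  proof (rule coll_abs_le_fiber_integral)
    fix x :: "nat \<Rightarrow> real" assume x: "pos_quad x" and x3: "x 3 = x 1 + x 2 - x 0"
    have pos: "0 < x 0" "0 < x i" "0 < x l" "0 < x 3" using x i l by (auto simp: pos_quad_def)
    define d where "d = \<bar>x i - x 0\<bar>"
    have d: "x 3 - x l = x i - x 0" using x3 i by (auto simp: l_def)
    have e0: "0 \<le> equil \<mu> (x n)" if "n = i \<or> n = l \<or> n = 3" for n using that pos \<mu> by (auto simp: equil_def)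
    have eq: "root_min x / sqrt (x 0) * \<bar>?K x\<bar> = (root_min x / sqrt (x 0) * equil \<mu> (x l) * equil \<mu> (x 3) * d) * (equil \<mu> (x i) * \<bar>g (x i)\<bar>)"
      using i e0 by (auto simp: abs_mult d_def l_def mult_ac)
    have core: "root_min x / sqrt (x 0) * equil \<mu> (x l) * equil \<mu> (x 3) * d \<le> 2 * x i powr (1/4) * (?B (x l) + ?B (x 3))"
    proof (cases "d = 0")
      case True
      then show ?thesis by (simp add: add_nonneg_nonneg)
    next
      case False
      then have "0 < d" by (simp add: d_def)
      then obtain w where w: "0 < w" "d = w ^ 4" "d powr (1/4) = w"
        by (rule fourth_root) (rule that; assumption)
      obtain q q' where q: "0 < q" "0 < q'" "q < q'" "x l = q ^ 4" "equil \<mu> (x l) = inverse (q' ^ 4)" "?B (x l) = inverse (q' ^ 4) * inverse q"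
        by (rule equil_fourth_root[OF \<mu> pos(3)]) (rule that; assumption)
      obtain r r' where r: "0 < r" "0 < r'" "r < r'" "x 3 = r ^ 4" "equil \<mu> (x 3) = inverse (r' ^ 4)" "?B (x 3) = inverse (r' ^ 4) * inverse r"
        by (rule equil_fourth_root[OF \<mu> pos(4)]) (rule that; assumption)
      have dle: "d \<le> 2 * max (x 0) (x i)" using pos by (auto simp: d_def)
      have om: "root_min x / sqrt (x 0) * w \<le> 2 * x i powr (1/4)"
      proof -
        have "root_min x / sqrt (x 0) * d powr (1/4) \<le> 2 * x i powr (1/4)"
          by (rule root_min_over_sqrt_bound[OF x _ _ dle]) (use i \<open>0 < d\<close> in auto)
        then show ?thesis by (simp only: w(3))
      qed
      (* The dominating entry t ^ 4 absorbs d, up to the fourth root w of d and the fourth root s of the other entry. *)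
      have aux: "inverse (t' ^ 4) * d \<le> w * inverse s" if t: "0 < t" "t < t'" "w ^ 4 \<le> t ^ 4" "0 < s" "s ^ 4 \<le> t ^ 4" for t t' s
      proof -
        have "w \<le> t" "s \<le> t" using t w(1) by (auto simp: power_mono_iff)
        have "inverse (t' ^ 4) * d \<le> inverse (t ^ 4) * w ^ 4"
          unfolding w(2) using t by (intro mult_right_mono le_imp_inverse_le power_mono) auto
        also have "\<dots> = (w / t) ^ 3 * (w / t)" using t by (simp add: field_simps power_numeral_reduce)
        also have "\<dots> \<le> 1 * (w / t)" using \<open>w \<le> t\<close> t w(1) by (intro mult_right_mono power_le_one) auto
        also have "\<dots> \<le> w * inverse s" using \<open>s \<le> t\<close> t w(1) by (simp add: divide_inverse le_imp_inverse_le)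
        finally show ?thesis .
      qed
      have B0: "0 \<le> ?B (x l)" "0 \<le> ?B (x 3)" by simp_all
      have r0: "0 \<le> root_min x / sqrt (x 0)" using pos by simp
      show ?thesis
      proof (cases "x l \<le> x 3")
        case True
        have "inverse (r' ^ 4) * d \<le> w * inverse q"
        proof (rule aux[OF r(1,3) _ q(1)])
          have "d \<le> x 3" using True pos d by (simp add: d_def)
          then show "w ^ 4 \<le> r ^ 4" by (simp only: w(2) r(4))
          show "q ^ 4 \<le> r ^ 4" using True by (simp only: q(4) r(4))
        qed
        then have "root_min x / sqrt (x 0) * inverse (q' ^ 4) * (inverse (r' ^ 4) * d) \<le> root_min x / sqrt (x 0) * inverse (q' ^ 4) * (w * inverse q)"
          by (rule mult_left_mono) (rule mult_nonneg_nonneg[OF r0], use q in simp)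
        also have "\<dots> = (root_min x / sqrt (x 0) * w) * ?B (x l)" by (simp add: q(6))
        also have "\<dots> \<le> 2 * x i powr (1/4) * ?B (x l)" by (intro mult_right_mono om B0)
        also have "\<dots> \<le> 2 * x i powr (1/4) * (?B (x l) + ?B (x 3))" by (intro mult_left_mono) auto
        finally show ?thesis by (simp add: q(5) r(5) mult.assoc)
      next
        case False
        have "inverse (q' ^ 4) * d \<le> w * inverse r"
        proof (rule aux[OF q(1,3) _ r(1)])
          have "d \<le> x l" using False pos d by (simp add: d_def)
          then show "w ^ 4 \<le> q ^ 4" by (simp only: w(2) q(4))
          show "r ^ 4 \<le> q ^ 4" using False by (simp only: q(4) r(4) not_le less_imp_le)
        qed
        then have "root_min x / sqrt (x 0) * inverse (r' ^ 4) * (inverse (q' ^ 4) * d) \<le> root_min x / sqrt (x 0) * inverse (r' ^ 4) * (w * inverse r)"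
          by (rule mult_left_mono) (rule mult_nonneg_nonneg[OF r0], use r in simp)
        also have "\<dots> = (root_min x / sqrt (x 0) * w) * ?B (x 3)" by (simp add: r(6))
        also have "\<dots> \<le> 2 * x i powr (1/4) * ?B (x 3)" by (intro mult_right_mono om B0)
        also have "\<dots> \<le> 2 * x i powr (1/4) * (?B (x l) + ?B (x 3))" by (intro mult_left_mono) auto
        finally show ?thesis by (simp add: q(5) r(5) mult_ac)
      qed
    qed
    have "root_min x / sqrt (x 0) * \<bar>?K x\<bar> \<le> (2 * x i powr (1/4) * (?B (x l) + ?B (x 3))) * (equil \<mu> (x i) * \<bar>g (x i)\<bar>)"
      unfolding eq using e0[of i] by (intro mult_right_mono core) auto
    also have "\<dots> = 2 * (?m (x i) * ?B (x l)) + 2 * (?m (x i) * ?B (x 3))"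
      using pos by (simp add: equil_powr_abs_def algebra_simps)
    finally have "ennreal (root_min x / sqrt (x 0) * \<bar>?K x\<bar>) \<le> ennreal (2 * (?m (x i) * ?B (x l)) + 2 * (?m (x i) * ?B (x 3)))"
      by (rule ennreal_leI)
    also have "\<dots> = 2 * ennreal (?m (x i) * ?B (x l)) + 2 * ennreal (?m (x i) * ?B (x 3))"
      using \<mu> by (simp add: ennreal_mult)
    finally show "ennreal (root_min x / sqrt (x 0) * \<bar>?K x\<bar>) \<le> 2 * ennreal (?m (x i) * ?B (x l)) + 2 * ennreal (?m (x i) * ?B (x 3))" .
  qed
  also have "\<dots> = 2 * ((\<integral>\<^sup>+t. ennreal (?m t) \<partial>lborel) * moment \<mu> 1 (1/4)) + 2 * ((\<integral>\<^sup>+t. ennreal (?m t) \<partial>lborel) * moment \<mu> 1 (1/4))"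
  proof -
    have "fiber_integral (\<lambda>x. ennreal (?m (x i) * ?B (x n))) a = (\<integral>\<^sup>+t. ennreal (?m t) \<partial>lborel) * moment \<mu> 1 (1/4)" if "n = l \<or> n = 3" for n
      unfolding moment_def using i l that \<mu> by (intro fiber_integral_real_mult) auto
    from this[of l] this[of 3] show ?thesis
      unfolding fiber_integral_add[OF mm mm] fiber_integral_cmult[OF mm'] by simp
  qed
  also have "\<dots> = (2 + 2) * ((\<integral>\<^sup>+t. ennreal (?m t) \<partial>lborel) * moment \<mu> 1 (1/4))" by (simp only: distrib_right)
  finally have "(coll_abs ?K a)\<^sup>2 \<le> ((2 + 2) * ((\<integral>\<^sup>+t. ennreal (?m t) \<partial>lborel) * moment \<mu> 1 (1/4)))\<^sup>2" by (intro power_mono) auto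
  also have "\<dots> = 16 * (moment \<mu> 1 (1/4))\<^sup>2 * (\<integral>\<^sup>+t. ennreal (?m t) \<partial>lborel)\<^sup>2"
    by (simp add: power_mult_distrib mult_ac)
  also have "\<dots> \<le> 16 * (moment \<mu> 1 (1/4))\<^sup>2 * (moment \<mu> 2 0 * sq_mass g)"
    by (intro mult_left_mono integral_equil_powr_abs_le \<mu> g) auto
  finally show ?thesis by (simp add: mult.assoc)
qed

text \<open>Here the collision weight is just bounded by \<open>1\<close>, and the integral factorises.\<close>

lemma bilinear_multiplier_bound:
  assumes \<mu>: "0 < \<mu>" and g [measurable]: "g \<in> borel_measurable borel" and h [measurable]: "h \<in> borel_measurable borel"
    and ij: "i \<in> {1, 2, 3}" "j \<in> {1, 2, 3}" "i \<noteq> j"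
  shows "(coll_abs (\<lambda>x. equil \<mu> (x i) * equil \<mu> (x j) * (g (x i) * h (x j))) a)\<^sup>2
    \<le> (moment \<mu> 2 (1/2))\<^sup>2 * (sq_mass g * sq_mass h)"
proof -
  let ?m = "\<lambda>g. equil_powr_abs 0 \<mu> g"
  have "coll_abs (\<lambda>x. equil \<mu> (x i) * equil \<mu> (x j) * (g (x i) * h (x j))) a \<le> fiber_integral (\<lambda>x. ennreal (?m g (x i) * ?m h (x j))) a"
  proof (rule coll_abs_le_fiber_integral, rule ennreal_leI)
    fix x :: "nat \<Rightarrow> real" assume x: "pos_quad x"
    have pos: "0 < x 0" "0 < x i" "0 < x j" using pos_quad_nth[OF x] ij by auto
    have one: "root_min x / sqrt (x 0) \<le> 1" using root_min_le[OF x, of 0] pos by simp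
    have "root_min x / sqrt (x 0) * \<bar>equil \<mu> (x i) * equil \<mu> (x j) * (g (x i) * h (x j))\<bar> \<le> 1 * \<bar>equil \<mu> (x i) * equil \<mu> (x j) * (g (x i) * h (x j))\<bar>"
      by (intro mult_right_mono one) auto
    also have "\<dots> = ?m g (x i) * ?m h (x j)" using pos \<mu> by (simp add: equil_powr_abs_def abs_mult equil_def)
    finally show "root_min x / sqrt (x 0) * \<bar>equil \<mu> (x i) * equil \<mu> (x j) * (g (x i) * h (x j))\<bar> \<le> ?m g (x i) * ?m h (x j)" .
  qed
  also have "\<dots> = (\<integral>\<^sup>+t. ennreal (?m g t) \<partial>lborel) * (\<integral>\<^sup>+t. ennreal (?m h t) \<partial>lborel)"
    using ij \<mu> by (intro fiber_integral_real_mult) auto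
  finally have "(coll_abs (\<lambda>x. equil \<mu> (x i) * equil \<mu> (x j) * (g (x i) * h (x j))) a)\<^sup>2
      \<le> ((\<integral>\<^sup>+t. ennreal (?m g t) \<partial>lborel) * (\<integral>\<^sup>+t. ennreal (?m h t) \<partial>lborel))\<^sup>2" by (intro power_mono) auto
  also have "\<dots> = (\<integral>\<^sup>+t. ennreal (?m g t) \<partial>lborel)\<^sup>2 * (\<integral>\<^sup>+t. ennreal (?m h t) \<partial>lborel)\<^sup>2" by (simp add: power_mult_distrib)
  also have "\<dots> \<le> (moment \<mu> 2 (1/2) * sq_mass g) * (moment \<mu> 2 (1/2) * sq_mass h)"
    by (intro mult_mono integral_equil_powr_abs_le \<mu> g h) auto
  finally show ?thesis by (simp add: power2_eq_square mult_ac)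
qed

text \<open>The factor \<open>x 0 + \<mu>\<close> grows, so the decay in \<open>x 0\<close> has to come from the kernel. If \<open>x 0 \<ge> \<mu> / 2\<close>, then \<open>x 0 + \<mu> \<le> 3 * x 0\<close> and one
of \<open>x 1\<close>, \<open>x 2\<close> is at least \<open>x 0 / 2\<close>; what remains is the Schur weight. If \<open>x 0\<close> is smaller, the prefactor is bounded by
\<open>3/2 * \<mu>\<close>, and \<open>x 3 + \<mu>\<close> is at least half of \<open>x 1 + \<mu>\<close> and of \<open>x 2 + \<mu>\<close>, so that its decay can be shared between the
coordinates \<open>x 1\<close> and \<open>x 2\<close>.\<close>

lemma collision_frequency_bound:
  assumes \<mu>: "0 < \<mu>" and a: "0 < a"
  shows "coll_abs (\<lambda>x. (x 0 + \<mu>) * (equil \<mu> (x 1) * equil \<mu> (x 2) * equil \<mu> (x 3))) a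
    \<le> ennreal (6 * 576) + ennreal (3 * \<mu>) * (moment \<mu> (3/2) 0)\<^sup>2"
proof (cases "\<mu> / 2 \<le> a")
  let ?K = "\<lambda>x. (x 0 + \<mu>) * (equil \<mu> (x 1) * equil \<mu> (x 2) * equil \<mu> (x 3))"
  case True
  have "coll_abs ?K a \<le> fiber_integral (\<lambda>x. ennreal (6 * a powr (1/4)) * ennreal (triple_powr x)) a"
  proof (rule coll_abs_le_fiber_integral)
    fix x :: "nat \<Rightarrow> real" assume x: "pos_quad x" and x3: "x 3 = x 1 + x 2 - x 0" and x0: "x 0 = a"
    have pos: "0 < x 0" "0 < x 1" "0 < x 2" "0 < x 3" using x by (auto simp: pos_quad_def)
    have main: "root_min x / sqrt (x 0) * ?K x \<le> 6 * x 0 powr (1/4) * (x i powr - (3/4) * (x j powr - (3/4) * x 3 powr - (3/4)))"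
      if ij: "i \<in> {1, 2}" "j \<in> {1, 2}" "i \<noteq> j" and le: "x 0 \<le> 2 * x i" for i j
    proof -
      have p': "0 < x i" "0 < x j" using pos ij by auto
      have K: "?K x = (x 0 + \<mu>) * (equil \<mu> (x i) * equil \<mu> (x j) * equil \<mu> (x 3))" using ij by auto
      obtain z where z: "0 < z" "x 0 = z ^ 4" "sqrt (x 0) = z\<^sup>2" "x 0 powr (1/4) = z"
        by (rule fourth_root[OF pos(1)]) (rule that; assumption)
      obtain p q' where p: "0 < p" "x i = p ^ 4" "x i powr - (3/4) = inverse (p ^ 3)" "equil \<mu> (x i) = inverse (q' ^ 4)" "0 < q'" "p < q'"
        by (rule equil_fourth_root[OF \<mu> p'(1)]) (rule that; assumption)
      obtain r r' where r: "0 < r" "sqrt (x j) = r\<^sup>2" "x j powr - (3/4) = inverse (r ^ 3)" "equil \<mu> (x j) = inverse (r' ^ 4)" "0 < r'" "r < r'"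
        by (rule equil_fourth_root[OF \<mu> p'(2)]) (rule that; assumption)
      obtain s s' where s: "0 < s" "sqrt (x 3) = s\<^sup>2" "x 3 powr - (3/4) = inverse (s ^ 3)" "equil \<mu> (x 3) = inverse (s' ^ 4)" "0 < s'" "s < s'"
        by (rule equil_fourth_root[OF \<mu> pos(4)]) (rule that; assumption)
      have rm: "root_min x \<le> r * s"
      proof (rule power2_le_imp_le)
        have "(root_min x)\<^sup>2 \<le> sqrt (x j) * sqrt (x 3)" using ij by (intro root_min_sq_le x) auto
        then show "(root_min x)\<^sup>2 \<le> (r * s)\<^sup>2" by (simp add: r(2) s(2) power_mult_distrib)
      qed (use r s in auto)
      have "z ^ 4 \<le> 2 * p ^ 4" using le by (simp only: z(2) p(2))
      also have "\<dots> \<le> (2 * p) ^ 4" by (simp add: power_mult_distrib)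
      finally have "z ^ 4 \<le> (2 * p) ^ 4" .
      then have zp: "z \<le> 2 * p"
        using p(1) power_strict_mono[of "2 * p" z 4] by (cases "z \<le> 2 * p") (auto simp: not_le)
      have "root_min x / sqrt (x 0) * ?K x = root_min x / z\<^sup>2 * ((x 0 + \<mu>) * (inverse (q' ^ 4) * inverse (r' ^ 4) * inverse (s' ^ 4)))"
        by (subst K) (simp only: p(4) r(4) s(4) z(3))
      also have "\<dots> \<le> (r * s) / z\<^sup>2 * ((3 * z ^ 4) * (inverse (p ^ 4) * inverse (r ^ 4) * inverse (s ^ 4)))"
      proof (intro mult_mono divide_right_mono rm le_imp_inverse_le power_mono)
        show "x 0 + \<mu> \<le> 3 * z ^ 4" using True x0 unfolding z(2)[symmetric] by simp
      qed (use p r s z pos \<mu> in auto)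
      also have "\<dots> = 3 * z * (z * inverse p) * (inverse (p ^ 3) * (inverse (r ^ 3) * inverse (s ^ 3)))"
        using p r s z by (simp add: field_simps power_numeral_reduce)
      also have "\<dots> \<le> 3 * z * 2 * (inverse (p ^ 3) * (inverse (r ^ 3) * inverse (s ^ 3)))"
        using zp p r s z by (intro mult_right_mono mult_left_mono) (auto simp: field_simps)
      finally show ?thesis unfolding z(4) p(3) r(3) s(3) by simp
    qed
    have tp: "triple_powr x = x 1 powr - (3/4) * (x 2 powr - (3/4) * x 3 powr - (3/4))"
      using pos by (simp add: triple_powr_def powr_mult)
    have "root_min x / sqrt (x 0) * \<bar>?K x\<bar> \<le> 6 * a powr (1/4) * triple_powr x"
    proof -
      have "\<bar>?K x\<bar> = ?K x" using pos \<mu> by (intro abs_of_nonneg mult_nonneg_nonneg) (auto simp: equil_def)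
      moreover have "x 0 \<le> 2 * x 1 \<or> x 0 \<le> 2 * x 2" using x3 pos by linarith
      ultimately show ?thesis
        using main[of 1 2] main[of 2 1] unfolding tp by (auto simp: x0 mult_ac)
    qed
    then show "ennreal (root_min x / sqrt (x 0) * \<bar>?K x\<bar>) \<le> ennreal (6 * a powr (1/4)) * ennreal (triple_powr x)"
      by (subst ennreal_mult[symmetric]) (auto intro: ennreal_leI)
  qed
  also have "\<dots> = ennreal (6 * a powr (1/4)) * fiber_integral (\<lambda>x. ennreal (triple_powr x)) a"
    by (intro fiber_integral_cmult quad_measurable_ennreal quad_measurable_triple_powr)
  also have "\<dots> \<le> ennreal (6 * a powr (1/4)) * ennreal (576 * a powr - (1/4))"
    by (intro mult_left_mono fiber_integral_triple_powr a) simp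
  also have "\<dots> = ennreal (6 * a powr (1/4) * (576 * a powr - (1/4)))" by (rule ennreal_mult[symmetric]) simp_all
  also have "6 * a powr (1/4) * (576 * a powr - (1/4)) = 6 * 576" using a by (simp flip: powr_add)
  finally show ?thesis by (rule order_trans) (simp add: add_increasing2)
next
  let ?K = "\<lambda>x. (x 0 + \<mu>) * (equil \<mu> (x 1) * equil \<mu> (x 2) * equil \<mu> (x 3))"
  let ?B = "shifted_powr \<mu> (3/2) 0"
  case False
  have mm: "quad_measurable (\<lambda>x. ennreal (?B (x 1) * ?B (x 2)))"
    by (intro quad_measurable_real(1) quad_measurable_ennreal quad_measurable_slot) measurable
  have "coll_abs ?K a \<le> fiber_integral (\<lambda>x. ennreal (3 * \<mu>) * ennreal (?B (x 1) * ?B (x 2))) a"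
  proof (rule coll_abs_le_fiber_integral)
    fix x :: "nat \<Rightarrow> real" assume x: "pos_quad x" and x3: "x 3 = x 1 + x 2 - x 0" and x0: "x 0 = a"
    have pos: "0 < x 0" "0 < x 1" "0 < x 2" "0 < x 3" using x by (auto simp: pos_quad_def)
    have one: "root_min x / sqrt (x 0) \<le> 1" using root_min_le[OF x, of 0] pos by simp
    obtain q where q: "0 < q" "x 1 + \<mu> = q ^ 4" "equil \<mu> (x 1) = inverse (q ^ 4)" "?B (x 1) = inverse (q ^ 6)"
      by (rule equil_fourth_root[OF \<mu> pos(2)]) (rule that; assumption)
    obtain r where r: "0 < r" "x 2 + \<mu> = r ^ 4" "equil \<mu> (x 2) = inverse (r ^ 4)" "?B (x 2) = inverse (r ^ 6)"
      by (rule equil_fourth_root[OF \<mu> pos(3)]) (rule that; assumption)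
    have lin: "t \<le> 2 * (d + \<mu>)" if "b + \<mu> = t" "d = b + c - a" "0 < b" "0 < c" for b c d t :: real
    proof -
      have "2 * a < \<mu>" using False by (simp add: not_le)
      moreover have "2 * (d + \<mu>) = t + (b + 2 * c) + (\<mu> - 2 * a)" using that(1,2) by (simp add: algebra_simps)
      ultimately show ?thesis using that(3,4) by simp
    qed
    have "q ^ 4 \<le> 2 * (x 3 + \<mu>)" by (rule lin[OF q(2) x3[unfolded x0] pos(2,3)])
    moreover have "r ^ 4 \<le> 2 * (x 3 + \<mu>)" by (rule lin[OF r(2) _ pos(3,2)]) (simp add: x3 x0)
    moreover have "q\<^sup>2 * r\<^sup>2 \<le> (q ^ 4 + r ^ 4) / 2"
      using zero_le_power2[of "q\<^sup>2 - r\<^sup>2"] by (simp add: power2_eq_square algebra_simps power_numeral_reduce)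
    ultimately have "q\<^sup>2 * r\<^sup>2 \<le> 2 * (x 3 + \<mu>)" by simp
    then have "inverse (2 * (x 3 + \<mu>)) \<le> inverse (q\<^sup>2 * r\<^sup>2)" using q r by (intro le_imp_inverse_le) auto
    then have e3: "equil \<mu> (x 3) \<le> 2 * (inverse (q\<^sup>2) * inverse (r\<^sup>2))"
    proof -
      have "equil \<mu> (x 3) = 2 * inverse (2 * (x 3 + \<mu>))" using pos \<mu> by (simp add: equil_def field_simps)
      then show ?thesis using \<open>inverse (2 * (x 3 + \<mu>)) \<le> inverse (q\<^sup>2 * r\<^sup>2)\<close> by (simp only: inverse_mult_distrib[of "q\<^sup>2"] mult_le_cancel_left_pos zero_less_numeral)
    qed
    have K0: "0 \<le> ?K x" using pos \<mu> by (intro mult_nonneg_nonneg) (auto simp: equil_def)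
    have "root_min x / sqrt (x 0) * \<bar>?K x\<bar> \<le> 1 * ?K x" using K0 one by (simp only: abs_of_nonneg[OF K0], intro mult_right_mono) auto
    also have "\<dots> \<le> (3/2 * \<mu>) * (inverse (q ^ 4) * inverse (r ^ 4) * (2 * (inverse (q\<^sup>2) * inverse (r\<^sup>2))))"
      unfolding q(3) r(3) using False x0 pos \<mu> q r e3
      by (simp only: mult_1) (intro mult_mono mult_nonneg_nonneg, auto simp: equil_def)
    also have "\<dots> = 3 * \<mu> * (?B (x 1) * ?B (x 2))"
      unfolding q(4) r(4) using q(1) r(1) by (simp add: field_simps power_numeral_reduce)
    finally show "ennreal (root_min x / sqrt (x 0) * \<bar>?K x\<bar>) \<le> ennreal (3 * \<mu>) * ennreal (?B (x 1) * ?B (x 2))"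
      using \<mu> by (subst ennreal_mult[symmetric]) (auto intro: ennreal_leI)
  qed
  also have "\<dots> = ennreal (3 * \<mu>) * (moment \<mu> (3/2) 0)\<^sup>2"
    unfolding fiber_integral_cmult[OF mm] moment_def by (subst fiber_integral_real_mult) (auto simp: power2_eq_square)
  finally show ?thesis by (rule order_trans) (simp add: add_increasing)
qed

section \<open>Collision integrals as elements of the Hilbert space\<close>

definition coll_integrand :: "((nat \<Rightarrow> real) \<Rightarrow> real) \<Rightarrow> real \<Rightarrow> real \<times> real \<Rightarrow> real" where
  "coll_integrand F a z = root_min (quad a (fst z) (snd z)) / sqrt a * F (quad a (fst z) (snd z))"

lemma coll_integrand_measurable:
  assumes F: "quad_measurable F"
  shows "coll_integrand F a \<in> borel_measurable (lborel \<Otimes>\<^sub>M lborel)"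
proof -
  note [measurable (raw)] = quad_measurableD[OF F] quad_measurableD[OF quad_measurable_root_min]
  show ?thesis unfolding coll_integrand_def by measurable
qed

lemma coll_eq: "coll F a = (\<integral>z. coll_integrand F a z \<partial>(lborel \<Otimes>\<^sub>M lborel))"
  by (simp add: coll_def coll_integrand_def)

lemma coll_abs_eq: "0 < a \<Longrightarrow> coll_abs F a = (\<integral>\<^sup>+z. ennreal (norm (coll_integrand F a z)) \<partial>(lborel \<Otimes>\<^sub>M lborel))"
  by (simp add: coll_abs_def fiber_integral_def coll_integrand_def abs_mult)

lemma coll_integrable:
  assumes "quad_measurable F" "0 < a" "coll_abs F a < \<infinity>"
  shows "integrable (lborel \<Otimes>\<^sub>M lborel) (coll_integrand F a)"
  using assms coll_integrand_measurable[OF assms(1)] coll_abs_eq[OF assms(2)] by (simp add: integrable_iff_bounded)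

lemma coll_le_coll_abs:
  assumes "0 < a"
  shows "ennreal \<bar>coll F a\<bar> \<le> coll_abs F a"
proof (cases "integrable (lborel \<Otimes>\<^sub>M lborel) (coll_integrand F a)")
  case True
  then show ?thesis
    using integral_norm_bound_ennreal[OF True] by (simp add: coll_eq coll_abs_eq[OF assms])
next
  case False
  then show ?thesis by (simp add: coll_eq not_integrable_integral_eq)
qed

lemma coll_measurable [measurable]:
  assumes F: "quad_measurable F"
  shows "coll F \<in> borel_measurable borel"
proof -
  note [measurable (raw)] = quad_measurableD[OF F] quad_measurableD[OF quad_measurable_root_min]
  have "sigma_finite_measure (lborel \<Otimes>\<^sub>M lborel :: (real \<times> real) measure)"
    by (simp add: lborel_prod lborel.sigma_finite_measure_axioms)
  from sigma_finite_measure.borel_measurable_lebesgue_integral[OF this, of "coll_integrand F" borel]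
  have "(\<lambda>a. \<integral>z. coll_integrand F a z \<partial>(lborel \<Otimes>\<^sub>M lborel)) \<in> borel_measurable borel"
    unfolding coll_integrand_def by measurable
  then show ?thesis by (simp add: coll_eq[abs_def])
qed

lemma coll_abs_finite_AE:
  assumes F: "quad_measurable F" and fin: "coll_energy F < \<infinity>"
  shows "AE \<omega> in wmeas. coll_abs F \<omega> < \<infinity>"
proof -
  have "AE \<omega> in wmeas. (coll_abs F \<omega>)\<^sup>2 \<noteq> \<infinity>"
    using fin unfolding coll_energy_def by (intro nn_integral_PInf_AE) (use F in auto)
  then show ?thesis
    by eventually_elim (auto simp: power2_eq_square ennreal_mult_eq_top_iff less_top)
qed

lemma coll_sq_int:
  assumes F: "quad_measurable F" and fin: "coll_energy F < \<infinity>"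
  shows "sq_int (coll F)" and "ennreal ((norm (abs_wL2 (coll F)))\<^sup>2) \<le> coll_energy F"
proof -
  have le: "(\<integral>\<^sup>+\<omega>. ennreal ((coll F \<omega>)\<^sup>2) \<partial>wmeas) \<le> coll_energy F"
    unfolding coll_energy_def
  proof (rule nn_integral_mono_AE, use AE_wmeas_pos in eventually_elim)
    case (elim \<omega>)
    have "ennreal ((coll F \<omega>)\<^sup>2) = (ennreal \<bar>coll F \<omega>\<bar>)\<^sup>2" by (simp add: ennreal_power)
    also have "\<dots> \<le> (coll_abs F \<omega>)\<^sup>2" by (intro power_mono coll_le_coll_abs elim) simp
    finally show ?case .
  qed
  show sq: "sq_int (coll F)"
    using le fin F by (intro sq_intI_nn) (auto intro: le_less_trans)
  show "ennreal ((norm (abs_wL2 (coll F)))\<^sup>2) \<le> coll_energy F"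
    using le by (simp add: ennreal_norm_abs_wL2[OF sq])
qed

lemma coll_scale: "coll (\<lambda>x. c * F x) a = c * coll F a"
proof -
  have "coll (\<lambda>x. c * F x) a = (\<integral>z. c * coll_integrand F a z \<partial>(lborel \<Otimes>\<^sub>M lborel))"
    unfolding coll_eq coll_integrand_def by (simp add: mult_ac)
  then show ?thesis by (simp add: coll_eq)
qed

lemma coll_add:
  assumes "quad_measurable F" "coll_abs F a < \<infinity>" "quad_measurable G" "coll_abs G a < \<infinity>" "0 < a"
  shows "coll (\<lambda>x. F x + G x) a = coll F a + coll G a"
proof -
  have "coll (\<lambda>x. F x + G x) a = (\<integral>z. coll_integrand F a z + coll_integrand G a z \<partial>(lborel \<Otimes>\<^sub>M lborel))"
    unfolding coll_eq coll_integrand_def by (simp add: distrib_left)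
  also have "\<dots> = coll F a + coll G a"
    unfolding coll_eq using assms by (intro Bochner_Integration.integral_add coll_integrable)
  finally show ?thesis .
qed

lemma coll_add_AE:
  assumes "quad_measurable F" "coll_energy F < \<infinity>" "quad_measurable G" "coll_energy G < \<infinity>"
  shows "AE \<omega> in wmeas. coll (\<lambda>x. F x + G x) \<omega> = coll F \<omega> + coll G \<omega>"
  using coll_abs_finite_AE[OF assms(1,2)] coll_abs_finite_AE[OF assms(3,4)] AE_wmeas_pos
  by eventually_elim (rule coll_add, use assms in auto)

lemma sq_mass_abs_wL2: "sq_int \<phi> \<Longrightarrow> sq_mass \<phi> = ennreal ((norm (abs_wL2 \<phi>))\<^sup>2)"
  unfolding sq_mass_def by (rule ennreal_norm_abs_wL2)

text \<open>A linear assignment \<open>\<Phi>\<close> of integrands to functions whose energy is bounded by the mass. Linearity is required pointwise, on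
functions; the energy bound makes the assignment well defined on classes.\<close>

definition quad_linear :: "((real \<Rightarrow> real) \<Rightarrow> (nat \<Rightarrow> real) \<Rightarrow> real) \<Rightarrow> real \<Rightarrow> bool" where
  "quad_linear \<Phi> C \<longleftrightarrow> 0 \<le> C \<and>
     (\<forall>g\<in>borel_measurable borel. quad_measurable (\<Phi> g) \<and> coll_energy (\<Phi> g) \<le> ennreal C * sq_mass g) \<and>
     (\<forall>g h x. \<Phi> (\<lambda>t. g t + h t) x = \<Phi> g x + \<Phi> h x) \<and> (\<forall>c g x. \<Phi> (\<lambda>t. c * g t) x = c * \<Phi> g x)"

context
  fixes \<Phi> C assumes \<Phi>: "quad_linear \<Phi> C"
begin

lemma quad_linear_finite:
  assumes "sq_int \<phi>"
  shows "quad_measurable (\<Phi> \<phi>)" "coll_energy (\<Phi> \<phi>) < \<infinity>"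
proof -
  have m: "\<phi> \<in> borel_measurable borel" using assms by (rule sq_int_measurable)
  then show "quad_measurable (\<Phi> \<phi>)" using \<Phi> by (auto simp: quad_linear_def)
  have "coll_energy (\<Phi> \<phi>) \<le> ennreal C * sq_mass \<phi>" using \<Phi> m by (auto simp: quad_linear_def)
  also have "\<dots> < \<infinity>" by (simp add: sq_mass_abs_wL2[OF assms] ennreal_mult_less_top)
  finally show "coll_energy (\<Phi> \<phi>) < \<infinity>" .
qed

lemma quad_linear_sq_int:
  assumes "sq_int \<phi>"
  shows "sq_int (coll (\<Phi> \<phi>))" "norm (abs_wL2 (coll (\<Phi> \<phi>))) \<le> sqrt C * norm (abs_wL2 \<phi>)"
proof -
  note f = quad_linear_finite[OF assms]
  show "sq_int (coll (\<Phi> \<phi>))" by (rule coll_sq_int(1)[OF f])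
  have "ennreal ((norm (abs_wL2 (coll (\<Phi> \<phi>))))\<^sup>2) \<le> coll_energy (\<Phi> \<phi>)" by (rule coll_sq_int(2)[OF f])
  also have "\<dots> \<le> ennreal C * sq_mass \<phi>" using \<Phi> sq_int_measurable[OF assms] by (auto simp: quad_linear_def)
  also have "\<dots> = ennreal (C * (norm (abs_wL2 \<phi>))\<^sup>2)"
    using \<Phi> by (simp add: sq_mass_abs_wL2[OF assms] ennreal_mult quad_linear_def)
  finally have "(norm (abs_wL2 (coll (\<Phi> \<phi>))))\<^sup>2 \<le> (sqrt C * norm (abs_wL2 \<phi>))\<^sup>2"
    using \<Phi> by (simp add: power_mult_distrib quad_linear_def)
  then show "norm (abs_wL2 (coll (\<Phi> \<phi>))) \<le> sqrt C * norm (abs_wL2 \<phi>)"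
    by (rule power2_le_imp_le) (use \<Phi> in \<open>auto simp: quad_linear_def\<close>)
qed

lemma quad_linear_add:
  assumes "sq_int \<phi>" "sq_int \<psi>"
  shows "abs_wL2 (coll (\<Phi> (\<lambda>t. \<phi> t + \<psi> t))) = abs_wL2 (coll (\<Phi> \<phi>)) + abs_wL2 (coll (\<Phi> \<psi>))"
proof -
  have eq: "\<Phi> (\<lambda>t. \<phi> t + \<psi> t) = (\<lambda>x. \<Phi> \<phi> x + \<Phi> \<psi> x)" using \<Phi> by (auto simp: quad_linear_def)
  have "AE \<omega> in wmeas. coll (\<Phi> (\<lambda>t. \<phi> t + \<psi> t)) \<omega> = coll (\<Phi> \<phi>) \<omega> + coll (\<Phi> \<psi>) \<omega>"
    unfolding eq by (intro coll_add_AE quad_linear_finite assms)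
  then have "abs_wL2 (coll (\<Phi> (\<lambda>t. \<phi> t + \<psi> t))) = abs_wL2 (\<lambda>\<omega>. coll (\<Phi> \<phi>) \<omega> + coll (\<Phi> \<psi>) \<omega>)"
    by (intro abs_wL2_cong quad_linear_sq_int sq_int_add assms)
  then show ?thesis by (simp add: abs_wL2_add quad_linear_sq_int assms)
qed

lemma quad_linear_scale:
  assumes "sq_int \<phi>"
  shows "abs_wL2 (coll (\<Phi> (\<lambda>t. c * \<phi> t))) = c *\<^sub>R abs_wL2 (coll (\<Phi> \<phi>))"
proof -
  have eq: "\<Phi> (\<lambda>t. c * \<phi> t) = (\<lambda>x. c * \<Phi> \<phi> x)" using \<Phi> by (auto simp: quad_linear_def)
  show ?thesis unfolding eq coll_scale[abs_def] by (intro abs_wL2_scale quad_linear_sq_int assms)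
qed

text \<open>The difference of \<open>\<phi>\<close> and \<open>\<psi>\<close> has mass \<open>0\<close>, so its integrand has energy \<open>0\<close>.\<close>

lemma quad_linear_cong:
  assumes "sq_int \<phi>" "sq_int \<psi>" "AE \<omega> in wmeas. \<phi> \<omega> = \<psi> \<omega>"
  shows "abs_wL2 (coll (\<Phi> \<phi>)) = abs_wL2 (coll (\<Phi> \<psi>))"
proof -
  let ?d = "\<lambda>t. \<phi> t + (- 1) * \<psi> t"
  have m: "sq_int (\<lambda>t. (- 1) * \<psi> t)" by (rule sq_int_scale[OF assms(2)])
  have d: "sq_int ?d" by (intro sq_int_add assms(1) m)
  have "abs_wL2 ?d = 0"
    unfolding zero_wL2_def by (rule abs_wL2_cong[OF d sq_int_zero], use assms(3) in eventually_elim) simp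
  then have "abs_wL2 (coll (\<Phi> ?d)) = 0" using quad_linear_sq_int(2)[OF d] by simp
  moreover have "abs_wL2 (coll (\<Phi> ?d)) = abs_wL2 (coll (\<Phi> \<phi>)) + (- 1) *\<^sub>R abs_wL2 (coll (\<Phi> \<psi>))"
    unfolding quad_linear_add[OF assms(1) m] quad_linear_scale[OF assms(2)] ..
  ultimately show ?thesis by simp
qed

end

definition coll_lift :: "((real \<Rightarrow> real) \<Rightarrow> (nat \<Rightarrow> real) \<Rightarrow> real) \<Rightarrow> wL2 \<Rightarrow> wL2" where
  "coll_lift \<Phi> g = abs_wL2 (coll (\<Phi> (rep_wL2 g)))"

lemma coll_lift_abs:
  assumes "quad_linear \<Phi> C" "sq_int \<phi>"
  shows "coll_lift \<Phi> (abs_wL2 \<phi>) = abs_wL2 (coll (\<Phi> \<phi>))"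
  unfolding coll_lift_def by (intro quad_linear_cong[OF assms(1)] rep_abs_wL2 assms) simp

lemma coll_lift_add: "quad_linear \<Phi> C \<Longrightarrow> coll_lift \<Phi> (g + h) = coll_lift \<Phi> g + coll_lift \<Phi> h"
  using coll_lift_abs[of \<Phi> C "\<lambda>t. rep_wL2 g t + rep_wL2 h t"]
  by (simp add: abs_wL2_add sq_int_add quad_linear_add) (simp add: coll_lift_def)

lemma coll_lift_scale: "quad_linear \<Phi> C \<Longrightarrow> coll_lift \<Phi> (c *\<^sub>R g) = c *\<^sub>R coll_lift \<Phi> g"
  using coll_lift_abs[of \<Phi> C "\<lambda>t. c * rep_wL2 g t"]
  by (simp add: abs_wL2_scale sq_int_scale quad_linear_scale) (simp add: coll_lift_def)

lemma coll_lift_norm: "quad_linear \<Phi> C \<Longrightarrow> norm (coll_lift \<Phi> g) \<le> sqrt C * norm g"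
  using quad_linear_sq_int(2)[of \<Phi> C "rep_wL2 g"] by (simp add: coll_lift_def)

lemma coll_lift_bounded_linear: "quad_linear \<Phi> C \<Longrightarrow> bounded_linear (coll_lift \<Phi>)"
  by (rule bounded_linear_intro[where K = "sqrt C"])
    (auto simp: coll_lift_add coll_lift_scale coll_lift_norm mult.commute)

section \<open>Currying of bounded multilinear maps\<close>

definition curry2 :: "('a::real_normed_vector \<Rightarrow> 'b::real_normed_vector \<Rightarrow> 'c::real_normed_vector) \<Rightarrow> 'a \<Rightarrow>\<^sub>L 'b \<Rightarrow>\<^sub>L 'c" where
  "curry2 b = Blinfun (\<lambda>x. Blinfun (b x))"

lemma curry2_apply:
  assumes b: "bounded_bilinear b"
  shows "blinfun_apply (blinfun_apply (curry2 b) x) y = b x y"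
proof -
  interpret bounded_bilinear b by fact
  obtain K where K: "0 \<le> K" "\<And>x y. norm (b x y) \<le> norm x * norm y * K" using nonneg_bounded by blast
  have app: "blinfun_apply (Blinfun (b x)) = b x" for x by (rule bounded_linear_Blinfun_apply[OF bounded_linear_right])
  have "bounded_linear (\<lambda>x. Blinfun (b x))"
  proof (rule bounded_linear_intro[where K = K])
    show "Blinfun (b (x + y)) = Blinfun (b x) + Blinfun (b y)" for x y
      by (rule blinfun_eqI) (simp add: app add_left blinfun.add_left)
    show "Blinfun (b (r *\<^sub>R x)) = r *\<^sub>R Blinfun (b x)" for r x
      by (rule blinfun_eqI) (simp add: app scaleR_left blinfun.scaleR_left)
    show "norm (Blinfun (b x)) \<le> norm x * K" for x
      by (rule norm_blinfun_bound) (use K in \<open>auto simp: app mult_ac\<close>)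
  qed
  then show ?thesis unfolding curry2_def by (simp add: bounded_linear_Blinfun_apply app)
qed

lemma trilinear_blinfun:
  fixes t :: "'a::real_normed_vector \<Rightarrow> 'b::real_normed_vector \<Rightarrow> 'c::real_normed_vector \<Rightarrow> 'd::real_normed_vector"
  assumes t1: "\<And>x x' y z. t (x + x') y z = t x y z + t x' y z" "\<And>r x y z. t (r *\<^sub>R x) y z = r *\<^sub>R t x y z"
    and t2: "\<And>x y y' z. t x (y + y') z = t x y z + t x y' z" "\<And>r x y z. t x (r *\<^sub>R y) z = r *\<^sub>R t x y z"
    and t3: "\<And>x y z z'. t x y (z + z') = t x y z + t x y z'" "\<And>r x y z. t x y (r *\<^sub>R z) = r *\<^sub>R t x y z"
    and K: "0 \<le> K" "\<And>x y z. norm (t x y z) \<le> K * norm x * norm y * norm z"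
  obtains T :: "'a \<Rightarrow>\<^sub>L 'b \<Rightarrow>\<^sub>L 'c \<Rightarrow>\<^sub>L 'd" where "\<And>x y z. T x y z = t x y z"
proof -
  have bb: "bounded_bilinear (t x)" for x
    by standard (use K in \<open>auto simp: t2 t3 intro!: exI[of _ "K * norm x"] simp: mult_ac\<close>)
  have ap: "blinfun_apply (blinfun_apply (curry2 (t x)) y) z = t x y z" for x y z by (rule curry2_apply[OF bb])
  have "bounded_linear (\<lambda>x. curry2 (t x))"
  proof (rule bounded_linear_intro[where K = K])
    show "curry2 (t (x + x')) = curry2 (t x) + curry2 (t x')" for x x'
      by (intro blinfun_eqI) (simp add: ap t1 blinfun.add_left)
    show "curry2 (t (r *\<^sub>R x)) = r *\<^sub>R curry2 (t x)" for r x
      by (intro blinfun_eqI) (simp add: ap t1 blinfun.scaleR_left)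
    show "norm (curry2 (t x)) \<le> norm x * K" for x
    proof (intro norm_blinfun_bound)
      fix y z
      show "norm (blinfun_apply (blinfun_apply (curry2 (t x)) y) z) \<le> norm x * K * norm y * norm z"
        using K(2)[of x y z] by (simp add: ap mult_ac)
    qed (use K in auto)
  qed
  then have "blinfun_apply (Blinfun (\<lambda>x. curry2 (t x))) = (\<lambda>x. curry2 (t x))" by (rule bounded_linear_Blinfun_apply)
  then show ?thesis using ap that[of "Blinfun (\<lambda>x. curry2 (t x))"] by simp
qed

section \<open>Boundedness of the three operators\<close>

text \<open>The integrands of the three formulas, polarised: the quadratic and the cubic one have one argument for each factor, so
that they are linear in each argument separately.\<close>

definition L_density :: "real \<Rightarrow> (real \<Rightarrow> real) \<Rightarrow> (nat \<Rightarrow> real) \<Rightarrow> real" where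
  "L_density \<mu> g x = equil \<mu> (x 1) * equil \<mu> (x 2) * equil \<mu> (x 3) *
     (- g (x 0) / equil \<mu> (x 0) - g (x 3) / equil \<mu> (x 3) + g (x 1) / equil \<mu> (x 1) + g (x 2) / equil \<mu> (x 2))"

definition \<Gamma>_density :: "real \<Rightarrow> (real \<Rightarrow> real) \<Rightarrow> (real \<Rightarrow> real) \<Rightarrow> (nat \<Rightarrow> real) \<Rightarrow> real" where
  "\<Gamma>_density \<mu> g h x = equil \<mu> (x 1) * equil \<mu> (x 2) * equil \<mu> (x 3) * (let m = (\<lambda>\<omega>. inverse (equil \<mu> \<omega>)) in
     - g (x 0) * h (x 3) * (m (x 2) + m (x 1))
     + g (x 0) * h (x 1) * (m (x 3) - m (x 2))
     + g (x 0) * h (x 2) * (m (x 3) - m (x 1))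
     + g (x 3) * h (x 1) * (m (x 1) - m (x 3))
     + g (x 3) * h (x 2) * (m (x 2) - m (x 3))
     + g (x 1) * h (x 2) * (m (x 2) + m (x 1)))"

definition Q_density :: "real \<Rightarrow> (real \<Rightarrow> real) \<Rightarrow> (real \<Rightarrow> real) \<Rightarrow> (real \<Rightarrow> real) \<Rightarrow> (nat \<Rightarrow> real) \<Rightarrow> real" where
  "Q_density \<mu> g h k x = equil \<mu> (x 1) * equil \<mu> (x 2) * equil \<mu> (x 3) * (let m = (\<lambda>\<omega>. inverse (equil \<mu> \<omega>)) in
     m (x 3) * g (x 0) * h (x 1) * k (x 2) + m (x 0) * g (x 1) * h (x 2) * k (x 3)
     - m (x 1) * g (x 0) * h (x 2) * k (x 3) - m (x 2) * g (x 0) * h (x 1) * k (x 3))"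

text \<open>On the boundary of the domain, where some entry is \<open>0\<close>, both sides vanish.\<close>

lemma coll_dom_weight:
  assumes "0 < \<omega>"
  shows "indicator (coll_dom \<omega>) (b, c) * coll_weight \<omega> b c (b + c - \<omega>) = root_min (quad \<omega> b c) / sqrt \<omega>"
proof (cases "0 < b \<and> 0 < c \<and> 0 < b + c - \<omega>")
  case True
  then have "Min {sqrt \<omega>, sqrt b, sqrt c, sqrt (b + c - \<omega>)} = sqrt (min (min \<omega> b) (min c (b + c - \<omega>)))"
    by (simp add: min_def)
  then show ?thesis using True assms by (simp add: coll_dom_def coll_weight_def root_min_def pos_quad_def)
next
  case False
  have "Min {sqrt \<omega>, sqrt b, sqrt c, sqrt (b + c - \<omega>)} = 0" if "0 \<le> b" "0 \<le> c" "\<omega> \<le> b + c"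
    using that False assms by (auto simp: min_def)
  then show ?thesis using False by (auto simp: coll_dom_def coll_weight_def root_min_def pos_quad_def indicator_def)
qed

lemma coll_int_eq_coll:
  assumes "0 < \<omega>"
  shows "coll_int \<mu> B \<omega> = coll (\<lambda>x. equil \<mu> (x 1) * equil \<mu> (x 2) * equil \<mu> (x 3) * B (x 0) (x 1) (x 2) (x 3)) \<omega>"
proof -
  let ?G = "\<lambda>x. equil \<mu> (x 1) * equil \<mu> (x 2) * equil \<mu> (x 3) * B (x 0) (x 1) (x 2) (x 3)"
  have "coll_integrand ?G \<omega> z = indicat_real (coll_dom \<omega>) z *\<^sub>R
       (case z of (\<omega>1, \<omega>2) \<Rightarrow> let \<omega>3 = \<omega>1 + \<omega>2 - \<omega> in
        coll_weight \<omega> \<omega>1 \<omega>2 \<omega>3 * equil \<mu> \<omega>1 * equil \<mu> \<omega>2 * equil \<mu> \<omega>3 * B \<omega> \<omega>1 \<omega>2 \<omega>3)" for z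
    unfolding coll_integrand_def using coll_dom_weight[OF assms, of "fst z" "snd z", symmetric]
    by (simp add: split_beta Let_def)
  then show ?thesis unfolding coll_int_def set_lebesgue_integral_def coll_eq lborel_prod
    by (intro Bochner_Integration.integral_cong refl) (rule sym)
qed

lemma L_formula_eq: "0 < \<omega> \<Longrightarrow> L_formula \<mu> g \<omega> = coll (L_density \<mu> g) \<omega>"
  unfolding L_formula_def by (simp add: coll_int_eq_coll L_density_def[abs_def] Let_def)

lemma \<Gamma>_formula_eq: "0 < \<omega> \<Longrightarrow> \<Gamma>_formula \<mu> g \<omega> = coll (\<Gamma>_density \<mu> g g) \<omega>"
  unfolding \<Gamma>_formula_def by (simp add: coll_int_eq_coll \<Gamma>_density_def[abs_def] Let_def)

lemma Q_formula_eq: "0 < \<omega> \<Longrightarrow> Q_formula \<mu> g \<omega> = coll (Q_density \<mu> g g g) \<omega>"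
  unfolding Q_formula_def by (simp add: coll_int_eq_coll Q_density_def[abs_def] Let_def)

lemma equil_inverse: "inverse (equil \<mu> t) = t + \<mu>"
  by (simp add: equil_def)

lemma equil_divide: "y / equil \<mu> t = y * (t + \<mu>)"
  by (simp add: equil_def)

lemma quad_measurable_equil [intro, simp]: "quad_measurable (\<lambda>x. equil \<mu> (x i))"
  by (intro quad_measurable_slot) measurable

lemma abs_add_le_add_abs: "\<bar>a\<bar> \<le> A \<Longrightarrow> \<bar>a + b\<bar> \<le> A + \<bar>b\<bar>" for a b A :: real
  by linarith

lemma abs_diff_le_add_abs: "\<bar>a\<bar> \<le> A \<Longrightarrow> \<bar>a - b\<bar> \<le> A + \<bar>b\<bar>" for a b A :: real
  by linarith

text \<open>One constant that dominates all the estimates, so that their terms can be added up uniformly.\<close>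

definition kernel_bound :: "real \<Rightarrow> ennreal" where
  "kernel_bound \<mu> = ennreal (576 * 576) + 2 * moment \<mu> 2 0 * moment \<mu> (3/4) (1/2) * moment \<mu> (5/4) 0
    + moment \<mu> 2 (1/2) * moment \<mu> 2 (1/2) + 4 * (moment \<mu> 1 (1/4))\<^sup>2 * moment \<mu> 2 0
    + 16 * (moment \<mu> 1 (1/4))\<^sup>2 * moment \<mu> 2 0 + (moment \<mu> 2 (1/2))\<^sup>2
    + (ennreal (6 * 576) + ennreal (3 * \<mu>) * (moment \<mu> (3/2) 0)\<^sup>2)\<^sup>2"

lemma kernel_bound_finite: "0 < \<mu> \<Longrightarrow> kernel_bound \<mu> < \<infinity>"
  unfolding kernel_bound_def moment_def
  using nn_integral_shifted_powr_finite[of \<mu> 2 0] nn_integral_shifted_powr_finite[of \<mu> "3/4" "1/2"]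
    nn_integral_shifted_powr_finite[of \<mu> "5/4" 0] nn_integral_shifted_powr_finite[of \<mu> 2 "1/2"]
    nn_integral_shifted_powr_finite[of \<mu> 1 "1/4"] nn_integral_shifted_powr_finite[of \<mu> "3/2" 0]
  by (simp add: ennreal_mult_less_top power2_eq_square)

lemma kernel_bound_parts:
  "ennreal (576 * 576) \<le> kernel_bound \<mu>"
  "2 * moment \<mu> 2 0 * moment \<mu> (3/4) (1/2) * moment \<mu> (5/4) 0 \<le> kernel_bound \<mu>"
  "moment \<mu> 2 (1/2) * moment \<mu> 2 (1/2) \<le> kernel_bound \<mu>"
  "4 * (moment \<mu> 1 (1/4))\<^sup>2 * moment \<mu> 2 0 \<le> kernel_bound \<mu>"
  "16 * (moment \<mu> 1 (1/4))\<^sup>2 * moment \<mu> 2 0 \<le> kernel_bound \<mu>"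
  "(moment \<mu> 2 (1/2))\<^sup>2 \<le> kernel_bound \<mu>"
  "(ennreal (6 * 576) + ennreal (3 * \<mu>) * (moment \<mu> (3/2) 0)\<^sup>2)\<^sup>2 \<le> kernel_bound \<mu>"
proof -
  have *: "a \<le> a + b" "b \<le> a + b" for a b :: ennreal by (simp_all add: add_increasing add_increasing2)
  show "ennreal (576 * 576) \<le> kernel_bound \<mu>"
    "2 * moment \<mu> 2 0 * moment \<mu> (3/4) (1/2) * moment \<mu> (5/4) 0 \<le> kernel_bound \<mu>"
    "moment \<mu> 2 (1/2) * moment \<mu> 2 (1/2) \<le> kernel_bound \<mu>"
    "4 * (moment \<mu> 1 (1/4))\<^sup>2 * moment \<mu> 2 0 \<le> kernel_bound \<mu>"
    "16 * (moment \<mu> 1 (1/4))\<^sup>2 * moment \<mu> 2 0 \<le> kernel_bound \<mu>"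
    "(moment \<mu> 2 (1/2))\<^sup>2 \<le> kernel_bound \<mu>"
    "(ennreal (6 * 576) + ennreal (3 * \<mu>) * (moment \<mu> (3/2) 0)\<^sup>2)\<^sup>2 \<le> kernel_bound \<mu>"
    unfolding kernel_bound_def by (meson * order_trans)+
qed

context
  fixes \<mu> :: real
  assumes \<mu>: "0 < \<mu>"
begin

lemma linear_energy_le:
  assumes g: "g \<in> borel_measurable borel" and "{i, j, k} = {1, 2, 3::nat}"
  shows "coll_energy (\<lambda>x. equil \<mu> (x j) * equil \<mu> (x k) * g (x i)) \<le> kernel_bound \<mu> * sq_mass g"
  by (rule order_trans[OF coll_energy_linear[OF \<mu> assms] mult_right_mono[OF kernel_bound_parts(1)]]) simp

lemma bilinear_energy_le:
  assumes "g \<in> borel_measurable borel" "h \<in> borel_measurable borel" "{i, j, k} = {1, 2, 3::nat}"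
  shows "coll_energy (\<lambda>x. equil \<mu> (x j) * equil \<mu> (x k) * (g (x i) * h (x j))) \<le> kernel_bound \<mu> * (sq_mass g * sq_mass h)"
  by (rule order_trans[OF coll_energy_bilinear[OF \<mu> assms] mult_right_mono[OF kernel_bound_parts(2)]]) simp

lemma trilinear_energy_le:
  assumes "g \<in> borel_measurable borel" "h \<in> borel_measurable borel" "f \<in> borel_measurable borel" "{i, j, k} = {1, 2, 3::nat}"
  shows "coll_energy (\<lambda>x. equil \<mu> (x j) * equil \<mu> (x k) * (g (x i) * h (x j) * f (x k))) \<le> kernel_bound \<mu> * (sq_mass g * sq_mass h * sq_mass f)"
  by (rule order_trans[OF coll_energy_trilinear[OF \<mu> assms] mult_right_mono[OF kernel_bound_parts(3)]]) simp

lemma collision_frequency_le: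
  assumes "0 < a"
  shows "(coll_abs (\<lambda>x. (x 0 + \<mu>) * (equil \<mu> (x 1) * equil \<mu> (x 2) * equil \<mu> (x 3))) a)\<^sup>2 \<le> kernel_bound \<mu>"
  by (rule order_trans[OF power_mono[OF collision_frequency_bound[OF \<mu> assms]] kernel_bound_parts(7)]) simp

lemma loss_multiplier_le:
  assumes "g \<in> borel_measurable borel" "j \<in> {1, 2}"
  shows "(coll_abs (\<lambda>x. equil \<mu> (x j) * equil \<mu> (x 3) * g (x 3)) a)\<^sup>2 \<le> kernel_bound \<mu> * sq_mass g"
  by (rule order_trans[OF loss_multiplier_bound[OF \<mu> assms] mult_right_mono[OF kernel_bound_parts(4)]]) simp

lemma difference_multiplier_le:
  assumes "g \<in> borel_measurable borel" "i \<in> {1, 2}"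
  shows "(coll_abs (\<lambda>x. equil \<mu> (x 1) * equil \<mu> (x 2) * equil \<mu> (x 3) * (x i - x 0) * g (x i)) a)\<^sup>2 \<le> kernel_bound \<mu> * sq_mass g"
  by (rule order_trans[OF difference_multiplier_bound[OF \<mu> assms] mult_right_mono[OF kernel_bound_parts(5)]]) simp

lemma bilinear_multiplier_le:
  assumes "g \<in> borel_measurable borel" "h \<in> borel_measurable borel" "i \<in> {1, 2, 3}" "j \<in> {1, 2, 3}" "i \<noteq> j"
  shows "(coll_abs (\<lambda>x. equil \<mu> (x i) * equil \<mu> (x j) * (g (x i) * h (x j))) a)\<^sup>2 \<le> kernel_bound \<mu> * (sq_mass g * sq_mass h)"
  by (rule order_trans[OF bilinear_multiplier_bound[OF \<mu> assms] mult_right_mono[OF kernel_bound_parts(6)]]) simp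

lemma equil_mult: "0 < t \<Longrightarrow> equil \<mu> t * (t + \<mu>) = 1"
  using \<mu> by (simp add: equil_def)

text \<open>The product \<open>n\<^sub>1 n\<^sub>2 n\<^sub>3\<close> cancels one reciprocal factor, except in the loss term with \<open>g\<^sub>0\<close>, which is multiplication by the collision
frequency.\<close>

lemma L_density_split:
  assumes "pos_quad x"
  shows "L_density \<mu> g x = - (g (x 0) * ((x 0 + \<mu>) * (equil \<mu> (x 1) * equil \<mu> (x 2) * equil \<mu> (x 3))))
    - equil \<mu> (x 1) * equil \<mu> (x 2) * g (x 3) + equil \<mu> (x 2) * equil \<mu> (x 3) * g (x 1) + equil \<mu> (x 1) * equil \<mu> (x 3) * g (x 2)"
proof -
  have "equil \<mu> (x 1) * (x 1 + \<mu>) = 1" "equil \<mu> (x 2) * (x 2 + \<mu>) = 1" "equil \<mu> (x 3) * (x 3 + \<mu>) = 1"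
    using assms by (auto simp: pos_quad_def intro!: equil_mult)
  then show ?thesis unfolding L_density_def equil_divide by algebra
qed

text \<open>In the two terms with \<open>g\<^sub>0 h\<^sub>1\<close> and \<open>g\<^sub>0 h\<^sub>2\<close>, splitting the differences of reciprocals would leave two multipliers
that are not bounded separately. The resonance is used to write the difference as \<open>x 1 - x 0\<close> or \<open>x 2 - x 0\<close>. All other
differences are split.\<close>

lemma \<Gamma>_density_split:
  assumes "pos_quad x" "x 3 = x 1 + x 2 - x 0"
  shows "\<Gamma>_density \<mu> g h x =
      - (g (x 0) * (equil \<mu> (x 1) * equil \<mu> (x 3) * h (x 3))) - g (x 0) * (equil \<mu> (x 2) * equil \<mu> (x 3) * h (x 3))
      + g (x 0) * (equil \<mu> (x 1) * equil \<mu> (x 2) * equil \<mu> (x 3) * (x 1 - x 0) * h (x 1))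
      + g (x 0) * (equil \<mu> (x 1) * equil \<mu> (x 2) * equil \<mu> (x 3) * (x 2 - x 0) * h (x 2))
      + equil \<mu> (x 3) * equil \<mu> (x 2) * (h (x 1) * g (x 3)) - equil \<mu> (x 1) * equil \<mu> (x 2) * (g (x 3) * h (x 1))
      + equil \<mu> (x 3) * equil \<mu> (x 1) * (h (x 2) * g (x 3)) - equil \<mu> (x 2) * equil \<mu> (x 1) * (g (x 3) * h (x 2))
      + equil \<mu> (x 1) * equil \<mu> (x 3) * (h (x 2) * g (x 1)) + equil \<mu> (x 2) * equil \<mu> (x 3) * (g (x 1) * h (x 2))"
proof -
  have "equil \<mu> (x 1) * (x 1 + \<mu>) = 1" "equil \<mu> (x 2) * (x 2 + \<mu>) = 1" "equil \<mu> (x 3) * (x 3 + \<mu>) = 1"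
    using assms by (auto simp: pos_quad_def intro!: equil_mult)
  then show ?thesis using assms(2) unfolding \<Gamma>_density_def Let_def equil_inverse by algebra
qed

lemma Q_density_split:
  assumes "pos_quad x" "x 3 = x 1 + x 2 - x 0"
  shows "Q_density \<mu> g h k x =
      g (x 0) * (equil \<mu> (x 1) * equil \<mu> (x 2) * (h (x 1) * k (x 2)))
      - g (x 0) * (equil \<mu> (x 2) * equil \<mu> (x 3) * (h (x 2) * k (x 3)))
      - g (x 0) * (equil \<mu> (x 1) * equil \<mu> (x 3) * (h (x 1) * k (x 3)))
      + equil \<mu> (x 2) * equil \<mu> (x 3) * (g (x 1) * h (x 2) * k (x 3))
      + equil \<mu> (x 1) * equil \<mu> (x 3) * (h (x 2) * g (x 1) * k (x 3))
      - equil \<mu> (x 1) * equil \<mu> (x 2) * (k (x 3) * g (x 1) * h (x 2))"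
proof -
  have "equil \<mu> (x 1) * (x 1 + \<mu>) = 1" "equil \<mu> (x 2) * (x 2 + \<mu>) = 1" "equil \<mu> (x 3) * (x 3 + \<mu>) = 1"
    using assms by (auto simp: pos_quad_def intro!: equil_mult)
  then show ?thesis using assms(2) unfolding Q_density_def Let_def equil_inverse by algebra
qed

lemma quad_measurable_densities:
  assumes "g \<in> borel_measurable borel" "h \<in> borel_measurable borel" "k \<in> borel_measurable borel"
  shows "quad_measurable (L_density \<mu> g)" "quad_measurable (\<Gamma>_density \<mu> g h)" "quad_measurable (Q_density \<mu> g h k)"
  unfolding L_density_def \<Gamma>_density_def Q_density_def Let_def equil_inverse
  by (intro quad_measurable_real quad_measurable_unary quad_measurable_slot[OF assms(1)] quad_measurable_slot[OF assms(2)]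
      quad_measurable_slot[OF assms(3)] quad_measurable_coord quad_measurable_const quad_measurable_equil)+

lemma L_energy:
  assumes [measurable]: "g \<in> borel_measurable borel"
  shows "coll_energy (L_density \<mu> g) \<le> 2 ^ 30 * kernel_bound \<mu> * sq_mass g"
proof -
  let ?Fs = "[\<lambda>x. g (x 0) * ((x 0 + \<mu>) * (equil \<mu> (x 1) * equil \<mu> (x 2) * equil \<mu> (x 3))),
      \<lambda>x. equil \<mu> (x 1) * equil \<mu> (x 2) * g (x 3), \<lambda>x. equil \<mu> (x 2) * equil \<mu> (x 3) * g (x 1),
      \<lambda>x. equil \<mu> (x 1) * equil \<mu> (x 3) * g (x 2)] :: ((nat \<Rightarrow> real) \<Rightarrow> real) list"
  note qm = quad_measurable_real quad_measurable_slot[OF assms] quad_measurable_coord quad_measurable_const quad_measurable_equil assms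
  have "coll_energy (L_density \<mu> g) \<le> 2 ^ (3 * length ?Fs) * (kernel_bound \<mu> * sq_mass g)"
  proof (rule coll_energy_le_sum_list)
    fix x assume x: "pos_quad x"
    show "\<bar>L_density \<mu> g x\<bar> \<le> (\<Sum>F\<leftarrow>?Fs. \<bar>F x\<bar>)"
      unfolding L_density_split[OF x] list.map sum_list.Cons sum_list.Nil by linarith
  next
    have "\<forall>F\<in>set ?Fs. quad_measurable F"
      unfolding list.set ball_simps by (intro conjI qm TrueI)
    moreover have "\<forall>F\<in>set ?Fs. coll_energy F \<le> kernel_bound \<mu> * sq_mass g"
      unfolding list.set ball_simps
      by (intro conjI TrueI coll_energy_multiplier linear_energy_le collision_frequency_le qm) auto
    ultimately show "quad_measurable F \<and> coll_energy F \<le> kernel_bound \<mu> * sq_mass g" if "F \<in> set ?Fs" for F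
      using that by blast
  qed
  also have "\<dots> \<le> 2 ^ 30 * (kernel_bound \<mu> * sq_mass g)"
    by (intro mult_right_mono power_increasing) auto
  finally show ?thesis by (simp add: mult.assoc)
qed

text \<open>The ten terms of the splitting are estimated one by one; adding up costs a factor \<open>8\<close> for each, whence \<open>2 ^ 30\<close>. The same
constant is used for the other two densities, which have fewer terms.\<close>

lemma \<Gamma>_energy:
  assumes [measurable]: "g \<in> borel_measurable borel" "h \<in> borel_measurable borel"
  shows "coll_energy (\<Gamma>_density \<mu> g h) \<le> 2 ^ 30 * kernel_bound \<mu> * (sq_mass g * sq_mass h)"
proof -
  let ?Fs = "[\<lambda>x. g (x 0) * (equil \<mu> (x 1) * equil \<mu> (x 3) * h (x 3)),
      \<lambda>x. g (x 0) * (equil \<mu> (x 2) * equil \<mu> (x 3) * h (x 3)),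
      \<lambda>x. g (x 0) * (equil \<mu> (x 1) * equil \<mu> (x 2) * equil \<mu> (x 3) * (x 1 - x 0) * h (x 1)),
      \<lambda>x. g (x 0) * (equil \<mu> (x 1) * equil \<mu> (x 2) * equil \<mu> (x 3) * (x 2 - x 0) * h (x 2)),
      \<lambda>x. equil \<mu> (x 3) * equil \<mu> (x 2) * (h (x 1) * g (x 3)), \<lambda>x. equil \<mu> (x 1) * equil \<mu> (x 2) * (g (x 3) * h (x 1)),
      \<lambda>x. equil \<mu> (x 3) * equil \<mu> (x 1) * (h (x 2) * g (x 3)), \<lambda>x. equil \<mu> (x 2) * equil \<mu> (x 1) * (g (x 3) * h (x 2)),
      \<lambda>x. equil \<mu> (x 1) * equil \<mu> (x 3) * (h (x 2) * g (x 1)), \<lambda>x. equil \<mu> (x 2) * equil \<mu> (x 3) * (g (x 1) * h (x 2))] :: ((nat \<Rightarrow> real) \<Rightarrow> real) list"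
  note qm = quad_measurable_real quad_measurable_slot[OF assms(1)] quad_measurable_slot[OF assms(2)] quad_measurable_coord quad_measurable_const quad_measurable_equil assms
  have mult: "coll_energy (\<lambda>x. g (x 0) * K x) \<le> kernel_bound \<mu> * (sq_mass g * sq_mass h)"
    if "quad_measurable K" "\<And>a. 0 < a \<Longrightarrow> (coll_abs K a)\<^sup>2 \<le> kernel_bound \<mu> * sq_mass h" for K
    using coll_energy_multiplier[OF assms(1) that] by (simp add: mult_ac)
  have mult': "coll_energy F \<le> kernel_bound \<mu> * (sq_mass g * sq_mass h)" if "coll_energy F \<le> kernel_bound \<mu> * (sq_mass h * sq_mass g)" for F
    using that by (simp add: mult_ac)
  have "coll_energy (\<Gamma>_density \<mu> g h) \<le> 2 ^ (3 * length ?Fs) * (kernel_bound \<mu> * (sq_mass g * sq_mass h))"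
  proof (rule coll_energy_le_sum_list)
    fix x assume x: "pos_quad x" "x 3 = x 1 + x 2 - x 0"
    show "\<bar>\<Gamma>_density \<mu> g h x\<bar> \<le> (\<Sum>F\<leftarrow>?Fs. \<bar>F x\<bar>)"
      unfolding \<Gamma>_density_split[OF x] list.map sum_list.Cons sum_list.Nil add_0_right add.assoc[symmetric]
      by (intro abs_add_le_add_abs abs_diff_le_add_abs eq_refl[OF abs_minus_cancel])
  next
    have "\<forall>F\<in>set ?Fs. quad_measurable F"
      unfolding list.set ball_simps by (intro conjI qm TrueI)
    moreover have "\<forall>F\<in>set ?Fs. coll_energy F \<le> kernel_bound \<mu> * (sq_mass g * sq_mass h)"
    proof -
      have "coll_energy (\<lambda>x. equil \<mu> (x 3) * equil \<mu> (x 2) * (h (x 1) * g (x 3))) \<le> kernel_bound \<mu> * (sq_mass g * sq_mass h)"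
        "coll_energy (\<lambda>x. equil \<mu> (x 3) * equil \<mu> (x 1) * (h (x 2) * g (x 3))) \<le> kernel_bound \<mu> * (sq_mass g * sq_mass h)"
        "coll_energy (\<lambda>x. equil \<mu> (x 1) * equil \<mu> (x 3) * (h (x 2) * g (x 1))) \<le> kernel_bound \<mu> * (sq_mass g * sq_mass h)"
        by (rule mult', rule bilinear_energy_le; use assms in auto)+
      moreover have "coll_energy (\<lambda>x. equil \<mu> (x 1) * equil \<mu> (x 2) * (g (x 3) * h (x 1))) \<le> kernel_bound \<mu> * (sq_mass g * sq_mass h)"
        "coll_energy (\<lambda>x. equil \<mu> (x 2) * equil \<mu> (x 1) * (g (x 3) * h (x 2))) \<le> kernel_bound \<mu> * (sq_mass g * sq_mass h)"
        "coll_energy (\<lambda>x. equil \<mu> (x 2) * equil \<mu> (x 3) * (g (x 1) * h (x 2))) \<le> kernel_bound \<mu> * (sq_mass g * sq_mass h)"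
        by (rule bilinear_energy_le; use assms in auto)+
      moreover have "coll_energy (\<lambda>x. g (x 0) * (equil \<mu> (x 1) * equil \<mu> (x 3) * h (x 3))) \<le> kernel_bound \<mu> * (sq_mass g * sq_mass h)"
        "coll_energy (\<lambda>x. g (x 0) * (equil \<mu> (x 2) * equil \<mu> (x 3) * h (x 3))) \<le> kernel_bound \<mu> * (sq_mass g * sq_mass h)"
        "coll_energy (\<lambda>x. g (x 0) * (equil \<mu> (x 1) * equil \<mu> (x 2) * equil \<mu> (x 3) * (x 1 - x 0) * h (x 1))) \<le> kernel_bound \<mu> * (sq_mass g * sq_mass h)"
        "coll_energy (\<lambda>x. g (x 0) * (equil \<mu> (x 1) * equil \<mu> (x 2) * equil \<mu> (x 3) * (x 2 - x 0) * h (x 2))) \<le> kernel_bound \<mu> * (sq_mass g * sq_mass h)"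
        by (rule mult, intro qm, (rule loss_multiplier_le difference_multiplier_le; use assms in auto))+
      ultimately show ?thesis unfolding list.set ball_simps by blast
    qed
    ultimately show "quad_measurable F \<and> coll_energy F \<le> kernel_bound \<mu> * (sq_mass g * sq_mass h)" if "F \<in> set ?Fs" for F
      using that by blast
  qed
  also have "\<dots> \<le> 2 ^ 30 * (kernel_bound \<mu> * (sq_mass g * sq_mass h))"
    by (intro mult_right_mono power_increasing) auto
  finally show ?thesis by (simp add: mult.assoc)
qed

lemma Q_energy:
  assumes [measurable]: "g \<in> borel_measurable borel" "h \<in> borel_measurable borel" "k \<in> borel_measurable borel"
  shows "coll_energy (Q_density \<mu> g h k) \<le> 2 ^ 30 * kernel_bound \<mu> * (sq_mass g * sq_mass h * sq_mass k)"
proof -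
  let ?Fs = "[\<lambda>x. g (x 0) * (equil \<mu> (x 1) * equil \<mu> (x 2) * (h (x 1) * k (x 2))),
      \<lambda>x. g (x 0) * (equil \<mu> (x 2) * equil \<mu> (x 3) * (h (x 2) * k (x 3))),
      \<lambda>x. g (x 0) * (equil \<mu> (x 1) * equil \<mu> (x 3) * (h (x 1) * k (x 3))),
      \<lambda>x. equil \<mu> (x 2) * equil \<mu> (x 3) * (g (x 1) * h (x 2) * k (x 3)),
      \<lambda>x. equil \<mu> (x 1) * equil \<mu> (x 3) * (h (x 2) * g (x 1) * k (x 3)),
      \<lambda>x. equil \<mu> (x 1) * equil \<mu> (x 2) * (k (x 3) * g (x 1) * h (x 2))] :: ((nat \<Rightarrow> real) \<Rightarrow> real) list"
  let ?B = "kernel_bound \<mu> * (sq_mass g * sq_mass h * sq_mass k)"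
  note qm = quad_measurable_real quad_measurable_slot[OF assms(1)] quad_measurable_slot[OF assms(2)] quad_measurable_slot[OF assms(3)] quad_measurable_coord quad_measurable_const quad_measurable_equil assms
  have mult: "coll_energy (\<lambda>x. g (x 0) * K x) \<le> ?B"
    if "quad_measurable K" "\<And>a. 0 < a \<Longrightarrow> (coll_abs K a)\<^sup>2 \<le> kernel_bound \<mu> * (sq_mass h * sq_mass k)" for K
    using coll_energy_multiplier[OF assms(1) that] by (simp add: mult_ac)
  have "coll_energy (Q_density \<mu> g h k) \<le> 2 ^ (3 * length ?Fs) * ?B"
  proof (rule coll_energy_le_sum_list)
    fix x assume x: "pos_quad x" "x 3 = x 1 + x 2 - x 0"
    show "\<bar>Q_density \<mu> g h k x\<bar> \<le> (\<Sum>F\<leftarrow>?Fs. \<bar>F x\<bar>)"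
      unfolding Q_density_split[OF x] list.map sum_list.Cons sum_list.Nil by linarith
  next
    have "\<forall>F\<in>set ?Fs. quad_measurable F"
      unfolding list.set ball_simps by (intro conjI qm TrueI)
    moreover have "\<forall>F\<in>set ?Fs. coll_energy F \<le> ?B"
    proof -
      have "coll_energy (\<lambda>x. equil \<mu> (x 2) * equil \<mu> (x 3) * (g (x 1) * h (x 2) * k (x 3))) \<le> ?B"
        by (rule trilinear_energy_le; use assms in auto)
      moreover have "coll_energy (\<lambda>x. equil \<mu> (x 1) * equil \<mu> (x 3) * (h (x 2) * g (x 1) * k (x 3))) \<le> kernel_bound \<mu> * (sq_mass h * sq_mass g * sq_mass k)"
        by (rule trilinear_energy_le; use assms in auto)
      then have "coll_energy (\<lambda>x. equil \<mu> (x 1) * equil \<mu> (x 3) * (h (x 2) * g (x 1) * k (x 3))) \<le> ?B"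
        by (simp only: mult_ac)
      moreover have "coll_energy (\<lambda>x. equil \<mu> (x 1) * equil \<mu> (x 2) * (k (x 3) * g (x 1) * h (x 2))) \<le> kernel_bound \<mu> * (sq_mass k * sq_mass g * sq_mass h)"
        by (rule trilinear_energy_le; use assms in auto)
      then have "coll_energy (\<lambda>x. equil \<mu> (x 1) * equil \<mu> (x 2) * (k (x 3) * g (x 1) * h (x 2))) \<le> ?B"
        by (simp only: mult_ac)
      moreover have "coll_energy (\<lambda>x. g (x 0) * (equil \<mu> (x 1) * equil \<mu> (x 2) * (h (x 1) * k (x 2)))) \<le> ?B"
        "coll_energy (\<lambda>x. g (x 0) * (equil \<mu> (x 2) * equil \<mu> (x 3) * (h (x 2) * k (x 3)))) \<le> ?B"
        "coll_energy (\<lambda>x. g (x 0) * (equil \<mu> (x 1) * equil \<mu> (x 3) * (h (x 1) * k (x 3)))) \<le> ?B"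
        by (rule mult, intro qm, (rule bilinear_multiplier_le; use assms in auto))+
      ultimately show ?thesis unfolding list.set ball_simps by blast
    qed
    ultimately show "quad_measurable F \<and> coll_energy F \<le> ?B" if "F \<in> set ?Fs" for F
      using that by blast
  qed
  also have "\<dots> \<le> 2 ^ 30 * ?B"
    by (intro mult_right_mono power_increasing) auto
  finally show ?thesis by (simp add: mult.assoc)
qed

definition op_const :: real where
  "op_const = enn2real (2 ^ 30 * kernel_bound \<mu>)"

lemma op_const: "ennreal op_const = 2 ^ 30 * kernel_bound \<mu>" "0 \<le> op_const"
  using kernel_bound_finite[OF \<mu>] by (simp_all add: op_const_def ennreal_mult_less_top power_less_top_ennreal)

lemma quad_linear_L: "quad_linear (L_density \<mu>) op_const"
  unfolding quad_linear_def op_const(1)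
proof (intro conjI ballI allI op_const(2) L_energy quad_measurable_densities)
  show "L_density \<mu> (\<lambda>t. g t + h t) x = L_density \<mu> g x + L_density \<mu> h x" for g h x
    unfolding L_density_def equil_divide by algebra
  show "L_density \<mu> (\<lambda>t. c * g t) x = c * L_density \<mu> g x" for c g x
    unfolding L_density_def equil_divide by algebra
qed auto

lemma quad_linear_\<Gamma>:
  assumes k: "k \<in> borel_measurable borel" "sq_mass k = ennreal r" "0 \<le> r"
  shows "quad_linear (\<lambda>g. \<Gamma>_density \<mu> g k) (op_const * r)" "quad_linear (\<Gamma>_density \<mu> k) (op_const * r)"
proof -
  have C: "ennreal (op_const * r) * m = 2 ^ 30 * kernel_bound \<mu> * (m * sq_mass k)" for m
    using assms(2,3) op_const by (simp add: ennreal_mult mult_ac)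
  note lin = \<Gamma>_density_def Let_def equil_inverse
  show "quad_linear (\<lambda>g. \<Gamma>_density \<mu> g k) (op_const * r)"
    unfolding quad_linear_def C
  proof (intro conjI ballI allI \<Gamma>_energy quad_measurable_densities k)
    show "\<Gamma>_density \<mu> (\<lambda>t. g t + h t) k x = \<Gamma>_density \<mu> g k x + \<Gamma>_density \<mu> h k x" for g h x unfolding lin by algebra
    show "\<Gamma>_density \<mu> (\<lambda>t. c * g t) k x = c * \<Gamma>_density \<mu> g k x" for c g x unfolding lin by algebra
  qed (use k op_const in auto)
  show "quad_linear (\<Gamma>_density \<mu> k) (op_const * r)"
    unfolding quad_linear_def C mult.commute[of _ "sq_mass k"]
  proof (intro conjI ballI allI \<Gamma>_energy quad_measurable_densities k)
    show "\<Gamma>_density \<mu> k (\<lambda>t. g t + h t) x = \<Gamma>_density \<mu> k g x + \<Gamma>_density \<mu> k h x" for g h x unfolding lin by algebra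
    show "\<Gamma>_density \<mu> k (\<lambda>t. c * g t) x = c * \<Gamma>_density \<mu> k g x" for c g x unfolding lin by algebra
  qed (use k op_const in auto)
qed

lemma quad_linear_Q:
  assumes k: "k \<in> borel_measurable borel" "sq_mass k = ennreal r" "0 \<le> r"
    and k': "k' \<in> borel_measurable borel" "sq_mass k' = ennreal r'" "0 \<le> r'"
  shows "quad_linear (\<lambda>g. Q_density \<mu> g k k') (op_const * r * r')" "quad_linear (\<lambda>g. Q_density \<mu> k g k') (op_const * r * r')"
    "quad_linear (Q_density \<mu> k k') (op_const * r * r')"
proof -
  have C: "ennreal (op_const * r * r') * m = 2 ^ 30 * kernel_bound \<mu> * (m * sq_mass k * sq_mass k')"
    "ennreal (op_const * r * r') * m = 2 ^ 30 * kernel_bound \<mu> * (sq_mass k * m * sq_mass k')"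
    "ennreal (op_const * r * r') * m = 2 ^ 30 * kernel_bound \<mu> * (sq_mass k * sq_mass k' * m)" for m
    using assms op_const by (simp_all add: ennreal_mult mult_ac)
  note lin = Q_density_def Let_def equil_inverse
  show "quad_linear (\<lambda>g. Q_density \<mu> g k k') (op_const * r * r')"
    unfolding quad_linear_def C(1)
  proof (intro conjI ballI allI Q_energy quad_measurable_densities k k')
    show "Q_density \<mu> (\<lambda>t. g t + h t) k k' x = Q_density \<mu> g k k' x + Q_density \<mu> h k k' x" for g h x unfolding lin by algebra
    show "Q_density \<mu> (\<lambda>t. c * g t) k k' x = c * Q_density \<mu> g k k' x" for c g x unfolding lin by algebra
  qed (use k k' op_const in auto)
  show "quad_linear (\<lambda>g. Q_density \<mu> k g k') (op_const * r * r')"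
    unfolding quad_linear_def C(2)
  proof (intro conjI ballI allI Q_energy quad_measurable_densities k k')
    show "Q_density \<mu> k (\<lambda>t. g t + h t) k' x = Q_density \<mu> k g k' x + Q_density \<mu> k h k' x" for g h x unfolding lin by algebra
    show "Q_density \<mu> k (\<lambda>t. c * g t) k' x = c * Q_density \<mu> k g k' x" for c g x unfolding lin by algebra
  qed (use k k' op_const in auto)
  show "quad_linear (Q_density \<mu> k k') (op_const * r * r')"
    unfolding quad_linear_def C(3)
  proof (intro conjI ballI allI Q_energy quad_measurable_densities k k')
    show "Q_density \<mu> k k' (\<lambda>t. g t + h t) x = Q_density \<mu> k k' g x + Q_density \<mu> k k' h x" for g h x unfolding lin by algebra
    show "Q_density \<mu> k k' (\<lambda>t. c * g t) x = c * Q_density \<mu> k k' g x" for c g x unfolding lin by algebra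
  qed (use k k' op_const in auto)
qed

end

section \<open>The operators as collision integrals\<close>

text \<open>Two continuous maps that agree on the dense set of classes of test functions are equal.\<close>

lemma extends_formula_unique:
  assumes T: "continuous_on UNIV T" "extends_formula F T" and T': "continuous_on UNIV T'" "extends_formula F T'"
  shows "T = T'"
proof -
  have "closed {g. T g = T' g}" using T(1) T'(1) by (rule closed_Collect_eq)
  moreover have "abs_wL2 ` test_fun \<subseteq> {g. T g = T' g}"
  proof clarify
    fix \<phi> assume "\<phi> \<in> test_fun"
    then have "AE \<omega> in wmeas. rep_wL2 (T (abs_wL2 \<phi>)) \<omega> = F \<phi> \<omega>" "AE \<omega> in wmeas. rep_wL2 (T' (abs_wL2 \<phi>)) \<omega> = F \<phi> \<omega>"
      using T(2) T'(2) by (auto simp: extends_formula_def)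
    then have "AE \<omega> in wmeas. rep_wL2 (T (abs_wL2 \<phi>)) \<omega> = rep_wL2 (T' (abs_wL2 \<phi>)) \<omega>"
      by eventually_elim simp
    then show "T (abs_wL2 \<phi>) = T' (abs_wL2 \<phi>)" by (rule wL2_eqI)
  qed
  ultimately have "UNIV \<subseteq> {g. T g = T' g}" using closure_minimal test_fun_dense by metis
  then show ?thesis by auto
qed

lemma bounded_quadratic_continuous: "bounded_quadratic T \<Longrightarrow> continuous_on UNIV T"
proof -
  assume "bounded_quadratic T"
  then obtain B :: "wL2 \<Rightarrow>\<^sub>L wL2 \<Rightarrow>\<^sub>L wL2" where "T = (\<lambda>g. B g g)" by (auto simp: bounded_quadratic_def)
  then show ?thesis by (auto intro!: continuous_intros)
qed

lemma bounded_cubic_continuous: "bounded_cubic T \<Longrightarrow> continuous_on UNIV T"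
proof -
  assume "bounded_cubic T"
  then obtain C :: "wL2 \<Rightarrow>\<^sub>L wL2 \<Rightarrow>\<^sub>L wL2 \<Rightarrow>\<^sub>L wL2" where "T = (\<lambda>g. C g g g)" by (auto simp: bounded_cubic_def)
  then show ?thesis by (auto intro!: continuous_intros)
qed

lemma extends_formulaI:
  assumes "\<And>\<phi>. sq_int \<phi> \<Longrightarrow> T (abs_wL2 \<phi>) = abs_wL2 (coll (\<Phi> \<phi>))" "\<And>\<phi>. sq_int \<phi> \<Longrightarrow> sq_int (coll (\<Phi> \<phi>))"
    and "\<And>\<phi> \<omega>. 0 < \<omega> \<Longrightarrow> F \<phi> \<omega> = coll (\<Phi> \<phi>) \<omega>"
  shows "extends_formula F T"
  unfolding extends_formula_def
proof
  fix \<phi> assume "\<phi> \<in> test_fun"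
  then have \<phi>: "sq_int \<phi>" by (rule test_fun_sq_int)
  show "AE \<omega> in wmeas. rep_wL2 (T (abs_wL2 \<phi>)) \<omega> = F \<phi> \<omega>"
    using rep_abs_wL2[OF assms(2)[OF \<phi>]] AE_wmeas_pos unfolding assms(1)[OF \<phi>]
    by eventually_elim (simp add: assms(3))
qed

definition \<Gamma>_bil :: "real \<Rightarrow> wL2 \<Rightarrow> wL2 \<Rightarrow> wL2" where
  "\<Gamma>_bil \<mu> g h = abs_wL2 (coll (\<Gamma>_density \<mu> (rep_wL2 g) (rep_wL2 h)))"

definition Q_tri :: "real \<Rightarrow> wL2 \<Rightarrow> wL2 \<Rightarrow> wL2 \<Rightarrow> wL2" where
  "Q_tri \<mu> g h k = abs_wL2 (coll (Q_density \<mu> (rep_wL2 g) (rep_wL2 h) (rep_wL2 k)))"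

context
  fixes \<mu> :: real
  assumes \<mu>: "0 < \<mu>"
begin

text \<open>The collision integral of a representative is a bounded map that extends the formula, so it is the operator. The same
argument identifies the quadratic and the cubic operator below.\<close>

lemma L_op_eq_lift: "L_op \<mu> = coll_lift (L_density \<mu>)"
  unfolding L_op_def
proof (rule the_equality)
  let ?T = "coll_lift (L_density \<mu>)"
  note ql = quad_linear_L[OF \<mu>]
  have bl: "bounded_linear ?T" by (rule coll_lift_bounded_linear[OF ql])
  have ext: "extends_formula (L_formula \<mu>) ?T"
    by (rule extends_formulaI[where \<Phi> = "L_density \<mu>"])
      (auto simp: coll_lift_abs[OF ql] quad_linear_sq_int(1)[OF ql] L_formula_eq)
  show "bounded_linear ?T \<and> extends_formula (L_formula \<mu>) ?T" using bl ext by simp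
  show "T = ?T" if "bounded_linear T \<and> extends_formula (L_formula \<mu>) T" for T
    using that bl ext by (intro extends_formula_unique) (auto intro: linear_continuous_on)
qed

lemma L_op_abs: "sq_int \<phi> \<Longrightarrow> L_op \<mu> (abs_wL2 \<phi>) = abs_wL2 (coll (L_density \<mu> \<phi>))"
  unfolding L_op_eq_lift by (rule coll_lift_abs[OF quad_linear_L[OF \<mu>]])

lemma L_op_bounded_linear: "bounded_linear (L_op \<mu>)"
  unfolding L_op_eq_lift by (rule coll_lift_bounded_linear[OF quad_linear_L[OF \<mu>]])

lemma sq_int_mass: "sq_int k \<Longrightarrow> k \<in> borel_measurable borel" "sq_int k \<Longrightarrow> sq_mass k = ennreal ((norm (abs_wL2 k))\<^sup>2)"
  by (auto simp: sq_int_measurable sq_mass_abs_wL2)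

lemmas quad_linear_\<Gamma>' = quad_linear_\<Gamma>[OF \<mu> sq_int_mass zero_le_power2]
lemmas quad_linear_Q' = quad_linear_Q[OF \<mu> sq_int_mass zero_le_power2 sq_int_mass zero_le_power2]

lemma \<Gamma>_bil_abs:
  assumes "sq_int \<phi>" "sq_int \<psi>"
  shows "\<Gamma>_bil \<mu> (abs_wL2 \<phi>) (abs_wL2 \<psi>) = abs_wL2 (coll (\<Gamma>_density \<mu> \<phi> \<psi>))"
proof -
  let ?\<phi> = "rep_wL2 (abs_wL2 \<phi>)" and ?\<psi> = "rep_wL2 (abs_wL2 \<psi>)"
  have "abs_wL2 (coll (\<Gamma>_density \<mu> ?\<phi> ?\<psi>)) = abs_wL2 (coll (\<Gamma>_density \<mu> \<phi> ?\<psi>))"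
    by (rule quad_linear_cong[OF quad_linear_\<Gamma>'(1)]) (use assms rep_abs_wL2 in auto)
  also have "\<dots> = abs_wL2 (coll (\<Gamma>_density \<mu> \<phi> \<psi>))"
    by (rule quad_linear_cong[OF quad_linear_\<Gamma>'(2)]) (use assms rep_abs_wL2 in auto)
  finally show ?thesis by (simp add: \<Gamma>_bil_def)
qed

lemma \<Gamma>_bil_bounded_bilinear: "bounded_bilinear (\<Gamma>_bil \<mu>)"
proof
  have l: "\<Gamma>_bil \<mu> g h = coll_lift (\<lambda>g. \<Gamma>_density \<mu> g (rep_wL2 h)) g" for g h by (simp add: \<Gamma>_bil_def coll_lift_def)
  have r: "\<Gamma>_bil \<mu> g h = coll_lift (\<Gamma>_density \<mu> (rep_wL2 g)) h" for g h by (simp add: \<Gamma>_bil_def coll_lift_def)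
  note ql = quad_linear_\<Gamma>'(1)[OF sq_int_rep sq_int_rep] and qr = quad_linear_\<Gamma>'(2)[OF sq_int_rep sq_int_rep]
  show "\<Gamma>_bil \<mu> (g + g') h = \<Gamma>_bil \<mu> g h + \<Gamma>_bil \<mu> g' h" for g g' h unfolding l by (rule coll_lift_add[OF ql])
  show "\<Gamma>_bil \<mu> (r *\<^sub>R g) h = r *\<^sub>R \<Gamma>_bil \<mu> g h" for r g h unfolding l by (rule coll_lift_scale[OF ql])
  show "\<Gamma>_bil \<mu> g (h + h') = \<Gamma>_bil \<mu> g h + \<Gamma>_bil \<mu> g h'" for g h h' unfolding r by (rule coll_lift_add[OF qr])
  show "\<Gamma>_bil \<mu> g (c *\<^sub>R h) = c *\<^sub>R \<Gamma>_bil \<mu> g h" for c g h unfolding r by (rule coll_lift_scale[OF qr])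
  have "norm (\<Gamma>_bil \<mu> g h) \<le> norm g * norm h * sqrt (op_const \<mu>)" for g h
    unfolding l using coll_lift_norm[OF ql, of h g] op_const(2)[OF \<mu>] by (simp add: real_sqrt_mult mult_ac)
  then show "\<exists>K. \<forall>g h. norm (\<Gamma>_bil \<mu> g h) \<le> norm g * norm h * K" by blast
qed

lemma \<Gamma>_op_eq: "\<Gamma>_op \<mu> = (\<lambda>g. \<Gamma>_bil \<mu> g g)"
  unfolding \<Gamma>_op_def
proof (rule the_equality)
  let ?T = "\<lambda>g. \<Gamma>_bil \<mu> g g"
  have bq: "bounded_quadratic ?T"
    unfolding bounded_quadratic_def using curry2_apply[OF \<Gamma>_bil_bounded_bilinear] by metis
  have ext: "extends_formula (\<Gamma>_formula \<mu>) ?T"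
    by (rule extends_formulaI[where \<Phi> = "\<lambda>\<phi>. \<Gamma>_density \<mu> \<phi> \<phi>"])
      (auto simp: \<Gamma>_bil_abs \<Gamma>_formula_eq intro: quad_linear_sq_int(1)[OF quad_linear_\<Gamma>'(1)])
  show "bounded_quadratic ?T \<and> extends_formula (\<Gamma>_formula \<mu>) ?T" using bq ext by simp
  show "T = ?T" if "bounded_quadratic T \<and> extends_formula (\<Gamma>_formula \<mu>) T" for T
    using that bq ext by (intro extends_formula_unique) (auto intro: bounded_quadratic_continuous)
qed

lemma Q_tri_abs:
  assumes "sq_int \<phi>" "sq_int \<psi>" "sq_int \<theta>"
  shows "Q_tri \<mu> (abs_wL2 \<phi>) (abs_wL2 \<psi>) (abs_wL2 \<theta>) = abs_wL2 (coll (Q_density \<mu> \<phi> \<psi> \<theta>))"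
proof -
  let ?\<phi> = "rep_wL2 (abs_wL2 \<phi>)" and ?\<psi> = "rep_wL2 (abs_wL2 \<psi>)" and ?\<theta> = "rep_wL2 (abs_wL2 \<theta>)"
  have "abs_wL2 (coll (Q_density \<mu> ?\<phi> ?\<psi> ?\<theta>)) = abs_wL2 (coll (Q_density \<mu> \<phi> ?\<psi> ?\<theta>))"
    by (rule quad_linear_cong[OF quad_linear_Q'(1)]) (use assms rep_abs_wL2 in auto)
  also have "\<dots> = abs_wL2 (coll (Q_density \<mu> \<phi> \<psi> ?\<theta>))"
    by (rule quad_linear_cong[OF quad_linear_Q'(2)]) (use assms rep_abs_wL2 in auto)
  also have "\<dots> = abs_wL2 (coll (Q_density \<mu> \<phi> \<psi> \<theta>))"
    by (rule quad_linear_cong[OF quad_linear_Q'(3)]) (use assms rep_abs_wL2 in auto)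
  finally show ?thesis by (simp add: Q_tri_def)
qed

lemma Q_tri_blinfun:
  obtains T :: "wL2 \<Rightarrow>\<^sub>L wL2 \<Rightarrow>\<^sub>L wL2 \<Rightarrow>\<^sub>L wL2" where "\<And>g h k. T g h k = Q_tri \<mu> g h k"
proof (rule trilinear_blinfun[of "Q_tri \<mu>"])
  have 1: "Q_tri \<mu> g h k = coll_lift (\<lambda>g. Q_density \<mu> g (rep_wL2 h) (rep_wL2 k)) g"
    and 2: "Q_tri \<mu> g h k = coll_lift (\<lambda>h. Q_density \<mu> (rep_wL2 g) h (rep_wL2 k)) h"
    and 3: "Q_tri \<mu> g h k = coll_lift (Q_density \<mu> (rep_wL2 g) (rep_wL2 h)) k" for g h k
    by (simp_all add: Q_tri_def coll_lift_def)
  note q = quad_linear_Q'[OF sq_int_rep sq_int_rep sq_int_rep sq_int_rep]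
  show "Q_tri \<mu> (g + g') h k = Q_tri \<mu> g h k + Q_tri \<mu> g' h k" for g g' h k unfolding 1 by (rule coll_lift_add[OF q(1)])
  show "Q_tri \<mu> (r *\<^sub>R g) h k = r *\<^sub>R Q_tri \<mu> g h k" for r g h k unfolding 1 by (rule coll_lift_scale[OF q(1)])
  show "Q_tri \<mu> g (h + h') k = Q_tri \<mu> g h k + Q_tri \<mu> g h' k" for g h h' k unfolding 2 by (rule coll_lift_add[OF q(2)])
  show "Q_tri \<mu> g (r *\<^sub>R h) k = r *\<^sub>R Q_tri \<mu> g h k" for r g h k unfolding 2 by (rule coll_lift_scale[OF q(2)])
  show "Q_tri \<mu> g h (k + k') = Q_tri \<mu> g h k + Q_tri \<mu> g h k'" for g h k k' unfolding 3 by (rule coll_lift_add[OF q(3)])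
  show "Q_tri \<mu> g h (r *\<^sub>R k) = r *\<^sub>R Q_tri \<mu> g h k" for r g h k unfolding 3 by (rule coll_lift_scale[OF q(3)])
  show "norm (Q_tri \<mu> g h k) \<le> sqrt (op_const \<mu>) * norm g * norm h * norm k" for g h k
    unfolding 1 using coll_lift_norm[OF q(1), of h k g] by (simp add: real_sqrt_mult mult_ac)
  show "0 \<le> sqrt (op_const \<mu>)" using op_const(2)[OF \<mu>] by simp
qed (rule that)

lemma Q_op_eq: "Q_op \<mu> = (\<lambda>g. Q_tri \<mu> g g g)"
  unfolding Q_op_def
proof (rule the_equality)
  let ?T = "\<lambda>g. Q_tri \<mu> g g g"
  have bq: "bounded_cubic ?T"
    unfolding bounded_cubic_def using Q_tri_blinfun by metis
  have ext: "extends_formula (Q_formula \<mu>) ?T"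
    by (rule extends_formulaI[where \<Phi> = "\<lambda>\<phi>. Q_density \<mu> \<phi> \<phi> \<phi>"])
      (auto simp: Q_tri_abs Q_formula_eq intro: quad_linear_sq_int(1)[OF quad_linear_Q'(1)])
  show "bounded_cubic ?T \<and> extends_formula (Q_formula \<mu>) ?T" using bq ext by simp
  show "T = ?T" if "bounded_cubic T \<and> extends_formula (Q_formula \<mu>) T" for T
    using that bq ext by (intro extends_formula_unique) (auto intro: bounded_cubic_continuous)
qed

lemma \<Gamma>_op_abs: "sq_int \<phi> \<Longrightarrow> \<Gamma>_op \<mu> (abs_wL2 \<phi>) = abs_wL2 (coll (\<Gamma>_density \<mu> \<phi> \<phi>))"
  by (simp add: \<Gamma>_op_eq \<Gamma>_bil_abs)

lemma Q_op_abs: "sq_int \<phi> \<Longrightarrow> Q_op \<mu> (abs_wL2 \<phi>) = abs_wL2 (coll (Q_density \<mu> \<phi> \<phi> \<phi>))"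
  by (simp add: Q_op_eq Q_tri_abs)

lemma densities_finite:
  assumes "sq_int \<phi>"
  shows "quad_measurable (L_density \<mu> \<phi>)" "coll_energy (L_density \<mu> \<phi>) < \<infinity>"
    "quad_measurable (\<Gamma>_density \<mu> \<phi> \<phi>)" "coll_energy (\<Gamma>_density \<mu> \<phi> \<phi>) < \<infinity>"
    "quad_measurable (Q_density \<mu> \<phi> \<phi> \<phi>)" "coll_energy (Q_density \<mu> \<phi> \<phi> \<phi>) < \<infinity>"
  using quad_linear_finite[OF quad_linear_L[OF \<mu>] assms] quad_linear_finite[OF quad_linear_\<Gamma>'(1)[OF assms assms] assms]
    quad_linear_finite[OF quad_linear_Q'(1)[OF assms assms assms assms] assms] by auto

end

section \<open>Orthogonality to the kernel\<close>

definition quad_lborel :: "(real \<times> real \<times> real) measure" where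
  "quad_lborel = lborel \<Otimes>\<^sub>M (lborel \<Otimes>\<^sub>M lborel)"

definition quad_of :: "real \<times> real \<times> real \<Rightarrow> nat \<Rightarrow> real" where
  "quad_of w = quad (fst w) (fst (snd w)) (snd (snd w))"

definition quad_integrable :: "((nat \<Rightarrow> real) \<Rightarrow> real) \<Rightarrow> bool" where
  "quad_integrable f \<longleftrightarrow> integrable quad_lborel (\<lambda>w. f (quad_of w))"

text \<open>The signed integral over all resonant quadruples, which inherits the collisional symmetries from the
nonnegative one.\<close>

definition quad_lint :: "((nat \<Rightarrow> real) \<Rightarrow> real) \<Rightarrow> real" where
  "quad_lint f = (\<integral>w. f (quad_of w) \<partial>quad_lborel)"

lemma pair_sigma_finite_quad: "pair_sigma_finite (lborel :: real measure) (lborel \<Otimes>\<^sub>M lborel :: (real \<times> real) measure)"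
  by (simp add: pair_sigma_finite_def lborel.sigma_finite_measure_axioms lborel_prod)

lemma quad_integral_eq:
  assumes "quad_measurable f"
  shows "quad_integral f = (\<integral>\<^sup>+w. f (quad_of w) \<partial>quad_lborel)"
proof -
  have sf: "sigma_finite_measure (lborel \<Otimes>\<^sub>M lborel :: (real \<times> real) measure)"
    by (simp add: lborel_prod lborel.sigma_finite_measure_axioms)
  show ?thesis
    unfolding quad_integral_def fiber_integral_def quad_lborel_def quad_of_def
    using sigma_finite_measure.nn_integral_fst[OF sf assms[unfolded quad_measurable_def]] by simp
qed

lemma quad_measurable_quad_of: "quad_measurable f \<longleftrightarrow> (\<lambda>w. f (quad_of w)) \<in> borel_measurable quad_lborel"
  by (simp add: quad_measurable_def quad_of_def quad_lborel_def)

lemma quad_integrable_iff: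
  "quad_integrable f \<longleftrightarrow> quad_measurable f \<and> quad_integral (\<lambda>x. ennreal \<bar>f x\<bar>) < \<infinity>"
proof (cases "quad_measurable f")
  case True
  then have "quad_measurable (\<lambda>x. ennreal \<bar>f x\<bar>)" by (intro quad_measurable_ennreal quad_measurable_unary)
  from quad_integral_eq[OF this] True show ?thesis
    by (simp add: quad_integrable_def integrable_iff_bounded quad_measurable_quad_of)
next
  case False
  then show ?thesis by (auto simp: quad_integrable_def quad_measurable_quad_of)
qed

lemma quad_lint_eq:
  assumes "quad_integrable f"
  shows "quad_lint f = enn2real (quad_integral (\<lambda>x. ennreal (f x))) - enn2real (quad_integral (\<lambda>x. ennreal (- f x)))"
proof -
  have m: "quad_measurable f" using assms by (simp add: quad_integrable_iff)
  show ?thesis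
    using assms m unfolding quad_lint_def quad_integrable_def
    by (simp add: real_lebesgue_integral_def quad_integral_eq[OF quad_measurable_ennreal[OF m]]
        quad_integral_eq[OF quad_measurable_ennreal[OF quad_measurable_unary(2)[OF m]]])
qed

lemma quad_lint_invariant:
  assumes f: "quad_integrable f"
    and P: "\<And>f :: (nat \<Rightarrow> real) \<Rightarrow> ennreal. quad_measurable f \<Longrightarrow> quad_integral (\<lambda>x. f (quad (x i) (x j) (x k))) = quad_integral f"
  shows "quad_integrable (\<lambda>x. f (quad (x i) (x j) (x k)))" "quad_lint (\<lambda>x. f (quad (x i) (x j) (x k))) = quad_lint f"
proof -
  have m: "quad_measurable f" using f by (simp add: quad_integrable_iff)
  note P1 = P[OF quad_measurable_ennreal[OF m]] P[OF quad_measurable_ennreal[OF quad_measurable_unary(1)[OF m]]]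
    P[OF quad_measurable_ennreal[OF quad_measurable_unary(2)[OF m]]]
  show i: "quad_integrable (\<lambda>x. f (quad (x i) (x j) (x k)))"
    using f unfolding quad_integrable_iff P1 by (simp add: quad_measurable_permute)
  show "quad_lint (\<lambda>x. f (quad (x i) (x j) (x k))) = quad_lint f"
    unfolding quad_lint_eq[OF i] quad_lint_eq[OF f] P1 ..
qed

lemma quad_lint_cong: "(\<And>a b c. f (quad a b c) = g (quad a b c)) \<Longrightarrow> quad_lint f = quad_lint g"
  by (simp add: quad_lint_def quad_of_def)

lemma quad_integrable_cong: "(\<And>a b c. f (quad a b c) = g (quad a b c)) \<Longrightarrow> quad_integrable f = quad_integrable g"
  by (simp add: quad_integrable_def quad_of_def)

text \<open>The weight \<open>sqrt (x 0)\<close> of \<open>H\<close> cancels the denominator of the collision weight, so the inner product is an integral over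
quadruples against the symmetric weight \<open>root_min\<close>. Absolute integrability comes from \<open>\<bar>g\<bar> * c \<le> g\<^sup>2 + c\<^sup>2\<close>.\<close>

lemma inner_coll:
  assumes F: "quad_measurable F" "coll_energy F < \<infinity>" and g: "sq_int g"
  shows "quad_integrable (\<lambda>x. root_min x * F x * g (x 0))"
    and "abs_wL2 (coll F) \<bullet> abs_wL2 g = quad_lint (\<lambda>x. root_min x * F x * g (x 0))"
proof -
  let ?X = "\<lambda>x. root_min x * F x * g (x 0)"
  have [measurable]: "g \<in> borel_measurable borel" by (rule sq_int_measurable[OF g])
  have mX: "quad_measurable ?X"
    by (intro quad_measurable_real(1) quad_measurable_root_min F quad_measurable_slot) measurable
  have m1: "quad_measurable (\<lambda>x. ennreal (root_min x / sqrt (x 0) * \<bar>F x\<bar>))" by (rule quad_measurable_coll_integrand[OF F(1)])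
  have zero: "root_min (quad a b c) = 0" if "\<not> 0 < a" for a b c using that by (simp add: root_min_def pos_quad_def)
  have "quad_integral (\<lambda>x. ennreal \<bar>?X x\<bar>) \<le> (\<integral>\<^sup>+a. ennreal (indicator {0<..} a * sqrt a) * (ennreal ((g a)\<^sup>2) + (coll_abs F a)\<^sup>2) \<partial>lborel)"
    unfolding quad_integral_def
  proof (rule nn_integral_mono)
    fix a :: real
    show "fiber_integral (\<lambda>x. ennreal \<bar>?X x\<bar>) a \<le> ennreal (indicator {0<..} a * sqrt a) * (ennreal ((g a)\<^sup>2) + (coll_abs F a)\<^sup>2)"
    proof (cases "0 < a")
      case a: True
      have "fiber_integral (\<lambda>x. ennreal \<bar>?X x\<bar>) a = fiber_integral (\<lambda>x. ennreal (sqrt a * \<bar>g a\<bar>) * ennreal (root_min x / sqrt (x 0) * \<bar>F x\<bar>)) a"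
        by (rule fiber_integral_cong) (use a in \<open>simp add: ennreal_mult[symmetric] abs_mult mult_ac\<close>)
      also have "\<dots> = ennreal (sqrt a * \<bar>g a\<bar>) * coll_abs F a"
        unfolding fiber_integral_cmult[OF m1] by (simp add: coll_abs_def)
      also have "\<dots> = ennreal (sqrt a) * (ennreal \<bar>g a\<bar> * coll_abs F a)"
        using a by (simp add: ennreal_mult mult.assoc)
      also have "ennreal \<bar>g a\<bar> * coll_abs F a \<le> (ennreal \<bar>g a\<bar>)\<^sup>2 + (coll_abs F a)\<^sup>2"
      proof (cases "ennreal \<bar>g a\<bar> \<le> coll_abs F a")
        case True
        then have "ennreal \<bar>g a\<bar> * coll_abs F a \<le> (coll_abs F a)\<^sup>2" by (simp add: power2_eq_square mult_right_mono)
        then show ?thesis by (simp add: add_increasing)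
      next
        case False
        then have "ennreal \<bar>g a\<bar> * coll_abs F a \<le> (ennreal \<bar>g a\<bar>)\<^sup>2" by (simp add: power2_eq_square mult_left_mono)
        then show ?thesis by (simp add: add_increasing2)
      qed
      also have "(ennreal \<bar>g a\<bar>)\<^sup>2 = ennreal ((g a)\<^sup>2)" by (simp add: ennreal_power)
      finally show ?thesis using a by (simp add: mult_left_mono)
    next
      case False
      then have "fiber_integral (\<lambda>x. ennreal \<bar>?X x\<bar>) a = fiber_integral (\<lambda>x. 0) a" by (intro fiber_integral_cong) (simp add: zero)
      then show ?thesis by (simp add: fiber_integral_def)
    qed
  qed
  also have "\<dots> = (\<integral>\<^sup>+a. ennreal ((g a)\<^sup>2) + (coll_abs F a)\<^sup>2 \<partial>wmeas)"
    by (rule nn_integral_wmeas[symmetric]) (use F in measurable)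
  also have "\<dots> = sq_mass g + coll_energy F"
    unfolding sq_mass_def coll_energy_def using F by (intro nn_integral_add) auto
  also have "\<dots> < \<infinity>" using F by (simp add: sq_mass_abs_wL2[OF g])
  finally show int: "quad_integrable ?X" using mX by (simp add: quad_integrable_iff)
  interpret pair_sigma_finite "lborel :: real measure" "lborel \<Otimes>\<^sub>M lborel :: (real \<times> real) measure"
    by (rule pair_sigma_finite_quad)
  have sq: "sq_int (coll F)" by (rule coll_sq_int(1)[OF F])
  have "abs_wL2 (coll F) \<bullet> abs_wL2 g = (\<integral>a. coll F a * g a \<partial>wmeas)" by (rule inner_abs_wL2[OF sq g])
  also have "\<dots> = (\<integral>a. (indicator {0<..} a * sqrt a) *\<^sub>R (coll F a * g a) \<partial>lborel)"
    unfolding wmeas_def by (rule integral_density) (use F in \<open>auto simp: indicator_def\<close>)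
  also have "\<dots> = (\<integral>a. \<integral>z. ?X (quad_of (a, z)) \<partial>(lborel \<Otimes>\<^sub>M lborel) \<partial>lborel)"
  proof (rule Bochner_Integration.integral_cong[OF refl])
    fix a :: real
    show "(indicator {0<..} a * sqrt a) *\<^sub>R (coll F a * g a) = (\<integral>z. ?X (quad_of (a, z)) \<partial>(lborel \<Otimes>\<^sub>M lborel))"
    proof (cases "0 < a")
      case True
      have "(\<integral>z. ?X (quad_of (a, z)) \<partial>(lborel \<Otimes>\<^sub>M lborel)) = (\<integral>z. (sqrt a * g a) * coll_integrand F a z \<partial>(lborel \<Otimes>\<^sub>M lborel))"
        by (rule Bochner_Integration.integral_cong[OF refl]) (use True in \<open>simp add: quad_of_def coll_integrand_def\<close>)
      also have "\<dots> = (sqrt a * g a) * coll F a" by (simp add: coll_eq)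
      finally show ?thesis using True by simp
    next
      case False
      then show ?thesis by (simp add: quad_of_def zero)
    qed
  qed
  also have "\<dots> = quad_lint ?X"
    using integral_fst'[of "\<lambda>w. ?X (quad_of w)"] int by (simp add: quad_integrable_def quad_lint_def quad_lborel_def)
  finally show "abs_wL2 (coll F) \<bullet> abs_wL2 g = quad_lint ?X" .
qed

text \<open>The behaviour of a collision term: it keeps its value when the two particles of one pair are exchanged and changes
sign when the pairs \<open>(0, 3)\<close> and \<open>(1, 2)\<close> are exchanged.\<close>

definition antisymmetric_density :: "((nat \<Rightarrow> real) \<Rightarrow> real) \<Rightarrow> bool" where
  "antisymmetric_density B \<longleftrightarrow> (\<forall>a b c. B (quad a c b) = B (quad a b c) \<and> B (quad (b + c - a) b c) = B (quad a b c) \<and>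
     B (quad b a (b + c - a)) = - B (quad a b c))"

definition sym_weight :: "real \<Rightarrow> (nat \<Rightarrow> real) \<Rightarrow> real" where
  "sym_weight \<mu> x = root_min x * (equil \<mu> (x 0) * equil \<mu> (x 1) * equil \<mu> (x 2) * equil \<mu> (x 3))"

text \<open>This vanishes precisely when \<open>\<phi>\<close> is conserved by the collision.\<close>

definition coll_defect :: "(real \<Rightarrow> real) \<Rightarrow> (nat \<Rightarrow> real) \<Rightarrow> real" where
  "coll_defect \<phi> x = \<phi> (x 0) + \<phi> (x 3) - \<phi> (x 1) - \<phi> (x 2)"

lemma sym_weight_permute:
  "sym_weight \<mu> (quad a c b) = sym_weight \<mu> (quad a b c)"
  "sym_weight \<mu> (quad (b + c - a) b c) = sym_weight \<mu> (quad a b c)"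
  "sym_weight \<mu> (quad b a (b + c - a)) = sym_weight \<mu> (quad a b c)"
  by (auto simp: sym_weight_def root_min_def pos_quad_def algebra_simps min.commute min.left_commute min.assoc)

text \<open>The weak form of the collision integral. With \<open>g = equil \<mu> * \<phi>\<close> the equilibrium factors form a symmetric product, and
averaging over the four symmetries that move slot \<open>0\<close> to each of the slots replaces \<open>\<phi> (x 0)\<close> by a quarter of the defect.\<close>

lemma inner_coll_antisymmetric:
  assumes \<mu>: "0 < \<mu>" and B: "antisymmetric_density B"
    and F: "quad_measurable F" "coll_energy F < \<infinity>" "\<And>x. F x = equil \<mu> (x 1) * equil \<mu> (x 2) * equil \<mu> (x 3) * B x"
    and g: "sq_int g"
  shows "quad_integrable (\<lambda>x. sym_weight \<mu> x * B x * coll_defect (\<lambda>t. g t / equil \<mu> t) x)"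
    and "4 * (abs_wL2 (coll F) \<bullet> abs_wL2 g) = quad_lint (\<lambda>x. sym_weight \<mu> x * B x * coll_defect (\<lambda>t. g t / equil \<mu> t) x)"
proof -
  define \<phi> where "\<phi> = (\<lambda>t. g t / equil \<mu> t)"
  define X where "X = (\<lambda>x. root_min x * F x * g (x 0))"
  have X: "X x = sym_weight \<mu> x * B x * \<phi> (x 0)" for x
  proof (cases "pos_quad x")
    case True
    then have "equil \<mu> (x 0) \<noteq> 0" using \<mu> by (simp add: pos_quad_def equil_def)
    then show ?thesis by (simp add: X_def F(3) sym_weight_def \<phi>_def)
  qed (simp add: X_def sym_weight_def root_min_def)
  have iX: "quad_integrable X" unfolding X_def by (rule inner_coll(1)[OF F(1,2) g])
  have inner: "abs_wL2 (coll F) \<bullet> abs_wL2 g = quad_lint X" unfolding X_def by (rule inner_coll(2)[OF F(1,2) g])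
  have B1: "B (quad a c b) = B (quad a b c)" and B2: "B (quad (b + c - a) b c) = B (quad a b c)"
    and B3: "B (quad b a (b + c - a)) = - B (quad a b c)" for a b c using B by (auto simp: antisymmetric_density_def)
  have B4: "B (quad c a (b + c - a)) = - B (quad a b c)" for a b c using B3[of c a b] B1[of a c b] by (simp add: add.commute)
  have S4: "sym_weight \<mu> (quad c a (b + c - a)) = sym_weight \<mu> (quad a b c)" for a b c
    using sym_weight_permute(3)[of \<mu> c a b] sym_weight_permute(1)[of \<mu> a c b] by (simp add: add.commute)
  let ?W = "\<lambda>x. sym_weight \<mu> x * B x"
  have 3: "quad_integrable (\<lambda>x. ?W x * \<phi> (x 3))" "quad_lint (\<lambda>x. ?W x * \<phi> (x 3)) = quad_lint X"
  proof -
    have "quad_integrable (\<lambda>x. X (quad (x 3) (x 1) (x 2))) = quad_integrable (\<lambda>x. ?W x * \<phi> (x 3))"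
      by (rule quad_integrable_cong) (simp add: X sym_weight_permute B2)
    moreover have "quad_lint (\<lambda>x. X (quad (x 3) (x 1) (x 2))) = quad_lint (\<lambda>x. ?W x * \<phi> (x 3))"
      by (rule quad_lint_cong) (simp add: X sym_weight_permute B2)
    ultimately show "quad_integrable (\<lambda>x. ?W x * \<phi> (x 3))" "quad_lint (\<lambda>x. ?W x * \<phi> (x 3)) = quad_lint X"
      using quad_lint_invariant[OF iX quad_integral_swap03] by simp_all
  qed
  have 1: "quad_integrable (\<lambda>x. - (?W x * \<phi> (x 1)))" "quad_lint (\<lambda>x. - (?W x * \<phi> (x 1))) = quad_lint X"
  proof -
    have "quad_integrable (\<lambda>x. X (quad (x 1) (x 0) (x 3))) = quad_integrable (\<lambda>x. - (?W x * \<phi> (x 1)))"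
      by (rule quad_integrable_cong) (simp add: X sym_weight_permute B3)
    moreover have "quad_lint (\<lambda>x. X (quad (x 1) (x 0) (x 3))) = quad_lint (\<lambda>x. - (?W x * \<phi> (x 1)))"
      by (rule quad_lint_cong) (simp add: X sym_weight_permute B3)
    ultimately show "quad_integrable (\<lambda>x. - (?W x * \<phi> (x 1)))" "quad_lint (\<lambda>x. - (?W x * \<phi> (x 1))) = quad_lint X"
      using quad_lint_invariant[OF iX quad_integral_swap01_23] by simp_all
  qed
  have 2: "quad_integrable (\<lambda>x. - (?W x * \<phi> (x 2)))" "quad_lint (\<lambda>x. - (?W x * \<phi> (x 2))) = quad_lint X"
  proof -
    have "quad_integrable (\<lambda>x. X (quad (x 2) (x 0) (x 3))) = quad_integrable (\<lambda>x. - (?W x * \<phi> (x 2)))"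
      by (rule quad_integrable_cong) (simp add: X S4 B4)
    moreover have "quad_lint (\<lambda>x. X (quad (x 2) (x 0) (x 3))) = quad_lint (\<lambda>x. - (?W x * \<phi> (x 2)))"
      by (rule quad_lint_cong) (simp add: X S4 B4)
    ultimately show "quad_integrable (\<lambda>x. - (?W x * \<phi> (x 2)))" "quad_lint (\<lambda>x. - (?W x * \<phi> (x 2))) = quad_lint X"
      using quad_lint_invariant[OF iX quad_integral_swap02_13] by simp_all
  qed
  have sum: "?W x * coll_defect \<phi> x = X x + (?W x * \<phi> (x 3)) + (- (?W x * \<phi> (x 1))) + (- (?W x * \<phi> (x 2)))" for x
    by (simp add: X coll_defect_def algebra_simps)
  note i = iX 3(1) 1(1) 2(1)
  show "quad_integrable (\<lambda>x. ?W x * coll_defect (\<lambda>t. g t / equil \<mu> t) x)"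
    unfolding \<phi>_def[symmetric] sum quad_integrable_def
    by (intro Bochner_Integration.integrable_add i[unfolded quad_integrable_def])
  have "quad_lint (\<lambda>x. ?W x * coll_defect \<phi> x) = quad_lint X + quad_lint (\<lambda>x. ?W x * \<phi> (x 3)) + quad_lint (\<lambda>x. - (?W x * \<phi> (x 1))) + quad_lint (\<lambda>x. - (?W x * \<phi> (x 2)))"
    unfolding sum quad_lint_def
    by (simp only: Bochner_Integration.integral_add i[unfolded quad_integrable_def] Bochner_Integration.integrable_add)
  then show "4 * (abs_wL2 (coll F) \<bullet> abs_wL2 g) = quad_lint (\<lambda>x. ?W x * coll_defect (\<lambda>t. g t / equil \<mu> t) x)"
    unfolding \<phi>_def[symmetric] 3(2) 1(2) 2(2) inner by simp
qed

lemma antisymmetric_densities: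
  "antisymmetric_density (\<lambda>x. - coll_defect \<phi> x)"
  "antisymmetric_density (\<lambda>x. let m = (\<lambda>\<omega>. inverse (equil \<mu> \<omega>)) in
     - g (x 0) * g (x 3) * (m (x 2) + m (x 1))
     + g (x 0) * g (x 1) * (m (x 3) - m (x 2))
     + g (x 0) * g (x 2) * (m (x 3) - m (x 1))
     + g (x 3) * g (x 1) * (m (x 1) - m (x 3))
     + g (x 3) * g (x 2) * (m (x 2) - m (x 3))
     + g (x 1) * g (x 2) * (m (x 2) + m (x 1)))"
  "antisymmetric_density (\<lambda>x. let m = (\<lambda>\<omega>. inverse (equil \<mu> \<omega>)) in
     m (x 3) * g (x 0) * g (x 1) * g (x 2) + m (x 0) * g (x 1) * g (x 2) * g (x 3)
     - m (x 1) * g (x 0) * g (x 2) * g (x 3) - m (x 2) * g (x 0) * g (x 1) * g (x 3))"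
  unfolding antisymmetric_density_def Let_def equil_inverse
  by (simp_all add: coll_defect_def algebra_simps)

text \<open>For the linearised operator the density is minus the defect itself, so \<open>- 4 * (L_op \<mu> g \<bullet> g)\<close> is the weighted integral of the
squared defect, which can only vanish if the defect does.\<close>

lemma ker_L_defect:
  assumes \<mu>: "0 < \<mu>" and g: "g \<in> ker_L \<mu>"
  shows "AE w in quad_lborel. sym_weight \<mu> (quad_of w) * coll_defect (\<lambda>t. rep_wL2 g t / equil \<mu> t) (quad_of w) = 0"
proof -
  let ?\<phi> = "\<lambda>t. rep_wL2 g t / equil \<mu> t"
  note f = densities_finite[OF \<mu> sq_int_rep[of g]]
  have L: "L_density \<mu> (rep_wL2 g) x = equil \<mu> (x 1) * equil \<mu> (x 2) * equil \<mu> (x 3) * (- coll_defect ?\<phi> x)" for x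
    by (simp add: L_density_def coll_defect_def)
  note A = inner_coll_antisymmetric[OF \<mu> antisymmetric_densities(1) f(1,2) L sq_int_rep[of g]]
  have "abs_wL2 (coll (L_density \<mu> (rep_wL2 g))) = 0"
    using g L_op_abs[OF \<mu> sq_int_rep[of g]] by (simp add: ker_L_def)
  then have zero: "quad_lint (\<lambda>x. sym_weight \<mu> x * - coll_defect ?\<phi> x * coll_defect ?\<phi> x) = 0" using A(2) by simp
  have nn: "0 \<le> sym_weight \<mu> x * (coll_defect ?\<phi> x)\<^sup>2" for x
    using \<mu> by (cases "pos_quad x") (auto simp: sym_weight_def pos_quad_def equil_def root_min_def intro!: mult_nonneg_nonneg)
  have eq: "sym_weight \<mu> x * - coll_defect ?\<phi> x * coll_defect ?\<phi> x = - (sym_weight \<mu> x * (coll_defect ?\<phi> x)\<^sup>2)" for x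
    by (simp add: power2_eq_square)
  have int: "integrable quad_lborel (\<lambda>w. sym_weight \<mu> (quad_of w) * (coll_defect ?\<phi> (quad_of w))\<^sup>2)"
    using Bochner_Integration.integrable_minus[OF A(1)[unfolded eq quad_integrable_def]] by simp
  have "(\<integral>w. sym_weight \<mu> (quad_of w) * (coll_defect ?\<phi> (quad_of w))\<^sup>2 \<partial>quad_lborel) = 0"
    using zero unfolding eq quad_lint_def by simp
  then have "AE w in quad_lborel. sym_weight \<mu> (quad_of w) * (coll_defect ?\<phi> (quad_of w))\<^sup>2 = 0"
    using integral_nonneg_eq_0_iff_AE[OF int] nn by simp
  then show ?thesis by eventually_elim auto
qed

text \<open>The weak form tests the collision integral against the defect of \<open>g\<close>, which vanishes for \<open>g\<close> in the kernel. No
description of the kernel is needed.\<close>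

lemma coll_orthogonal_ker_L:
  assumes \<mu>: "0 < \<mu>" and B: "antisymmetric_density B"
    and F: "quad_measurable F" "coll_energy F < \<infinity>" "\<And>x. F x = equil \<mu> (x 1) * equil \<mu> (x 2) * equil \<mu> (x 3) * B x"
  shows "abs_wL2 (coll F) \<in> (ker_L \<mu>)\<^sup>\<bottom>"
  unfolding orthogonal_comp_def
proof clarify
  fix g assume g: "g \<in> ker_L \<mu>"
  let ?\<phi> = "\<lambda>t. rep_wL2 g t / equil \<mu> t"
  have "AE w in quad_lborel. sym_weight \<mu> (quad_of w) * B (quad_of w) * coll_defect ?\<phi> (quad_of w) = 0"
    using ker_L_defect[OF \<mu> g] by eventually_elim auto
  then have "quad_lint (\<lambda>x. sym_weight \<mu> x * B x * coll_defect ?\<phi> x) = 0"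
    unfolding quad_lint_def by (rule integral_eq_zero_AE)
  then have "abs_wL2 (coll F) \<bullet> g = 0"
    using inner_coll_antisymmetric(2)[OF \<mu> B F sq_int_rep[of g]] by simp
  then show "orthogonal g (abs_wL2 (coll F))" by (simp add: orthogonal_def inner_commute)
qed

lemma operators_orthogonal_ker_L:
  assumes \<mu>: "0 < \<mu>"
  shows "L_op \<mu> g + \<Gamma>_op \<mu> g + Q_op \<mu> g \<in> (ker_L \<mu>)\<^sup>\<bottom>"
proof -
  note f = densities_finite[OF \<mu> sq_int_rep[of g]]
  have "abs_wL2 (coll (L_density \<mu> (rep_wL2 g))) \<in> (ker_L \<mu>)\<^sup>\<bottom>"
    by (rule coll_orthogonal_ker_L[OF \<mu> antisymmetric_densities(1)[where \<phi> = "\<lambda>t. rep_wL2 g t / equil \<mu> t"] f(1,2)])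
      (simp add: L_density_def coll_defect_def)
  moreover have "abs_wL2 (coll (\<Gamma>_density \<mu> (rep_wL2 g) (rep_wL2 g))) \<in> (ker_L \<mu>)\<^sup>\<bottom>"
    by (rule coll_orthogonal_ker_L[OF \<mu> antisymmetric_densities(2) f(3,4)]) (rule \<Gamma>_density_def)
  moreover have "abs_wL2 (coll (Q_density \<mu> (rep_wL2 g) (rep_wL2 g) (rep_wL2 g))) \<in> (ker_L \<mu>)\<^sup>\<bottom>"
    by (rule coll_orthogonal_ker_L[OF \<mu> antisymmetric_densities(3) f(5,6)]) (rule Q_density_def)
  moreover have "L_op \<mu> g = abs_wL2 (coll (L_density \<mu> (rep_wL2 g)))" "\<Gamma>_op \<mu> g = abs_wL2 (coll (\<Gamma>_density \<mu> (rep_wL2 g) (rep_wL2 g)))"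
    "Q_op \<mu> g = abs_wL2 (coll (Q_density \<mu> (rep_wL2 g) (rep_wL2 g) (rep_wL2 g)))"
    using L_op_abs[OF \<mu> sq_int_rep[of g]] \<Gamma>_op_abs[OF \<mu> sq_int_rep[of g]] Q_op_abs[OF \<mu> sq_int_rep[of g]] by simp_all
  ultimately show ?thesis using subspace_orthogonal_comp[of "ker_L \<mu>"] by (simp add: subspace_def)
qed

section \<open>The perturbation equation as a dissipative equation\<close>

text \<open>Multilinearity: the difference of two values telescopes into terms each of which contains \<open>g - h\<close> once.\<close>

lemma cubic_lipschitz_on_balls:
  fixes A :: "'a::real_normed_vector \<Rightarrow>\<^sub>L 'a" and B :: "'a \<Rightarrow>\<^sub>L 'a \<Rightarrow>\<^sub>L 'a" and C :: "'a \<Rightarrow>\<^sub>L 'a \<Rightarrow>\<^sub>L 'a \<Rightarrow>\<^sub>L 'a"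
  shows "lipschitz_on_balls (\<lambda>g. A g + B g g + C g g g)"
  unfolding lipschitz_on_balls_def
proof
  fix R :: real
  have nB: "norm (B g h) \<le> norm B * norm g * norm h" for g h
    using norm_blinfun[of "B g" h] norm_blinfun[of B g] by (meson mult_right_mono norm_ge_zero order_trans)
  have nC: "norm (C g h k) \<le> norm C * norm g * norm h * norm k" for g h k
    using norm_blinfun[of "C g h" k] norm_blinfun[of "C g" h] norm_blinfun[of C g]
    by (meson mult_right_mono norm_ge_zero order_trans)
  define L where "L = norm A + norm B * (2 * \<bar>R\<bar>) + norm C * (3 * \<bar>R\<bar>\<^sup>2)"
  have "L-lipschitz_on (cball 0 R) (\<lambda>g. A g + B g g + C g g g)"
  proof (rule lipschitz_onI)
    fix g h :: 'a assume "g \<in> cball 0 R" "h \<in> cball 0 R"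
    then have gh: "norm g \<le> \<bar>R\<bar>" "norm h \<le> \<bar>R\<bar>" by auto
    define d where "d = g - h"
    have "(A g + B g g + C g g g) - (A h + B h h + C h h h) = A d + (B d g + B h d) + (C d g g + C h d g + C h h d)"
      by (simp add: d_def blinfun.diff_left blinfun.diff_right)
    also have "norm \<dots> \<le> norm (A d) + (norm (B d g) + norm (B h d)) + (norm (C d g g) + norm (C h d g) + norm (C h h d))"
      by (intro norm_triangle_le add_mono order_refl)
    also have "\<dots> \<le> norm A * norm d + (norm B * norm d * \<bar>R\<bar> + norm B * \<bar>R\<bar> * norm d)
        + (norm C * norm d * \<bar>R\<bar> * \<bar>R\<bar> + norm C * \<bar>R\<bar> * norm d * \<bar>R\<bar> + norm C * \<bar>R\<bar> * \<bar>R\<bar> * norm d)"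
      by (intro add_mono norm_blinfun order_trans[OF nB] order_trans[OF nC] mult_mono gh) auto
    also have "\<dots> = L * norm d" by (simp add: L_def algebra_simps power2_eq_square)
    finally show "dist (A g + B g g + C g g g) (A h + B h h + C h h h) \<le> L * dist g h" by (simp add: dist_norm d_def)
  qed (simp add: L_def)
  then show "\<exists>L. L-lipschitz_on (cball 0 R) (\<lambda>g. A g + B g g + C g g g)" ..
qed

definition coll_field :: "real \<Rightarrow> wL2 \<Rightarrow> wL2" where
  "coll_field \<mu> g = L_op \<mu> g + \<Gamma>_op \<mu> g + Q_op \<mu> g"

lemma coll_field_cubic:
  assumes "0 < \<mu>"
  obtains A :: "wL2 \<Rightarrow>\<^sub>L wL2" and B :: "wL2 \<Rightarrow>\<^sub>L wL2 \<Rightarrow>\<^sub>L wL2" and C :: "wL2 \<Rightarrow>\<^sub>L wL2 \<Rightarrow>\<^sub>L wL2 \<Rightarrow>\<^sub>L wL2"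
  where "\<And>g. L_op \<mu> g = A g" "\<And>g. \<Gamma>_op \<mu> g = B g g" "\<And>g. Q_op \<mu> g = C g g g"
proof -
  obtain C :: "wL2 \<Rightarrow>\<^sub>L wL2 \<Rightarrow>\<^sub>L wL2 \<Rightarrow>\<^sub>L wL2" where C: "\<And>g h k. C g h k = Q_tri \<mu> g h k"
    using Q_tri_blinfun[OF assms] by blast
  show ?thesis
    by (rule that[of "Blinfun (L_op \<mu>)" "curry2 (\<Gamma>_bil \<mu>)" C])
      (simp_all add: bounded_linear_Blinfun_apply[OF L_op_bounded_linear[OF assms]]
        curry2_apply[OF \<Gamma>_bil_bounded_bilinear[OF assms]] \<Gamma>_op_eq[OF assms] Q_op_eq[OF assms] C)
qed

lemma coll_field_lipschitz: "0 < \<mu> \<Longrightarrow> lipschitz_on_balls (coll_field \<mu>)"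
proof -
  assume "0 < \<mu>"
  obtain A :: "wL2 \<Rightarrow>\<^sub>L wL2" and B C where "\<And>g. L_op \<mu> g = A g" "\<And>g. \<Gamma>_op \<mu> g = blinfun_apply (blinfun_apply B g) g"
    "\<And>g. Q_op \<mu> g = blinfun_apply (blinfun_apply (blinfun_apply C g) g) g"
    using coll_field_cubic[OF \<open>0 < \<mu>\<close>] by blast
  then have eq: "coll_field \<mu> = (\<lambda>g. A g + B g g + C g g g)" by (auto simp: coll_field_def)
  show ?thesis unfolding eq by (rule cubic_lipschitz_on_balls)
qed

lemma lipschitz_on_balls_continuous:
  fixes F :: "'a::real_normed_vector \<Rightarrow> 'a"
  assumes "lipschitz_on_balls F"
  shows "continuous_on UNIV F"
  unfolding continuous_on_eq_continuous_at[OF open_UNIV]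
proof
  fix x :: 'a
  obtain L where "L-lipschitz_on (cball 0 (norm x + 1)) F" using assms by (auto simp: lipschitz_on_balls_def)
  then have "continuous_on (ball 0 (norm x + 1)) F"
    by (intro lipschitz_on_continuous_on[of L]) (erule lipschitz_on_subset, auto)
  then show "isCont F x" by (simp add: continuous_on_eq_continuous_at)
qed

text \<open>The projection is defined by a description, so its uniqueness is part of the argument: an element of the kernel that is
also orthogonal to it vanishes.\<close>

lemma orth_proj_of_orthogonal:
  assumes "0 < \<mu>" and "g \<in> (ker_L \<mu>)\<^sup>\<bottom>"
  shows "orth_proj (ker_L \<mu>) g = 0"
  unfolding orth_proj_def
proof (rule the_equality)
  have "L_op \<mu> 0 = 0" using L_op_bounded_linear[OF assms(1)] by (rule linear_simps)
  then show "0 \<in> ker_L \<mu> \<and> g - 0 \<in> (ker_L \<mu>)\<^sup>\<bottom>" using assms(2) by (simp add: ker_L_def)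
next
  fix p assume p: "p \<in> ker_L \<mu> \<and> g - p \<in> (ker_L \<mu>)\<^sup>\<bottom>"
  then have "p \<bullet> g = 0" "p \<bullet> (g - p) = 0" using assms(2) by (auto simp: orthogonal_comp_def orthogonal_def)
  then show "p = 0" by (simp add: inner_diff_right)
qed

text \<open>On the orthogonal complement of the kernel the gap inequality gives \<open>- l\<close>; in a small ball the quadratic and the cubic
term cost at most \<open>(l - \<delta>) * (norm g)\<^sup>2\<close>.\<close>

lemma coll_field_dissipative:
  assumes \<mu>: "0 < \<mu>" and gap: "spectral_gap \<mu> l" and \<delta>: "\<delta> < l"
  obtains R where "0 < R" "\<And>g. g \<in> (ker_L \<mu>)\<^sup>\<bottom> \<Longrightarrow> norm g \<le> R \<Longrightarrow> coll_field \<mu> g \<bullet> g \<le> - \<delta> * (norm g)\<^sup>2"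
proof -
  obtain A :: "wL2 \<Rightarrow>\<^sub>L wL2" and B C where ABC: "\<And>g. L_op \<mu> g = A g" "\<And>g. \<Gamma>_op \<mu> g = blinfun_apply (blinfun_apply B g) g"
    "\<And>g. Q_op \<mu> g = blinfun_apply (blinfun_apply (blinfun_apply C g) g) g"
    using coll_field_cubic[OF \<mu>] by blast
  define M where "M = norm B + norm C"
  (* Radius at most 1: then the cubic term is at most as large as a quadratic one with constant norm C. *)
  define R where "R = min 1 ((l - \<delta>) / (M + 1))"
  have M: "0 \<le> M" by (simp add: M_def)
  have R: "0 < R" "R \<le> 1" using \<delta> M by (auto simp: R_def)
  have RM: "M * R \<le> l - \<delta>"
  proof -
    have "M * R \<le> (M + 1) * ((l - \<delta>) / (M + 1))"
      using M \<delta> R(1) by (intro mult_mono) (auto simp: R_def)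
    then show ?thesis using M by simp
  qed
  have "coll_field \<mu> g \<bullet> g \<le> - \<delta> * (norm g)\<^sup>2" if g: "g \<in> (ker_L \<mu>)\<^sup>\<bottom>" and gR: "norm g \<le> R" for g
  proof -
    have L: "L_op \<mu> g \<bullet> g \<le> - l * (norm g)\<^sup>2"
    proof -
      have "l * (norm (g - orth_proj (ker_L \<mu>) g))\<^sup>2 \<le> - (L_op \<mu> g \<bullet> g)"
        using gap unfolding spectral_gap_def by blast
      then show ?thesis by (simp add: orth_proj_of_orthogonal[OF \<mu> g])
    qed
    have inner_le: "x \<bullet> g \<le> K * norm g" if "norm x \<le> K" for x K
      using norm_cauchy_schwarz[of x g] mult_right_mono[OF that norm_ge_zero[of g]] by linarith
    have "norm (\<Gamma>_op \<mu> g) \<le> norm B * norm g * norm g"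
      unfolding ABC using norm_blinfun[of "B g" g] norm_blinfun[of B g] by (meson mult_right_mono norm_ge_zero order_trans)
    then have G: "\<Gamma>_op \<mu> g \<bullet> g \<le> norm B * norm g * norm g * norm g" by (rule inner_le)
    have "norm (Q_op \<mu> g) \<le> norm C * norm g * norm g * norm g"
      unfolding ABC using norm_blinfun[of "C g g" g] norm_blinfun[of "C g" g] norm_blinfun[of C g]
      by (meson mult_right_mono norm_ge_zero order_trans)
    also have "\<dots> \<le> norm C * norm g * norm g * 1"
      using gR R by (intro mult_left_mono) auto
    finally have Q: "Q_op \<mu> g \<bullet> g \<le> norm C * norm g * norm g * norm g"
      using inner_le[of "Q_op \<mu> g" "norm C * norm g * norm g"] by simp
    have "coll_field \<mu> g \<bullet> g \<le> - l * (norm g)\<^sup>2 + (norm B * norm g * norm g * norm g + norm C * norm g * norm g * norm g)"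
      using L G Q by (simp add: coll_field_def inner_add_left)
    also have "\<dots> = - l * (norm g)\<^sup>2 + M * norm g * (norm g)\<^sup>2" by (simp add: M_def algebra_simps power2_eq_square)
    also have "\<dots> \<le> - l * (norm g)\<^sup>2 + (l - \<delta>) * (norm g)\<^sup>2"
      using gR M RM order_trans[OF mult_left_mono[OF gR M] RM] by (intro add_left_mono mult_right_mono) auto
    also have "\<dots> = - \<delta> * (norm g)\<^sup>2" by (simp add: algebra_simps)
    finally show ?thesis .
  qed
  then show ?thesis using R(1) that by blast
qed

section \<open>Positivity\<close>

text \<open>These are the perturbations of nonnegative densities: \<open>equil \<mu> * (1 + g)\<close> is nonnegative iff \<open>g \<ge> - 1\<close>.\<close>

definition nonneg_perturbations :: "wL2 set" where
  "nonneg_perturbations = {g. AE \<omega> in wmeas. - 1 \<le> rep_wL2 g \<omega>}"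

text \<open>The part \<open>v\<close> of \<open>g\<close> below \<open>- 1\<close> is at most \<open>\<bar>k - g\<bar>\<close> almost everywhere, for every \<open>k\<close> in the set.\<close>

lemma nonneg_perturbations_closed: "closed nonneg_perturbations"
  unfolding closed_sequential_limits
proof clarify
  fix X g assume X: "\<forall>n. X n \<in> nonneg_perturbations" "X \<longlonglongrightarrow> g"
  define v where "v \<omega> = max 0 (- 1 - rep_wL2 g \<omega>)" for \<omega>
  have v: "sq_int v" unfolding v_def by (rule sq_int_bound[of "rep_wL2 g"]) auto
  have le: "norm (abs_wL2 v) \<le> norm (X n - g)" for n
  proof (rule power2_le_imp_le)
    have "ennreal ((norm (abs_wL2 v))\<^sup>2) = (\<integral>\<^sup>+\<omega>. ennreal ((v \<omega>)\<^sup>2) \<partial>wmeas)" by (rule ennreal_norm_abs_wL2[OF v, symmetric])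
    also have "\<dots> \<le> (\<integral>\<^sup>+\<omega>. ennreal ((rep_wL2 (X n - g) \<omega>)\<^sup>2) \<partial>wmeas)"
    proof (rule nn_integral_mono_AE)
      have "AE \<omega> in wmeas. - 1 \<le> rep_wL2 (X n) \<omega>" using X(1) by (auto simp: nonneg_perturbations_def)
      then show "AE \<omega> in wmeas. ennreal ((v \<omega>)\<^sup>2) \<le> ennreal ((rep_wL2 (X n - g) \<omega>)\<^sup>2)"
        using rep_diff[of "X n" g]
      proof eventually_elim
        case (elim \<omega>)
        then have "\<bar>v \<omega>\<bar> \<le> \<bar>rep_wL2 (X n - g) \<omega>\<bar>" by (auto simp: v_def)
        then show ?case using abs_le_square_iff by (intro ennreal_leI) blast
      qed
    qed
    also have "\<dots> = ennreal ((norm (X n - g))\<^sup>2)" using ennreal_norm_abs_wL2[of "rep_wL2 (X n - g)"] by simp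
    finally show "(norm (abs_wL2 v))\<^sup>2 \<le> (norm (X n - g))\<^sup>2" by simp
  qed simp
  have "(\<lambda>n. norm (X n - g)) \<longlonglongrightarrow> 0" using X(2) by (simp add: LIM_zero tendsto_norm_zero)
  then have "norm (abs_wL2 v) \<le> 0" by (rule LIMSEQ_le_const) (use le in auto)
  then have "abs_wL2 v = 0" by simp
  then have "AE \<omega> in wmeas. v \<omega> = rep_wL2 0 \<omega>" using rep_abs_wL2[OF v] by (auto elim: AE_mp)
  moreover have "AE \<omega> in wmeas. rep_wL2 0 \<omega> = 0" using rep_abs_wL2[OF sq_int_zero] by (simp add: zero_wL2_def)
  ultimately have "AE \<omega> in wmeas. - 1 \<le> rep_wL2 g \<omega>" by eventually_elim (auto simp: v_def max_def split: if_splits)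
  then show "g \<in> nonneg_perturbations" by (simp add: nonneg_perturbations_def)
qed

lemma ennreal_le_of_power2_le: "x\<^sup>2 \<le> ennreal (c\<^sup>2) \<Longrightarrow> 0 \<le> c \<Longrightarrow> x \<le> ennreal c"
proof (cases x)
  case (real r)
  assume "x\<^sup>2 \<le> ennreal (c\<^sup>2)" "0 \<le> c"
  then have "r\<^sup>2 \<le> c\<^sup>2" using real by (simp add: ennreal_power)
  then show ?thesis using real \<open>0 \<le> c\<close> by (auto intro!: ennreal_leI power2_le_imp_le)
qed (auto simp: power2_eq_square ennreal_top_mult top_unique)

lemma coll_abs_sum_list:
  assumes "\<And>F. F \<in> set Fs \<Longrightarrow> quad_measurable F \<and> coll_abs F a \<le> B"
  shows "coll_abs (\<lambda>x. \<Sum>F\<leftarrow>Fs. \<bar>F x\<bar>) a \<le> of_nat (length Fs) * B"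
  using assms
proof (induction Fs)
  case Nil
  then show ?case by (simp add: coll_abs_def fiber_integral_def)
next
  case (Cons F Fs)
  have m: "quad_measurable F" "quad_measurable (\<lambda>x. \<Sum>F\<leftarrow>Fs. \<bar>F x\<bar>)"
    using Cons.prems by (auto intro!: quad_measurable_sum_list_abs)
  have "coll_abs (\<lambda>x. \<Sum>F\<leftarrow>F # Fs. \<bar>F x\<bar>) a = coll_abs F a + coll_abs (\<lambda>x. \<Sum>F\<leftarrow>Fs. \<bar>F x\<bar>) a"
    using coll_abs_add[OF m] by simp
  also have "\<dots> \<le> B + of_nat (length Fs) * B" using Cons by (intro add_mono) auto
  finally show ?case by (simp add: distrib_right)
qed

text \<open>With \<open>f = equil \<mu> * (1 + \<phi>)\<close> this is \<open>f\<^sub>1 f\<^sub>2 - f\<^sub>2 f\<^sub>3 - f\<^sub>1 f\<^sub>3\<close>, the coefficient of \<open>f\<^sub>0\<close> in the collision integrand.\<close>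

definition gain_loss_rate :: "real \<Rightarrow> (real \<Rightarrow> real) \<Rightarrow> (nat \<Rightarrow> real) \<Rightarrow> real" where
  "gain_loss_rate \<mu> \<phi> x = equil \<mu> (x 1) * equil \<mu> (x 2) * (1 + \<phi> (x 1)) * (1 + \<phi> (x 2))
     - equil \<mu> (x 2) * equil \<mu> (x 3) * (1 + \<phi> (x 2)) * (1 + \<phi> (x 3))
     - equil \<mu> (x 1) * equil \<mu> (x 3) * (1 + \<phi> (x 1)) * (1 + \<phi> (x 3))"

lemma equil_triple:
  assumes \<mu>: "0 < \<mu>" and x: "pos_quad x" "x 3 = x 1 + x 2 - x 0"
  shows "equil \<mu> (x 1) * equil \<mu> (x 2) * equil \<mu> (x 3) * (x 1 - x 0) = equil \<mu> (x 1) * equil \<mu> (x 2) - equil \<mu> (x 1) * equil \<mu> (x 3)"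
    and "equil \<mu> (x 1) * equil \<mu> (x 2) * equil \<mu> (x 3) * (x 2 - x 0) = equil \<mu> (x 1) * equil \<mu> (x 2) - equil \<mu> (x 2) * equil \<mu> (x 3)"
    and "(x 0 + \<mu>) * (equil \<mu> (x 1) * equil \<mu> (x 2) * equil \<mu> (x 3))
      = equil \<mu> (x 2) * equil \<mu> (x 3) + equil \<mu> (x 1) * equil \<mu> (x 3) - equil \<mu> (x 1) * equil \<mu> (x 2)"
proof -
  have e: "equil \<mu> (x 1) * (x 1 + \<mu>) = 1" "equil \<mu> (x 2) * (x 2 + \<mu>) = 1" "equil \<mu> (x 3) * (x 3 + \<mu>) = 1"
    using x \<mu> by (auto simp: pos_quad_def intro!: equil_mult)
  show "equil \<mu> (x 1) * equil \<mu> (x 2) * equil \<mu> (x 3) * (x 1 - x 0) = equil \<mu> (x 1) * equil \<mu> (x 2) - equil \<mu> (x 1) * equil \<mu> (x 3)"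
    using e x(2) by algebra
  show "equil \<mu> (x 1) * equil \<mu> (x 2) * equil \<mu> (x 3) * (x 2 - x 0) = equil \<mu> (x 1) * equil \<mu> (x 2) - equil \<mu> (x 2) * equil \<mu> (x 3)"
    using e x(2) by algebra
  show "(x 0 + \<mu>) * (equil \<mu> (x 1) * equil \<mu> (x 2) * equil \<mu> (x 3))
      = equil \<mu> (x 2) * equil \<mu> (x 3) + equil \<mu> (x 1) * equil \<mu> (x 3) - equil \<mu> (x 1) * equil \<mu> (x 2)"
    using e x(2) by algebra
qed

text \<open>The three densities add up to the full nonlinear collision term \<open>f\<^sub>0 (f\<^sub>1 f\<^sub>2 - f\<^sub>2 f\<^sub>3 - f\<^sub>1 f\<^sub>3) + f\<^sub>1 f\<^sub>2 f\<^sub>3\<close>, divided by the equilibrium at slot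
\<open>0\<close>. The terms of degree \<open>0\<close> in \<open>\<phi>\<close> cancel because the equilibrium is stationary. The last summand, the pure gain, is nonnegative if
\<open>\<phi> \<ge> - 1\<close>.\<close>

lemma densities_gain_loss:
  assumes \<mu>: "0 < \<mu>" and x: "pos_quad x" "x 3 = x 1 + x 2 - x 0"
  shows "L_density \<mu> \<phi> x + \<Gamma>_density \<mu> \<phi> \<phi> x + Q_density \<mu> \<phi> \<phi> \<phi> x
    = (1 + \<phi> (x 0)) * gain_loss_rate \<mu> \<phi> x
      + (x 0 + \<mu>) * (equil \<mu> (x 1) * equil \<mu> (x 2) * equil \<mu> (x 3)) * ((1 + \<phi> (x 1)) * (1 + \<phi> (x 2)) * (1 + \<phi> (x 3)))"
  unfolding L_density_split[OF \<mu> x(1)] \<Gamma>_density_split[OF \<mu> x] Q_density_split[OF \<mu> x] equil_triple[OF \<mu> x] gain_loss_rate_def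
  by algebra

text \<open>Expanded in such a way that every term is covered by one of the multiplier bounds: the products \<open>n\<^sub>i n\<^sub>j\<close> without a factor \<open>\<phi>\<close>
are not integrable separately, but their combination is the collision frequency.\<close>

lemma gain_loss_rate_split:
  assumes \<mu>: "0 < \<mu>" and x: "pos_quad x" "x 3 = x 1 + x 2 - x 0"
  shows "gain_loss_rate \<mu> \<phi> x = - ((x 0 + \<mu>) * (equil \<mu> (x 1) * equil \<mu> (x 2) * equil \<mu> (x 3)))
    + equil \<mu> (x 1) * equil \<mu> (x 2) * equil \<mu> (x 3) * (x 1 - x 0) * \<phi> (x 1)
    + equil \<mu> (x 1) * equil \<mu> (x 2) * equil \<mu> (x 3) * (x 2 - x 0) * \<phi> (x 2)
    - equil \<mu> (x 2) * equil \<mu> (x 3) * \<phi> (x 3) - equil \<mu> (x 1) * equil \<mu> (x 3) * \<phi> (x 3)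
    + equil \<mu> (x 1) * equil \<mu> (x 2) * (\<phi> (x 1) * \<phi> (x 2)) - equil \<mu> (x 2) * equil \<mu> (x 3) * (\<phi> (x 2) * \<phi> (x 3))
    - equil \<mu> (x 1) * equil \<mu> (x 3) * (\<phi> (x 1) * \<phi> (x 3))"
  unfolding equil_triple[OF \<mu> x] gain_loss_rate_def by algebra

lemma gain_loss_rate_bound:
  assumes \<mu>: "0 < \<mu>"
  shows "\<exists>c\<ge>0. \<forall>\<phi> a. sq_int \<phi> \<and> norm (abs_wL2 \<phi>) \<le> R \<and> 0 < a \<longrightarrow> coll_abs (gain_loss_rate \<mu> \<phi>) a \<le> ennreal c"
proof -
  define \<kappa> where "\<kappa> = enn2real (kernel_bound \<mu>)"
  have \<kappa>: "kernel_bound \<mu> = ennreal \<kappa>" "0 \<le> \<kappa>" using kernel_bound_finite[OF \<mu>] by (simp_all add: \<kappa>_def)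
  define b where "b = \<kappa> * (1 + R\<^sup>2 + R\<^sup>2 * R\<^sup>2)"
  have b0: "0 \<le> b" using \<kappa> by (simp add: b_def)
  have "coll_abs (gain_loss_rate \<mu> \<phi>) a \<le> ennreal (8 * sqrt b)" if \<phi>: "sq_int \<phi>" "norm (abs_wL2 \<phi>) \<le> R" and a: "0 < a" for \<phi> a
  proof -
    have [measurable]: "\<phi> \<in> borel_measurable borel" by (rule sq_int_measurable[OF \<phi>(1)])
    have mass: "sq_mass \<phi> \<le> ennreal (R\<^sup>2)"
      unfolding sq_mass_abs_wL2[OF \<phi>(1)] using \<phi>(2) by (intro ennreal_leI power_mono) auto
    have b1: "kernel_bound \<mu> \<le> ennreal b" unfolding \<kappa> b_def using \<kappa>(2) by (intro ennreal_leI) (simp add: algebra_simps)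
    have "kernel_bound \<mu> * sq_mass \<phi> \<le> ennreal \<kappa> * ennreal (R\<^sup>2)" unfolding \<kappa>(1) by (intro mult_left_mono mass) simp
    also have "\<dots> = ennreal (\<kappa> * R\<^sup>2)" using \<kappa>(2) by (simp add: ennreal_mult)
    also have "\<dots> \<le> ennreal b" unfolding b_def using \<kappa>(2) by (intro ennreal_leI) (simp add: algebra_simps)
    finally have b2: "kernel_bound \<mu> * sq_mass \<phi> \<le> ennreal b" .
    have "kernel_bound \<mu> * (sq_mass \<phi> * sq_mass \<phi>) \<le> ennreal \<kappa> * (ennreal (R\<^sup>2) * ennreal (R\<^sup>2))"
      unfolding \<kappa>(1) by (intro mult_left_mono mult_mono mass) auto
    also have "\<dots> = ennreal (\<kappa> * (R\<^sup>2 * R\<^sup>2))"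
      using ennreal_mult[OF \<kappa>(2), of "R\<^sup>2 * R\<^sup>2"] ennreal_mult[of "R\<^sup>2" "R\<^sup>2"] by simp
    also have "\<dots> \<le> ennreal b" unfolding b_def using \<kappa>(2) by (intro ennreal_leI) (simp add: algebra_simps)
    finally have b3: "kernel_bound \<mu> * (sq_mass \<phi> * sq_mass \<phi>) \<le> ennreal b" .
    have root: "coll_abs F a \<le> ennreal (sqrt b)" if "(coll_abs F a)\<^sup>2 \<le> B" "B \<le> ennreal b" for F B
      by (rule ennreal_le_of_power2_le) (use that b0 in auto)
    let ?Fs = "[\<lambda>x. (x 0 + \<mu>) * (equil \<mu> (x 1) * equil \<mu> (x 2) * equil \<mu> (x 3)),
      \<lambda>x. equil \<mu> (x 1) * equil \<mu> (x 2) * equil \<mu> (x 3) * (x 1 - x 0) * \<phi> (x 1),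
      \<lambda>x. equil \<mu> (x 1) * equil \<mu> (x 2) * equil \<mu> (x 3) * (x 2 - x 0) * \<phi> (x 2),
      \<lambda>x. equil \<mu> (x 2) * equil \<mu> (x 3) * \<phi> (x 3), \<lambda>x. equil \<mu> (x 1) * equil \<mu> (x 3) * \<phi> (x 3),
      \<lambda>x. equil \<mu> (x 1) * equil \<mu> (x 2) * (\<phi> (x 1) * \<phi> (x 2)), \<lambda>x. equil \<mu> (x 2) * equil \<mu> (x 3) * (\<phi> (x 2) * \<phi> (x 3)),
      \<lambda>x. equil \<mu> (x 1) * equil \<mu> (x 3) * (\<phi> (x 1) * \<phi> (x 3))] :: ((nat \<Rightarrow> real) \<Rightarrow> real) list"
    have slot: "quad_measurable (\<lambda>x. \<phi> (x i))" for i by (intro quad_measurable_slot) measurable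
    note qm = quad_measurable_real slot quad_measurable_coord quad_measurable_const quad_measurable_equil
    have "coll_abs (gain_loss_rate \<mu> \<phi>) a \<le> coll_abs (\<lambda>x. \<Sum>F\<leftarrow>?Fs. \<bar>F x\<bar>) a"
    proof (rule coll_abs_mono)
      fix x assume x: "pos_quad x" "x 3 = x 1 + x 2 - x 0"
      have "\<bar>gain_loss_rate \<mu> \<phi> x\<bar> \<le> (\<Sum>F\<leftarrow>?Fs. \<bar>F x\<bar>)"
        unfolding gain_loss_rate_split[OF \<mu> x] list.map sum_list.Cons sum_list.Nil add_0_right add.assoc[symmetric]
        by (intro abs_add_le_add_abs abs_diff_le_add_abs eq_refl[OF abs_minus_cancel])
      then show "\<bar>gain_loss_rate \<mu> \<phi> x\<bar> \<le> \<bar>\<Sum>F\<leftarrow>?Fs. \<bar>F x\<bar>\<bar>" by linarith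
    qed
    also have "\<dots> \<le> of_nat (length ?Fs) * ennreal (sqrt b)"
    proof (rule coll_abs_sum_list)
      have "\<forall>F\<in>set ?Fs. quad_measurable F" unfolding list.set ball_simps by (intro conjI qm TrueI)
      moreover have "\<forall>F\<in>set ?Fs. coll_abs F a \<le> ennreal (sqrt b)"
        unfolding list.set ball_simps
      proof (intro conjI TrueI)
        show "coll_abs (\<lambda>x. (x 0 + \<mu>) * (equil \<mu> (x 1) * equil \<mu> (x 2) * equil \<mu> (x 3))) a \<le> ennreal (sqrt b)"
          by (rule root[OF collision_frequency_le[OF \<mu> a] b1])
        show "coll_abs (\<lambda>x. equil \<mu> (x 1) * equil \<mu> (x 2) * equil \<mu> (x 3) * (x 1 - x 0) * \<phi> (x 1)) a \<le> ennreal (sqrt b)"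
          by (rule root[OF difference_multiplier_le[OF \<mu>] b2]) auto
        show "coll_abs (\<lambda>x. equil \<mu> (x 1) * equil \<mu> (x 2) * equil \<mu> (x 3) * (x 2 - x 0) * \<phi> (x 2)) a \<le> ennreal (sqrt b)"
          by (rule root[OF difference_multiplier_le[OF \<mu>] b2]) auto
        show "coll_abs (\<lambda>x. equil \<mu> (x 2) * equil \<mu> (x 3) * \<phi> (x 3)) a \<le> ennreal (sqrt b)"
          by (rule root[OF loss_multiplier_le[OF \<mu>] b2]) auto
        show "coll_abs (\<lambda>x. equil \<mu> (x 1) * equil \<mu> (x 3) * \<phi> (x 3)) a \<le> ennreal (sqrt b)"
          by (rule root[OF loss_multiplier_le[OF \<mu>] b2]) auto
        show "coll_abs (\<lambda>x. equil \<mu> (x 1) * equil \<mu> (x 2) * (\<phi> (x 1) * \<phi> (x 2))) a \<le> ennreal (sqrt b)"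
          by (rule root[OF bilinear_multiplier_le[OF \<mu>] b3]) auto
        show "coll_abs (\<lambda>x. equil \<mu> (x 2) * equil \<mu> (x 3) * (\<phi> (x 2) * \<phi> (x 3))) a \<le> ennreal (sqrt b)"
          by (rule root[OF bilinear_multiplier_le[OF \<mu>] b3]) auto
        show "coll_abs (\<lambda>x. equil \<mu> (x 1) * equil \<mu> (x 3) * (\<phi> (x 1) * \<phi> (x 3))) a \<le> ennreal (sqrt b)"
          by (rule root[OF bilinear_multiplier_le[OF \<mu>] b3]) auto
      qed
      ultimately show "quad_measurable F \<and> coll_abs F a \<le> ennreal (sqrt b)" if "F \<in> set ?Fs" for F
        using that by blast
    qed
    also have "\<dots> = ennreal (8 * sqrt b)" using b0 by (simp add: ennreal_mult[of 8 "sqrt b"])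
    finally show ?thesis .
  qed
  then show ?thesis using b0 by (intro exI[of _ "8 * sqrt b"]) auto
qed

lemma quad_measurable_gain_loss_rate:
  assumes "\<phi> \<in> borel_measurable borel"
  shows "quad_measurable (gain_loss_rate \<mu> \<phi>)"
  unfolding gain_loss_rate_def
  by (intro quad_measurable_real quad_measurable_slot[OF assms] quad_measurable_const quad_measurable_equil)

text \<open>At a point where \<open>\<phi>\<close> is close to \<open>- 1\<close> the loss is small too, because it is proportional to \<open>1 + \<phi>\<close> with a rate that is
bounded on balls; the gain is nonnegative. So \<open>1 + \<phi> + h * F \<ge> (1 + \<phi>) * (1 - h * c) \<ge> 0\<close> if \<open>h * c \<le> 1\<close>.\<close>

lemma nonneg_perturbations_step:
  assumes \<mu>: "0 < \<mu>"
  shows "\<exists>h0>0. \<forall>h k. 0 < h \<and> h \<le> h0 \<and> k \<in> nonneg_perturbations \<and> norm k \<le> R \<longrightarrow> k + h *\<^sub>R coll_field \<mu> k \<in> nonneg_perturbations"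
proof -
  obtain c where c: "0 \<le> c" "\<And>\<phi> a. sq_int \<phi> \<Longrightarrow> norm (abs_wL2 \<phi>) \<le> R \<Longrightarrow> 0 < a \<Longrightarrow> coll_abs (gain_loss_rate \<mu> \<phi>) a \<le> ennreal c"
    using gain_loss_rate_bound[OF \<mu>, of R] by blast
  (* The denominator c + 1 also covers c = 0. *)
  define h0 where "h0 = 1 / (c + 1)"
  have h0: "0 < h0" using c(1) by (simp add: h0_def)
  have "k + h *\<^sub>R coll_field \<mu> k \<in> nonneg_perturbations"
    if h: "0 < h" "h \<le> h0" and k: "k \<in> nonneg_perturbations" and kR: "norm k \<le> R" for h k
  proof -
    have hc: "h * c \<le> 1"
    proof -
      have "h * c \<le> h0 * (c + 1)" using h h0 c(1) by (intro mult_mono) auto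
      then show ?thesis using c(1) by (simp add: h0_def)
    qed
    (* A representative that is at least -1 everywhere, so that the gain is nonnegative at every quadruple. *)
    define \<phi> where "\<phi> \<omega> = max (- 1) (rep_wL2 k \<omega>)" for \<omega>
    have \<phi>: "sq_int \<phi>" unfolding \<phi>_def by (rule sq_int_bound[of "rep_wL2 k"]) auto
    have \<phi>1: "- 1 \<le> \<phi> \<omega>" for \<omega> by (simp add: \<phi>_def)
    have \<phi>k: "AE \<omega> in wmeas. rep_wL2 k \<omega> = \<phi> \<omega>"
      using k unfolding nonneg_perturbations_def mem_Collect_eq by eventually_elim (simp add: \<phi>_def)
    have abs: "abs_wL2 \<phi> = k" by (rule abs_wL2_eqI[OF \<phi> \<phi>k])
    note f = densities_finite[OF \<mu> \<phi>]
    let ?L = "L_density \<mu> \<phi>" and ?G = "\<Gamma>_density \<mu> \<phi> \<phi>" and ?Q = "Q_density \<mu> \<phi> \<phi> \<phi>" and ?\<alpha> = "gain_loss_rate \<mu> \<phi>"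
    have \<alpha>m: "quad_measurable ?\<alpha>" by (rule quad_measurable_gain_loss_rate[OF sq_int_measurable[OF \<phi>]])
    have "coll_field \<mu> k = abs_wL2 (coll ?L) + abs_wL2 (coll ?G) + abs_wL2 (coll ?Q)"
      by (simp add: coll_field_def abs[symmetric] L_op_abs[OF \<mu> \<phi>] \<Gamma>_op_abs[OF \<mu> \<phi>] Q_op_abs[OF \<mu> \<phi>])
    note field = this
    have F: "AE \<omega> in wmeas. rep_wL2 (coll_field \<mu> k) \<omega> = coll ?L \<omega> + coll ?G \<omega> + coll ?Q \<omega>"
      unfolding field
      using rep_add[of "abs_wL2 (coll ?L) + abs_wL2 (coll ?G)" "abs_wL2 (coll ?Q)"] rep_add[of "abs_wL2 (coll ?L)" "abs_wL2 (coll ?G)"]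
        rep_abs_wL2[OF coll_sq_int(1)[OF f(1,2)]] rep_abs_wL2[OF coll_sq_int(1)[OF f(3,4)]] rep_abs_wL2[OF coll_sq_int(1)[OF f(5,6)]]
      by eventually_elim simp
    have "AE \<omega> in wmeas. - 1 \<le> rep_wL2 (k + h *\<^sub>R coll_field \<mu> k) \<omega>"
      using rep_add[of k "h *\<^sub>R coll_field \<mu> k"] rep_scale[of h "coll_field \<mu> k"] F \<phi>k AE_wmeas_pos
        coll_abs_finite_AE[OF f(1,2)] coll_abs_finite_AE[OF f(3,4)] coll_abs_finite_AE[OF f(5,6)]
    proof eventually_elim
      case (elim \<omega>)
      note il = coll_integrable[OF f(1) elim(5,6)] and ig = coll_integrable[OF f(3) elim(5,7)] and iq = coll_integrable[OF f(5) elim(5,8)]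
      have \<alpha>c: "coll_abs ?\<alpha> \<omega> \<le> ennreal c" using c(2)[OF \<phi> _ elim(5)] kR by (simp add: abs)
      then have "coll_abs ?\<alpha> \<omega> < \<infinity>" by (auto intro: le_less_trans)
      note ia = coll_integrable[OF \<alpha>m elim(5) this]
      have "(1 + \<phi> \<omega>) * coll ?\<alpha> \<omega> = (\<integral>z. (1 + \<phi> \<omega>) * coll_integrand ?\<alpha> \<omega> z \<partial>(lborel \<Otimes>\<^sub>M lborel))"
        by (simp add: coll_eq)
      also have "\<dots> \<le> (\<integral>z. coll_integrand ?L \<omega> z + coll_integrand ?G \<omega> z + coll_integrand ?Q \<omega> z \<partial>(lborel \<Otimes>\<^sub>M lborel))"
      proof (rule integral_mono)
        show "integrable (lborel \<Otimes>\<^sub>M lborel) (\<lambda>z. (1 + \<phi> \<omega>) * coll_integrand ?\<alpha> \<omega> z)" using ia by simp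
        show "integrable (lborel \<Otimes>\<^sub>M lborel) (\<lambda>z. coll_integrand ?L \<omega> z + coll_integrand ?G \<omega> z + coll_integrand ?Q \<omega> z)"
          using il ig iq by simp
        fix z :: "real \<times> real"
        let ?x = "quad \<omega> (fst z) (snd z)"
        show "(1 + \<phi> \<omega>) * coll_integrand ?\<alpha> \<omega> z \<le> coll_integrand ?L \<omega> z + coll_integrand ?G \<omega> z + coll_integrand ?Q \<omega> z"
        proof (cases "pos_quad ?x")
          case True
          have x3: "?x 3 = ?x 1 + ?x 2 - ?x 0" by simp
          have "0 \<le> (?x 0 + \<mu>) * (equil \<mu> (?x 1) * equil \<mu> (?x 2) * equil \<mu> (?x 3)) * ((1 + \<phi> (?x 1)) * (1 + \<phi> (?x 2)) * (1 + \<phi> (?x 3)))"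
            using True \<mu> \<phi>1[of "?x 1"] \<phi>1[of "?x 2"] \<phi>1[of "?x 3"]
            by (intro mult_nonneg_nonneg) (auto simp: pos_quad_def equil_def)
          then have "(1 + \<phi> \<omega>) * ?\<alpha> ?x \<le> ?L ?x + ?G ?x + ?Q ?x"
            using densities_gain_loss[OF \<mu> True x3, of \<phi>] by simp
          moreover define w where "w = root_min ?x / sqrt \<omega>"
          ultimately have "w * ((1 + \<phi> \<omega>) * ?\<alpha> ?x) \<le> w * (?L ?x + ?G ?x + ?Q ?x)"
            using elim(5) by (intro mult_left_mono) (auto simp: w_def)
          then show ?thesis unfolding coll_integrand_def w_def[symmetric] by (simp add: algebra_simps)
        qed (simp add: coll_integrand_def root_min_def)
      qed
      also have "\<dots> = coll ?L \<omega> + coll ?G \<omega> + coll ?Q \<omega>" using il ig iq by (simp add: coll_eq)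
      finally have low: "(1 + \<phi> \<omega>) * coll ?\<alpha> \<omega> \<le> coll ?L \<omega> + coll ?G \<omega> + coll ?Q \<omega>" .
      have "ennreal \<bar>coll ?\<alpha> \<omega>\<bar> \<le> ennreal c" by (rule order_trans[OF coll_le_coll_abs[OF elim(5)] \<alpha>c])
      then have "- c \<le> coll ?\<alpha> \<omega>" using c(1) by (simp add: ennreal_le_iff)
      then have "(1 + \<phi> \<omega>) * (- c) \<le> (1 + \<phi> \<omega>) * coll ?\<alpha> \<omega>" using \<phi>1[of \<omega>] by (intro mult_left_mono) auto
      then have "h * ((1 + \<phi> \<omega>) * (- c)) \<le> h * (coll ?L \<omega> + coll ?G \<omega> + coll ?Q \<omega>)" using low h by (intro mult_left_mono) auto
      moreover have "0 \<le> (1 + \<phi> \<omega>) * (1 - h * c)" using hc \<phi>1[of \<omega>] by (intro mult_nonneg_nonneg) auto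
      ultimately show ?case unfolding elim(1-4) by (simp add: algebra_simps)
    qed
    then show ?thesis by (simp add: nonneg_perturbations_def)
  qed
  then show ?thesis using h0 by blast
qed

section \<open>From perturbations to densities\<close>

lemma equil_sq_int:
  assumes "0 < \<mu>"
  shows "sq_int (equil \<mu>)"
proof (rule sq_intI_nn)
  have "(\<integral>\<^sup>+\<omega>. ennreal ((equil \<mu> \<omega>)\<^sup>2) \<partial>wmeas) = (\<integral>\<^sup>+t. ennreal (wsq (equil \<mu>) t) \<partial>lborel)"
    using sq_mass_wsq[of "equil \<mu>"] by (simp add: sq_mass_def)
  also have "wsq (equil \<mu>) = shifted_powr \<mu> 2 (- (1/2))"
  proof
    fix t
    show "wsq (equil \<mu>) t = shifted_powr \<mu> 2 (- (1/2)) t"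
      using assms powr_minus[of "t + \<mu>" 2] by (simp add: wsq_def shifted_powr_def equil_def powr_half_sqrt power_divide inverse_eq_divide)
  qed
  also have "(\<integral>\<^sup>+t. ennreal (shifted_powr \<mu> 2 (- (1/2)) t) \<partial>lborel) < \<infinity>"
    by (rule nn_integral_shifted_powr_finite) (use assms in auto)
  finally show "(\<integral>\<^sup>+\<omega>. ennreal ((equil \<mu> \<omega>)\<^sup>2) \<partial>wmeas) < \<infinity>" .
qed simp

definition equil_mul :: "real \<Rightarrow> wL2 \<Rightarrow> wL2" where
  "equil_mul \<mu> g = abs_wL2 (\<lambda>\<omega>. equil \<mu> \<omega> * rep_wL2 g \<omega>)"

lemma equil_mul_sq_int:
  assumes \<mu>: "0 < \<mu>" and \<phi>: "sq_int \<phi>"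
  shows "sq_int (\<lambda>\<omega>. equil \<mu> \<omega> * \<phi> \<omega>)" "norm (abs_wL2 (\<lambda>\<omega>. equil \<mu> \<omega> * \<phi> \<omega>)) \<le> norm (abs_wL2 \<phi>) * (1 / \<mu>)"
proof -
  have [measurable]: "\<phi> \<in> borel_measurable borel" by (rule sq_int_measurable[OF \<phi>])
  have le: "AE \<omega> in wmeas. \<bar>equil \<mu> \<omega> * \<phi> \<omega>\<bar> \<le> \<bar>1 / \<mu> * \<phi> \<omega>\<bar>"
    using AE_wmeas_pos
  proof eventually_elim
    case (elim \<omega>)
    then show ?case using \<mu> unfolding abs_mult by (intro mult_right_mono) (auto simp: equil_def frac_le)
  qed
  show sq: "sq_int (\<lambda>\<omega>. equil \<mu> \<omega> * \<phi> \<omega>)"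
    by (rule sq_int_bound[OF sq_int_scale[OF \<phi>, of "1 / \<mu>"] _ le]) measurable
  have "ennreal ((norm (abs_wL2 (\<lambda>\<omega>. equil \<mu> \<omega> * \<phi> \<omega>)))\<^sup>2) \<le> ennreal ((norm (abs_wL2 (\<lambda>\<omega>. 1 / \<mu> * \<phi> \<omega>)))\<^sup>2)"
    unfolding ennreal_norm_abs_wL2[OF sq, symmetric] ennreal_norm_abs_wL2[OF sq_int_scale[OF \<phi>], symmetric]
  proof (rule nn_integral_mono_AE, use le in eventually_elim)
    case (elim \<omega>)
    then show ?case using abs_le_square_iff by (intro ennreal_leI) blast
  qed
  then have "norm (abs_wL2 (\<lambda>\<omega>. equil \<mu> \<omega> * \<phi> \<omega>)) \<le> norm (abs_wL2 (\<lambda>\<omega>. 1 / \<mu> * \<phi> \<omega>))"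
    unfolding ennreal_le_iff[OF zero_le_power2] by (rule power2_le_imp_le) simp
  then show "norm (abs_wL2 (\<lambda>\<omega>. equil \<mu> \<omega> * \<phi> \<omega>)) \<le> norm (abs_wL2 \<phi>) * (1 / \<mu>)"
    unfolding abs_wL2_scale[OF \<phi>] using \<mu> by simp
qed

lemma rep_equil_mul: "0 < \<mu> \<Longrightarrow> AE \<omega> in wmeas. rep_wL2 (equil_mul \<mu> g) \<omega> = equil \<mu> \<omega> * rep_wL2 g \<omega>"
  unfolding equil_mul_def by (intro rep_abs_wL2 equil_mul_sq_int) auto

lemma equil_mul_bounded_linear:
  assumes \<mu>: "0 < \<mu>"
  shows "bounded_linear (equil_mul \<mu>)"
proof (rule bounded_linear_intro[where K = "1 / \<mu>"])
  show "equil_mul \<mu> (g + h) = equil_mul \<mu> g + equil_mul \<mu> h" for g h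
  proof (rule wL2_eqI)
    show "AE \<omega> in wmeas. rep_wL2 (equil_mul \<mu> (g + h)) \<omega> = rep_wL2 (equil_mul \<mu> g + equil_mul \<mu> h) \<omega>"
      using rep_equil_mul[OF \<mu>, of "g + h"] rep_equil_mul[OF \<mu>, of g] rep_equil_mul[OF \<mu>, of h] rep_add[of g h]
        rep_add[of "equil_mul \<mu> g" "equil_mul \<mu> h"]
      by eventually_elim (simp add: distrib_left)
  qed
  show "equil_mul \<mu> (c *\<^sub>R g) = c *\<^sub>R equil_mul \<mu> g" for c g
  proof (rule wL2_eqI)
    show "AE \<omega> in wmeas. rep_wL2 (equil_mul \<mu> (c *\<^sub>R g)) \<omega> = rep_wL2 (c *\<^sub>R equil_mul \<mu> g) \<omega>"
      using rep_equil_mul[OF \<mu>, of "c *\<^sub>R g"] rep_equil_mul[OF \<mu>, of g] rep_scale[of c g] rep_scale[of c "equil_mul \<mu> g"]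
      by eventually_elim simp
  qed
  show "norm (equil_mul \<mu> g) \<le> norm g * (1 / \<mu>)" for g
    using equil_mul_sq_int(2)[OF \<mu>, of "rep_wL2 g"] by (simp add: equil_mul_def)
qed

text \<open>The density is the image of the perturbation under a continuous affine map. This is how the time regularity of the
perturbation passes to the density.\<close>

lemma perturbation_of_iff:
  assumes \<mu>: "0 < \<mu>"
  shows "perturbation_of \<mu> f g \<longleftrightarrow> f = abs_wL2 (equil \<mu>) + equil_mul \<mu> g"
proof -
  have r: "AE \<omega> in wmeas. rep_wL2 (abs_wL2 (equil \<mu>) + equil_mul \<mu> g) \<omega> = equil \<mu> \<omega> * (1 + rep_wL2 g \<omega>)"
    using rep_add[of "abs_wL2 (equil \<mu>)" "equil_mul \<mu> g"] rep_abs_wL2[OF equil_sq_int[OF \<mu>]] rep_equil_mul[OF \<mu>, of g]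
    by eventually_elim (simp add: distrib_left)
  show ?thesis
  proof
    assume "perturbation_of \<mu> f g"
    then have "AE \<omega> in wmeas. rep_wL2 f \<omega> = equil \<mu> \<omega> * (1 + rep_wL2 g \<omega>)" by (simp add: perturbation_of_def)
    then have "AE \<omega> in wmeas. rep_wL2 f \<omega> = rep_wL2 (abs_wL2 (equil \<mu>) + equil_mul \<mu> g) \<omega>"
      using r by eventually_elim simp
    then show "f = abs_wL2 (equil \<mu>) + equil_mul \<mu> g" by (rule wL2_eqI)
  next
    assume "f = abs_wL2 (equil \<mu>) + equil_mul \<mu> g"
    then show "perturbation_of \<mu> f g" using r by (simp add: perturbation_of_def)
  qed
qed

lemma perturbation_of_inverse:
  assumes "0 < \<mu>" "perturbation_of \<mu> f g"
  shows "AE \<omega> in wmeas. rep_wL2 g \<omega> = (\<mu> + \<omega>) * rep_wL2 f \<omega> - 1"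
  using assms(2)[unfolded perturbation_of_def] AE_wmeas_pos
proof eventually_elim
  case (elim \<omega>)
  then show ?case using assms(1) by (simp add: equil_def field_simps)
qed

lemma perturbation_of_unique:
  assumes "0 < \<mu>" "perturbation_of \<mu> f g" "perturbation_of \<mu> f h"
  shows "g = h"
proof -
  have "AE \<omega> in wmeas. rep_wL2 g \<omega> = rep_wL2 h \<omega>"
    using perturbation_of_inverse[OF assms(1,2)] perturbation_of_inverse[OF assms(1,3)] by eventually_elim simp
  then show ?thesis by (rule wL2_eqI)
qed

lemma perturbation_of_nonneg:
  assumes "0 < \<mu>" "perturbation_of \<mu> f g"
  shows "(AE \<omega> in wmeas. 0 \<le> rep_wL2 f \<omega>) \<longleftrightarrow> g \<in> nonneg_perturbations"
proof -
  have "AE \<omega> in wmeas. 0 \<le> rep_wL2 f \<omega> \<longleftrightarrow> - 1 \<le> rep_wL2 g \<omega>"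
    using assms(2)[unfolded perturbation_of_def] AE_wmeas_pos
  proof eventually_elim
    case (elim \<omega>)
    then have "0 < equil \<mu> \<omega>" using assms(1) by (simp add: equil_def)
    then show ?case unfolding elim(1) by (auto simp: zero_le_mult_iff)
  qed
  then show ?thesis unfolding nonneg_perturbations_def mem_Collect_eq
    by (intro iffI) (auto elim: AE_mp)
qed

theorem corollary1p2:
  fixes \<mu> l \<delta> :: real
  assumes "\<mu> > 0" and "spectral_gap \<mu> l" and "0 < \<delta>" and "\<delta> < l"
  shows "\<exists>\<rho>>0. \<forall>f0 g0 :: wL2.
    (AE \<omega> in wmeas. rep_wL2 f0 \<omega> = 1 / (\<omega> + \<mu>) * (1 + rep_wL2 g0 \<omega>)) \<and>
    g0 \<in> (ker_L \<mu>)\<^sup>\<bottom> \<and> norm g0 \<le> \<rho> \<longrightarrow>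
    (\<exists>f :: real \<Rightarrow> wL2.
       perturbative_solution \<mu> f \<and> C1_half_line f \<and> f 0 = f0 \<and>
       (\<forall>h. perturbative_solution \<mu> h \<and> h 0 = f0 \<longrightarrow> (\<forall>t\<ge>0. h t = f t)) \<and>
       (\<forall>t\<ge>0. \<exists>g :: wL2.
          (AE \<omega> in wmeas. rep_wL2 g \<omega> = (\<mu> + \<omega>) * rep_wL2 (f t) \<omega> - 1) \<and>
          g \<in> (ker_L \<mu>)\<^sup>\<bottom> \<and> norm g \<le> exp (- \<delta> * t) * norm g0) \<and>
       ((AE \<omega> in wmeas. 0 \<le> rep_wL2 f0 \<omega>) \<longrightarrow>
          (\<forall>t>0. AE \<omega> in wmeas. 0 \<le> rep_wL2 (f t) \<omega>)))"
proof -
  note \<mu> = assms(1)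
  obtain \<rho> where \<rho>: "0 < \<rho>" and dissip: "\<And>g. g \<in> (ker_L \<mu>)\<^sup>\<bottom> \<Longrightarrow> norm g \<le> \<rho> \<Longrightarrow> coll_field \<mu> g \<bullet> g \<le> - \<delta> * (norm g)\<^sup>2"
    using coll_field_dissipative[OF assms(1,2,4)] by blast
  note lip = coll_field_lipschitz[OF \<mu>]
  have Fc: "continuous_on UNIV (coll_field \<mu>)" by (rule lipschitz_on_balls_continuous[OF lip])
  show ?thesis
  proof (intro exI[of _ \<rho>] conjI \<rho> allI impI; elim conjE)
    fix f0 g0 :: wL2
    assume "AE \<omega> in wmeas. rep_wL2 f0 \<omega> = 1 / (\<omega> + \<mu>) * (1 + rep_wL2 g0 \<omega>)"
      and g0: "g0 \<in> (ker_L \<mu>)\<^sup>\<bottom>" "norm g0 \<le> \<rho>"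
    then have p0: "perturbation_of \<mu> f0 g0" by (simp add: perturbation_of_def equil_def)
    obtain u where u0: "u 0 = g0"
      and u: "\<And>t. 0 \<le> t \<Longrightarrow> (u has_vector_derivative coll_field \<mu> (u t)) (at t within {0..})"
      and uN: "\<And>t. 0 \<le> t \<Longrightarrow> u t \<in> (ker_L \<mu>)\<^sup>\<bottom>"
      and udecay: "\<And>t. 0 \<le> t \<Longrightarrow> norm (u t) \<le> exp (- \<delta> * t) * norm g0"
      using dissipative_ode_global_solution[OF lip _ dissip \<rho> less_imp_le[OF assms(3)] g0]
        operators_orthogonal_ker_L[OF \<mu>, folded coll_field_def] by blast
    define f where "f t = abs_wL2 (equil \<mu>) + equil_mul \<mu> (u t)" for t
    have pf: "perturbation_of \<mu> (f t) (u t)" for t by (simp add: perturbation_of_iff[OF \<mu>] f_def)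
    have uc: "continuous_on {0..} u" by (rule continuous_on_vector_derivative) (use u in auto)
    have Fuc: "continuous_on {0..} (\<lambda>t. coll_field \<mu> (u t))"
      by (rule continuous_on_compose2[OF Fc uc]) simp
    have "C1_half_line u"
      unfolding C1_half_line_def by (intro exI[of _ "\<lambda>t. coll_field \<mu> (u t)"] conjI allI impI u Fuc)
    moreover have "solves_perturbation_eq \<mu> u"
      unfolding solves_perturbation_eq_def coll_field_def[symmetric] using u by blast
    ultimately have sol: "perturbative_solution \<mu> f" unfolding perturbative_solution_def using pf by blast
    have C1: "C1_half_line f"
      unfolding C1_half_line_def
    proof (intro exI[of _ "\<lambda>t. equil_mul \<mu> (coll_field \<mu> (u t))"] conjI allI impI)
      fix t :: real assume "0 \<le> t"
      have "(f has_vector_derivative 0 + equil_mul \<mu> (coll_field \<mu> (u t))) (at t within {0..})"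
        unfolding f_def
        by (intro has_vector_derivative_add has_vector_derivative_const
            bounded_linear.has_vector_derivative[OF equil_mul_bounded_linear[OF \<mu>]] u \<open>0 \<le> t\<close>)
      then show "(f has_vector_derivative equil_mul \<mu> (coll_field \<mu> (u t))) (at t within {0..})" by simp
    next
      show "continuous_on {0..} (\<lambda>t. equil_mul \<mu> (coll_field \<mu> (u t)))"
        by (rule bounded_linear.continuous_on[OF equil_mul_bounded_linear[OF \<mu>] Fuc])
    qed
    have f0: "f 0 = f0" using p0 by (simp add: f_def u0 perturbation_of_iff[OF \<mu>])
    have uniq: "h t = f t" if h: "perturbative_solution \<mu> h" "h 0 = f0" and t: "0 \<le> t" for h t
    proof -
      obtain v where v: "solves_perturbation_eq \<mu> v" "\<And>t. 0 \<le> t \<Longrightarrow> perturbation_of \<mu> (h t) (v t)"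
        using h(1) unfolding perturbative_solution_def by blast
      have "v 0 = u 0" using perturbation_of_unique[OF \<mu> v(2)[of 0]] p0 h(2) u0 by simp
      moreover have "(v has_vector_derivative coll_field \<mu> (v s)) (at s within {0..})" if "0 \<le> s" for s
        using v(1) that unfolding solves_perturbation_eq_def coll_field_def by blast
      ultimately have "v t = u t" using ode_solution_unique[OF lip _ u _ t, of v] by blast
      then show ?thesis using v(2)[OF t] by (simp add: perturbation_of_iff[OF \<mu>] f_def)
    qed
    have pos: "AE \<omega> in wmeas. 0 \<le> rep_wL2 (f t) \<omega>" if "AE \<omega> in wmeas. 0 \<le> rep_wL2 f0 \<omega>" "0 < t" for t
    proof -
      have "u 0 \<in> nonneg_perturbations" using that(1) perturbation_of_nonneg[OF \<mu> p0] u0 by simp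
      from ode_invariant_closed_set[OF lip u nonneg_perturbations_closed this nonneg_perturbations_step[OF \<mu>], of t]
      have "u t \<in> nonneg_perturbations" using that(2) by simp
      then show ?thesis using perturbation_of_nonneg[OF \<mu> pf] by blast
    qed
    show "\<exists>f :: real \<Rightarrow> wL2.
       perturbative_solution \<mu> f \<and> C1_half_line f \<and> f 0 = f0 \<and>
       (\<forall>h. perturbative_solution \<mu> h \<and> h 0 = f0 \<longrightarrow> (\<forall>t\<ge>0. h t = f t)) \<and>
       (\<forall>t\<ge>0. \<exists>g :: wL2.
          (AE \<omega> in wmeas. rep_wL2 g \<omega> = (\<mu> + \<omega>) * rep_wL2 (f t) \<omega> - 1) \<and>
          g \<in> (ker_L \<mu>)\<^sup>\<bottom> \<and> norm g \<le> exp (- \<delta> * t) * norm g0) \<and>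
       ((AE \<omega> in wmeas. 0 \<le> rep_wL2 f0 \<omega>) \<longrightarrow>
          (\<forall>t>0. AE \<omega> in wmeas. 0 \<le> rep_wL2 (f t) \<omega>))"
    proof (intro exI[of _ f] conjI allI impI)
      show "perturbative_solution \<mu> f" by (rule sol)
      show "C1_half_line f" by (rule C1)
      show "f 0 = f0" by (rule f0)
      show "h t = f t" if "perturbative_solution \<mu> h \<and> h 0 = f0" "0 \<le> t" for h t
        using uniq that by blast
      show "\<exists>g. (AE \<omega> in wmeas. rep_wL2 g \<omega> = (\<mu> + \<omega>) * rep_wL2 (f t) \<omega> - 1) \<and>
          g \<in> (ker_L \<mu>)\<^sup>\<bottom> \<and> norm g \<le> exp (- \<delta> * t) * norm g0" if "0 \<le> t" for t
        by (rule exI[of _ "u t"], intro conjI perturbation_of_inverse[OF \<mu> pf] uN udecay that)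
      show "AE \<omega> in wmeas. 0 \<le> rep_wL2 (f t) \<omega>" if "AE \<omega> in wmeas. 0 \<le> rep_wL2 f0 \<omega>" "0 < t" for t
        using pos that by simp
    qed
  qed
qed

end
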